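(* Let $\Omega\subset\mathbb{R}^N$, $N\ge2$, be a bounded domain with boundary $\Gamma$ of class $C^2$, and let $u\in C^2(\overline\Omega)$ satisfy $\Delta u=N$ in $\Omega$ and $u_\nu=R$ on $\Gamma$. Let $q(x)=\frac12|x-z|^2+a$ for some $z\in\mathbb{R}^N$, $a\in\mathbb{R}$, and $h=q-u$, $\overline u=\max_{\overline\Omega}u$. If $$\frac12\int_\Gamma|\nabla_\Gamma u|^2h_\nu\,dS_x+\int_\Gamma(\overline u-u)\big[(N-1)RH-N\big]h_\nu\,dS_x-\int_\Gamma(\overline u-u)\,\langle(\nabla\nu)\nabla_\Gamma u,\nabla_\Gamma u\rangle\,dS_x\le 0,$$ then $h$ is affine, $u$ is a quadratic polynomial, and $\Omega$ is a ball (of radius $R$).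
   Context: $\nu$ is the exterior unit normal to $\Gamma$, $v_\nu=\langle\nabla v,\nu\rangle$; $R:=N|\Omega|/|\Gamma|$; $\nabla_\Gamma u=\nabla u-u_\nu\nu$ on $\Gamma$. $H=\frac1{N-1}\sum_{j=1}^{N-1}\kappa_j$ is the mean curvature of $\Gamma$, with $\kappa_j$ the principal curvatures with respect to the interior normal. $\nabla\nu$ denotes, on $\Gamma$, the Jacobian matrix of the extension $\nu=-\nabla\delta_\Gamma$ of the normal to a neighborhood of $\Gamma$ in $\overline\Omega$, where $\delta_\Gamma(x)=\operatorname{dist}(x,\Gamma)$; in suitable coordinates at a point of $\Gamma$ it is $\operatorname{diag}(\kappa_1,\dots,\kappa_{N-1},0)$. *)

theory Defs
  imports "HOL-Analysis.Analysis"
begin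

definition C2_on_with ::
  "(real^'n::finite) set \<Rightarrow> (real^'n \<Rightarrow> real) \<Rightarrow> (real^'n \<Rightarrow> real^'n) \<Rightarrow> (real^'n \<Rightarrow> real^'n^'n) \<Rightarrow> bool"
  where "C2_on_with U f Df D2f \<longleftrightarrow>
     continuous_on U Df \<and> continuous_on U D2f \<and>
     (\<forall>x\<in>U. (f has_derivative (\<lambda>h. Df x \<bullet> h)) (at x)) \<and>
     (\<forall>x\<in>U. (Df has_derivative (\<lambda>h. D2f x *v h)) (at x))"

definition C2_closure_with ::
  "(real^'n::finite) set \<Rightarrow> (real^'n \<Rightarrow> real) \<Rightarrow> (real^'n \<Rightarrow> real^'n) \<Rightarrow> (real^'n \<Rightarrow> real^'n^'n) \<Rightarrow> bool"
  where "C2_closure_with \<Omega> u Du D2u \<longleftrightarrow>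
     continuous_on (closure \<Omega>) u \<and> continuous_on (closure \<Omega>) Du \<and> continuous_on (closure \<Omega>) D2u \<and>
     (\<forall>x\<in>closure \<Omega>. (u has_derivative (\<lambda>h. Du x \<bullet> h)) (at x within closure \<Omega>)) \<and>
     (\<forall>x\<in>closure \<Omega>. (Du has_derivative (\<lambda>h. D2u x *v h)) (at x within closure \<Omega>))"

definition C2_bounded_domain :: "(real^'n::finite) set \<Rightarrow> bool"
  where "C2_bounded_domain \<Omega> \<longleftrightarrow>
     bounded \<Omega> \<and> open \<Omega> \<and> connected \<Omega> \<and> \<Omega> \<noteq> {} \<and>
     (\<forall>p\<in>frontier \<Omega>. \<exists>U \<rho> D\<rho> D2\<rho>. open U \<and> p \<in> U \<and> C2_on_with U \<rho> D\<rho> D2\<rho> \<and>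
         (\<forall>x\<in>U. D\<rho> x \<noteq> 0) \<and> \<Omega> \<inter> U = {x\<in>U. \<rho> x < 0})"

definition unit_ball_vol :: "real \<Rightarrow> real"
  where "unit_ball_vol s = pi powr (s / 2) / Gamma (s / 2 + 1)"

definition hausdorff_pre :: "real \<Rightarrow> real \<Rightarrow> 'a::metric_space set \<Rightarrow> ennreal"
  where "hausdorff_pre s d A =
     (INF C \<in> {C :: nat \<Rightarrow> 'a set. A \<subseteq> (\<Union>i. C i) \<and> (\<forall>i. bounded (C i) \<and> diameter (C i) \<le> d)}.
        (\<Sum>i. ennreal (unit_ball_vol s * (diameter (C i) / 2) powr s)))"

definition hausdorff_outer :: "real \<Rightarrow> 'a::metric_space set \<Rightarrow> ennreal"
  where "hausdorff_outer s A = (SUP d \<in> {0<..}. hausdorff_pre s d A)"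

definition hausdorff_measure :: "real \<Rightarrow> 'a::metric_space measure"
  where "hausdorff_measure s = measure_of UNIV (sets borel) (hausdorff_outer s)"

definition surf_int :: "(real^'n::finite) set \<Rightarrow> (real^'n \<Rightarrow> real) \<Rightarrow> real"
  where "surf_int \<Gamma> f = (LINT x:\<Gamma>|hausdorff_measure (real CARD('n) - 1). f x)"

definition surf_area :: "(real^'n::finite) set \<Rightarrow> real"
  where "surf_area \<Gamma> = measure (hausdorff_measure (real CARD('n) - 1)) \<Gamma>"

text \<open>nu is the extension nu = - grad(dist(.,Gamma)) of the exterior unit normal to a
  neighbourhood of Gamma in closure Omega, and Dnu x is its Jacobian at x in Gamma.\<close>
definition normal_field_with ::
  "(real^'n::finite) set \<Rightarrow> (real^'n \<Rightarrow> real^'n) \<Rightarrow> (real^'n \<Rightarrow> real^'n^'n) \<Rightarrow> bool"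
  where "normal_field_with \<Omega> nu Dnu \<longleftrightarrow>
     (\<exists>U. open U \<and> frontier \<Omega> \<subseteq> U \<and>
        (\<forall>x\<in>U \<inter> closure \<Omega>. ((\<lambda>y. setdist {y} (frontier \<Omega>)) has_derivative (\<lambda>h. - (nu x \<bullet> h)))
                                  (at x within closure \<Omega>))) \<and>
     (\<forall>x\<in>frontier \<Omega>. (nu has_derivative (\<lambda>h. Dnu x *v h)) (at x within closure \<Omega>))"

text \<open>Mean curvature: H = (kappa_1 + ... + kappa_(N-1))/(N-1) = trace(Dnu)/(N-1).\<close>
definition mean_curv :: "(real^'n::finite \<Rightarrow> real^'n^'n) \<Rightarrow> real^'n \<Rightarrow> real"
  where "mean_curv Dnu x = trace (Dnu x) / (real CARD('n) - 1)"

end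

theory Submission imports Defs
begin

text \<open>Put \<open>M = I - D2u\<close>, \<open>w = ubar - u\<close>, \<open>\<nabla>h = x - z - Du\<close> and
  \<open>F = 1/2 (|Du|^2 + R^2) \<nabla>h - (Du \<bullet> \<nabla>h) Du - N w \<nabla>h - w M Du\<close>. Formally \<open>div F = w |M|^2\<close>, and on
  the boundary the surface divergence theorem for \<open>w \<nabla>h\<close> turns the integral of \<open>F \<bullet> \<nu>\<close> into the left
  hand side of the assumed inequality. As \<open>w > 0\<close> inside, the inequality forces \<open>M = 0\<close>; so \<open>h\<close> is affine,
  \<open>Du = x - c\<close>, and at a boundary point farthest from \<open>c\<close> the Neumann condition gives that the distance is
  \<open>R\<close>, while everywhere else on the boundary the distance is at least \<open>R\<close>.

  Both divergence theorems come from one-dimensional functions of a global defining function \<open>g\<close>: multiply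
  by \<open>K (- g)\<close> with \<open>K\<close> vanishing near \<open>0\<close>, integrate by parts with compact support, and let the layer
  where \<open>K\<close> varies shrink to the boundary. The layer integrals converge to Hausdorff integrals over the
  boundary by Fubini for the pairs \<open>(x, y)\<close> with \<open>|x - y| < r\<close>, \<open>x\<close> inside and \<open>y\<close> on the boundary: seen
  from \<open>y\<close> the domain is a half ball, seen from \<open>x\<close> the boundary is a flat disc. The value of the Hausdorff
  measure of the unit disc only enters as a common positive factor, so the isodiametric inequality is not
  needed.\<close>

section \<open>Hausdorff measure\<close>

text \<open>The obstacle is regularity. \<open>\<Omega>\<close> and \<open>u\<close> are only C^2,
  so \<open>M Du\<close> has no classical divergence, and the surface integral is given by Hausdorff
  measure, not by charts. Every divergence is therefore tested against a compactly supported
  cut-off, and third derivatives of \<open>u\<close> are avoided by swapping partial derivatives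
  under the integral. The layer kernel is dictated by geometry: a ball of radius \<rho> whose centre
  has height s above a hyperplane cuts out a disc of area proportional to the power (N - 1)/2 of
  \<open>\<rho>^2 - s^2\<close>. Taking \<rho> = r / |Dg| near the boundary makes this a function of
  g / r alone, and its primitive \<open>Psi\<close> is the cut-off. In \<open>F\<close>, the summand
  with \<open>R^2\<close> has divergence zero because tr M = 0, and the square |M|^2 comes from tr
  (M D2u) = - |M|^2. On the boundary the surface divergence theorem accounts for \<open>R^2\<close>
  times the normal derivative of h and leaves 1/2 (|Du|^2 - R^2) times it, which is the term with
  the tangential gradient.\<close>

lemma unit_ball_vol_pos: "0 < s \<Longrightarrow> 0 < unit_ball_vol s"
  unfolding unit_ball_vol_def by (auto intro!: divide_pos_pos Gamma_real_pos)

lemma hausdorff_pre_le: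
  assumes "A \<subseteq> (\<Union>i. C i)" "\<And>i. bounded (C i)" "\<And>i. diameter (C i) \<le> d"
  shows "hausdorff_pre s d A \<le> (\<Sum>i. ennreal (unit_ball_vol s * (diameter (C i) / 2) powr s))"
  unfolding hausdorff_pre_def by (rule INF_lower) (use assms in auto)

lemma hausdorff_pre_le_finite:
  fixes C :: "'i \<Rightarrow> 'a::metric_space set"
  assumes "finite I" "A \<subseteq> (\<Union>i\<in>I. C i)" "\<And>i. i \<in> I \<Longrightarrow> bounded (C i)"
    "\<And>i. i \<in> I \<Longrightarrow> diameter (C i) \<le> d" "0 \<le> d"
  shows "hausdorff_pre s d A \<le> (\<Sum>i\<in>I. ennreal (unit_ball_vol s * (diameter (C i) / 2) powr s))"
proof -
  let ?c = "\<lambda>C::'a set. ennreal (unit_ball_vol s * (diameter C / 2) powr s)"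
  obtain f where f: "bij_betw f {..<card I} I"
    using ex_bij_betw_nat_finite[OF assms(1)] by (auto simp: atLeast0LessThan)
  \<comment> \<open>Padding with empty sets costs nothing: their diameter is 0, and
    \<open>0 powr s = 0\<close> for every \<open>s\<close>.\<close>
  define C' where "C' n = (if n < card I then C (f n) else {})" for n
  have fI: "f n \<in> I" if "n < card I" for n using f that by (auto simp: bij_betw_def)
  have "A \<subseteq> (\<Union>i. C' i)"
  proof
    fix x assume "x \<in> A"
    then obtain i where i: "i \<in> I" "x \<in> C i" using assms(2) by auto
    then obtain n where "n < card I" "f n = i" using f by (force simp: bij_betw_def)
    then show "x \<in> (\<Union>i. C' i)" using i by (auto simp: C'_def)
  qed
  then have "hausdorff_pre s d A \<le> (\<Sum>i. ?c (C' i))"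
    by (rule hausdorff_pre_le) (use assms fI in \<open>auto simp: C'_def\<close>)
  also have "\<dots> = (\<Sum>i<card I. ?c (C' i))"
    by (rule suminf_finite) (auto simp: C'_def)
  also have "\<dots> = (\<Sum>i<card I. ?c (C (f i)))" by (simp add: C'_def)
  also have "\<dots> = (\<Sum>i\<in>I. ?c (C i))" by (rule sum.reindex_bij_betw[OF f])
  finally show ?thesis .
qed

lemma hausdorff_pre_mono: "A \<subseteq> B \<Longrightarrow> hausdorff_pre s d A \<le> hausdorff_pre s d B"
  unfolding hausdorff_pre_def by (rule INF_superset_mono) auto

lemma hausdorff_pre_antimono: "d \<le> d' \<Longrightarrow> hausdorff_pre s d' A \<le> hausdorff_pre s d A"
  unfolding hausdorff_pre_def by (rule INF_superset_mono) (auto intro: order_trans)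

lemma hausdorff_pre_empty: "0 \<le> d \<Longrightarrow> hausdorff_pre s d {} = 0"
  using hausdorff_pre_le_finite[of "{}" "{}" "\<lambda>_. {}" d s] by simp

lemma hausdorff_pre_cover:
  assumes "hausdorff_pre s d A < c"
  obtains C where "A \<subseteq> (\<Union>i::nat. C i)" "\<And>i. bounded (C i)" "\<And>i. diameter (C i) \<le> d"
    "(\<Sum>i. ennreal (unit_ball_vol s * (diameter (C i) / 2) powr s)) < c"
  using assms unfolding hausdorff_pre_def INF_less_iff by blast

lemma hausdorff_pre_countable_subadditive:
  fixes A :: "nat \<Rightarrow> 'a::metric_space set"
  shows "hausdorff_pre s d (\<Union>i. A i) \<le> (\<Sum>i. hausdorff_pre s d (A i))"
proof (rule ennreal_le_epsilon)
  fix e :: real assume e: "0 < e" and fin: "(\<Sum>i. hausdorff_pre s d (A i)) < top"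
  let ?c = "\<lambda>C::'a set. ennreal (unit_ball_vol s * (diameter C / 2) powr s)"
  have "\<exists>C. A n \<subseteq> (\<Union>i::nat. C i) \<and> (\<forall>i. bounded (C i)) \<and> (\<forall>i. diameter (C i) \<le> d) \<and>
      (\<Sum>i. ?c (C i)) \<le> hausdorff_pre s d (A n) + ennreal (e * (1/2)^Suc n)" for n
  proof -
    have "hausdorff_pre s d (A n) < top"
      using fin by (metis ennreal_suminf_lessD infinity_ennreal_def)
    \<comment> \<open>Finiteness is what makes adding the slack a strict increase; the geometric
      slacks sum to \<open>e\<close>.\<close>
    then have "hausdorff_pre s d (A n) < hausdorff_pre s d (A n) + ennreal (e * (1/2)^Suc n)"
      using e by (simp add: ennreal_add_left_cancel_less)
    from hausdorff_pre_cover[OF this] show ?thesis by (metis less_imp_le)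
  qed
  then obtain C where C: "\<And>n. A n \<subseteq> (\<Union>i::nat. C n i)" "\<And>n i. bounded (C n i)"
    "\<And>n i. diameter (C n i) \<le> d"
    "\<And>n. (\<Sum>i. ?c (C n i)) \<le> hausdorff_pre s d (A n) + ennreal (e * (1/2)^Suc n)"
    by metis
  define D where "D = (\<lambda>k. case prod_decode k of (n, i) \<Rightarrow> C n i)"
  have "(\<Union>i. A i) \<subseteq> (\<Union>k. D k)"
  proof clarify
    fix x n assume "x \<in> A n"
    then obtain i where "x \<in> C n i" using C(1) by blast
    then have "x \<in> D (prod_encode (n, i))" by (simp add: D_def)
    then show "x \<in> (\<Union>k. D k)" by blast
  qed
  then have "hausdorff_pre s d (\<Union>i. A i) \<le> (\<Sum>k. ?c (D k))"
    by (rule hausdorff_pre_le) (use C in \<open>auto simp: D_def split: prod.split\<close>)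
  also have "\<dots> = (\<Sum>n. \<Sum>i. ?c (C n i))"
  proof -
    have eq: "(\<lambda>k. ?c (D k)) = (\<lambda>(n,i). ?c (C n i)) \<circ> prod_decode"
      by (auto simp: D_def fun_eq_iff split: prod.split)
    show ?thesis unfolding eq o_def by (rule suminf_ennreal_2dimen) auto
  qed
  also have "\<dots> \<le> (\<Sum>n. hausdorff_pre s d (A n) + ennreal (e * (1/2)^Suc n))"
    by (intro suminf_le C(4)) auto
  also have "\<dots> = (\<Sum>n. hausdorff_pre s d (A n)) + (\<Sum>n. ennreal (e * (1/2)^Suc n))"
    by (rule suminf_add[symmetric]) auto
  also have "(\<Sum>n. ennreal (e * (1/2)^Suc n)) = ennreal e"
  proof -
    have "(\<lambda>n. e * (1/2)^Suc n) sums (e * 1)" by (rule sums_mult[OF power_half_series])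
    then show ?thesis using e by (subst suminf_ennreal_eq) auto
  qed
  finally show "hausdorff_pre s d (\<Union>i. A i) \<le> (\<Sum>i. hausdorff_pre s d (A i)) + ennreal e" .
qed

lemma hausdorff_pre_le_outer: "0 < d \<Longrightarrow> hausdorff_pre s d A \<le> hausdorff_outer s A"
  unfolding hausdorff_outer_def by (rule SUP_upper) auto

lemma hausdorff_outer_empty: "hausdorff_outer s {} = 0"
  unfolding hausdorff_outer_def
  by (rule antisym) (auto intro!: SUP_least simp: hausdorff_pre_empty)

lemma hausdorff_outer_mono: "A \<subseteq> B \<Longrightarrow> hausdorff_outer s A \<le> hausdorff_outer s B"
  unfolding hausdorff_outer_def by (intro SUP_mono') (rule hausdorff_pre_mono)

lemma hausdorff_outer_countable_subadditive:
  fixes A :: "nat \<Rightarrow> 'a::metric_space set"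
  shows "hausdorff_outer s (\<Union>i. A i) \<le> (\<Sum>i. hausdorff_outer s (A i))"
  unfolding hausdorff_outer_def[of s "\<Union>i. A i"]
proof (rule SUP_least)
  fix d :: real assume d: "d \<in> {0<..}"
  have "hausdorff_pre s d (\<Union>i. A i) \<le> (\<Sum>i. hausdorff_pre s d (A i))"
    by (rule hausdorff_pre_countable_subadditive)
  also have "\<dots> \<le> (\<Sum>i. hausdorff_outer s (A i))"
    using d by (intro suminf_le hausdorff_pre_le_outer) auto
  finally show "hausdorff_pre s d (\<Union>i. A i) \<le> (\<Sum>i. hausdorff_outer s (A i))" .
qed

lemma hausdorff_outer_Un:
  "hausdorff_outer s (A \<union> B) \<le> hausdorff_outer s A + hausdorff_outer s B"
proof -
  define C where "C n = (if n = 0 then A else if n = 1 then B else {})" for n :: nat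
  have "A \<union> B = (\<Union>i. C i)" by (auto simp: C_def split: if_splits)
  then have "hausdorff_outer s (A \<union> B) \<le> (\<Sum>i. hausdorff_outer s (C i))"
    using hausdorff_outer_countable_subadditive[of s C] by simp
  also have "\<dots> = (\<Sum>i\<in>{0,1}. hausdorff_outer s (C i))"
    by (rule suminf_finite) (auto simp: C_def hausdorff_outer_empty)
  finally show ?thesis by (simp add: C_def)
qed

text \<open>A covering set of diameter at most \<open>d < e\<close> cannot meet both
  \<open>A\<close> and \<open>B\<close>, so a cover of the union splits into covers of the two sets
  that share no member.\<close>

lemma hausdorff_pre_metric:
  fixes A B :: "'a::metric_space set"
  assumes sep: "\<And>x y. x \<in> A \<Longrightarrow> y \<in> B \<Longrightarrow> e \<le> dist x y" and de: "0 \<le> d" "d < e"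
  shows "hausdorff_pre s d A + hausdorff_pre s d B \<le> hausdorff_pre s d (A \<union> B)"
  unfolding hausdorff_pre_def[of s d "A \<union> B"]
proof (rule INF_greatest, clarify)
  fix C :: "nat \<Rightarrow> 'a set"
  assume cov: "A \<union> B \<subseteq> (\<Union>i. C i)" and C: "\<forall>i. bounded (C i) \<and> diameter (C i) \<le> d"
  let ?c = "\<lambda>C::'a set. ennreal (unit_ball_vol s * (diameter C / 2) powr s)"
  define CA where "CA i = (if C i \<inter> A \<noteq> {} then C i else {})" for i
  define CB where "CB i = (if C i \<inter> B \<noteq> {} then C i else {})" for i
  have "hausdorff_pre s d A \<le> (\<Sum>i. ?c (CA i))"
  proof (rule hausdorff_pre_le)
    show "A \<subseteq> (\<Union>i. CA i)"
    proof
      fix x assume "x \<in> A"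
      then obtain i where "x \<in> C i" "x \<in> A" using cov by auto
      then have "x \<in> CA i" by (auto simp: CA_def)
      then show "x \<in> (\<Union>i. CA i)" by blast
    qed
  qed (use C de in \<open>auto simp: CA_def\<close>)
  moreover have "hausdorff_pre s d B \<le> (\<Sum>i. ?c (CB i))"
  proof (rule hausdorff_pre_le)
    show "B \<subseteq> (\<Union>i. CB i)"
    proof
      fix x assume "x \<in> B"
      then obtain i where "x \<in> C i" "x \<in> B" using cov by auto
      then have "x \<in> CB i" by (auto simp: CB_def)
      then show "x \<in> (\<Union>i. CB i)" by blast
    qed
  qed (use C de in \<open>auto simp: CB_def\<close>)
  ultimately have "hausdorff_pre s d A + hausdorff_pre s d B \<le> (\<Sum>i. ?c (CA i)) + (\<Sum>i. ?c (CB i))"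
    by (rule add_mono)
  also have "\<dots> = (\<Sum>i. ?c (CA i) + ?c (CB i))" by (rule suminf_add) auto
  also have "\<dots> \<le> (\<Sum>i. ?c (C i))"
  proof (rule suminf_le)
    fix i
    have "C i \<inter> A = {} \<or> C i \<inter> B = {}"
    proof (rule ccontr)
      assume "\<not> ?thesis"
      then obtain x y where "x \<in> C i" "x \<in> A" "y \<in> C i" "y \<in> B" by auto
      then have "e \<le> dist x y" "dist x y \<le> diameter (C i)"
        using sep C by (auto intro: diameter_bounded_bound)
      then show False using C de by (smt (verit))
    qed
    then show "?c (CA i) + ?c (CB i) \<le> ?c (C i)" by (auto simp: CA_def CB_def)
  qed auto
  finally show "hausdorff_pre s d A + hausdorff_pre s d B \<le> (\<Sum>i. ?c (C i))" .
qed

lemma hausdorff_outer_metric: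
  fixes A B :: "'a::metric_space set"
  assumes sep: "\<And>x y. x \<in> A \<Longrightarrow> y \<in> B \<Longrightarrow> e \<le> dist x y" and "0 < e"
  shows "hausdorff_outer s (A \<union> B) = hausdorff_outer s A + hausdorff_outer s B"
proof (rule antisym[OF hausdorff_outer_Un])
  have "hausdorff_pre s d1 A + hausdorff_pre s d2 B \<le> hausdorff_outer s (A \<union> B)"
    if "0 < d1" "0 < d2" for d1 d2
  proof -
    \<comment> \<open>The mesh sizes for \<open>A\<close> and \<open>B\<close> are independent so
      that the sum of two suprema can be formed; one finer size below the gap \<open>e\<close>
      dominates both.\<close>
    define d where "d = min (min d1 d2) (e/2)"
    have d: "0 < d" "d \<le> d1" "d \<le> d2" "d < e" using that \<open>0 < e\<close> by (auto simp: d_def)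
    have "hausdorff_pre s d1 A + hausdorff_pre s d2 B \<le> hausdorff_pre s d A + hausdorff_pre s d B"
      by (intro add_mono hausdorff_pre_antimono d)
    also have "\<dots> \<le> hausdorff_pre s d (A \<union> B)"
      by (rule hausdorff_pre_metric[OF sep]) (use d in auto)
    also have "\<dots> \<le> hausdorff_outer s (A \<union> B)" by (rule hausdorff_pre_le_outer[OF d(1)])
    finally show ?thesis .
  qed
  then have "(SUP d1\<in>{0<..}. SUP d2\<in>{0<..}. hausdorff_pre s d1 A + hausdorff_pre s d2 B)
     \<le> hausdorff_outer s (A \<union> B)"
    by (intro SUP_least) auto
  also have "(SUP d1\<in>{0<..}. SUP d2\<in>{0<..}. hausdorff_pre s d1 A + hausdorff_pre s d2 B)
      = (SUP d1\<in>{0<..}. hausdorff_pre s d1 A + hausdorff_outer s B)"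
    unfolding hausdorff_outer_def[of s B]
    by (intro SUP_cong refl ennreal_SUP_add_right[symmetric]) auto
  also have "\<dots> = hausdorff_outer s A + hausdorff_outer s B"
    unfolding hausdorff_outer_def[of s A] 
    by (subst ennreal_SUP_add_left) auto
  finally show "hausdorff_outer s A + hausdorff_outer s B \<le> hausdorff_outer s (A \<union> B)" .
qed

text \<open>Caratheodory's criterion for closed sets. Points of \<open>T\<close> outside
  \<open>F\<close> are sorted into rings by their distance to \<open>F\<close>. Rings whose indices
  have the same parity are separated, so the measures of all rings sum to at most twice that of
  \<open>T\<close>. Hence the tails, which hold what lies close to \<open>F\<close>, tend to 0,
  while the rest of \<open>T - F\<close> is separated from \<open>F\<close>.\<close>

lemma hausdorff_outer_incr:
  fixes A :: "nat \<Rightarrow> 'a::metric_space set" and F :: "'a set" and T :: "'a set"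
  assumes F: "closed F" "F \<noteq> {}"
  shows "hausdorff_outer s T \<ge> hausdorff_outer s (T \<inter> F) + hausdorff_outer s (T - F)"
proof (cases "hausdorff_outer s T = top")
  case False
  define Tn where "Tn n = {x\<in>T. 1 / real (Suc n) \<le> infdist x F}" for n :: nat
  define Rk where "Rk k = {x\<in>T. 1 / real (Suc (Suc k)) \<le> infdist x F \<and> infdist x F < 1 / real (Suc k)}" for k :: nat
  have sep: "dist x y \<ge> a - b" if "infdist x F \<ge> a" "infdist y F \<le> b" for x y and a b :: real
    using infdist_triangle[of x F y] that by (simp add: dist_commute)
  have union_le: "(\<Sum>j<n. hausdorff_outer s (Rk (2*j+c))) \<le> hausdorff_outer s (\<Union>j<n. Rk (2*j+c))" for n c
  proof (induction n)
    case (Suc n)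
    have "hausdorff_outer s ((\<Union>j<n. Rk (2*j+c)) \<union> Rk (2*n+c)) = 
       hausdorff_outer s (\<Union>j<n. Rk (2*j+c)) + hausdorff_outer s (Rk (2*n+c))"
    proof (rule hausdorff_outer_metric)
      fix x y assume x: "x \<in> (\<Union>j<n. Rk (2*j+c))" and y: "y \<in> Rk (2*n+c)"
      then obtain j where j: "j < n" "x \<in> Rk (2*j+c)" by auto
      have "1 / real (2*n+c) \<le> 1 / real (Suc (Suc (2*j+c)))"
        using j by (intro divide_left_mono) auto
      also have "\<dots> \<le> infdist x F" using j by (simp add: Rk_def)
      finally have "1 / real (2*n+c) - 1 / real (Suc (2*n+c)) \<le> dist x y"
        using y by (intro sep) (auto simp: Rk_def)
      \<comment> \<open>For \<open>n = 0\<close> the union on the left is empty and the gap may read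
        \<open>1 / 0\<close>, so an arbitrary positive number takes its place.\<close>
      then show "(if n = 0 then 1 else 1 / real (2*n+c) - 1 / real (Suc (2*n+c))) \<le> dist x y"
        using j by simp
    next
      show "0 < (if n = 0 then 1 else 1 / real (2*n+c) - 1 / real (Suc (2*n+c)))"
      proof (cases "n = 0")
        case False
        then have "1 / real (Suc (2*n+c)) < 1 / real (2*n+c)" by (intro divide_strict_left_mono) auto
        then show ?thesis using False by simp
      qed simp
    qed
    then show ?case using Suc by (simp add: lessThan_Suc Un_commute add_mono)
  qed (simp add: hausdorff_outer_empty)
  have sum_c: "(\<Sum>j. hausdorff_outer s (Rk (2*j+c))) \<le> hausdorff_outer s T" for c
  proof (rule suminf_le_const)
    show "(\<Sum>j<n. hausdorff_outer s (Rk (2*j+c))) \<le> hausdorff_outer s T" for n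
      using union_le[of c n] hausdorff_outer_mono[of "\<Union>j<n. Rk (2*j+c)" T s]
      by (auto simp: Rk_def intro: order_trans)
  qed auto
  have fin: "(\<Sum>k. hausdorff_outer s (Rk k)) < top"
  proof -
    have "(\<Sum>k<2*n. hausdorff_outer s (Rk k)) \<le> hausdorff_outer s T + hausdorff_outer s T" for n
    proof -
      have "(\<Sum>k<2*n. hausdorff_outer s (Rk k)) = 
         (\<Sum>j<n. hausdorff_outer s (Rk (2*j+0))) + (\<Sum>j<n. hausdorff_outer s (Rk (2*j+1)))"
        by (induction n) (simp_all add: algebra_simps)
      also have "\<dots> \<le> hausdorff_outer s T + hausdorff_outer s T"
        by (intro add_mono order_trans[OF sum_le_suminf sum_c]) auto
      finally show ?thesis .
    qed
    moreover have "(\<Sum>k<n. hausdorff_outer s (Rk k)) \<le> (\<Sum>k<2*n. hausdorff_outer s (Rk k))" for n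
      by (rule sum_mono2) auto
    ultimately have "(\<Sum>k. hausdorff_outer s (Rk k)) \<le> hausdorff_outer s T + hausdorff_outer s T"
      by (intro suminf_le_const) (auto intro: order_trans)
    then show ?thesis using False by (auto simp: less_top[symmetric] top_unique)
  qed
  have "hausdorff_outer s (T \<inter> F) + hausdorff_outer s (T - F) \<le> hausdorff_outer s T + (\<Sum>k. hausdorff_outer s (Rk (k + n)))" for n
  proof -
    have "T - F \<subseteq> Tn n \<union> (\<Union>k. Rk (k + n))"
    proof
      fix x assume x: "x \<in> T - F"
      then have pos: "0 < infdist x F" using F by (simp add: infdist_pos_not_in_closed)
      show "x \<in> Tn n \<union> (\<Union>k. Rk (k + n))"
      proof (cases "1 / real (Suc n) \<le> infdist x F")
        case True then show ?thesis using x by (simp add: Tn_def)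
      next
        case lt: False
        \<comment> \<open>The least such \<open>m\<close> gives both bounds of a ring: its own
          inequality is the lower bound, and minimality is the strict upper bound from index
          \<open>m - 1\<close>.\<close>
        define m where "m = (LEAST m. 1 / real (Suc m) \<le> infdist x F)"
        obtain m0 where "1 / real (Suc m0) < infdist x F" using nat_approx_posE[OF pos] by auto
        then have m: "1 / real (Suc m) \<le> infdist x F" unfolding m_def by (rule LeastI[OF less_imp_le])
        have mn: "n < m"
        proof (rule ccontr)
          assume "\<not> n < m"
          then have "1 / real (Suc n) \<le> 1 / real (Suc m)" by (intro divide_left_mono) auto
          then show False using m lt by simp
        qed
        then obtain k where k: "m = Suc (k + n)" by (metis add.commute less_iff_Suc_add)
        have "\<not> 1 / real (Suc (k+n)) \<le> infdist x F"
          by (rule not_less_Least) (use k m_def in simp)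
        then have "x \<in> Rk (k + n)" using m k x by (simp add: Rk_def)
        then show ?thesis by blast
      qed
    qed
    then have "hausdorff_outer s (T - F) \<le> hausdorff_outer s (Tn n) + (\<Sum>k. hausdorff_outer s (Rk (k + n)))"
      using hausdorff_outer_mono hausdorff_outer_Un[of s "Tn n" "\<Union>k. Rk (k + n)"]
        add_left_mono[OF hausdorff_outer_countable_subadditive[of s "\<lambda>k. Rk (k + n)"], of "hausdorff_outer s (Tn n)"]
      by (blast intro: order_trans)
    then have "hausdorff_outer s (T \<inter> F) + hausdorff_outer s (T - F) \<le>
       (hausdorff_outer s (T \<inter> F) + hausdorff_outer s (Tn n)) + (\<Sum>k. hausdorff_outer s (Rk (k + n)))"
      by (simp add: add_left_mono add.assoc)
    also have "hausdorff_outer s (T \<inter> F) + hausdorff_outer s (Tn n) = hausdorff_outer s (T \<inter> F \<union> Tn n)"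
    proof (rule hausdorff_outer_metric[symmetric])
      fix x y assume "x \<in> T \<inter> F" "y \<in> Tn n"
      then show "1 / real (Suc n) \<le> dist x y"
        using sep[of "1 / real (Suc n)" y x 0] by (simp add: Tn_def dist_commute)
    qed auto
    also have "\<dots> \<le> hausdorff_outer s T" by (rule hausdorff_outer_mono) (auto simp: Tn_def)
    finally show ?thesis by (simp add: add_right_mono)
  qed
  moreover have "(\<lambda>n. hausdorff_outer s T + (\<Sum>k. hausdorff_outer s (Rk (k + n)))) \<longlonglongrightarrow> hausdorff_outer s T + 0"
  proof (intro tendsto_add tendsto_const)
    define a where "a k = enn2real (hausdorff_outer s (Rk k))" for k
    have a: "hausdorff_outer s (Rk k) = ennreal (a k)" "0 \<le> a k" for k
      using fin by (auto simp: a_def intro!: ennreal_enn2real[symmetric] ennreal_suminf_lessD)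
    have sa: "summable a"
      by (rule summable_suminf_not_top) (use fin a in auto)
    have "(\<lambda>n. ennreal (\<Sum>k. a (k + n))) \<longlonglongrightarrow> ennreal 0"
      by (intro tendsto_ennrealI suminf_exist_split2 sa)
    then show "(\<lambda>n. \<Sum>k. hausdorff_outer s (Rk (k + n))) \<longlonglongrightarrow> 0"
      using sa a by (subst a(1), subst suminf_ennreal2) (auto simp: summable_iff_shift)
  qed
  ultimately show ?thesis
    by (intro LIMSEQ_le_const) auto
qed auto

section \<open>From the outer measure to a Borel measure\<close>

lemma outer_measure_space_hausdorff:
  "outer_measure_space (UNIV :: 'a::metric_space set set) (hausdorff_outer s)"
  unfolding outer_measure_space_def
  by (auto simp: positive_def increasing_def countably_subadditive_def hausdorff_outer_empty
      hausdorff_outer_mono hausdorff_outer_countable_subadditive)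

lemma borel_subset_lambda_system_hausdorff:
  "sets borel \<subseteq> lambda_system (UNIV :: 'a::metric_space set) UNIV (hausdorff_outer s)"
proof -
  interpret sigma_algebra "UNIV :: 'a set" UNIV
    using sigma_algebra_Pow[of "UNIV :: 'a set"] by simp
  have ms: "measure_space (UNIV :: 'a set) (lambda_system UNIV UNIV (hausdorff_outer s)) (hausdorff_outer s)"
    by (rule caratheodory_lemma[OF outer_measure_space_hausdorff])
  then interpret L: sigma_algebra "UNIV :: 'a set" "lambda_system UNIV UNIV (hausdorff_outer s)"
    by (simp add: measure_space_def)
  have "closed F \<Longrightarrow> F \<in> lambda_system UNIV UNIV (hausdorff_outer s)" for F :: "'a set"
  proof (cases "F = {}")
    case False
    assume "closed F"
    show ?thesis unfolding lambda_system_def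
    proof (clarsimp, rule antisym)
      fix T
      show "hausdorff_outer s (F \<inter> T) + hausdorff_outer s ((UNIV - F) \<inter> T) \<le> hausdorff_outer s T"
        using hausdorff_outer_incr[OF \<open>closed F\<close> False, of s T]
        by (simp add: Int_commute Diff_eq)
      show "hausdorff_outer s T \<le> hausdorff_outer s (F \<inter> T) + hausdorff_outer s ((UNIV - F) \<inter> T)"
        by (rule order_trans[OF hausdorff_outer_mono hausdorff_outer_Un]) auto
    qed
  qed auto
  then show ?thesis
    unfolding borel_eq_closed by (auto intro!: L.sigma_sets_subset)
qed

lemma sets_hausdorff_measure [simp]: "sets (hausdorff_measure s) = sets borel"
  unfolding hausdorff_measure_def
  by (metis sets.sets_measure_of_eq space_borel)

lemma space_hausdorff_measure [simp]: "space (hausdorff_measure s) = UNIV"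
  by (simp add: hausdorff_measure_def)

text \<open>\<open>measure_of\<close> silently returns the zero measure unless the given set
  function is a measure on the given sets; Caratheodory's theorem on the Borel sets excludes this
  default.\<close>

lemma emeasure_hausdorff_measure:
  assumes "A \<in> sets (borel :: 'a::metric_space measure)"
  shows "emeasure (hausdorff_measure s) A = hausdorff_outer s A"
proof -
  interpret sigma_algebra "UNIV :: 'a set" UNIV
    using sigma_algebra_Pow[of "UNIV :: 'a set"] by simp
  have "measure_space (UNIV :: 'a set) (lambda_system UNIV UNIV (hausdorff_outer s)) (hausdorff_outer s)"
    by (rule caratheodory_lemma[OF outer_measure_space_hausdorff])
  then have "measure_space (UNIV :: 'a set) (sets borel) (hausdorff_outer s)"
    by (rule measure_down) (use borel_subset_lambda_system_hausdorff sets.sigma_algebra_axioms[of "borel :: 'a measure"] in auto)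
  then show ?thesis unfolding hausdorff_measure_def 
    using emeasure_measure_of_sigma[of UNIV "sets borel" "hausdorff_outer s" A] assms
    by (simp add: measure_space_def)
qed

section \<open>Lipschitz images and similarities\<close>

lemma hausdorff_outer_lipschitz_image:
  fixes f :: "'a::metric_space \<Rightarrow> 'b::metric_space"
  assumes lip: "\<And>x y. x \<in> A \<Longrightarrow> y \<in> A \<Longrightarrow> dist (f x) (f y) \<le> L * dist x y"
    and L: "0 < L" and s: "0 < s"
  shows "hausdorff_outer s (f ` A) \<le> ennreal (L powr s) * hausdorff_outer s A"
proof -
  have step: "hausdorff_pre s d (f ` A) \<le> ennreal (L powr s) * hausdorff_pre s (d / L) A" if d: "0 < d" for d
  proof -
    \<comment> \<open>With the factor on the left, the infimum over the covers of \<open>A\<close>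
      can be treated one cover at a time.\<close>
    have "ennreal (L powr - s) * hausdorff_pre s d (f ` A) \<le> hausdorff_pre s (d / L) A"
      unfolding hausdorff_pre_def[of s "d/L" A]
    proof (rule INF_greatest, clarify)
      fix C :: "nat \<Rightarrow> 'a set"
      assume cov: "A \<subseteq> (\<Union>i. C i)" and C: "\<forall>i. bounded (C i) \<and> diameter (C i) \<le> d / L"
      \<comment> \<open>The intersection with \<open>A\<close> is there because \<open>f\<close> is
        Lipschitz only on \<open>A\<close>.\<close>
      define D where "D i = f ` (C i \<inter> A)" for i
      have dD: "dist x y \<le> L * diameter (C i)" if xyD: "x \<in> D i" "y \<in> D i" for x y i
      proof -
        obtain x' y' where xy: "x' \<in> C i \<inter> A" "y' \<in> C i \<inter> A" "x = f x'" "y = f y'"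
          using xyD unfolding D_def by blast
        then have "dist x y \<le> L * dist x' y'" using lip by auto
        also have "\<dots> \<le> L * diameter (C i)"
          using L xy C by (intro mult_left_mono diameter_bounded_bound) auto
        finally show ?thesis .
      qed
      have bD: "bounded (D i)" for i
      proof (cases "D i = {}")
        case False
        then obtain x where "x \<in> D i" by auto
        then show ?thesis using dD unfolding bounded_def by blast
      qed simp
      have diD: "diameter (D i) \<le> L * diameter (C i)" for i
      proof (cases "D i = {}")
        case False
        then have "(SUP (x,y)\<in>D i \<times> D i. dist x y) \<le> L * diameter (C i)"
          using dD by (intro cSUP_least) auto
        then show ?thesis using False by (simp add: diameter_def[of "D i"])
      qed (use C L in \<open>auto intro!: mult_nonneg_nonneg diameter_ge_0\<close>)
      have "hausdorff_pre s d (f ` A) \<le> (\<Sum>i. ennreal (unit_ball_vol s * (diameter (D i) / 2) powr s))"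
      proof (rule hausdorff_pre_le)
        show "f ` A \<subseteq> (\<Union>i. D i)" using cov by (fastforce simp: D_def)
        show "diameter (D i) \<le> d" for i
          using order_trans[OF diD mult_left_mono[of "diameter (C i)" "d / L" L]] C L by auto
      qed (rule bD)
      also have "\<dots> \<le> (\<Sum>i. ennreal (L powr s) * ennreal (unit_ball_vol s * (diameter (C i) / 2) powr s))"
      proof (intro suminf_le)
        fix i
        have "(diameter (D i) / 2) powr s \<le> (L * (diameter (C i) / 2)) powr s"
          using diD[of i] s bD by (intro powr_mono2) (auto intro: diameter_ge_0)
        also have "\<dots> = L powr s * (diameter (C i) / 2) powr s"
          using L C by (subst powr_mult) (auto intro: diameter_ge_0)
        finally have "unit_ball_vol s * (diameter (D i) / 2) powr s \<le> L powr s * (unit_ball_vol s * (diameter (C i) / 2) powr s)"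
          using unit_ball_vol_pos[OF s] by (simp add: mult.left_commute)
        then show "ennreal (unit_ball_vol s * (diameter (D i) / 2) powr s) \<le> ennreal (L powr s) * ennreal (unit_ball_vol s * (diameter (C i) / 2) powr s)"
          by (simp add: ennreal_mult'[symmetric] ennreal_leI)
      qed auto
      also have "\<dots> = ennreal (L powr s) * (\<Sum>i. ennreal (unit_ball_vol s * (diameter (C i) / 2) powr s))"
        by (rule ennreal_suminf_cmult)
      finally have "ennreal (L powr - s) * hausdorff_pre s d (f ` A) \<le>
         ennreal (L powr - s) * (ennreal (L powr s) * (\<Sum>i. ennreal (unit_ball_vol s * (diameter (C i) / 2) powr s)))"
        by (rule mult_left_mono) simp
      also have "\<dots> = (\<Sum>i. ennreal (unit_ball_vol s * (diameter (C i) / 2) powr s))"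
        using L by (simp add: mult.assoc[symmetric] ennreal_mult'[symmetric] powr_add[symmetric])
      finally show "ennreal (L powr - s) * hausdorff_pre s d (f ` A) \<le> (\<Sum>i. ennreal (unit_ball_vol s * (diameter (C i) / 2) powr s))" .
    qed
    then have "ennreal (L powr s) * (ennreal (L powr - s) * hausdorff_pre s d (f ` A)) \<le> ennreal (L powr s) * hausdorff_pre s (d / L) A"
      by (rule mult_left_mono) simp
    then show ?thesis
      using L by (simp add: mult.assoc[symmetric] ennreal_mult'[symmetric] powr_add[symmetric])
  qed
  show ?thesis unfolding hausdorff_outer_def[of s "f ` A"]
  proof (rule SUP_least)
    fix d :: real assume "d \<in> {0<..}"
    then have "hausdorff_pre s d (f ` A) \<le> ennreal (L powr s) * hausdorff_pre s (d / L) A"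
      and "0 < d / L" using step L by auto
    then show "hausdorff_pre s d (f ` A) \<le> ennreal (L powr s) * hausdorff_outer s A"
      by (meson hausdorff_pre_le_outer mult_left_mono order_trans zero_le)
  qed
qed

lemma hausdorff_outer_scale_image:
  fixes f :: "'a::metric_space \<Rightarrow> 'b::metric_space"
  assumes eq: "\<And>x y. x \<in> A \<Longrightarrow> y \<in> A \<Longrightarrow> dist (f x) (f y) = L * dist x y"
    and L: "0 < L" and s: "0 < s"
  shows "hausdorff_outer s (f ` A) = ennreal (L powr s) * hausdorff_outer s A"
proof (rule antisym)
  show "hausdorff_outer s (f ` A) \<le> ennreal (L powr s) * hausdorff_outer s A"
    by (rule hausdorff_outer_lipschitz_image) (use assms in auto)
  have inj: "inj_on f A"
    using eq L by (intro inj_onI) (metis dist_eq_0_iff less_irrefl mult_eq_0_iff)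
  \<comment> \<open>The reverse inequality is the Lipschitz bound for the inverse map, with constant
    \<open>1 / L\<close>.\<close>
  define g where "g = inv_into A f"
  have gA: "g ` (f ` A) = A" using inj by (simp add: g_def)
  have gf: "g (f x) = x" if "x \<in> A" for x using inj that by (simp add: g_def)
  have "hausdorff_outer s (g ` (f ` A)) \<le> ennreal ((1/L) powr s) * hausdorff_outer s (f ` A)"
    by (rule hausdorff_outer_lipschitz_image) (use assms gf in auto)
  then have "ennreal (L powr s) * hausdorff_outer s A \<le> ennreal (L powr s) * (ennreal ((1/L) powr s) * hausdorff_outer s (f ` A))"
    unfolding gA by (rule mult_left_mono) simp
  also have "\<dots> = hausdorff_outer s (f ` A)"
    using L by (simp add: mult.assoc[symmetric] ennreal_mult'[symmetric] powr_mult[symmetric])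
  finally show "ennreal (L powr s) * hausdorff_outer s A \<le> hausdorff_outer s (f ` A)" .
qed

section \<open>Hausdorff measure of flat discs\<close>

definition normal_disc :: "real^'n::finite \<Rightarrow> real \<Rightarrow> (real^'n) set" where
  "normal_disc e \<rho> = {v. v \<bullet> e = 0 \<and> norm v \<le> \<rho>}"

text \<open>A grid of mesh \<open>1 / j\<close> covers the disc by
  \<open>(2 * j + 1) ^ (N - 1)\<close> flat cells, each contributing a multiple of
  \<open>(1 / j) powr (N - 1)\<close>; the product stays bounded as \<open>j\<close> grows.\<close>

lemma hausdorff_outer_coordinate_disc_finite:
  fixes k :: "'n::finite"
  assumes N: "CARD('n) \<ge> 2"
  shows "hausdorff_outer (real CARD('n) - 1) (normal_disc (axis k 1 :: real^'n) 1) < top"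
proof -
  define N where "N = CARD('n)"
  define s where "s = real N - 1"
  have s: "0 < s" and Ns: "real (N - 1) = s" using N by (auto simp: s_def N_def)
  \<comment> \<open>At most \<open>3 * j\<close> cells per direction times half the diameter bound
    \<open>N / j\<close>, raised to the power \<open>s\<close>.\<close>
  define K where "K = unit_ball_vol s * (3 * real N / 2) powr s"
  have "hausdorff_pre s d (normal_disc (axis k 1 :: real^'n) 1) \<le> ennreal K" if d: "0 < d" for d
  proof -
    obtain j where j: "real N / d < real j" "0 < j"
      using reals_Archimedean2[of "max (real N / d) 0"] by (metis max_less_iff_conj of_nat_0_less_iff)
    \<comment> \<open>The index \<open>2 * j\<close> occurs only for the coordinate value 1, where
      the floor in the choice of \<open>a\<close> below reaches its maximum.\<close>
    define I where "I = PiE (UNIV - {k}) (\<lambda>_. {0..2*j})"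
    define C where "C a = {x :: real^'n. x $ k = 0 \<and> (\<forall>i\<in>UNIV - {k}. real (a i) / j - 1 \<le> x $ i \<and> x $ i \<le> (real (a i) + 1) / j - 1)}" for a :: "'n \<Rightarrow> nat"
    have finI: "finite I" by (auto simp: I_def intro!: finite_PiE)
    have cardI: "card I = (2 * j + 1) ^ (N - 1)"
      by (simp add: I_def card_PiE N_def)
    have dC: "dist x y \<le> real N / j" if "x \<in> C a" "y \<in> C a" for x y a
    proof -
      have "norm (x - y) \<le> (\<Sum>i\<in>UNIV. \<bar>(x - y) $ i\<bar>)" by (rule norm_le_l1_cart)
      also have "\<dots> \<le> (\<Sum>i\<in>(UNIV::'n set). 1 / j)"
      proof (rule sum_mono)
        fix i :: 'n
        show "\<bar>(x - y) $ i\<bar> \<le> 1 / real j"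
        proof (cases "i = k")
          case False
          then have "real (a i) / j - 1 \<le> x $ i" "x $ i \<le> (real (a i) + 1) / j - 1"
            "real (a i) / j - 1 \<le> y $ i" "y $ i \<le> (real (a i) + 1) / j - 1"
            using that by (auto simp: C_def)
          then show ?thesis by (simp add: abs_le_iff add_divide_distrib)
        qed (use that in \<open>simp add: C_def\<close>)
      qed
      also have "\<dots> = real N / j" by (simp add: N_def)
      finally show ?thesis by (simp add: dist_norm)
    qed
    have bC: "bounded (C a)" for a
    proof (cases "C a = {}")
      case False then show ?thesis using dC[of _ a] unfolding bounded_def by blast
    qed simp
    have diC: "diameter (C a) \<le> real N / j" for a
      using dC[of _ a] by (intro diameter_le) (auto simp: dist_norm)
    have "hausdorff_pre s d (normal_disc (axis k 1 :: real^'n) 1) \<le> (\<Sum>a\<in>I. ennreal (unit_ball_vol s * (diameter (C a) / 2) powr s))"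
    proof (rule hausdorff_pre_le_finite[OF finI])
      show "normal_disc (axis k 1) 1 \<subseteq> (\<Union>a\<in>I. C a)"
      proof
        fix x :: "real^'n" assume "x \<in> normal_disc (axis k 1) 1"
        then have x: "x $ k = 0" "norm x \<le> 1" by (auto simp: normal_disc_def inner_axis)
        define a where "a = (\<lambda>i. if i = k then undefined else nat \<lfloor>(x $ i + 1) * j\<rfloor>)"
        have xi: "\<bar>x $ i\<bar> \<le> 1" for i using x(2) component_le_norm_cart[of x i] by simp
        have nn: "0 \<le> (x $ i + 1) * j" for i using xi[of i] by auto
        have "a \<in> I"
        proof -
          have "nat \<lfloor>(x $ i + 1) * j\<rfloor> \<le> 2 * j" for i
          proof -
            have "(x $ i + 1) * j \<le> 2 * real j" using xi[of i] by (intro mult_right_mono) auto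
            then show ?thesis by linarith
          qed
          then show ?thesis unfolding I_def by (intro PiE_I) (auto simp: a_def)
        qed
        moreover have "x \<in> C a"
        proof -
          have "real (a i) / j - 1 \<le> x $ i \<and> x $ i \<le> (real (a i) + 1) / j - 1" if "i \<noteq> k" for i
          proof -
            have "real (a i) = of_int \<lfloor>(x $ i + 1) * j\<rfloor>" using nn[of i] that by (simp add: a_def)
            then have "real (a i) \<le> (x $ i + 1) * j" "(x $ i + 1) * j \<le> real (a i) + 1"
              by linarith+
            then show ?thesis using j(2) by (simp add: field_simps)
          qed
          then show ?thesis using x by (auto simp: C_def)
        qed
        ultimately show "x \<in> (\<Union>a\<in>I. C a)" by blast
      qed
      show "diameter (C a) \<le> d" for a
      proof -
        have "real N / j \<le> d" using j d by (simp add: field_simps)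
        then show ?thesis using diC[of a] by linarith
      qed
    qed (use bC d in auto)
    also have "\<dots> \<le> (\<Sum>a\<in>I. ennreal (unit_ball_vol s * (real N / j / 2) powr s))"
    proof (intro sum_mono ennreal_leI mult_left_mono powr_mono2)
      show "diameter (C a) / 2 \<le> real N / j / 2" for a using diC[of a] by simp
    qed (use s bC unit_ball_vol_pos[OF s] in \<open>auto intro: diameter_ge_0\<close>)
    also have "\<dots> = ennreal (real (card I) * (unit_ball_vol s * (real N / j / 2) powr s))"
      using unit_ball_vol_pos[OF s] by (simp add: ennreal_of_nat_eq_real_of_nat ennreal_mult')
    also have "\<dots> \<le> ennreal K"
    proof (rule ennreal_leI)
      have "real (card I) = (2 * real j + 1) powr s"
        using Ns s powr_realpow[of "2 * real j + 1" "N - 1"] by (simp add: cardI add.commute)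
      also have "\<dots> \<le> (3 * real j) powr s" using j s by (intro powr_mono2) auto
      finally have "real (card I) * (unit_ball_vol s * (real N / j / 2) powr s)
          \<le> (3 * real j) powr s * (unit_ball_vol s * (real N / j / 2) powr s)"
        using unit_ball_vol_pos[OF s] by (intro mult_right_mono) auto
      also have "\<dots> = unit_ball_vol s * (3 * real j * (real N / j / 2)) powr s"
        using j(2) by (subst powr_mult) auto
      also have "3 * real j * (real N / j / 2) = 3 * real N / 2" using j(2) by simp
      finally show "real (card I) * (unit_ball_vol s * (real N / j / 2) powr s) \<le> K" by (simp add: K_def)
    qed
    finally show ?thesis .
  qed
  then have "hausdorff_outer s (normal_disc (axis k 1 :: real^'n) 1) \<le> ennreal K"
    unfolding hausdorff_outer_def by (intro SUP_least) auto
  then have "hausdorff_outer s (normal_disc (axis k 1 :: real^'n) 1) < top"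
    by (rule le_less_trans) simp
  then show ?thesis by (simp add: s_def N_def)
qed

text \<open>Each covering set is thickened to a box: its diameter to both sides of a chosen point in
  the directions of the disc, and the interval from -1 to 1 along the axis \<open>k\<close>. These
  boxes cover the unit ball, so its Lebesgue measure bounds the cost of the cover from
  below.\<close>

lemma hausdorff_outer_coordinate_disc_pos:
  fixes k :: "'n::finite"
  assumes N: "CARD('n) \<ge> 2"
  shows "0 < hausdorff_outer (real CARD('n) - 1) (normal_disc (axis k 1 :: real^'n) 1)"
proof -
  define m where "m = CARD('n) - 1"
  define s where "s = real CARD('n) - 1"
  have s: "0 < s" and ms: "real m = s" and m0: "0 < m" using N by (auto simp: s_def m_def)
  define c where "c = unit_ball_vol s"
  have c: "0 < c" using unit_ball_vol_pos[OF s] by (simp add: c_def)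
  define V where "V = emeasure lborel (ball (0::real^'n) 1)"
  have V: "0 < V"
    using content_ball_pos[of 1 "0::real^'n"] unfolding V_def
    by (auto simp: measure_def enn2real_positive_iff)
  have "ennreal (c / (2 * 4 ^ m)) * V \<le> hausdorff_pre s 1 (normal_disc (axis k 1 :: real^'n) 1)"
    unfolding hausdorff_pre_def
  proof (rule INF_greatest, clarify)
    fix C :: "nat \<Rightarrow> (real^'n) set"
    assume cov: "normal_disc (axis k 1) 1 \<subseteq> (\<Union>i. C i)" and C: "\<forall>i. bounded (C i) \<and> diameter (C i) \<le> 1"
    \<comment> \<open>For an empty \<open>C i\<close> the point is arbitrary, but then
      \<open>d i = 0\<close> and the box is a null set.\<close>
    define z where "z i = (SOME x. x \<in> C i)" for i
    define d where "d i = diameter (C i)" for i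
    have d0: "0 \<le> d i" for i using C by (auto simp: d_def intro: diameter_ge_0)
    define lo where "lo i = (\<chi> j. if j = k then - 1 else z i $ j - d i)" for i
    define hi where "hi i = (\<chi> j. if j = k then 1 else z i $ j + d i)" for i
    have "ball 0 1 \<subseteq> (\<Union>i. cbox (lo i) (hi i))"
    proof
      fix x :: "real^'n" assume "x \<in> ball 0 1"
      then have x: "norm x < 1" by simp
      define y where "y = (\<chi> j. if j = k then 0 else x $ j)"
      have "norm y \<le> norm x" by (rule norm_le_componentwise_cart) (simp add: y_def)
      then have "y \<in> normal_disc (axis k 1) 1" using x by (simp add: normal_disc_def inner_axis y_def)
      then obtain i where i: "y \<in> C i" using cov by auto
      then have "z i \<in> C i" unfolding z_def by (rule someI)
      then have "dist y (z i) \<le> d i" using i C by (auto simp: d_def intro: diameter_bounded_bound)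
      then have yz: "\<bar>y $ j - z i $ j\<bar> \<le> d i" for j
        using component_le_norm_cart[of "y - z i" j] by (simp add: dist_norm)
      have "j \<noteq> k \<Longrightarrow> \<bar>x $ j - z i $ j\<bar> \<le> d i" for j using yz[of j] by (simp add: y_def)
      moreover have "\<bar>x $ k\<bar> \<le> 1" using x component_le_norm_cart[of x k] by simp
      ultimately have xx: "j \<noteq> k \<Longrightarrow> \<bar>x $ j - z i $ j\<bar> \<le> d i" "\<bar>x $ k\<bar> \<le> 1" for j by auto
      have "x \<in> cbox (lo i) (hi i)"
        unfolding mem_box_cart
      proof
        fix j show "lo i $ j \<le> x $ j \<and> x $ j \<le> hi i $ j"
          using xx(1)[of j] xx(2) by (cases "j = k") (auto simp: lo_def hi_def abs_le_iff)
      qed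
      then show "x \<in> (\<Union>i. cbox (lo i) (hi i))" by blast
    qed
    then have "V \<le> emeasure lborel (\<Union>i. cbox (lo i) (hi i))"
      unfolding V_def by (rule emeasure_mono) auto
    also have "\<dots> \<le> (\<Sum>i. emeasure lborel (cbox (lo i) (hi i)))"
      by (rule emeasure_subadditive_countably) auto
    also have "\<dots> = (\<Sum>i. ennreal (2 * 4 ^ m / c) * ennreal (c * (d i / 2) powr s))"
    proof (intro suminf_cong)
      fix i
      have ne: "cbox (lo i) (hi i) \<noteq> {}"
        using d0[of i] by (auto simp: interval_ne_empty_cart lo_def hi_def)
      have "emeasure lborel (cbox (lo i) (hi i)) = ennreal (measure lborel (cbox (lo i) (hi i)))"
        by (rule emeasure_eq_ennreal_measure) (simp add: emeasure_lborel_cbox_eq)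
      also have "measure lborel (cbox (lo i) (hi i)) = (\<Prod>j\<in>UNIV. hi i $ j - lo i $ j)"
        by (rule content_cbox_cart[OF ne])
      also have "\<dots> = (\<Prod>j\<in>insert k (UNIV - {k}). hi i $ j - lo i $ j)" by (simp add: insert_absorb)
      also have "\<dots> = 2 * (\<Prod>j\<in>UNIV - {k}. 2 * d i)"
        by (subst prod.insert) (auto simp: lo_def hi_def intro!: prod.cong)
      also have "\<dots> = 2 * (2 * d i) ^ m" by (simp add: m_def)
      also have "\<dots> = 2 * 4 ^ m * (d i / 2) ^ m"
        using power_mult_distrib[of 4 "d i / 2" m] by (simp add: mult.assoc)
      also have "(d i / 2) ^ m = (d i / 2) powr s"
        using d0[of i] m0 ms by (cases "d i = 0") (auto simp: powr_realpow[symmetric])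
      finally have "emeasure lborel (cbox (lo i) (hi i)) = ennreal (2 * 4 ^ m * (d i / 2) powr s)" .
      also have "\<dots> = ennreal (2 * 4 ^ m / c) * ennreal (c * (d i / 2) powr s)"
        using c by (subst ennreal_mult'[symmetric]) auto
      finally show "emeasure lborel (cbox (lo i) (hi i)) = ennreal (2 * 4 ^ m / c) * ennreal (c * (d i / 2) powr s)" .
    qed
    also have "\<dots> = ennreal (2 * 4 ^ m / c) * (\<Sum>i. ennreal (c * (d i / 2) powr s))"
      by (rule ennreal_suminf_cmult)
    finally have "ennreal (c / (2 * 4 ^ m)) * V \<le> ennreal (c / (2 * 4 ^ m)) * (ennreal (2 * 4 ^ m / c) * (\<Sum>i. ennreal (c * (d i / 2) powr s)))"
      by (rule mult_left_mono) simp
    also have "\<dots> = (\<Sum>i. ennreal (c * (d i / 2) powr s))"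
      using c by (simp add: mult.assoc[symmetric] ennreal_mult'[symmetric])
    finally show "ennreal (c / (2 * 4 ^ m)) * V \<le> (\<Sum>i. ennreal (Defs.unit_ball_vol s * (diameter (C i) / 2) powr s))"
      by (simp add: d_def c_def)
  qed
  also have "\<dots> \<le> hausdorff_outer s (normal_disc (axis k 1 :: real^'n) 1)"
    by (rule hausdorff_pre_le_outer) simp
  finally have "ennreal (c / (2 * 4 ^ m)) * V \<le> hausdorff_outer s (normal_disc (axis k 1 :: real^'n) 1)" .
  moreover have "0 < ennreal (c / (2 * 4 ^ m)) * V"
    using V c by (simp add: ennreal_zero_less_mult_iff)
  ultimately show ?thesis by (simp add: s_def order_less_le_trans)
qed

text \<open>\<open>undefined\<close> stands for an arbitrary coordinate axis;
  \<open>hausdorff_outer_normal_disc\<close> carries the constant to every unit normal.\<close>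

definition disc_const :: "'n::finite itself \<Rightarrow> real" where
  "disc_const _ = enn2real (hausdorff_outer (real CARD('n) - 1) (normal_disc (axis undefined 1 :: real^'n) 1))"

lemma disc_const_pos: "CARD('n::finite) \<ge> 2 \<Longrightarrow> 0 < disc_const TYPE('n)"
  using hausdorff_outer_coordinate_disc_finite hausdorff_outer_coordinate_disc_pos
  by (auto simp: disc_const_def enn2real_positive_iff)

text \<open>A rotation taking the axis to \<open>e\<close>, followed by a dilation and a
  translation, is a similarity of ratio \<open>\<rho>\<close>. The ratio must be positive, so the
  disc that is a single point is treated apart.\<close>

lemma hausdorff_outer_normal_disc:
  fixes e w :: "real^'n::finite"
  assumes N: "CARD('n) \<ge> 2" and e: "norm e = 1" and \<rho>: "0 \<le> \<rho>"
  shows "hausdorff_outer (real CARD('n) - 1) ((+) w ` normal_disc e \<rho>) = ennreal (disc_const TYPE('n) * \<rho> ^ (CARD('n) - 1))"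
proof (cases "\<rho> = 0")
  case True
  have s: "0 < real CARD('n) - 1" using N by auto
  have "hausdorff_outer (real CARD('n) - 1) {w} = 0"
  proof -
    have "hausdorff_pre (real CARD('n) - 1) d {w} \<le> 0" if "0 < d" for d
      using hausdorff_pre_le_finite[of "{()}" "{w}" "\<lambda>_. {w}" d "real CARD('n) - 1"] that by simp
    then show ?thesis unfolding hausdorff_outer_def by (intro antisym SUP_least) auto
  qed
  moreover have "normal_disc e \<rho> = {0}" by (auto simp: normal_disc_def True)
  ultimately show ?thesis using N True by (simp add: power_0_left)
next
  case False
  then have \<rho>: "0 < \<rho>" using \<rho> by simp
  let ?s = "real CARD('n) - 1" let ?a = "axis undefined 1 :: real^'n"
  have s: "0 < ?s" using N by auto
  obtain T where T: "orthogonal_transformation T" "T ?a = e"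
    using orthogonal_transformation_exists[of ?a e] e by auto
  have lin: "linear T" using T(1) by (rule orthogonal_transformation_linear)
  define f where "f v = w + \<rho> *\<^sub>R T v" for v
  have img: "f ` normal_disc ?a 1 = (+) w ` normal_disc e \<rho>"
  proof -
    have "(\<lambda>v. \<rho> *\<^sub>R T v) ` normal_disc ?a 1 = normal_disc e \<rho>"
    proof (intro equalityI subsetI)
      fix x assume "x \<in> (\<lambda>v. \<rho> *\<^sub>R T v) ` normal_disc ?a 1"
      then obtain v where v: "x = \<rho> *\<^sub>R T v" "v \<bullet> ?a = 0" "norm v \<le> 1" by (auto simp: normal_disc_def)
      have "T v \<bullet> e = v \<bullet> ?a" using T by (metis orthogonal_transformation_def)
      then show "x \<in> normal_disc e \<rho>"
        using v \<rho> orthogonal_transformation_norm[OF T(1), of v] by (simp add: normal_disc_def)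
    next
      fix x assume x: "x \<in> normal_disc e \<rho>"
      obtain v where v: "T v = (1/\<rho>) *\<^sub>R x"
        using orthogonal_transformation_surj[OF T(1)] by (metis surjD)
      have "v \<bullet> ?a = T v \<bullet> T ?a" using T(1) by (metis orthogonal_transformation_def)
      then have "v \<bullet> ?a = 0" using x v T(2) by (simp add: normal_disc_def)
      moreover have "norm v \<le> 1"
        using orthogonal_transformation_norm[OF T(1), of v] x v \<rho>
        by (simp add: normal_disc_def) (metis divide_le_eq_1_pos)
      ultimately show "x \<in> (\<lambda>v. \<rho> *\<^sub>R T v) ` normal_disc ?a 1"
        using v \<rho> by (intro image_eqI[of _ _ v]) (auto simp: normal_disc_def)
    qed
    moreover have "f ` normal_disc ?a 1 = (+) w ` ((\<lambda>v. \<rho> *\<^sub>R T v) ` normal_disc ?a 1)"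
      unfolding image_image f_def ..
    ultimately show ?thesis by (simp only:)
  qed
  have "hausdorff_outer ?s (f ` normal_disc ?a 1) = ennreal (\<rho> powr ?s) * hausdorff_outer ?s (normal_disc ?a 1)"
  proof (rule hausdorff_outer_scale_image[OF _ \<rho> s])
    fix x y
    show "dist (f x) (f y) = \<rho> * dist x y"
      using \<rho> orthogonal_transformation_norm[OF T(1), of "x - y"]
      by (simp add: f_def dist_norm linear_diff[OF lin] flip: scaleR_diff_right)
  qed
  moreover have "hausdorff_outer ?s (normal_disc ?a 1) = ennreal (disc_const TYPE('n))"
    unfolding disc_const_def
    using hausdorff_outer_coordinate_disc_finite[OF N, of undefined] by simp
  moreover have "\<rho> powr ?s = \<rho> ^ (CARD('n) - 1)"
  proof -
    have eq: "?s = real (CARD('n) - 1)" using N by (simp add: of_nat_diff)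
    show ?thesis unfolding eq by (rule powr_realpow[OF \<rho>])
  qed
  ultimately have "hausdorff_outer ?s ((+) w ` normal_disc e \<rho>)
      = ennreal (\<rho> ^ (CARD('n) - 1)) * ennreal (disc_const TYPE('n))"
    by (simp only: img)
  then show ?thesis
    using \<rho> ennreal_mult''[of "\<rho> ^ (CARD('n) - 1)" "disc_const TYPE('n)"] by (simp add: mult.commute)
qed

section \<open>A global defining function\<close>

text \<open>The rank-one term in the Jacobian of a scalar function times a vector field.\<close>

definition outer_prod :: "real^'n::finite \<Rightarrow> real^'n \<Rightarrow> real^'n^'n" where
  "outer_prod x y = (\<chi> i j. x $ i * y $ j)"

lemma outer_prod_mult_vec: "outer_prod x y *v h = (y \<bullet> h) *\<^sub>R x"
  by (simp add: outer_prod_def matrix_vector_mult_def inner_vec_def vec_eq_iff sum_distrib_left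
      sum_distrib_right mult_ac)

lemma continuous_on_outer_prod:
  "continuous_on S f \<Longrightarrow> continuous_on S g \<Longrightarrow> continuous_on S (\<lambda>x. outer_prod (f x) (g x))"
  unfolding outer_prod_def by (intro continuous_intros)

text \<open>Powers of the positive part serve as bump functions: the cube is C^2 and the square is
  C^1, which is the smoothness required of the cut-offs below.\<close>

lemma has_derivative_max_power:
  "((\<lambda>t::real. (max 0 t) ^ Suc (Suc n)) has_real_derivative real (Suc (Suc n)) * (max 0 t) ^ Suc n) (at t)"
proof (cases "t = 0")
  case True
  have "(\<lambda>h. ((max 0 (0 + h)) ^ Suc (Suc n) - (max 0 (0::real)) ^ Suc (Suc n)) / h) \<midarrow>0\<rightarrow> 0"
  proof (rule Lim_null_comparison)
    show "\<forall>\<^sub>F h in at 0. norm (((max 0 (0 + h)) ^ Suc (Suc n) - (max 0 (0::real)) ^ Suc (Suc n)) / h) \<le> \<bar>h\<bar> ^ Suc n"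
    proof (rule always_eventually, rule allI)
      fix h :: real
      show "norm (((max 0 (0 + h)) ^ Suc (Suc n) - (max 0 (0::real)) ^ Suc (Suc n)) / h) \<le> \<bar>h\<bar> ^ Suc n"
        by (cases "h > 0") (auto simp: max_def abs_mult intro: mult_nonpos_nonneg)
    qed
    have "((\<lambda>h::real. \<bar>h\<bar> ^ Suc n) \<longlongrightarrow> \<bar>0\<bar> ^ Suc n) (at 0)" by (intro tendsto_intros)
    then show "((\<lambda>h::real. \<bar>h\<bar> ^ Suc n) \<longlongrightarrow> 0) (at 0)" by simp
  qed
  then show ?thesis unfolding True DERIV_def by simp
next
  case False
  show ?thesis
  proof (cases "t > 0")
    case True
    have "((\<lambda>t::real. t ^ Suc (Suc n)) has_real_derivative real (Suc (Suc n)) * max 0 t ^ Suc n) (at t)"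
      using DERIV_pow[of "Suc (Suc n)" t] True by (simp add: max_def)
    then show ?thesis
      by (rule has_field_derivative_transform_within_open[where S = "{0<..}"]) (use True in \<open>auto simp: max_def\<close>)
  next
    case neg: False
    have "((\<lambda>t::real. 0) has_real_derivative 0) (at t)" by simp
    then have "((\<lambda>t::real. (max 0 t) ^ Suc (Suc n)) has_real_derivative 0) (at t)"
      by (rule has_field_derivative_transform_within_open[where S = "{..<0}"]) (use neg False in \<open>auto simp: max_def\<close>)
    then show ?thesis using neg False by (simp add: max_def)
  qed
qed

section \<open>Calculus of C^2 functions on open sets\<close>

definition C2_fun :: "(real^'n::finite) set \<Rightarrow> (real^'n \<Rightarrow> real) \<Rightarrow> bool" where
  "C2_fun U f \<longleftrightarrow> (\<exists>Df D2f. C2_on_with U f Df D2f)"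

lemma has_derivative_inner_unique:
  fixes a b :: "'a::euclidean_space"
  assumes "(f has_derivative (\<lambda>h. a \<bullet> h)) (at x)" "(f has_derivative (\<lambda>h. b \<bullet> h)) (at x)"
  shows "a = b"
proof -
  have "(\<lambda>h. a \<bullet> h) = (\<lambda>h. b \<bullet> h)" by (rule has_derivative_unique[OF assms])
  then show ?thesis by (metis vector_eq_rdot inner_commute)
qed

lemma has_derivative_matrix_unique:
  fixes A B :: "real^'n::finite^'n"
  assumes "(f has_derivative (\<lambda>h. A *v h)) (at x)" "(f has_derivative (\<lambda>h. B *v h)) (at x)"
  shows "A = B"
proof -
  have "(\<lambda>h. A *v h) = (\<lambda>h. B *v h)" by (rule has_derivative_unique[OF assms])
  then show ?thesis by (metis matrix_eq)
qed

text \<open>Derivatives at a point are unique, so the globally chosen \<open>Df\<close> and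
  \<open>D2f\<close> agree with every local pair and inherit its continuity.\<close>

lemma C2_fun_local:
  assumes "\<And>x. x \<in> U \<Longrightarrow> \<exists>V. open V \<and> x \<in> V \<and> C2_fun V f"
  shows "C2_fun U f"
proof -
  define Df where "Df x = (SOME d. (f has_derivative (\<lambda>h. d \<bullet> h)) (at x))" for x
  define D2f where "D2f x = (SOME A. (Df has_derivative (\<lambda>h. A *v h)) (at x))" for x
  have key: "\<exists>V. open V \<and> x \<in> V \<and> C2_on_with V f Df D2f" if xU: "x \<in> U" for x
  proof -
    obtain V d A where V: "open V" "x \<in> V" and C: "C2_on_with V f d A"
      using assms[OF xU] by (auto simp: C2_fun_def)
    have fd: "(f has_derivative (\<lambda>h. d y \<bullet> h)) (at y)" if "y \<in> V" for y
      using C that by (simp add: C2_on_with_def)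
    have Dd: "Df y = d y" if "y \<in> V" for y
      using someI[of "\<lambda>e. (f has_derivative (\<lambda>h. e \<bullet> h)) (at y)", OF fd[OF that]] fd[OF that]
      unfolding Df_def by (rule has_derivative_inner_unique)
    have dA: "(Df has_derivative (\<lambda>h. A y *v h)) (at y)" if "y \<in> V" for y
    proof -
      have "(d has_derivative (\<lambda>h. A y *v h)) (at y)" using C that by (simp add: C2_on_with_def)
      then show ?thesis
        by (rule has_derivative_transform_within_open[OF _ V(1) that]) (simp add: Dd)
    qed
    have DA: "D2f y = A y" if "y \<in> V" for y
      using someI[of "\<lambda>e. (Df has_derivative (\<lambda>h. e *v h)) (at y)", OF dA[OF that]] dA[OF that]
      unfolding D2f_def by (rule has_derivative_matrix_unique)
    have "C2_on_with V f Df D2f"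
      unfolding C2_on_with_def
    proof (intro conjI ballI)
      show "continuous_on V Df"
        using C Dd by (subst continuous_on_cong[OF refl Dd]) (auto simp: C2_on_with_def)
      show "continuous_on V D2f"
        using C by (subst continuous_on_cong[OF refl DA]) (auto simp: C2_on_with_def)
    qed (use fd dA Dd DA in auto)
    then show ?thesis using V by blast
  qed
  have "C2_on_with U f Df D2f"
    unfolding C2_on_with_def
  proof (intro conjI ballI)
    have "isCont Df x \<and> isCont D2f x" if "x \<in> U" for x
      using key[OF that] by (auto simp: C2_on_with_def continuous_on_eq_continuous_at)
    then show "continuous_on U Df" "continuous_on U D2f"
      by (auto intro: continuous_at_imp_continuous_on)
  qed (use key in \<open>auto simp: C2_on_with_def\<close>)
  then show ?thesis by (auto simp: C2_fun_def)
qed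

lemma C2_fun_cong_open:
  assumes "C2_fun U f" "open U" "\<And>x. x \<in> U \<Longrightarrow> f x = g x" shows "C2_fun U g"
proof -
  obtain d A where "C2_on_with U f d A" using assms by (auto simp: C2_fun_def)
  then have "C2_on_with U g d A"
    unfolding C2_on_with_def
    using has_derivative_transform_within_open[OF _ assms(2) _ assms(3)] by auto
  then show ?thesis by (auto simp: C2_fun_def)
qed

lemma C2_fun_const: "C2_fun (U :: (real^'n::finite) set) (\<lambda>x. c)"
proof -
  have z: "(\<bullet>) (0::real^'n) = (\<lambda>_. 0)" "(*v) (0::real^'n^'n) = (\<lambda>_. 0)" by auto
  show ?thesis unfolding C2_fun_def C2_on_with_def
    by (rule exI[of _ "\<lambda>_. 0"], rule exI[of _ "\<lambda>_. 0"]) (auto simp: z)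
qed

lemma C2_fun_add:
  assumes "C2_fun U f" "C2_fun U g" shows "C2_fun U (\<lambda>x. f x + g x)"
proof -
  obtain a A b B where 1: "C2_on_with U f a A" and 2: "C2_on_with U g b B" using assms by (auto simp: C2_fun_def)
  have "C2_on_with U (\<lambda>x. f x + g x) (\<lambda>x. a x + b x) (\<lambda>x. A x + B x)"
    using 1 2 unfolding C2_on_with_def
    by (auto intro!: continuous_intros derivative_eq_intros
        simp: inner_add_left matrix_vector_mult_add_rdistrib)
  then show ?thesis by (auto simp: C2_fun_def)
qed

lemma C2_fun_mult:
  assumes "C2_fun U f" "C2_fun U g" shows "C2_fun U (\<lambda>x. f x * g x)"
proof -
  obtain a A b B where 1: "C2_on_with U f a A" and 2: "C2_on_with U g b B" using assms by (auto simp: C2_fun_def)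
  have cf: "continuous_on U f" "continuous_on U g"
    using 1 2 unfolding C2_on_with_def
    by (auto intro!: continuous_at_imp_continuous_on has_derivative_continuous)
  have "C2_on_with U (\<lambda>x. f x * g x) (\<lambda>x. f x *\<^sub>R b x + g x *\<^sub>R a x)
      (\<lambda>x. f x *\<^sub>R B x + outer_prod (b x) (a x) + (g x *\<^sub>R A x + outer_prod (a x) (b x)))"
    unfolding C2_on_with_def
  proof (intro conjI ballI)
    fix x assume x: "x \<in> U"
    have d: "(f has_derivative (\<lambda>h. a x \<bullet> h)) (at x)" "(g has_derivative (\<lambda>h. b x \<bullet> h)) (at x)"
      "(a has_derivative (\<lambda>h. A x *v h)) (at x)" "(b has_derivative (\<lambda>h. B x *v h)) (at x)"
      using 1 2 x by (auto simp: C2_on_with_def)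
    show "((\<lambda>x. f x * g x) has_derivative (\<lambda>h. (f x *\<^sub>R b x + g x *\<^sub>R a x) \<bullet> h)) (at x)"
      by (rule has_derivative_eq_rhs[OF has_derivative_mult[OF d(1,2)]])
        (simp add: inner_add_left fun_eq_iff mult.commute)
    show "((\<lambda>x. f x *\<^sub>R b x + g x *\<^sub>R a x) has_derivative
       (\<lambda>h. (f x *\<^sub>R B x + outer_prod (b x) (a x) + (g x *\<^sub>R A x + outer_prod (a x) (b x))) *v h)) (at x)"
      by (rule has_derivative_eq_rhs[OF has_derivative_add[OF has_derivative_scaleR[OF d(1,4)] has_derivative_scaleR[OF d(2,3)]]])
        (simp add: fun_eq_iff matrix_vector_mult_add_rdistrib outer_prod_mult_vec scaleR_matrix_vector_assoc)
  qed (use 1 2 cf in \<open>auto simp: C2_on_with_def intro!: continuous_intros continuous_on_outer_prod\<close>)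
  then show ?thesis by (auto simp: C2_fun_def)
qed

lemma C2_fun_compose:
  assumes "C2_fun U f" 
    and d1: "\<And>t. (\<phi> has_real_derivative \<phi>' t) (at t)" 
    and d2: "\<And>t. (\<phi>' has_real_derivative \<phi>'' t) (at t)" and cont: "continuous_on UNIV \<phi>''"
  shows "C2_fun U (\<lambda>x. \<phi> (f x))"
proof -
  obtain a A where 1: "C2_on_with U f a A" using assms by (auto simp: C2_fun_def)
  have cf: "continuous_on U f" 
    using 1 unfolding C2_on_with_def
    by (auto intro!: continuous_at_imp_continuous_on has_derivative_continuous)
  have c1: "continuous_on UNIV \<phi>'"
    using d2 by (auto intro!: continuous_at_imp_continuous_on DERIV_isCont)
  have "C2_on_with U (\<lambda>x. \<phi> (f x)) (\<lambda>x. \<phi>' (f x) *\<^sub>R a x)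
      (\<lambda>x. \<phi>' (f x) *\<^sub>R A x + outer_prod (a x) (\<phi>'' (f x) *\<^sub>R a x))"
    unfolding C2_on_with_def
  proof (intro conjI ballI)
    fix x assume x: "x \<in> U"
    have d: "(f has_derivative (\<lambda>h. a x \<bullet> h)) (at x)" "(a has_derivative (\<lambda>h. A x *v h)) (at x)"
      using 1 x by (auto simp: C2_on_with_def)
    show "((\<lambda>x. \<phi> (f x)) has_derivative (\<lambda>h. (\<phi>' (f x) *\<^sub>R a x) \<bullet> h)) (at x)"
      using DERIV_compose_FDERIV[OF d1 d(1)] by (simp add: mult.commute)
    have "((\<lambda>x. \<phi>' (f x)) has_derivative (\<lambda>h. (\<phi>'' (f x) *\<^sub>R a x) \<bullet> h)) (at x)"
      using DERIV_compose_FDERIV[OF d2 d(1)] by (simp add: mult.commute)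
    from has_derivative_scaleR[OF this d(2)]
    show "((\<lambda>x. \<phi>' (f x) *\<^sub>R a x) has_derivative
       (\<lambda>h. (\<phi>' (f x) *\<^sub>R A x + outer_prod (a x) (\<phi>'' (f x) *\<^sub>R a x)) *v h)) (at x)"
      by (rule has_derivative_eq_rhs)
        (simp add: fun_eq_iff matrix_vector_mult_add_rdistrib outer_prod_mult_vec scaleR_matrix_vector_assoc)
  next
    show "continuous_on U (\<lambda>x. \<phi>' (f x) *\<^sub>R a x)"
      using 1 by (auto simp: C2_on_with_def intro!: continuous_intros continuous_on_compose2[OF c1 cf])
    show "continuous_on U (\<lambda>x. \<phi>' (f x) *\<^sub>R A x + outer_prod (a x) (\<phi>'' (f x) *\<^sub>R a x))"
      using 1 by (auto simp: C2_on_with_def intro!: continuous_intros continuous_on_outer_prod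
          continuous_on_compose2[OF c1 cf] continuous_on_compose2[OF cont cf])
  qed
  then show ?thesis by (auto simp: C2_fun_def)
qed

lemma C2_fun_cube_plus: "C2_fun U f \<Longrightarrow> C2_fun U (\<lambda>x. (max 0 (f x)) ^ 3)"
proof (rule C2_fun_compose[where \<phi> = "\<lambda>t. (max 0 t) ^ 3" and \<phi>' = "\<lambda>t. 3 * (max 0 t) ^ 2" and \<phi>'' = "\<lambda>t. 6 * (max 0 t)"])
  show "((\<lambda>t. (max 0 t) ^ 3) has_real_derivative 3 * (max 0 t)\<^sup>2) (at t)" for t :: real
    using has_derivative_max_power[of 1 t] by (simp add: numeral_eq_Suc)
  show "((\<lambda>t. 3 * (max 0 t)\<^sup>2) has_real_derivative 6 * max 0 t) (at t)" for t :: real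
    using DERIV_cmult[OF has_derivative_max_power[of 0 t], of 3] by (simp add: numeral_eq_Suc)
qed (auto intro!: continuous_intros)

lemma C2_fun_dist_sq: "C2_fun U (\<lambda>x. (norm (x - p))\<^sup>2)"
proof -
  have "C2_on_with U (\<lambda>x. (norm (x - p))\<^sup>2) (\<lambda>x. 2 *\<^sub>R (x - p)) (\<lambda>x. 2 *\<^sub>R mat 1)"
    unfolding C2_on_with_def
  proof (intro conjI ballI)
    fix x assume "x \<in> U"
    show "((\<lambda>x. (norm (x - p))\<^sup>2) has_derivative (\<lambda>h. (2 *\<^sub>R (x - p)) \<bullet> h)) (at x)"
      unfolding power2_norm_eq_inner
      by (auto intro!: derivative_eq_intros simp: inner_commute)
    show "((\<lambda>x. 2 *\<^sub>R (x - p)) has_derivative (\<lambda>h. (2 *\<^sub>R mat 1) *v h)) (at x)"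
      by (auto intro!: derivative_eq_intros simp: scaleR_matrix_vector_assoc[symmetric])
  qed (auto intro!: continuous_intros)
  then show ?thesis by (auto simp: C2_fun_def)
qed

lemma C2_fun_sum: "finite I \<Longrightarrow> (\<And>i. i \<in> I \<Longrightarrow> C2_fun U (f i)) \<Longrightarrow> C2_fun U (\<lambda>x. \<Sum>i\<in>I. f i x)"
  by (induction I rule: finite_induct) (auto intro: C2_fun_add C2_fun_const)

text \<open>Farkas' lemma for a single inequality. It is used to compare gradients of local defining
  functions, to identify \<open>nu\<close>, and to see that the position vector of a farthest point
  is normal to the frontier.\<close>

lemma half_space_cone:
  fixes n k :: "'a::real_inner"
  assumes n: "n \<noteq> 0" and le: "\<And>h. n \<bullet> h < 0 \<Longrightarrow> k \<bullet> h \<le> 0"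
  shows "k = ((k \<bullet> n) / (n \<bullet> n)) *\<^sub>R n" "0 \<le> k \<bullet> n"
proof -
  have nn: "0 < n \<bullet> n" using n by simp
  show kn: "0 \<le> k \<bullet> n" using le[of "- n"] nn by simp
  define t where "t = k - ((k \<bullet> n) / (n \<bullet> n)) *\<^sub>R n"
  have tn: "n \<bullet> t = 0" using nn by (simp add: t_def inner_diff_right inner_commute)
  have "t \<bullet> t \<le> e" if e: "0 < e" for e
  proof -
    \<comment> \<open>The tangential part \<open>t\<close> lies on the edge of the half-space; a
      small step along \<open>- n\<close> moves it inside. The 1 guards against
      \<open>k \<bullet> n = 0\<close>.\<close>
    define d where "d = e / (k \<bullet> n + 1)"
    have d: "0 < d" "d * (k \<bullet> n) \<le> e" using e kn by (auto simp: d_def field_simps)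
    have "n \<bullet> (t - d *\<^sub>R n) < 0" using tn d nn by (simp add: inner_diff_right)
    then have "k \<bullet> (t - d *\<^sub>R n) \<le> 0" by (rule le)
    moreover have "k \<bullet> t = t \<bullet> t" using tn by (simp add: t_def inner_diff_left inner_diff_right inner_commute)
    ultimately show ?thesis using d by (simp add: inner_diff_right)
  qed
  then have "t \<bullet> t \<le> 0" by (metis field_le_epsilon add_0)
  then have "t = 0" by (metis inner_eq_zero_iff inner_ge_zero order_antisym)
  then show "k = ((k \<bullet> n) / (n \<bullet> n)) *\<^sub>R n" by (simp add: t_def)
qed

lemma has_derivative_neg_direction:
  fixes f :: "'a::real_normed_vector \<Rightarrow> real"
  assumes f: "(f has_derivative (\<lambda>h. L h)) (at x)" and Lh: "L h < 0"
  shows "\<forall>\<^sub>F t in at_right 0. f (x + t *\<^sub>R h) < f x"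
proof -
  have lin: "linear L" using f by (rule has_derivative_linear)
  have "((\<lambda>t. f (x + t *\<^sub>R h)) has_derivative (\<lambda>t. L (t *\<^sub>R h))) (at 0)"
    by (rule has_derivative_compose[where f = "\<lambda>t. x + t *\<^sub>R h" and g = f, simplified o_def])
      (use f in \<open>auto intro!: derivative_eq_intros\<close>)
  then have "((\<lambda>t. f (x + t *\<^sub>R h)) has_real_derivative L h) (at 0)"
    unfolding has_field_derivative_def
    by (rule has_derivative_eq_rhs) (simp add: linear_scale[OF lin] fun_eq_iff)
  from DERIV_neg_dec_right[OF this Lh] obtain d where d: "0 < d" "\<And>t. 0 < t \<Longrightarrow> t < d \<Longrightarrow> f (x + t *\<^sub>R h) < f x"
    by auto
  then show ?thesis unfolding eventually_at_right_field by (auto intro!: exI[of _ d])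
qed

lemma has_derivative_eventually_nonpos:
  fixes f :: "'a::real_normed_vector \<Rightarrow> real"
  assumes f: "(f has_derivative (\<lambda>h. L h)) (at x)" 
    and ev: "\<forall>\<^sub>F t in at_right 0. f (x + t *\<^sub>R h) \<le> f x"
  shows "L h \<le> 0"
proof (rule ccontr)
  assume "\<not> L h \<le> 0"
  then have "\<forall>\<^sub>F t in at_right 0. - f (x + t *\<^sub>R h) < - f x"
    by (intro has_derivative_neg_direction[OF has_derivative_minus[OF f]]) simp
  with ev have "\<forall>\<^sub>F t::real in at_right 0. False" by eventually_elim auto
  then show False by (simp add: eventually_False)
qed

text \<open>The local functions are glued with bumps as weights, and a cube is subtracted to keep
  \<open>g\<close> negative where the bumps fade out inside \<open>\<Omega>\<close>. On the frontier
  all local functions vanish, so \<open>Dg\<close> is the weighted sum of their gradients; these are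
  positive multiples of one another, which excludes cancellation.\<close>

lemma global_defining_function:
  fixes \<Omega> :: "(real^'n::finite) set"
  assumes dom: "C2_bounded_domain \<Omega>"
  obtains g Dg D2g W where "C2_on_with UNIV g Dg D2g" "\<And>x. x \<in> \<Omega> \<Longrightarrow> g x < 0"
    "\<And>x. x \<in> frontier \<Omega> \<Longrightarrow> g x = 0" "\<And>x. x \<in> frontier \<Omega> \<Longrightarrow> Dg x \<noteq> 0"
    "open W" "frontier \<Omega> \<subseteq> W" "\<And>x. x \<in> W \<Longrightarrow> g x < 0 \<Longrightarrow> x \<in> \<Omega>"
proof -
  have bdd: "bounded \<Omega>" and op: "open \<Omega>" using dom by (auto simp: C2_bounded_domain_def)
  have cpt: "compact (frontier \<Omega>)" using bdd by (rule compact_frontier_bounded)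
  have "\<forall>p\<in>frontier \<Omega>. \<exists>U \<rho> D\<rho> s. open U \<and> C2_fun U \<rho> \<and> (\<forall>x\<in>U. (\<rho> has_derivative (\<lambda>h. D\<rho> x \<bullet> h)) (at x)) \<and>
      (\<forall>x\<in>U. D\<rho> x \<noteq> 0) \<and> \<Omega> \<inter> U = {x\<in>U. \<rho> x < 0} \<and> 0 < s \<and> cball p s \<subseteq> U"
  proof
    fix p assume "p \<in> frontier \<Omega>"
    then obtain U \<rho> D\<rho> D2\<rho> where *: "open U" "p \<in> U" "C2_on_with U \<rho> D\<rho> D2\<rho>"
         "\<forall>x\<in>U. D\<rho> x \<noteq> 0" "\<Omega> \<inter> U = {x\<in>U. \<rho> x < 0}"
      using dom unfolding C2_bounded_domain_def by blast
    obtain s where "0 < s" "cball p s \<subseteq> U" using *(1,2) open_contains_cball by blast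
    then show "\<exists>U \<rho> D\<rho> s. open U \<and> C2_fun U \<rho> \<and> (\<forall>x\<in>U. (\<rho> has_derivative (\<lambda>h. D\<rho> x \<bullet> h)) (at x)) \<and>
      (\<forall>x\<in>U. D\<rho> x \<noteq> 0) \<and> \<Omega> \<inter> U = {x\<in>U. \<rho> x < 0} \<and> 0 < s \<and> cball p s \<subseteq> U"
      using * by (intro exI[of _ U] exI[of _ \<rho>] exI[of _ D\<rho>] exI[of _ s]) (auto simp: C2_fun_def C2_on_with_def)
  qed
  then obtain U \<rho> D\<rho> s where key: "\<forall>p\<in>frontier \<Omega>. open (U p) \<and> C2_fun (U p) (\<rho> p) \<and>
      (\<forall>x\<in>U p. (\<rho> p has_derivative (\<lambda>h. D\<rho> p x \<bullet> h)) (at x)) \<and>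
      (\<forall>x\<in>U p. D\<rho> p x \<noteq> 0) \<and> \<Omega> \<inter> U p = {x\<in>U p. \<rho> p x < 0} \<and> 0 < s p \<and> cball p (s p) \<subseteq> U p"
    unfolding bchoice_iff by (elim exE)
  have opU: "\<And>p. p \<in> frontier \<Omega> \<Longrightarrow> open (U p)"
    and C2\<rho>: "\<And>p. p \<in> frontier \<Omega> \<Longrightarrow> C2_fun (U p) (\<rho> p)"
    and D\<rho>: "\<And>p x. p \<in> frontier \<Omega> \<Longrightarrow> x \<in> U p \<Longrightarrow> (\<rho> p has_derivative (\<lambda>h. D\<rho> p x \<bullet> h)) (at x)"
    and D\<rho>0: "\<And>p x. p \<in> frontier \<Omega> \<Longrightarrow> x \<in> U p \<Longrightarrow> D\<rho> p x \<noteq> 0"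
    and \<Omega>U: "\<And>p. p \<in> frontier \<Omega> \<Longrightarrow> \<Omega> \<inter> U p = {x\<in>U p. \<rho> p x < 0}"
    and s0: "\<And>p. p \<in> frontier \<Omega> \<Longrightarrow> 0 < s p"
    and sU: "\<And>p. p \<in> frontier \<Omega> \<Longrightarrow> cball p (s p) \<subseteq> U p"
    using key by (blast+)
  obtain P where P: "finite P" "P \<subseteq> frontier \<Omega>" "frontier \<Omega> \<subseteq> (\<Union>p\<in>P. ball p (s p))"
    using compactE_image[OF cpt, of "frontier \<Omega>" "\<lambda>p. ball p (s p)"] s0
    by (metis (no_types, lifting) UN_I centre_in_ball open_ball subsetI)
  \<comment> \<open>C^2, positive exactly on \<open>ball p (s p)\<close>, hence zero wherever
    \<open>\<rho> p\<close> is not controlled.\<close>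
  define b where "b p x = (max 0 ((s p)\<^sup>2 + (- 1) * (norm (x - p))\<^sup>2)) ^ 3" for p x :: "real^'n"
  have b_ge: "0 \<le> b p x" for p x by (simp add: b_def)
  have b_pos: "0 < b p x \<longleftrightarrow> x \<in> ball p (s p)" if "p \<in> P" for p x
  proof -
    have "0 < b p x \<longleftrightarrow> (norm (x - p))\<^sup>2 < (s p)\<^sup>2" by (auto simp: b_def max_def)
    also have "\<dots> \<longleftrightarrow> norm (x - p) < s p"
    proof -
      have "0 < s p" using s0 that P by auto
      then show ?thesis using abs_le_square_iff[of "s p" "norm (x - p)"] by (simp add: not_le[symmetric])
    qed
    finally show ?thesis by (simp add: dist_norm norm_minus_commute)
  qed
  have b_C2: "C2_fun V (b p)" for V p
    unfolding b_def by (intro C2_fun_cube_plus C2_fun_add C2_fun_mult C2_fun_const C2_fun_dist_sq)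
  define B where "B x = (\<Sum>p\<in>P. b p x)" for x
  have contb: "continuous_on V (b p)" for V p
    unfolding b_def by (intro continuous_intros)
  have contB: "continuous_on V B" for V
    unfolding B_def by (intro continuous_on_sum contb)
  have Bpos: "0 < B x" if x: "x \<in> frontier \<Omega>" for x
  proof -
    obtain p where "p \<in> P" "x \<in> ball p (s p)" using P x by blast
    then show ?thesis unfolding B_def using b_pos b_ge P(1) by (intro sum_pos2[of P p]) auto
  qed
  \<comment> \<open>A value strictly below the minimum of \<open>B\<close> on the frontier: near the
    frontier \<open>b0 < B\<close>, so the correction in \<open>g\<close> is switched off
    there.\<close>
  obtain b0 where b0: "0 < b0" "\<And>x. x \<in> frontier \<Omega> \<Longrightarrow> b0 < B x"
  proof (cases "frontier \<Omega> = {}")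
    case False
    obtain x0 where x0: "x0 \<in> frontier \<Omega>" "\<And>x. x \<in> frontier \<Omega> \<Longrightarrow> B x0 \<le> B x"
      using continuous_attains_inf[OF cpt False contB] by blast
    show ?thesis
      by (rule that[of "B x0 / 2"]) (use Bpos x0 in \<open>force+\<close>)
  qed (use that[of 1] in auto)
  define S where "S x = (\<Sum>p\<in>P. b p x * \<rho> p x)" for x
  define g where "g x = S x + (- 1) * (max 0 (b0 + (- 1) * B x)) ^ 3" for x
  \<comment> \<open>\<open>U p\<close> and the complement of \<open>cball p (s p)\<close> are open
    and cover the space; on the second the product is 0.\<close>
  have "C2_fun UNIV (\<lambda>x. b p x * \<rho> p x)" if p: "p \<in> P" for p
  proof (rule C2_fun_local)
    fix x
    show "\<exists>V. open V \<and> x \<in> V \<and> C2_fun V (\<lambda>x. b p x * \<rho> p x)"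
    proof (cases "x \<in> U p")
      case True
      then show ?thesis using opU C2\<rho> p P(2) b_C2 C2_fun_mult by (intro exI[of _ "U p"]) blast
    next
      case False
      have "C2_fun (- cball p (s p)) (\<lambda>x. b p x * \<rho> p x)"
      proof (rule C2_fun_cong_open[OF C2_fun_const[of _ 0]])
        fix x assume "x \<in> - cball p (s p)"
        then have "\<not> 0 < b p x" using b_pos[OF p] ball_subset_cball by blast
        then show "0 = b p x * \<rho> p x" using b_ge[of p x] by simp
      qed auto
      moreover have "x \<in> - cball p (s p)" using False sU[of p] p P(2) by blast
      ultimately show ?thesis using open_Compl[OF closed_cball[of p "s p"]] by blast
    qed
  qed
  then have "C2_fun UNIV S" unfolding S_def using P(1) by (intro C2_fun_sum) auto
  then have "C2_fun UNIV g"
    unfolding g_def B_def 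
    by (intro C2_fun_cube_plus C2_fun_add C2_fun_mult C2_fun_const C2_fun_sum P(1) b_C2)
  then obtain Dg D2g where g: "C2_on_with UNIV g Dg D2g" by (auto simp: C2_fun_def)
  have \<rho>front: "\<rho> p x = 0" if p: "p \<in> P" and x: "x \<in> frontier \<Omega>" "x \<in> U p" for p x
  proof -
    have pf: "p \<in> frontier \<Omega>" using p P by auto
    have "x \<notin> \<Omega>" using x op by (simp add: frontier_def interior_open)
    then have "0 \<le> \<rho> p x" using \<Omega>U[OF pf] x by force
    moreover have "\<rho> p x \<le> 0"
    proof (rule ccontr)
      assume c: "\<not> \<rho> p x \<le> 0"
      have "isCont (\<rho> p) x" using D\<rho>[OF pf x(2)] by (rule has_derivative_continuous)
      then have "\<forall>\<^sub>F y in nhds x. 0 < \<rho> p y"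
        using c by (metis (no_types) isCont_def linorder_not_le order_tendstoD(1) tendsto_at_iff_tendsto_nhds)
      moreover have "\<forall>\<^sub>F y in nhds x. y \<in> U p" using opU[OF pf] x(2) by (rule eventually_nhds_in_open)
      ultimately have "\<forall>\<^sub>F y in nhds x. y \<notin> \<Omega>"
        by eventually_elim (use \<Omega>U[OF pf] in force)
      then obtain V where "open V" "x \<in> V" "V \<inter> \<Omega> = {}" by (auto simp: eventually_nhds)
      then have "x \<notin> closure \<Omega>" using open_Int_closure_eq_empty[of V \<Omega>] by blast
      then show False using x by (simp add: frontier_def)
    qed
    ultimately show ?thesis by simp
  qed
  have S0: "S x = 0" if x: "x \<in> frontier \<Omega>" for x
    unfolding S_def
  proof (rule sum.neutral, rule ballI)
    fix p assume p: "p \<in> P"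
    show "b p x * \<rho> p x = 0"
    proof (cases "x \<in> ball p (s p)")
      case True
      then have "x \<in> U p" using sU[of p] p P(2) ball_subset_cball by blast
      then show ?thesis using \<rho>front[OF p x] by simp
    next
      case False then show ?thesis using b_pos[OF p, of x] b_ge[of p x] by simp
    qed
  qed
  show ?thesis
  proof (rule that[OF g])
    have Sle: "b p x * \<rho> p x \<le> 0" "0 < b p x \<Longrightarrow> b p x * \<rho> p x < 0" if p: "p \<in> P" and x: "x \<in> \<Omega>" for p x
    proof -
      have "\<rho> p x < 0" if "x \<in> ball p (s p)" 
        using that \<Omega>U[of p] sU[of p] p P(2) ball_subset_cball x by blast
      then show "b p x * \<rho> p x \<le> 0" "0 < b p x \<Longrightarrow> b p x * \<rho> p x < 0"
        using b_pos[OF p, of x] b_ge[of p x] by (auto simp: mult_le_0_iff mult_less_0_iff)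
    qed
    show "g x < 0" if x: "x \<in> \<Omega>" for x
    proof (cases "B x < b0")
      case True
      have "S x \<le> 0" unfolding S_def using Sle x by (intro sum_nonpos) auto
      moreover have "0 < (max 0 (b0 + (- 1) * B x)) ^ 3" using True by (intro zero_less_power) auto
      ultimately show ?thesis unfolding g_def by linarith
    next
      case False
      then have "\<exists>p\<in>P. 0 < b p x"
        using b0 unfolding B_def by (metis (mono_tags, lifting) linorder_not_le order_less_le_trans sum_nonpos)
      then have "\<exists>p\<in>P. b p x * \<rho> p x < 0" using Sle(2) x by blast
      then have "S x < 0"
        unfolding S_def using Sle(1) x P(1) sum_strict_mono_ex1[of P "\<lambda>p. b p x * \<rho> p x" "\<lambda>_. 0"] by simp
      then show ?thesis using False by (simp add: g_def max_def)
    qed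
    show "g x = 0" if "x \<in> frontier \<Omega>" for x
      using S0[OF that] b0(2)[OF that] by (simp add: g_def max_def)
    have opW: "open {x. b0 < B x}"
      by (rule open_Collect_less[OF continuous_on_const contB])
    show "open {x. b0 < B x}" by (rule opW)
    show "frontier \<Omega> \<subseteq> {x. b0 < B x}" using b0 by auto
    show "x \<in> \<Omega>" if xW: "x \<in> {x. b0 < B x}" and gx: "g x < 0" for x
    proof (rule ccontr)
      assume x: "x \<notin> \<Omega>"
      have "0 \<le> b p x * \<rho> p x" if p: "p \<in> P" for p
      proof (cases "x \<in> ball p (s p)")
        case True
        have pf: "p \<in> frontier \<Omega>" using p P by auto
        have "x \<in> U p" using True sU[OF pf] ball_subset_cball by blast
        then have "\<not> \<rho> p x < 0" using \<Omega>U[OF pf] x by blast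
        then show ?thesis using b_ge by simp
      next
        case False then show ?thesis using b_pos[OF p, of x] b_ge[of p x] by simp
      qed
      then have "0 \<le> S x" unfolding S_def by (intro sum_nonneg) auto
      then show False using gx xW by (simp add: g_def max_def split: if_splits)
    qed
    show "Dg x \<noteq> 0" if x: "x \<in> frontier \<Omega>" for x
    proof -
      obtain q where q: "q \<in> P" "x \<in> ball q (s q)" using P x by blast
      have qf: "q \<in> frontier \<Omega>" and xq: "x \<in> U q" using q P sU[of q] ball_subset_cball by blast+
      define v where "v = D\<rho> q x"
      have pos: "0 < D\<rho> p x \<bullet> v" if p: "p \<in> P" and xp: "x \<in> U p" for p
      proof -
        have pf: "p \<in> frontier \<Omega>" using p P by auto
        \<comment> \<open>A direction that decreases \<open>\<rho> q\<close> enters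
          \<open>\<Omega>\<close>, where \<open>\<rho> p\<close> is negative as well. Thus
          \<open>\<rho> p\<close> cannot increase along it, and \<open>half_space_cone\<close>
          applies.\<close>
        have "D\<rho> p x \<bullet> h \<le> 0" if h: "v \<bullet> h < 0" for h
        proof (rule has_derivative_eventually_nonpos[OF D\<rho>[OF pf xp]])
          have inU: "\<forall>\<^sub>F t in at_right 0. x + t *\<^sub>R h \<in> U p'" if "p' \<in> frontier \<Omega>" "x \<in> U p'" for p'
          proof -
            have "((\<lambda>t. x + t *\<^sub>R h) \<longlongrightarrow> x + 0 *\<^sub>R h) (at_right 0)" by (intro tendsto_intros)
            then show ?thesis using opU[OF that(1)] that(2) by (auto dest: topological_tendstoD)
          qed
          have "\<forall>\<^sub>F t in at_right 0. \<rho> q (x + t *\<^sub>R h) < \<rho> q x"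
            using has_derivative_neg_direction[OF D\<rho>[OF qf xq]] h by (simp add: v_def)
          then show "\<forall>\<^sub>F t in at_right 0. \<rho> p (x + t *\<^sub>R h) \<le> \<rho> p x"
            using inU[OF qf xq] inU[OF pf xp]
          proof eventually_elim
            case (elim t)
            then have "x + t *\<^sub>R h \<in> \<Omega>" using \<Omega>U[OF qf] \<rho>front[OF q(1) x xq] by auto
            then have "\<rho> p (x + t *\<^sub>R h) < 0" using elim \<Omega>U[OF pf] by auto
            then show ?case using \<rho>front[OF p x xp] by simp
          qed
        qed
        from half_space_cone[OF D\<rho>0[OF qf xq, folded v_def] this]
        have "D\<rho> p x = ((D\<rho> p x \<bullet> v) / (v \<bullet> v)) *\<^sub>R v" "0 \<le> D\<rho> p x \<bullet> v" by auto
        moreover have "D\<rho> p x \<bullet> v \<noteq> 0" using D\<rho>0[OF pf xp] calculation(1) by auto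
        ultimately show ?thesis by simp
      qed
      \<comment> \<open>The gradient of \<open>b p\<close> does not appear because
        \<open>\<rho> p\<close> vanishes at \<open>x\<close>.\<close>
      define L where "L p = (if x \<in> U p then b p x *\<^sub>R D\<rho> p x else 0)" for p
      have dp: "((\<lambda>y. b p y * \<rho> p y) has_derivative (\<lambda>h. L p \<bullet> h)) (at x)" if p: "p \<in> P" for p
      proof (cases "x \<in> U p")
        case True
        have pf: "p \<in> frontier \<Omega>" using p P by auto
        obtain Db D2b where "C2_on_with UNIV (b p) Db D2b" using b_C2[of UNIV p] by (auto simp: C2_fun_def)
        then have "(b p has_derivative (\<lambda>h. Db x \<bullet> h)) (at x)" by (simp add: C2_on_with_def)
        from has_derivative_mult[OF this D\<rho>[OF pf True]] show ?thesis
          by (rule has_derivative_eq_rhs) (simp add: \<rho>front[OF p x True] L_def True)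
      next
        case False
        have "((\<lambda>y. 0) has_derivative (\<lambda>h. L p \<bullet> h)) (at x)" using False by (simp add: L_def)
        then show ?thesis
        proof (rule has_derivative_transform_within_open[OF _ open_Compl[OF closed_cball[of p "s p"]]])
          show "x \<in> - cball p (s p)" using False sU[of p] p P(2) by blast
          fix y assume "y \<in> - cball p (s p)"
          then have "\<not> 0 < b p y" using b_pos[OF p] ball_subset_cball by blast
          then show "0 = b p y * \<rho> p y" using b_ge[of p y] by simp
        qed
      qed
      have "(S has_derivative (\<lambda>h. \<Sum>p\<in>P. L p \<bullet> h)) (at x)"
        unfolding S_def by (rule has_derivative_sum) (rule dp)
      then have "(g has_derivative (\<lambda>h. \<Sum>p\<in>P. L p \<bullet> h)) (at x)"
        by (rule has_derivative_transform_within_open[OF _ opW]) (use b0(2)[OF x] in \<open>auto simp: g_def max_def\<close>)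
      moreover have "(g has_derivative (\<lambda>h. Dg x \<bullet> h)) (at x)" using g by (simp add: C2_on_with_def)
      ultimately have eq: "Dg x \<bullet> v = (\<Sum>p\<in>P. L p \<bullet> v)" using has_derivative_unique by metis
      have "0 < (\<Sum>p\<in>P. L p \<bullet> v)"
        using pos[OF q(1) xq] b_pos[OF q(1), of x] q xq pos b_ge less_imp_le[OF pos]
        by (intro sum_pos2[OF P(1) q(1)]) (auto simp: L_def)
      then show ?thesis using eq by auto
    qed
  qed
qed

section \<open>Hausdorff measure of small pieces of the boundary\<close>

text \<open>\<open>g\<close> can be negative far outside \<open>\<Omega>\<close> too, as the
  subtracted cube in \<open>global_defining_function\<close> shows; its sign detects
  \<open>\<Omega>\<close> only inside \<open>W\<close>.\<close>

locale C2_domain =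
  fixes \<Omega> :: "(real^'n::finite) set" and g :: "real^'n \<Rightarrow> real" and Dg :: "real^'n \<Rightarrow> real^'n"
    and D2g :: "real^'n \<Rightarrow> real^'n^'n" and W :: "(real^'n) set"
  assumes card2: "CARD('n) \<ge> 2"
    and bdd: "bounded \<Omega>" and op: "open \<Omega>" and ne: "\<Omega> \<noteq> {}"
    and C2g: "C2_on_with UNIV g Dg D2g"
    and neg: "x \<in> \<Omega> \<Longrightarrow> g x < 0"
    and zero: "x \<in> frontier \<Omega> \<Longrightarrow> g x = 0"
    and Dg_nz: "x \<in> frontier \<Omega> \<Longrightarrow> Dg x \<noteq> 0"
    and opW: "open W" and frontier_W: "frontier \<Omega> \<subseteq> W"
    and W_neg: "x \<in> W \<Longrightarrow> g x < 0 \<Longrightarrow> x \<in> \<Omega>"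
begin

abbreviation "\<Gamma> \<equiv> frontier \<Omega>"

definition m :: nat where "m = CARD('n) - 1"

text \<open>Since \<open>g\<close> is nonzero inside and \<open>Dg\<close> is nonzero on the boundary, \<open>\<beta>\<close> never vanishes on the
  closure and agrees with \<open>|Dg|\<close> on the boundary; hence \<open>nrm\<close> extends the unit normal to the closure.\<close>

definition \<beta> :: "real^'n \<Rightarrow> real" where "\<beta> x = sqrt ((norm (Dg x))\<^sup>2 + (g x)\<^sup>2)"

definition nrm :: "real^'n \<Rightarrow> real^'n" where "nrm x = (1 / \<beta> x) *\<^sub>R Dg x"

definition \<kappa> :: real where "\<kappa> = disc_const TYPE('n)"

definition hm :: "(real^'n) set \<Rightarrow> ennreal" where "hm A = hausdorff_outer (real CARD('n) - 1) A"

text \<open>The area of a flat disc as a function of its squared radius, extended by 0 to negative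
  arguments; the squared radius is what Pythagoras' theorem provides.\<close>

definition profile :: "real \<Rightarrow> real" where "profile a = \<kappa> * sqrt (max 0 a) ^ m"

lemma real_m: "real CARD('n) - 1 = real m" and m_pos: "0 < m" and card_m: "CARD('n) = Suc m"
  using card2 by (auto simp: m_def)

lemma \<kappa>_pos: "0 < \<kappa>" unfolding \<kappa>_def by (rule disc_const_pos[OF card2])

lemma compact_frontier: "compact \<Gamma>" using bdd by (rule compact_frontier_bounded)

lemma compact_closure: "compact (closure \<Omega>)" using bdd by simp

lemma frontier_nonempty: "\<Gamma> \<noteq> {}"
  using ne bdd not_bounded_UNIV by (auto simp: frontier_eq_empty)

lemma closure_eq: "closure \<Omega> = \<Omega> \<union> \<Gamma>" using op by (simp add: frontier_def interior_open closure_subset Un_absorb1)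

lemma frontier_disjoint: "x \<in> \<Gamma> \<Longrightarrow> x \<notin> \<Omega>" using op by (simp add: frontier_def interior_open)

lemma g_has_derivative: "(g has_derivative (\<lambda>h. Dg x \<bullet> h)) (at x)"
  and Dg_has_derivative: "(Dg has_derivative (\<lambda>h. D2g x *v h)) (at x)"
  using C2g by (auto simp: C2_on_with_def)

lemma cont_Dg: "continuous_on S Dg" and cont_D2g: "continuous_on S D2g" and cont_g: "continuous_on S g"
proof -
  have "isCont Dg x" "isCont D2g x" "isCont g x" for x
    using C2g has_derivative_continuous[OF g_has_derivative]
    by (auto simp: C2_on_with_def continuous_on_eq_continuous_at)
  then show "continuous_on S Dg" "continuous_on S D2g" "continuous_on S g"
    by (auto intro: continuous_at_imp_continuous_on)
qed

lemma cont_\<beta>: "continuous_on S \<beta>"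
  unfolding \<beta>_def by (intro continuous_intros cont_Dg cont_g)

lemma \<beta>_pos: "x \<in> closure \<Omega> \<Longrightarrow> 0 < \<beta> x"
proof -
  assume "x \<in> closure \<Omega>"
  then have "Dg x \<noteq> 0 \<or> g x \<noteq> 0" using closure_eq neg[of x] Dg_nz by auto
  then have "0 < (norm (Dg x))\<^sup>2 + (g x)\<^sup>2" by (auto simp: add_pos_nonneg add_nonneg_pos)
  then show ?thesis by (simp add: \<beta>_def)
qed

lemma \<beta>_frontier: "x \<in> \<Gamma> \<Longrightarrow> \<beta> x = norm (Dg x)"
  using zero by (simp add: \<beta>_def)

lemma frontier_closure: "x \<in> \<Gamma> \<Longrightarrow> x \<in> closure \<Omega>" by (simp add: frontier_def)

lemma norm_nrm: "x \<in> \<Gamma> \<Longrightarrow> norm (nrm x) = 1"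
  using Dg_nz by (simp add: nrm_def \<beta>_frontier)

lemma nrm_inner_self: "x \<in> \<Gamma> \<Longrightarrow> nrm x \<bullet> nrm x = 1"
  using norm_nrm by (simp add: norm_eq_1)

lemma Dg_eq_nrm: "x \<in> closure \<Omega> \<Longrightarrow> Dg x = \<beta> x *\<^sub>R nrm x"
  using \<beta>_pos[of x] by (simp add: nrm_def)

section \<open>Uniform local geometry of the frontier\<close>

lemma \<beta>_lower: obtains b where "0 < b" "b \<le> 1" "\<And>x. x \<in> closure \<Omega> \<Longrightarrow> b \<le> \<beta> x"
proof -
  obtain x0 where x0: "x0 \<in> closure \<Omega>" "\<And>x. x \<in> closure \<Omega> \<Longrightarrow> \<beta> x0 \<le> \<beta> x"
    using continuous_attains_inf[OF compact_closure _ cont_\<beta>] ne by auto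
  show ?thesis by (rule that[of "min 1 (\<beta> x0)"]) (use x0 \<beta>_pos in \<open>auto simp: min_le_iff_disj\<close>)
qed

lemma \<beta>_upper: obtains b where "1 \<le> b" "\<And>x. x \<in> closure \<Omega> \<Longrightarrow> \<beta> x \<le> b"
proof -
  obtain x0 where x0: "x0 \<in> closure \<Omega>" "\<And>x. x \<in> closure \<Omega> \<Longrightarrow> \<beta> x \<le> \<beta> x0"
    using continuous_attains_sup[OF compact_closure _ cont_\<beta>] ne by auto
  show ?thesis by (rule that[of "max 1 (\<beta> x0)"]) (use x0 in \<open>auto simp: le_max_iff_disj\<close>)
qed

lemma uniform_cont_near:
  fixes F :: "real^'n \<Rightarrow> 'b::metric_space"
  assumes F: "continuous_on UNIV F" and e: "0 < e"
  obtains r where "0 < r" "\<And>p x. p \<in> \<Gamma> \<Longrightarrow> dist x p < r \<Longrightarrow> dist (F x) (F p) < e"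
proof -
  obtain R where R: "\<And>x. x \<in> \<Gamma> \<Longrightarrow> norm x \<le> R"
    using compact_imp_bounded[OF compact_frontier] by (auto simp: bounded_iff)
  have "uniformly_continuous_on (cball 0 (R + 1)) F"
    by (rule compact_uniformly_continuous[OF continuous_on_subset[OF F]]) auto
  then obtain d where d: "0 < d" "\<And>x y. x \<in> cball 0 (R + 1) \<Longrightarrow> y \<in> cball 0 (R + 1) \<Longrightarrow> dist y x < d \<Longrightarrow> dist (F y) (F x) < e"
    using e unfolding uniformly_continuous_on_def by blast
  show ?thesis
  proof (rule that[of "min 1 d"])
    fix p x assume p: "p \<in> \<Gamma>" and x: "dist x p < min 1 d"
    have "norm x \<le> R + 1"
      using R[OF p] x norm_triangle_ineq[of "x - p" p] by (simp add: dist_norm)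
    then show "dist (F x) (F p) < e" using R[OF p] x by (intro d(2)) auto
  qed (use d in auto)
qed

text \<open>The mean value inequality for \<open>g\<close> minus its linear part at
  \<open>p\<close>; uniform continuity of \<open>Dg\<close> gives one radius for all
  \<open>p\<close>.\<close>

lemma strict_differentiability:
  assumes e: "0 < e"
  obtains r where "0 < r" "\<And>p x y. p \<in> \<Gamma> \<Longrightarrow> x \<in> ball p r \<Longrightarrow> y \<in> ball p r \<Longrightarrow>
     \<bar>g x - g y - Dg p \<bullet> (x - y)\<bar> \<le> e * norm (x - y)"
proof -
  obtain r where r: "0 < r" "\<And>p x. p \<in> \<Gamma> \<Longrightarrow> dist x p < r \<Longrightarrow> dist (Dg x) (Dg p) < e"
    using uniform_cont_near[OF cont_Dg e] by blast
  show ?thesis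
  proof (rule that[OF r(1)])
    fix p x y assume p: "p \<in> \<Gamma>" and xy: "x \<in> ball p r" "y \<in> ball p r"
    have "norm ((g x - Dg p \<bullet> x) - (g y - Dg p \<bullet> y)) \<le> e * norm (x - y)"
    proof (rule differentiable_bound[where f' = "\<lambda>z h. (Dg z - Dg p) \<bullet> h" and S = "ball p r"])
      fix z assume z: "z \<in> ball p r"
      show "((\<lambda>x. g x - Dg p \<bullet> x) has_derivative (\<lambda>h. (Dg z - Dg p) \<bullet> h)) (at z within ball p r)"
        by (auto intro!: derivative_eq_intros has_derivative_at_withinI[OF g_has_derivative] simp: inner_diff_left)
      have "norm (Dg z - Dg p) \<le> e"
        using r(2)[OF p, of z] z by (simp add: dist_norm norm_minus_commute)
      then have "norm ((Dg z - Dg p) \<bullet> h) \<le> e * norm h" for h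
        using Cauchy_Schwarz_ineq2[of "Dg z - Dg p" h] mult_right_mono[of "norm (Dg z - Dg p)" e "norm h"] by simp
      then show "onorm ((\<bullet>) (Dg z - Dg p)) \<le> e"
        by (rule onorm_le)
    qed (use xy in auto)
    then show "\<bar>g x - g y - Dg p \<bullet> (x - y)\<bar> \<le> e * norm (x - y)"
      by (simp add: inner_diff_right algebra_simps)
  qed
qed

lemma near_W: obtains r where "0 < r" "\<And>p. p \<in> \<Gamma> \<Longrightarrow> ball p r \<subseteq> W"
  using compact_subset_open_imp_ball_epsilon_subset[OF compact_frontier opW frontier_W]
  by (metis UN_subset_iff)

text \<open>Everything follows from the linear approximation of \<open>g\<close> with an error that
  is small against \<open>\<beta>\<close>. Together the parts act as an implicit function theorem
  whose radius does not depend on \<open>p\<close>, and they take the place of local charts.\<close>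

lemma flatness:
  assumes e: "0 < e" "e < 1"
  obtains r where "0 < r"
    "\<And>p y y'. p \<in> \<Gamma> \<Longrightarrow> y \<in> \<Gamma> \<Longrightarrow> y' \<in> \<Gamma> \<Longrightarrow> norm (y - p) < r \<Longrightarrow> norm (y' - p) < r \<Longrightarrow>
        \<bar>(y - y') \<bullet> nrm p\<bar> \<le> e * norm (y - y')"
    "\<And>p v. p \<in> \<Gamma> \<Longrightarrow> v \<bullet> nrm p = 0 \<Longrightarrow> norm v < r / 2 \<Longrightarrow>
        \<exists>t. \<bar>t\<bar> \<le> e * norm v \<and> p + v + t *\<^sub>R nrm p \<in> \<Gamma>"
    "\<And>p x. p \<in> \<Gamma> \<Longrightarrow> norm (x - p) < r \<Longrightarrow> \<bar>g x - \<beta> p * ((x - p) \<bullet> nrm p)\<bar> \<le> e * norm (x - p)"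
    "\<And>p x t. p \<in> \<Gamma> \<Longrightarrow> norm (x - p) < r / 2 \<Longrightarrow> 0 \<le> t \<Longrightarrow> t < r / 2 \<Longrightarrow>
        g x + \<beta> p / 2 * t \<le> g (x + t *\<^sub>R nrm p)"
    "\<And>p x. p \<in> \<Gamma> \<Longrightarrow> norm (x - p) < r \<Longrightarrow> g x = 0 \<Longrightarrow> x \<in> \<Gamma>"
proof -
  obtain b where b: "0 < b" "b \<le> 1" "\<And>x. x \<in> closure \<Omega> \<Longrightarrow> b \<le> \<beta> x" using \<beta>_lower by blast
  \<comment> \<open>Errors are compared with \<open>\<beta> p\<close>, which is at least
    \<open>b\<close>. The factor 2 pays for
    \<open>norm (v + t *\<^sub>R nrm p) \<le> 2 * norm v\<close> in the graph part.\<close>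
  define d where "d = e * b / 2"
  have d: "0 < d" "2 * d \<le> e * \<beta> p" "2 * d \<le> \<beta> p" "d \<le> e" if "p \<in> \<Gamma>" for p
  proof -
    have bp: "b \<le> \<beta> p" using b(3) that frontier_closure by auto
    have "e * b \<le> 1 * \<beta> p" using e bp b by (intro mult_mono) auto
    moreover have "e * b \<le> e * 1" using e b by (intro mult_left_mono) auto
    ultimately show "0 < d" "2 * d \<le> e * \<beta> p" "2 * d \<le> \<beta> p" "d \<le> e"
      using e b bp by (auto simp: d_def intro: mult_left_mono)
  qed
  have d0: "0 < d" using e b by (simp add: d_def)
  obtain r1 where r1: "0 < r1" "\<And>p x y. p \<in> \<Gamma> \<Longrightarrow> x \<in> ball p r1 \<Longrightarrow> y \<in> ball p r1 \<Longrightarrow>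
     \<bar>g x - g y - Dg p \<bullet> (x - y)\<bar> \<le> d * norm (x - y)"
    using strict_differentiability[OF d0] by blast
  obtain r2 where r2: "0 < r2" "\<And>p. p \<in> \<Gamma> \<Longrightarrow> ball p r2 \<subseteq> W" using near_W by blast
  define r where "r = min r1 r2"
  have r: "0 < r" using r1 r2 by (simp add: r_def)
  have est: "\<bar>g x - g y - \<beta> p * ((x - y) \<bullet> nrm p)\<bar> \<le> d * norm (x - y)" 
    if "p \<in> \<Gamma>" "norm (x - p) < r" "norm (y - p) < r" for p x y
    using r1(2)[OF that(1), of x y] that Dg_eq_nrm[OF frontier_closure[OF that(1)]]
    by (simp add: r_def dist_norm norm_minus_commute inner_commute)
  have inW: "x \<in> W" if "p \<in> \<Gamma>" "norm (x - p) < r" for p x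
    using r2(2)[OF that(1)] that(2) by (auto simp: r_def dist_norm norm_minus_commute)
  have up: "\<beta> p / 2 * t \<le> g (x + t *\<^sub>R nrm p) - g x"
    if p: "p \<in> \<Gamma>" and x: "norm (x - p) < r" "norm (x + t *\<^sub>R nrm p - p) < r" "0 \<le> t" for p x t
  proof -
    have "\<bar>g (x + t *\<^sub>R nrm p) - g x - \<beta> p * t\<bar> \<le> d * t"
      using est[OF p x(2,1)] nrm_inner_self[OF p] norm_nrm[OF p] x(3) by simp
    moreover have "d * t \<le> \<beta> p / 2 * t" using d[OF p] x(3) by (intro mult_right_mono) auto
    ultimately show ?thesis by (simp add: abs_le_iff algebra_simps)
  qed
  \<comment> \<open>Just below a zero of \<open>g\<close>, along \<open>- nrm p\<close>, the
    function is negative. These points lie in \<open>\<Omega>\<close>, so the zero lies in its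
    closure.\<close>
  have fr: "x \<in> \<Gamma>" if p: "p \<in> \<Gamma>" and x: "norm (x - p) < r" "g x = 0" for p x
  proof -
    have "x \<in> closure \<Omega>"
      unfolding closure_approachable
    proof (intro allI impI)
      fix \<epsilon> :: real assume \<epsilon>: "0 < \<epsilon>"
      define t where "t = min \<epsilon> (r - norm (x - p)) / 2"
      have t: "0 < t" "t < \<epsilon>" "norm (x - p) + t < r" using \<epsilon> x by (auto simp: t_def min_def field_simps)
      define y where "y = x - t *\<^sub>R nrm p"
      have y: "norm (y - p) < r"
      proof -
        have "norm (y - p) \<le> norm (x - p) + norm (t *\<^sub>R nrm p)"
          using norm_triangle_ineq4[of "x - p" "t *\<^sub>R nrm p"] by (simp add: y_def algebra_simps)
        then show ?thesis using t norm_nrm[OF p] by simp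
      qed
      have "\<beta> p / 2 * t \<le> g (y + t *\<^sub>R nrm p) - g y"
        by (rule up[OF p y]) (use x t in \<open>auto simp: y_def\<close>)
      moreover have "0 < \<beta> p" using \<beta>_pos frontier_closure[OF p] by blast
      moreover have "y + t *\<^sub>R nrm p = x" by (simp add: y_def)
      ultimately have "\<beta> p / 2 * t \<le> - g y" "0 < \<beta> p / 2 * t" using t(1) x(2) by simp_all
      then have "g y < 0" by linarith
      then have "y \<in> \<Omega>" by (rule W_neg[OF inW[OF p y]])
      moreover have "dist y x < \<epsilon>" using t norm_nrm[OF p] by (simp add: y_def dist_norm)
      ultimately show "\<exists>y\<in>\<Omega>. dist y x < \<epsilon>" by blast
    qed
    moreover have "x \<notin> \<Omega>" using neg[of x] x(2) by auto
    ultimately show ?thesis using closure_eq by auto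
  qed
  show ?thesis
  proof (rule that[OF r])
    fix p y y' assume p: "p \<in> \<Gamma>" and y: "y \<in> \<Gamma>" "y' \<in> \<Gamma>" "norm (y - p) < r" "norm (y' - p) < r"
    have "\<beta> p * \<bar>(y - y') \<bullet> nrm p\<bar> \<le> d * norm (y - y')"
      using est[OF p y(3,4)] zero[OF y(1)] zero[OF y(2)] \<beta>_pos[OF frontier_closure[OF p]]
      by (simp add: abs_mult)
    also have "\<dots> \<le> (e * \<beta> p) * norm (y - y')" using d[OF p] by (intro mult_right_mono) auto
    finally have "\<beta> p * \<bar>(y - y') \<bullet> nrm p\<bar> \<le> \<beta> p * (e * norm (y - y'))" by (simp add: mult_ac)
    then show "\<bar>(y - y') \<bullet> nrm p\<bar> \<le> e * norm (y - y')"
      using \<beta>_pos[OF frontier_closure[OF p]] by simp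
  next
    fix p v assume p: "p \<in> \<Gamma>" and v: "v \<bullet> nrm p = 0" "norm v < r / 2"
    \<comment> \<open>On the normal line through \<open>p + v\<close> the error of the linear
      approximation is at most \<open>\<beta> p * T\<close>, so \<open>g\<close> changes sign
      between the heights \<open>- T\<close> and \<open>T\<close>.\<close>
    define T where "T = e * norm v"
    have T0: "0 \<le> T" using e by (simp add: T_def)
    have Tv: "T \<le> norm v" using e by (simp add: T_def mult_left_le_one_le)
    have nv: "norm (v + t *\<^sub>R nrm p) \<le> 2 * norm v" if "\<bar>t\<bar> \<le> T" for t
      using norm_triangle_ineq[of v "t *\<^sub>R nrm p"] norm_nrm[OF p] that Tv by simp
    have gest: "\<bar>g (p + v + t *\<^sub>R nrm p) - \<beta> p * t\<bar> \<le> \<beta> p * T" if "\<bar>t\<bar> \<le> T" for t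
    proof -
      have "\<bar>g (p + v + t *\<^sub>R nrm p) - g p - \<beta> p * ((p + v + t *\<^sub>R nrm p - p) \<bullet> nrm p)\<bar> \<le> d * norm (p + v + t *\<^sub>R nrm p - p)"
        by (rule est[OF p]) (use nv[OF that] v r in \<open>auto simp: add.assoc\<close>)
      then have "\<bar>g (p + v + t *\<^sub>R nrm p) - \<beta> p * t\<bar> \<le> d * norm (v + t *\<^sub>R nrm p)"
        using zero[OF p] v(1) nrm_inner_self[OF p] by (simp add: add.assoc inner_add_left)
      also have "\<dots> \<le> d * (2 * norm v)" using nv[OF that] d0 by (intro mult_left_mono) auto
      also have "\<dots> \<le> \<beta> p * T" using mult_right_mono[OF d(2)[OF p], of "norm v"] by (simp add: T_def mult_ac)
      finally show ?thesis .
    qed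
    have "\<exists>t\<ge>- T. t \<le> T \<and> g (p + v + t *\<^sub>R nrm p) = 0"
    proof (rule IVT')
      show "g (p + v + (- T) *\<^sub>R nrm p) \<le> 0" using gest[of "- T"] T0 by (simp add: abs_le_iff)
      show "0 \<le> g (p + v + T *\<^sub>R nrm p)" using gest[of T] T0 by (simp add: abs_le_iff)
      show "continuous_on {- T..T} (\<lambda>t. g (p + v + t *\<^sub>R nrm p))"
        by (intro continuous_on_compose2[OF cont_g[of UNIV]] continuous_intros) auto
    qed (use T0 in auto)
    then obtain t where "- T \<le> t" "t \<le> T" "g (p + v + t *\<^sub>R nrm p) = 0" by blast
    then have t: "\<bar>t\<bar> \<le> T" "g (p + v + t *\<^sub>R nrm p) = 0" by auto
    have "p + v + t *\<^sub>R nrm p \<in> \<Gamma>"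
      by (rule fr[OF p _ t(2)]) (use nv[OF t(1)] v in \<open>auto simp: add.assoc\<close>)
    then show "\<exists>t. \<bar>t\<bar> \<le> e * norm v \<and> p + v + t *\<^sub>R nrm p \<in> \<Gamma>" using t by (auto simp: T_def)
  next
    fix p x assume p: "p \<in> \<Gamma>" and x: "norm (x - p) < r"
    have "\<bar>g x - g p - \<beta> p * ((x - p) \<bullet> nrm p)\<bar> \<le> d * norm (x - p)" by (rule est[OF p x]) (use r in simp)
    also have "\<dots> \<le> e * norm (x - p)" using d[OF p] by (intro mult_right_mono) auto
    finally show "\<bar>g x - \<beta> p * ((x - p) \<bullet> nrm p)\<bar> \<le> e * norm (x - p)" using zero[OF p] by simp
  next
    fix p x t assume p: "p \<in> \<Gamma>" and x: "norm (x - p) < r / 2" "0 \<le> t" "t < r / 2"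
    have "norm (x + t *\<^sub>R nrm p - p) \<le> norm (x - p) + norm (t *\<^sub>R nrm p)"
      using norm_triangle_ineq[of "x - p" "t *\<^sub>R nrm p"] by (simp add: algebra_simps)
    then have "norm (x + t *\<^sub>R nrm p - p) < r" using x norm_nrm[OF p] by simp
    from up[OF p _ this x(2)] show "g x + \<beta> p / 2 * t \<le> g (x + t *\<^sub>R nrm p)" using x r by simp
  qed (rule fr)
qed

text \<open>This makes the profile vanish away from the frontier: with
  \<open>r = \<beta> x * \<rho>\<close> the conclusion reads \<open>1 \<le> - g x / r\<close>. Near
  the frontier \<open>- g\<close> grows at least linearly with the distance, and on the compact
  remainder it has a positive lower bound.\<close>

lemma far_from_frontier:
  obtains L r where "1 \<le> L" "0 < r" 
   "\<And>x \<rho>. x \<in> \<Omega> \<Longrightarrow> 0 < \<rho> \<Longrightarrow> \<rho> \<le> r \<Longrightarrow> (\<And>p. p \<in> \<Gamma> \<Longrightarrow> L * \<rho> < norm (x - p)) \<Longrightarrow> \<beta> x * \<rho> \<le> - g x"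
proof -
  obtain b where b: "0 < b" "b \<le> 1" "\<And>x. x \<in> closure \<Omega> \<Longrightarrow> b \<le> \<beta> x" using \<beta>_lower by blast
  obtain B where B: "1 \<le> B" "\<And>x. x \<in> closure \<Omega> \<Longrightarrow> \<beta> x \<le> B" using \<beta>_upper by blast
  obtain r1 where r1: "0 < r1" 
    "\<And>p x t. p \<in> \<Gamma> \<Longrightarrow> norm (x - p) < r1 / 2 \<Longrightarrow> 0 \<le> t \<Longrightarrow> t < r1 / 2 \<Longrightarrow>
        g x + \<beta> p / 2 * t \<le> g (x + t *\<^sub>R nrm p)"
    "\<And>p x. p \<in> \<Gamma> \<Longrightarrow> norm (x - p) < r1 \<Longrightarrow> g x = 0 \<Longrightarrow> x \<in> \<Gamma>"
    by (rule flatness[of "1/2"], simp, simp) (rule that, assumption+)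
  define K where "K = {x \<in> closure \<Omega>. r1 / 4 \<le> infdist x \<Gamma>}"
  have cK: "compact K"
  proof -
    have "K = closure \<Omega> \<inter> {x. r1 / 4 \<le> infdist x \<Gamma>}" by (auto simp: K_def)
    moreover have "closed {x. r1 / 4 \<le> infdist x \<Gamma>}"
      by (intro closed_Collect_le continuous_intros)
    ultimately show ?thesis using compact_closure by (simp add: compact_Int_closed)
  qed
  have Kneg: "g x < 0" if "x \<in> K" for x
  proof -
    have "x \<notin> \<Gamma>"
    proof
      assume "x \<in> \<Gamma>" then have "infdist x \<Gamma> = 0" by simp
      then show False using that r1(1) by (simp add: K_def)
    qed
    then show ?thesis using that closure_eq neg by (auto simp: K_def)
  qed
  obtain \<mu> where \<mu>: "0 < \<mu>" "\<And>x. x \<in> K \<Longrightarrow> \<mu> \<le> - g x"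
  proof (cases "K = {}")
    case False
    obtain x0 where x0: "x0 \<in> K" "\<And>x. x \<in> K \<Longrightarrow> g x \<le> g x0"
      using continuous_attains_sup[OF cK False cont_g] by blast
    show ?thesis by (rule that[of "- g x0"]) (use x0 Kneg in auto)
  qed (use that[of 1] in auto)
  \<comment> \<open>At distance \<open>d\<close> from the frontier, \<open>- g x\<close> exceeds
    \<open>b * d / 4\<close>, and \<open>B * \<rho>\<close> is wanted.\<close>
  define L where "L = 4 * B / b"
  have L: "1 \<le> L" using b B by (simp add: L_def field_simps)
  show ?thesis
  proof (rule that[OF L])
    show "0 < \<mu> / B" using \<mu> B by simp
    fix x \<rho> assume x: "x \<in> \<Omega>" and \<rho>: "0 < \<rho>" "\<rho> \<le> \<mu> / B" and far: "\<And>p. p \<in> \<Gamma> \<Longrightarrow> L * \<rho> < norm (x - p)"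
    have xc: "x \<in> closure \<Omega>" using x closure_eq by auto
    have "B * \<rho> \<le> - g x"
    proof (cases "r1 / 4 \<le> infdist x \<Gamma>")
      case True
      then have "\<mu> \<le> - g x" using xc by (intro \<mu>) (simp add: K_def)
      then show ?thesis using \<rho> B by (simp add: field_simps)
    next
      case False
      obtain p where p: "p \<in> \<Gamma>" "infdist x \<Gamma> = dist x p"
        using infdist_attains_inf[OF frontier_closed frontier_nonempty] by blast
      define d where "d = norm (x - p)"
      have d: "d < r1 / 4" "L * \<rho> < d" using False p far by (auto simp: d_def dist_norm)
      have d0: "0 < d" using d \<rho> L by (smt (verit) mult_pos_pos)
      \<comment> \<open>Otherwise \<open>g\<close> would vanish within \<open>d / 2\<close> of
        \<open>x\<close>, producing a frontier point closer than the nearest one.\<close>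
      have "g x + \<beta> p / 2 * (d / 2) < 0"
      proof (rule ccontr)
        assume "\<not> ?thesis"
        moreover have "g x + \<beta> p / 2 * (d / 2) \<le> g (x + (d / 2) *\<^sub>R nrm p)"
          by (rule r1(2)[OF p(1)]) (use d d0 r1(1) in \<open>auto simp: d_def\<close>)
        ultimately have "0 \<le> g (x + (d / 2) *\<^sub>R nrm p)" by linarith
        moreover have "g (x + 0 *\<^sub>R nrm p) \<le> 0" using neg[OF x] by simp
        ultimately have "\<exists>t\<ge>0. t \<le> d / 2 \<and> g (x + t *\<^sub>R nrm p) = 0"
          by (intro IVT' continuous_on_compose2[OF cont_g[of UNIV]] continuous_intros) (use d0 in auto)
        then obtain t where t: "0 \<le> t" "t \<le> d / 2" "g (x + t *\<^sub>R nrm p) = 0" by blast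
        have "norm (x + t *\<^sub>R nrm p - p) \<le> d + t"
          using norm_triangle_ineq[of "x - p" "t *\<^sub>R nrm p"] norm_nrm[OF p(1)] t(1) by (simp add: d_def algebra_simps)
        then have "x + t *\<^sub>R nrm p \<in> \<Gamma>" using t d d0 by (intro r1(3)[OF p(1)]) auto
        then have "dist x p \<le> dist x (x + t *\<^sub>R nrm p)" using infdist_le[of _ \<Gamma> x] p(2) by metis
        then have "d \<le> t" using t(1) norm_nrm[OF p(1)] by (simp add: dist_norm d_def)
        then show False using t(2) d0 by linarith
      qed
      moreover have "b * d \<le> \<beta> p * d" using b(3)[OF frontier_closure[OF p(1)]] d0 by (intro mult_right_mono) auto
      moreover have "4 * B * \<rho> \<le> b * d" using d(2) b by (simp add: L_def field_simps)
      ultimately show ?thesis by simp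
    qed
    moreover have "\<beta> x * \<rho> \<le> B * \<rho>" using B(2)[OF xc] \<rho> by (intro mult_right_mono) auto
    ultimately show "\<beta> x * \<rho> \<le> - g x" by simp
  qed
qed

end

lemma norm_add_orthogonal_sq:
  fixes a n :: "'a::real_inner"
  assumes "a \<bullet> n = 0" "n \<bullet> n = 1"
  shows "(norm (a + c *\<^sub>R n))\<^sup>2 = (norm a)\<^sup>2 + c\<^sup>2"
  unfolding power2_norm_eq_inner using assms
  by (simp add: inner_add_left inner_add_right inner_commute[of n a] power2_eq_square)

context C2_domain begin

section \<open>Area of the frontier inside a small ball\<close>

lemma hm_lipschitz_image:
  assumes "\<And>x y. x \<in> A \<Longrightarrow> y \<in> A \<Longrightarrow> norm (f x - f y) \<le> c * norm (x - y)" and c: "0 < c"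
  shows "hm (f ` A) \<le> ennreal (c ^ m) * hm A"
  using hausdorff_outer_lipschitz_image[of A f c "real m"] assms m_pos
  by (simp add: hm_def real_m dist_norm powr_realpow)

lemma hm_mono: "A \<subseteq> B \<Longrightarrow> hm A \<le> hm B"
  unfolding hm_def by (rule hausdorff_outer_mono)

lemma hm_disc: "norm e = 1 \<Longrightarrow> hm ((+) w ` normal_disc e (sqrt (max 0 a))) = ennreal (profile a)"
  using hausdorff_outer_normal_disc[OF card2, of e "sqrt (max 0 a)" w]
  by (simp add: hm_def profile_def \<kappa>_def m_def)

lemma profile_nonneg: "0 \<le> profile a" using \<kappa>_pos by (simp add: profile_def)

text \<open>Orthogonal projection to the tangent plane at \<open>p\<close> is 1-Lipschitz, and on
  the frontier its inverse is Lipschitz with constant \<open>1 / (1 - e)\<close>. By Pythagoras the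
  image of the piece inside the ball lies between two flat discs whose squared radii differ from
  \<open>\<rho>^2 - s^2\<close> by \<open>e * \<rho>^2\<close>, where \<open>s\<close> is the height
  of \<open>x\<close> above the tangent plane.\<close>

lemma hm_ball_bounds:
  assumes e: "0 < e" "e < 1" and L: "1 \<le> L"
  obtains r where "0 < r"
    "\<And>p x \<rho>. p \<in> \<Gamma> \<Longrightarrow> 0 < \<rho> \<Longrightarrow> \<rho> \<le> r \<Longrightarrow> norm (x - p) \<le> L * \<rho> \<Longrightarrow>
        hm (\<Gamma> \<inter> ball x \<rho>) \<le> ennreal ((1 / (1 - e)) ^ m * profile (\<rho>\<^sup>2 - ((x - p) \<bullet> nrm p)\<^sup>2 + e * \<rho>\<^sup>2))"
    "\<And>p x \<rho>. p \<in> \<Gamma> \<Longrightarrow> 0 < \<rho> \<Longrightarrow> \<rho> \<le> r \<Longrightarrow> norm (x - p) \<le> L * \<rho> \<Longrightarrow>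
        ennreal (profile (\<rho>\<^sup>2 - ((x - p) \<bullet> nrm p)\<^sup>2 - e * \<rho>\<^sup>2)) \<le> hm (\<Gamma> \<inter> ball x \<rho>)"
proof -
  \<comment> \<open>Points of \<open>ball x \<rho>\<close> are within \<open>M * \<rho>\<close> of
    \<open>p\<close>.\<close>
  define M where "M = L + 1"
  have M: "2 \<le> M" using L by (simp add: M_def)
  \<comment> \<open>Frontier points in the ball have height at most \<open>d * (M * \<rho>)\<close>,
    which changes the squared radius by at most \<open>3 * M^2 * d * \<rho>^2\<close>.\<close>
  define d where "d = e / (4 * M\<^sup>2)"
  have M2: "4 \<le> M\<^sup>2" using power_mono[OF M, of 2] by simp
  have dM: "3 * M\<^sup>2 * d < e" using e M2 by (simp add: d_def field_simps)
  have d: "0 < d" "d < 1" "d \<le> e" 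
  proof -
    have "0 < M\<^sup>2" using M2 by linarith
    then show "0 < d" using e by (simp add: d_def)
    have "d \<le> e / 1" unfolding d_def using e M2 by (intro divide_left_mono) auto
    then show "d \<le> e" "d < 1" using e by auto
  qed
  obtain r1 where r1: "0 < r1"
    "\<And>p y y'. p \<in> \<Gamma> \<Longrightarrow> y \<in> \<Gamma> \<Longrightarrow> y' \<in> \<Gamma> \<Longrightarrow> norm (y - p) < r1 \<Longrightarrow> norm (y' - p) < r1 \<Longrightarrow>
        \<bar>(y - y') \<bullet> nrm p\<bar> \<le> d * norm (y - y')"
    "\<And>p v. p \<in> \<Gamma> \<Longrightarrow> v \<bullet> nrm p = 0 \<Longrightarrow> norm v < r1 / 2 \<Longrightarrow>
        \<exists>t. \<bar>t\<bar> \<le> d * norm v \<and> p + v + t *\<^sub>R nrm p \<in> \<Gamma>"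
    by (rule flatness[OF d(1,2)]) (rule that, assumption+)
  define r where "r = r1 / (4 * M)"
  have r: "0 < r" "2 * (M * r) < r1" using r1 M by (auto simp: r_def field_simps)
  define N where "N p x = (x - p) \<bullet> nrm p" for p x
  define T where "T p x = (x - p) - N p x *\<^sub>R nrm p" for p x
  have Tn: "T p x \<bullet> nrm p = 0" if "p \<in> \<Gamma>" for p x
    using nrm_inner_self[OF that] by (simp add: T_def N_def inner_diff_left)
  have pyth: "(norm (x - y))\<^sup>2 = (norm (T p x - T p y))\<^sup>2 + (N p x - N p y)\<^sup>2" if "p \<in> \<Gamma>" for p x y
  proof -
    have "x - y = (T p x - T p y) + (N p x - N p y) *\<^sub>R nrm p" by (simp add: T_def algebra_simps)
    then show ?thesis
      using norm_add_orthogonal_sq[of "T p x - T p y" "nrm p" "N p x - N p y"] Tn[OF that] nrm_inner_self[OF that]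
      by (simp add: inner_diff_left)
  qed
  have NT: "\<bar>(t - s)\<^sup>2 - s\<^sup>2\<bar> < e * \<rho>\<^sup>2" if "\<bar>t\<bar> \<le> d * (M * \<rho>)" "\<bar>s\<bar> \<le> M * \<rho>" "0 < \<rho>" for t s \<rho> :: real
  proof -
    have "\<bar>(t - s)\<^sup>2 - s\<^sup>2\<bar> = \<bar>t\<bar> * \<bar>t - 2 * s\<bar>" by (simp add: power2_eq_square algebra_simps flip: abs_mult)
    also have "\<dots> \<le> (d * (M * \<rho>)) * (3 * (M * \<rho>))"
    proof (rule mult_mono)
      have "d * (M * \<rho>) \<le> 1 * (M * \<rho>)" using d M that by (intro mult_right_mono) auto
      then show "\<bar>t - 2 * s\<bar> \<le> 3 * (M * \<rho>)" using that by linarith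
    qed (use that d M in auto)
    also have "\<dots> = (3 * M\<^sup>2 * d) * \<rho>\<^sup>2" by (simp add: power2_eq_square)
    also have "\<dots> < e * \<rho>\<^sup>2" using dM that by (intro mult_strict_right_mono) auto
    finally show ?thesis .
  qed
  have s_le: "\<bar>N p x\<bar> \<le> norm (x - p)" if "p \<in> \<Gamma>" for p x
    using Cauchy_Schwarz_ineq2[of "x - p" "nrm p"] norm_nrm[OF that] by (simp add: N_def)
  show ?thesis
  proof (rule that[OF r(1)])
    fix p x \<rho> assume p: "p \<in> \<Gamma>" and \<rho>: "0 < \<rho>" "\<rho> \<le> r" and x: "norm (x - p) \<le> L * \<rho>"
    define s where "s = N p x"
    have M\<rho>: "2 * (M * \<rho>) < r1" using r(2) \<rho> M mult_left_mono[of \<rho> r M] by linarith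
    have sM: "\<bar>s\<bar> \<le> M * \<rho>" using s_le[OF p, of x] x \<rho> by (simp add: s_def M_def distrib_right)
    have ynear: "norm (y - p) \<le> M * \<rho>" if "y \<in> ball x \<rho>" for y
      using that x norm_triangle_ineq[of "y - x" "x - p"] by (simp add: M_def dist_norm norm_minus_commute distrib_right)
    have Mr1: "M * \<rho> < r1" using M\<rho> M \<rho> mult_pos_pos[of M \<rho>] by linarith
    have Tdiff: "T p y - T p y' = (y - y') - ((y - y') \<bullet> nrm p) *\<^sub>R nrm p" for y y'
      by (simp add: T_def N_def algebra_simps)
    have T0: "N p p = 0" "T p p = 0" by (simp_all add: N_def T_def)
    {
      define A where "A = \<Gamma> \<inter> ball x \<rho>"
      define P where "P y = p + T p y" for y
      have low: "(1 - e) * norm (y - y') \<le> norm (P y - P y')" if "y \<in> A" "y' \<in> A" for y y'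
      proof -
        have "\<bar>(y - y') \<bullet> nrm p\<bar> \<le> d * norm (y - y')"
          using that Mr1 le_less_trans[OF ynear Mr1] by (intro r1(2)[OF p]) (auto simp: A_def)
        moreover have "d * norm (y - y') \<le> e * norm (y - y')" using d by (intro mult_right_mono) auto
        moreover have "norm (y - y') \<le> norm (P y - P y') + \<bar>(y - y') \<bullet> nrm p\<bar>"
          using norm_triangle_ineq[of "P y - P y'" "((y - y') \<bullet> nrm p) *\<^sub>R nrm p"] norm_nrm[OF p] Tdiff[of y y']
          by (simp add: P_def)
        ultimately show ?thesis by (simp add: algebra_simps)
      qed
      have inj: "inj_on P A"
      proof (rule inj_onI)
        fix y y' assume "y \<in> A" "y' \<in> A" "P y = P y'"
        with low[of y y'] show "y = y'" using e by (simp add: mult_le_0_iff)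
      qed
      define f where "f = inv_into A P"
      have fP: "f (P y) = y" if "y \<in> A" for y using inj that by (simp add: f_def)
      have "hm (f ` (P ` A)) \<le> ennreal ((1 / (1 - e)) ^ m) * hm (P ` A)"
      proof (rule hm_lipschitz_image)
        fix u v assume "u \<in> P ` A" "v \<in> P ` A"
        then obtain y y' where y: "y \<in> A" "y' \<in> A" "u = P y" "v = P y'" by auto
        then show "norm (f u - f v) \<le> 1 / (1 - e) * norm (u - v)"
          using low[of y y'] e fP by (simp add: field_simps)
      qed (use e in auto)
      also have "f ` (P ` A) = A" using fP by (simp add: image_image)
      also have "hm (P ` A) \<le> hm ((+) (p + T p x) ` normal_disc (nrm p) (sqrt (max 0 (\<rho>\<^sup>2 - s\<^sup>2 + e * \<rho>\<^sup>2))))"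
      proof (rule hm_mono, safe)
        fix y assume y: "y \<in> A"
        have "\<bar>(y - p) \<bullet> nrm p\<bar> \<le> d * norm (y - p)"
          using y ynear[of y] Mr1 r1(1) by (intro r1(2)[OF p _ p]) (auto simp: A_def)
        also have "\<dots> \<le> d * (M * \<rho>)" using ynear[of y] y d by (intro mult_left_mono) (auto simp: A_def)
        finally have "\<bar>(N p y - s)\<^sup>2 - s\<^sup>2\<bar> < e * \<rho>\<^sup>2" using sM \<rho> by (intro NT) (auto simp: N_def)
        moreover have "(norm (y - x))\<^sup>2 \<le> \<rho>\<^sup>2" using y by (intro power_mono) (auto simp: A_def dist_norm norm_minus_commute)
        ultimately have "(norm (T p y - T p x))\<^sup>2 \<le> \<rho>\<^sup>2 - s\<^sup>2 + e * \<rho>\<^sup>2"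
          using pyth[OF p, of y x] unfolding s_def abs_less_iff by linarith
        then have "norm (T p y - T p x) \<le> sqrt (max 0 (\<rho>\<^sup>2 - s\<^sup>2 + e * \<rho>\<^sup>2))"
          by (intro real_le_rsqrt) auto
        then have "T p y - T p x \<in> normal_disc (nrm p) (sqrt (max 0 (\<rho>\<^sup>2 - s\<^sup>2 + e * \<rho>\<^sup>2)))"
          using Tn[OF p] by (simp add: normal_disc_def inner_diff_left)
        then show "P y \<in> (+) (p + T p x) ` normal_disc (nrm p) (sqrt (max 0 (\<rho>\<^sup>2 - s\<^sup>2 + e * \<rho>\<^sup>2)))"
          by (rule rev_image_eqI) (simp add: P_def)
      qed
      also have "\<dots> = ennreal (profile (\<rho>\<^sup>2 - s\<^sup>2 + e * \<rho>\<^sup>2))" by (rule hm_disc[OF norm_nrm[OF p]])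
      finally have "hm A \<le> ennreal ((1 / (1 - e)) ^ m) * ennreal (profile (\<rho>\<^sup>2 - s\<^sup>2 + e * \<rho>\<^sup>2))"
        by (simp add: mult_left_mono)
      then show "hm (\<Gamma> \<inter> ball x \<rho>) \<le> ennreal ((1 / (1 - e)) ^ m * profile (\<rho>\<^sup>2 - ((x - p) \<bullet> nrm p)\<^sup>2 + e * \<rho>\<^sup>2))"
        using e by (simp add: A_def s_def N_def ennreal_mult')
    }
    show "ennreal (profile (\<rho>\<^sup>2 - ((x - p) \<bullet> nrm p)\<^sup>2 - e * \<rho>\<^sup>2)) \<le> hm (\<Gamma> \<inter> ball x \<rho>)"
    proof (cases "\<rho>\<^sup>2 - s\<^sup>2 - e * \<rho>\<^sup>2 \<le> 0")
      case True
      then have "profile (\<rho>\<^sup>2 - s\<^sup>2 - e * \<rho>\<^sup>2) = 0" using m_pos by (simp add: profile_def max_def)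
      then show ?thesis by (simp add: s_def N_def)
    next
      case False
      define a where "a = \<rho>\<^sup>2 - s\<^sup>2 - e * \<rho>\<^sup>2"
      have "0 \<le> e * \<rho>\<^sup>2" "0 \<le> s\<^sup>2" using e by auto
      then have a: "0 < a" "a \<le> \<rho>\<^sup>2" using False unfolding a_def by linarith+
      define P where "P y = p + T p y" for y
      \<comment> \<open>Above every point of the smaller disc the graph property in
        \<open>flatness\<close> supplies a frontier point, and its height is too small to leave the
        ball.\<close>
      have "(+) (p + T p x) ` normal_disc (nrm p) (sqrt (max 0 a)) \<subseteq> P ` (\<Gamma> \<inter> ball x \<rho>)"
      proof safe
        fix w assume "w \<in> normal_disc (nrm p) (sqrt (max 0 a))"
        then have w: "w \<bullet> nrm p = 0" "norm w \<le> sqrt a" using a by (auto simp: normal_disc_def)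
        have w2: "(norm w)\<^sup>2 \<le> a" using power_mono[OF w(2), of 2] a by simp
        have "sqrt a \<le> \<rho>" using a \<rho> by (intro real_le_lsqrt) auto
        moreover have "norm (T p x) \<le> norm (x - p)"
        proof (rule power2_le_imp_le)
          show "(norm (T p x))\<^sup>2 \<le> (norm (x - p))\<^sup>2" using pyth[OF p, of x p] T0 by simp
        qed simp
        ultimately have v: "norm (T p x + w) \<le> M * \<rho>" 
          using norm_triangle_ineq[of "T p x" w] w(2) x by (simp add: M_def distrib_right)
        have "(T p x + w) \<bullet> nrm p = 0" using Tn[OF p] w by (simp add: inner_add_left)
        moreover have "norm (T p x + w) < r1 / 2" using v M\<rho> by simp
        ultimately obtain t where t: "\<bar>t\<bar> \<le> d * norm (T p x + w)" "p + (T p x + w) + t *\<^sub>R nrm p \<in> \<Gamma>"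
          using r1(3)[OF p] by blast
        define y where "y = p + (T p x + w) + t *\<^sub>R nrm p"
        have Ny: "N p y = t" using Tn[OF p] w nrm_inner_self[OF p] by (simp add: y_def N_def inner_add_left)
        then have Ty: "T p y = T p x + w" by (simp add: T_def[of p y]) (simp add: y_def)
        have "\<bar>t\<bar> \<le> d * (M * \<rho>)" using t(1) mult_left_mono[OF v, of d] d by linarith
        then have "\<bar>(t - s)\<^sup>2 - s\<^sup>2\<bar> < e * \<rho>\<^sup>2" using sM \<rho> by (intro NT) auto
        then have "(norm (y - x))\<^sup>2 < \<rho>\<^sup>2"
          using pyth[OF p, of y x] Ny Ty w2 unfolding s_def a_def abs_less_iff by simp
        then have "norm (y - x) < \<rho>" using \<rho> by (simp add: power2_less_imp_less)
        then have "y \<in> \<Gamma> \<inter> ball x \<rho>" using t(2) by (simp add: y_def dist_norm norm_minus_commute)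
        then show "p + T p x + w \<in> P ` (\<Gamma> \<inter> ball x \<rho>)"
          by (rule rev_image_eqI) (simp add: P_def Ty)
      qed
      then have "ennreal (profile a) \<le> hm (P ` (\<Gamma> \<inter> ball x \<rho>))"
        unfolding hm_disc[OF norm_nrm[OF p], symmetric, of _ "p + T p x"] by (rule hm_mono)
      also have "\<dots> \<le> ennreal (1 ^ m) * hm (\<Gamma> \<inter> ball x \<rho>)"
      proof (rule hm_lipschitz_image)
        fix y y'
        have "norm (T p y - T p y') \<le> norm (y - y')"
          by (rule power2_le_imp_le) (use pyth[OF p, of y y'] in auto)
        then show "norm (P y - P y') \<le> 1 * norm (y - y')" by (simp add: P_def)
      qed simp
      finally show ?thesis by (simp add: a_def s_def N_def)
    qed
  qed
qed

lemma profile_mono: "a \<le> b \<Longrightarrow> profile a \<le> profile b"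
  unfolding profile_def using \<kappa>_pos by (intro mult_left_mono power_mono real_sqrt_le_mono) auto

lemma cont_profile: "continuous_on S profile"
  unfolding profile_def by (intro continuous_intros)

lemma hm_frontier_finite: "hm \<Gamma> < top"
proof -
  obtain r where r: "0 < r" 
    "\<And>p x \<rho>. p \<in> \<Gamma> \<Longrightarrow> 0 < \<rho> \<Longrightarrow> \<rho> \<le> r \<Longrightarrow> norm (x - p) \<le> 1 * \<rho> \<Longrightarrow>
        hm (\<Gamma> \<inter> ball x \<rho>) \<le> ennreal ((1 / (1 - 1/2)) ^ m * profile (\<rho>\<^sup>2 - ((x - p) \<bullet> nrm p)\<^sup>2 + 1/2 * \<rho>\<^sup>2))"
    by (rule hm_ball_bounds[of "1/2" 1], simp, simp, simp) (rule that, assumption+)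
  have fin: "hm (\<Gamma> \<inter> ball p r) < top" if "p \<in> \<Gamma>" for p
    using r(2)[OF that, of r p] r(1) by (simp add: le_less_trans)
  obtain P where P: "P \<subseteq> \<Gamma>" "finite P" "\<Gamma> \<subseteq> (\<Union>p\<in>P. ball p r)"
  proof (rule compactE_image[OF compact_frontier, of \<Gamma> "\<lambda>p. ball p r"])
    show "\<Gamma> \<subseteq> (\<Union>p\<in>\<Gamma>. ball p r)" using r(1) by (intro subsetI UN_I) auto
  qed auto
  have "finite Q \<Longrightarrow> Q \<subseteq> \<Gamma> \<Longrightarrow> hm (\<Union>p\<in>Q. \<Gamma> \<inter> ball p r) < top" for Q
  proof (induction Q rule: finite_induct)
    case (insert p Q)
    then have "hm (\<Gamma> \<inter> ball p r) + hm (\<Union>p\<in>Q. \<Gamma> \<inter> ball p r) < top" using fin by simp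
    then show ?case using hausdorff_outer_Un[of "real CARD('n) - 1" "\<Gamma> \<inter> ball p r" "\<Union>p\<in>Q. \<Gamma> \<inter> ball p r"]
      by (simp add: hm_def le_less_trans)
  qed (simp add: hm_def hausdorff_outer_empty)
  from this[OF P(2,1)] show ?thesis
    using hm_mono[of \<Gamma> "\<Union>p\<in>P. \<Gamma> \<inter> ball p r"] P(3) by (blast intro: le_less_trans)
qed

definition hmr :: "(real^'n) set \<Rightarrow> real" where "hmr A = enn2real (hm (\<Gamma> \<inter> A))"

lemma hm_eq_hmr: "hm (\<Gamma> \<inter> A) = ennreal (hmr A)"
proof -
  have "hm (\<Gamma> \<inter> A) < top" using hm_mono[of "\<Gamma> \<inter> A" \<Gamma>] hm_frontier_finite by (auto intro: le_less_trans)
  then show ?thesis by (simp add: hmr_def)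
qed

lemma hmr_nonneg: "0 \<le> hmr A" by (simp add: hmr_def)

lemma profile_scale: "0 < c \<Longrightarrow> profile (c\<^sup>2 * a) = c ^ m * profile a"
proof -
  assume c: "0 < c"
  have "max 0 (c\<^sup>2 * a) = c\<^sup>2 * max 0 a" using c by (simp add: max_def mult_le_0_iff zero_le_mult_iff)
  then show ?thesis using c by (simp add: profile_def real_sqrt_mult power_mult_distrib)
qed

text \<open>Seen from a point at height \<open>- g x / r\<close> above the frontier, the part of the frontier in a
  ball of radius \<open>r / \<beta> x\<close> is, up to a small error, a flat disc.\<close>

lemma hmr_asymptotics:
  obtains L where "0 < L" and
    "\<And>e. 0 < e \<Longrightarrow> \<exists>r0>0. \<forall>r x. 0 < r \<longrightarrow> r \<le> r0 \<longrightarrow> x \<in> \<Omega> \<longrightarrow> 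
       \<bar>(\<beta> x / r) ^ m * hmr (ball x (r / \<beta> x)) - profile (1 - (g x / r)\<^sup>2)\<bar> \<le> e \<and>
       ((\<forall>p\<in>\<Gamma>. L * r < norm (x - p)) \<longrightarrow> hmr (ball x (r / \<beta> x)) = 0 \<and> profile (1 - (g x / r)\<^sup>2) = 0)"
proof -
  obtain b where b: "0 < b" "b \<le> 1" "\<And>x. x \<in> closure \<Omega> \<Longrightarrow> b \<le> \<beta> x" using \<beta>_lower by blast
  obtain L rf where L: "1 \<le> L" and rf: "0 < rf"
    "\<And>x \<rho>. x \<in> \<Omega> \<Longrightarrow> 0 < \<rho> \<Longrightarrow> \<rho> \<le> rf \<Longrightarrow> (\<And>p. p \<in> \<Gamma> \<Longrightarrow> L * \<rho> < norm (x - p)) \<Longrightarrow> \<beta> x * \<rho> \<le> - g x"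
    using far_from_frontier by blast
  show ?thesis
  proof (rule that[of "L / b"])
    show "0 < L / b" using b L by simp
    fix e :: real assume e: "0 < e"
    \<comment> \<open>A compact range for all arguments of \<open>profile\<close> that occur:
      squares of rescaled heights are at most \<open>(L + 1)^2\<close>, and the shift
      \<open>\<eta>\<close> is below 1.\<close>
    define K where "K = (L + 1)\<^sup>2 + 2"
    have "uniformly_continuous_on {-K..K} profile"
      by (rule compact_uniformly_continuous[OF cont_profile]) auto
    then obtain \<delta> where \<delta>: "0 < \<delta>" "\<And>a a'. a \<in> {-K..K} \<Longrightarrow> a' \<in> {-K..K} \<Longrightarrow> \<bar>a' - a\<bar> < \<delta> \<Longrightarrow> \<bar>profile a' - profile a\<bar> < e / 2"
      using e unfolding uniformly_continuous_on_def dist_real_def by (metis half_gt_zero)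
    define \<Phi> where "\<Phi> = profile K"
    \<comment> \<open>\<open>\<eta>\<close> serves twice: it shifts the argument of
      \<open>profile\<close> by less than \<open>\<delta> / 2\<close>, and it is the Lipschitz loss,
      which the bound \<open>\<Phi>\<close> turns into an additive error.\<close>
    obtain \<eta> where \<eta>: "0 < \<eta>" "\<eta> < 1" "\<eta> < \<delta> / 2" "((1 / (1 - \<eta>)) ^ m - 1) * \<Phi> < e / 2"
    proof -
      have "((\<lambda>\<eta>::real. ((1 / (1 - \<eta>)) ^ m - 1) * \<Phi>) \<longlongrightarrow> ((1 / (1 - 0)) ^ m - 1) * \<Phi>) (at_right 0)"
        by (intro tendsto_intros) auto
      then have "\<forall>\<^sub>F \<eta> in at_right 0. ((1 / (1 - \<eta>)) ^ m - 1) * \<Phi> < e / 2"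
        using e by (intro order_tendstoD) auto
      moreover have "\<forall>\<^sub>F \<eta> in at_right (0::real). 0 < \<eta>" by (rule eventually_at_right_less)
      moreover have "\<forall>\<^sub>F \<eta> in at_right (0::real). \<eta> < min 1 (\<delta> / 2)"
        using \<delta> by (intro order_tendstoD(2)[OF tendsto_ident_at]) auto
      ultimately have "\<forall>\<^sub>F \<eta> in at_right (0::real). 0 < \<eta> \<and> \<eta> < 1 \<and> \<eta> < \<delta> / 2 \<and> ((1 / (1 - \<eta>)) ^ m - 1) * \<Phi> < e / 2"
        by eventually_elim auto
      then show ?thesis using that eventually_happens'[OF trivial_limit_at_right_real] by blast
    qed
    \<comment> \<open>\<open>\<theta>\<close> bounds the gap between \<open>s / \<rho>\<close> and
      \<open>g x / r\<close>. Their sum is at most \<open>2 * L + 1\<close> in absolute value, so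
      their squares differ by less than \<open>\<delta> / 2\<close>.\<close>
    define \<theta> where "\<theta> = min 1 (\<delta> / (4 * (2 * L + 1)))"
    have \<theta>: "0 < \<theta>" "\<theta> \<le> 1" "\<theta> * (2 * L + 1) < \<delta> / 2"
    proof -
      show "0 < \<theta>" "\<theta> \<le> 1" using \<delta> L by (auto simp: \<theta>_def)
      have "\<theta> * (2 * L + 1) \<le> (\<delta> / (4 * (2 * L + 1))) * (2 * L + 1)" 
        using L by (intro mult_right_mono) (auto simp: \<theta>_def)
      also have "\<dots> = \<delta> / 4" using L by (simp add: nonzero_divide_eq_eq)
      also have "\<dots> < \<delta> / 2" using \<delta>(1) by simp
      finally show "\<theta> * (2 * L + 1) < \<delta> / 2" .
    qed
    \<comment> \<open>Two errors of size \<open>\<omega> * (L * \<rho>)\<close> arise: one from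
      linearising \<open>g\<close> at \<open>p\<close>, one from replacing \<open>\<beta> p\<close>
      by \<open>\<beta> x\<close>.\<close>
    define \<omega> where "\<omega> = min (1/2) (\<theta> * b / (2 * L))"
    have \<omega>: "0 < \<omega>" "\<omega> < 1" "2 * (\<omega> * L) \<le> \<theta> * b" 
    proof -
      show "0 < \<omega>" "\<omega> < 1" using \<theta> b L by (auto simp: \<omega>_def)
      have "\<omega> * L \<le> \<theta> * b / (2 * L) * L" using L by (intro mult_right_mono) (auto simp: \<omega>_def)
      then show "2 * (\<omega> * L) \<le> \<theta> * b" using L by simp
    qed
    obtain r1 where r1: "0 < r1"
      "\<And>p x \<rho>. p \<in> \<Gamma> \<Longrightarrow> 0 < \<rho> \<Longrightarrow> \<rho> \<le> r1 \<Longrightarrow> norm (x - p) \<le> L * \<rho> \<Longrightarrow>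
        hm (\<Gamma> \<inter> ball x \<rho>) \<le> ennreal ((1 / (1 - \<eta>)) ^ m * profile (\<rho>\<^sup>2 - ((x - p) \<bullet> nrm p)\<^sup>2 + \<eta> * \<rho>\<^sup>2))"
      "\<And>p x \<rho>. p \<in> \<Gamma> \<Longrightarrow> 0 < \<rho> \<Longrightarrow> \<rho> \<le> r1 \<Longrightarrow> norm (x - p) \<le> L * \<rho> \<Longrightarrow>
        ennreal (profile (\<rho>\<^sup>2 - ((x - p) \<bullet> nrm p)\<^sup>2 - \<eta> * \<rho>\<^sup>2)) \<le> hm (\<Gamma> \<inter> ball x \<rho>)"
      by (rule hm_ball_bounds[OF \<eta>(1,2) L]) (rule that, assumption+)
    obtain r2 where r2: "0 < r2" 
      "\<And>p x. p \<in> \<Gamma> \<Longrightarrow> norm (x - p) < r2 \<Longrightarrow> \<bar>g x - \<beta> p * ((x - p) \<bullet> nrm p)\<bar> \<le> \<omega> * norm (x - p)"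
      by (rule flatness[OF \<omega>(1,2)]) (rule that, assumption+)
    obtain r3 where r3: "0 < r3" "\<And>p x. p \<in> \<Gamma> \<Longrightarrow> dist x p < r3 \<Longrightarrow> dist (\<beta> x) (\<beta> p) < \<omega>"
      using uniform_cont_near[OF cont_\<beta> \<omega>(1)] by blast
    define mm where "mm = min (min r1 rf) (min r2 r3)"
    have mm: "0 < mm" "mm \<le> r1" "mm \<le> rf" "mm \<le> r2" "mm \<le> r3" using r1 rf r2 r3 by (auto simp: mm_def)
    show "\<exists>r0>0. \<forall>r x. 0 < r \<longrightarrow> r \<le> r0 \<longrightarrow> x \<in> \<Omega> \<longrightarrow> 
       \<bar>(\<beta> x / r) ^ m * hmr (ball x (r / \<beta> x)) - profile (1 - (g x / r)\<^sup>2)\<bar> \<le> e \<and>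
       ((\<forall>p\<in>\<Gamma>. L / b * r < norm (x - p)) \<longrightarrow> hmr (ball x (r / \<beta> x)) = 0 \<and> profile (1 - (g x / r)\<^sup>2) = 0)"
    proof (intro exI[of _ "b * mm / (2 * L)"] conjI allI impI)
      show "0 < b * mm / (2 * L)" using b mm L by simp
      fix r x assume r: "0 < r" "r \<le> b * mm / (2 * L)" and x: "x \<in> \<Omega>"
      define \<rho> where "\<rho> = r / \<beta> x"
      have xc: "x \<in> closure \<Omega>" using x closure_eq by auto
      have \<beta>x: "b \<le> \<beta> x" "0 < \<beta> x" using b(3)[OF xc] b(1) by auto
      have \<rho>: "0 < \<rho>" using r \<beta>x by (simp add: \<rho>_def)
      have r\<rho>: "r = \<beta> x * \<rho>" using \<beta>x by (simp add: \<rho>_def)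
      have \<rho>b: "\<rho> \<le> r / b" unfolding \<rho>_def using \<beta>x b r by (intro divide_left_mono) auto
      have L\<rho>: "L * \<rho> < mm"
      proof -
        have "L * \<rho> \<le> L * (r / b)" using \<rho>b L by (intro mult_left_mono) auto
        also have "\<dots> \<le> mm / 2" using r b L by (simp add: field_simps)
        finally show ?thesis using mm by simp
      qed
      have \<rho>L: "\<rho> \<le> L * \<rho>" using L \<rho> by simp
      \<comment> \<open>Far from the frontier both quantities are zero: the ball misses the
        frontier, and \<open>far_from_frontier\<close> puts \<open>- g x / r\<close> at 1 or
        beyond.\<close>
      have far: "hmr (ball x (r / \<beta> x)) = 0 \<and> profile (1 - (g x / r)\<^sup>2) = 0" if far: "\<And>p. p \<in> \<Gamma> \<Longrightarrow> L * \<rho> < norm (x - p)"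
      proof
        have "\<Gamma> \<inter> ball x \<rho> = {}"
        proof -
          have "p \<notin> ball x \<rho>" if "p \<in> \<Gamma>" for p using far[OF that] \<rho>L by (simp add: dist_norm)
          then show ?thesis by blast
        qed
        then show "hmr (ball x (r / \<beta> x)) = 0" by (simp add: hmr_def hm_def hausdorff_outer_empty \<rho>_def[symmetric])
        have "r \<le> - g x" using rf(2)[OF x \<rho> _ far] L\<rho> \<rho>L mm r\<rho> by simp
        then have "1 \<le> - g x / r" using r(1) by (simp only: pos_le_divide_eq mult_1)
        then have "1 \<le> (- g x / r)\<^sup>2" by (rule one_le_power)
        then show "profile (1 - (g x / r)\<^sup>2) = 0" using m_pos by (simp add: profile_def)
      qed
      show "\<bar>(\<beta> x / r) ^ m * hmr (ball x (r / \<beta> x)) - profile (1 - (g x / r)\<^sup>2)\<bar> \<le> e"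
      proof (cases "\<exists>p\<in>\<Gamma>. norm (x - p) \<le> L * \<rho>")
        case False
        then have "hmr (ball x (r / \<beta> x)) = 0 \<and> profile (1 - (g x / r)\<^sup>2) = 0" by (intro far) auto
        then show ?thesis using e by simp
      next
        case True
        then obtain p where p: "p \<in> \<Gamma>" "norm (x - p) \<le> L * \<rho>" by blast
        define s where "s = (x - p) \<bullet> nrm p"
        define a where "a = 1 - (s / \<rho>)\<^sup>2"
        define a' where "a' = 1 - (g x / r)\<^sup>2"
        define X where "X = hmr (ball x \<rho>) / \<rho> ^ m"
        have scale: "profile (\<rho>\<^sup>2 - s\<^sup>2 + c * \<rho>\<^sup>2) = \<rho> ^ m * profile (a + c)" for c
        proof -
          have "\<rho>\<^sup>2 - s\<^sup>2 + c * \<rho>\<^sup>2 = \<rho>\<^sup>2 * (a + c)" using \<rho> by (simp add: a_def field_simps)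
          then show ?thesis using profile_scale[OF \<rho>, of "a + c"] by simp
        qed
        define q where "q = (1 / (1 - \<eta>)) ^ m"
        have q: "1 \<le> q" unfolding q_def using \<eta> by (intro one_le_power) simp
        have rr: "\<rho> \<le> r1" using L\<rho> \<rho>L mm by linarith
        have "ennreal (hmr (ball x \<rho>)) \<le> ennreal (q * (\<rho> ^ m * profile (a + \<eta>)))"
          using r1(2)[OF p(1) \<rho> rr p(2)] scale[of \<eta>] by (simp add: hm_eq_hmr q_def s_def)
        then have "hmr (ball x \<rho>) \<le> q * (\<rho> ^ m * profile (a + \<eta>))"
          using q \<rho> profile_nonneg by (subst (asm) ennreal_le_iff) auto
        then have X1: "X \<le> q * profile (a + \<eta>)" using \<rho> by (simp add: X_def field_simps)
        have "ennreal (\<rho> ^ m * profile (a - \<eta>)) \<le> ennreal (hmr (ball x \<rho>))"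
          using r1(3)[OF p(1) \<rho> rr p(2)] scale[of "- \<eta>"] by (simp add: hm_eq_hmr s_def)
        then have "\<rho> ^ m * profile (a - \<eta>) \<le> hmr (ball x \<rho>)"
          using hmr_nonneg by (subst (asm) ennreal_le_iff) auto
        then have X2: "profile (a - \<eta>) \<le> X" using \<rho> by (simp add: X_def field_simps)
        have sL: "\<bar>s\<bar> \<le> L * \<rho>"
          using Cauchy_Schwarz_ineq2[of "x - p" "nrm p"] norm_nrm[OF p(1)] p(2) by (simp add: s_def)
        have "\<bar>\<beta> x * s - g x\<bar> \<le> \<theta> * r"
        proof -
          have "\<bar>\<beta> p * s - g x\<bar> \<le> \<omega> * (L * \<rho>)"
          proof -
            have "\<bar>g x - \<beta> p * s\<bar> \<le> \<omega> * norm (x - p)" 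
              unfolding s_def using p L\<rho> mm by (intro r2(2)) auto
            also have "\<dots> \<le> \<omega> * (L * \<rho>)" using p \<omega> by (intro mult_left_mono) auto
            finally show ?thesis by (simp add: abs_minus_commute)
          qed
          moreover have "\<bar>(\<beta> x - \<beta> p) * s\<bar> \<le> \<omega> * (L * \<rho>)"
            unfolding abs_mult
          proof (rule mult_mono)
            show "\<bar>\<beta> x - \<beta> p\<bar> \<le> \<omega>" using r3(2)[OF p(1), of x] p(2) L\<rho> mm by (simp add: dist_norm)
          qed (use sL \<omega> in auto)
          moreover have "\<beta> x * s - g x = (\<beta> x - \<beta> p) * s + (\<beta> p * s - g x)" by (simp add: algebra_simps)
          ultimately have "\<bar>\<beta> x * s - g x\<bar> \<le> 2 * (\<omega> * L) * \<rho>" by (simp add: abs_le_iff algebra_simps)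
          also have "\<dots> \<le> \<theta> * b * \<rho>" using \<omega> \<rho> by (intro mult_right_mono) auto
          also have "\<dots> \<le> \<theta> * \<beta> x * \<rho>" using \<beta>x \<theta> \<rho> by (intro mult_right_mono mult_left_mono) auto
          finally show ?thesis by (simp add: r\<rho>)
        qed
        \<comment> \<open>Here the radius \<open>r / \<beta> x\<close> pays off: the height measured
          in units of \<open>\<rho>\<close> and \<open>g\<close> measured in units of
          \<open>r\<close> are the same number up to the error.\<close>
        moreover have "s / \<rho> - g x / r = (\<beta> x * s - g x) / r" using \<rho> \<beta>x by (simp add: r\<rho> field_simps)
        ultimately have st: "\<bar>s / \<rho> - g x / r\<bar> \<le> \<theta>" using r by (simp add: field_simps)
        have s\<rho>: "\<bar>s / \<rho>\<bar> \<le> L" using sL \<rho> by (simp add: field_simps)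
        have gr: "\<bar>g x / r\<bar> \<le> L + 1" using st s\<rho> \<theta> by linarith
        have aa: "\<bar>a - a'\<bar> < \<delta> / 2"
        proof -
          have "\<bar>a - a'\<bar> = \<bar>s / \<rho> - g x / r\<bar> * \<bar>s / \<rho> + g x / r\<bar>"
            unfolding abs_mult[symmetric] by (simp add: a_def a'_def power2_eq_square algebra_simps abs_minus_commute)
          also have "\<dots> \<le> \<theta> * (2 * L + 1)"
            using st s\<rho> gr \<theta> by (intro mult_mono) linarith+
          finally show ?thesis using \<theta> by simp
        qed
        have L2: "L\<^sup>2 \<le> (L + 1)\<^sup>2" using L by (intro power_mono) auto
        have aK: "a \<in> {- (L + 1)\<^sup>2..1}" "a' \<in> {- (L + 1)\<^sup>2..1}"
        proof -
          have "(s / \<rho>)\<^sup>2 \<le> L\<^sup>2" using power_mono[OF s\<rho> abs_ge_zero, of 2] by (simp only: power2_abs)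
          moreover have "(g x / r)\<^sup>2 \<le> (L + 1)\<^sup>2" using power_mono[OF gr abs_ge_zero, of 2] by (simp only: power2_abs)
          moreover have "0 \<le> (s / \<rho>)\<^sup>2" "0 \<le> (g x / r)\<^sup>2" by simp_all
          ultimately show "a \<in> {- (L + 1)\<^sup>2..1}" "a' \<in> {- (L + 1)\<^sup>2..1}"
            using L2 unfolding a_def a'_def atLeastAtMost_iff by linarith+
        qed
        define Q where "Q = (L + 1)\<^sup>2"
        have "0 \<le> Q" by (simp add: Q_def)
        then have K: "a' \<in> {-K..K}" "a + \<eta> \<in> {-K..K}" "a - \<eta> \<in> {-K..K}"
          using \<eta> aK[folded Q_def] by (auto simp: K_def Q_def[symmetric])
        have "\<bar>(a + \<eta>) - a'\<bar> < \<delta>" "\<bar>(a - \<eta>) - a'\<bar> < \<delta>" using aa \<eta> by linarith+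
        note close = this
        have p1: "\<bar>profile (a + \<eta>) - profile a'\<bar> < e / 2" using K close by (intro \<delta>(2)) auto
        have p2: "\<bar>profile (a - \<eta>) - profile a'\<bar> < e / 2" using K close by (intro \<delta>(2)) auto
        have "(q - 1) * profile (a + \<eta>) \<le> (q - 1) * \<Phi>"
          unfolding \<Phi>_def using q K by (intro mult_left_mono profile_mono) auto
        then have "q * profile (a + \<eta>) \<le> profile (a + \<eta>) + e / 2"
          using \<eta>(4) by (simp add: q_def[symmetric] algebra_simps)
        then have "\<bar>X - profile a'\<bar> \<le> e" using X1 X2 p1 p2 by linarith
        moreover have "(\<beta> x / r) ^ m * hmr (ball x (r / \<beta> x)) = X"
          using \<beta>x \<rho> by (simp add: X_def r\<rho> power_one_over field_simps)
        ultimately show ?thesis by (simp add: a'_def)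
      qed
      show "hmr (ball x (r / \<beta> x)) = 0" "profile (1 - (g x / r)\<^sup>2) = 0" if "\<forall>p\<in>\<Gamma>. L / b * r < norm (x - p)"
      proof -
        have "L * \<rho> < norm (x - p)" if "p \<in> \<Gamma>" for p
        proof -
          have "L * \<rho> \<le> L * (r / b)" using \<rho>b L by (intro mult_left_mono) auto
          then show ?thesis using \<open>\<forall>p\<in>\<Gamma>. L / b * r < norm (x - p)\<close> that by force
        qed
        then show "hmr (ball x (r / \<beta> x)) = 0" "profile (1 - (g x / r)\<^sup>2) = 0" using far by auto
      qed
    qed
  qed
qed

end

section \<open>Limits of integrals over a boundary layer\<close>

lemma lborel_integral_affine:
  fixes f :: "'a::euclidean_space \<Rightarrow> real"
  assumes f: "f \<in> borel_measurable borel" and c: "c \<noteq> 0"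
  shows "integral\<^sup>L lborel f = \<bar>c\<bar> ^ DIM('a) * (LINT x|lborel. f (t + c *\<^sub>R x))"
proof -
  have "integral\<^sup>L lborel f = integral\<^sup>L (density (distr lborel borel (\<lambda>x. t + c *\<^sub>R x)) (\<lambda>_. ennreal (\<bar>c\<bar> ^ DIM('a)))) f"
    by (subst lborel_affine[OF c, of t]) simp
  also have "\<dots> = (LINT x|distr lborel borel (\<lambda>x. t + c *\<^sub>R x). \<bar>c\<bar> ^ DIM('a) *\<^sub>R f x)"
    by (rule integral_density) (use f in auto)
  also have "\<dots> = (LINT x|lborel. \<bar>c\<bar> ^ DIM('a) *\<^sub>R f (t + c *\<^sub>R x))"
    by (rule integral_distr) (use f in auto)
  finally show ?thesis by simp
qed

lemma borel_measurable_hausdorff_measure: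
  "f \<in> borel_measurable borel \<Longrightarrow> f \<in> borel_measurable (hausdorff_measure s)"
  by (simp add: measurable_cong_sets[OF sets_hausdorff_measure refl])

text \<open>The reflection at the origin exchanges the two open half balls, and the hyperplane
  between them is a null set.\<close>

lemma half_ball_content:
  fixes n :: "'a::euclidean_space"
  assumes n: "n \<noteq> 0" and R: "0 < R"
  shows "(LINT x|lborel. indicator {x. n \<bullet> x < 0 \<and> norm x < R} x) = R ^ DIM('a) * (measure lborel (ball (0::'a) 1) / 2)"
proof -
  let ?N = "{x. n \<bullet> x < 0 \<and> norm x < R}" and ?P = "{x. 0 < n \<bullet> x \<and> norm x < R}"
  have opN: "open ?N" and opP: "open ?P"
    by (intro open_Collect_conj open_Collect_less continuous_intros)+
  have fin: "emeasure lborel ?N < top" "emeasure lborel ?P < top"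
  proof -
    have "bounded ?N" "bounded ?P" by (auto intro: bounded_subset[OF bounded_ball[of 0 R]])
    then show "emeasure lborel ?N < top" "emeasure lborel ?P < top" 
      using emeasure_bounded_finite by auto
  qed
  have iN: "integrable lborel (indicator ?N :: 'a \<Rightarrow> real)" and iP: "integrable lborel (indicator ?P :: 'a \<Rightarrow> real)"
    using fin opN opP by (auto intro!: integrable_real_indicator)
  have "(LINT x|lborel. indicator ?N x) = (LINT x|lborel. indicator ?N (- x) :: real)"
    using lborel_integral_affine[of "indicator ?N" "- 1" 0] opN by simp
  also have "\<dots> = (LINT x|lborel. indicator ?P x)"
    by (intro Bochner_Integration.integral_cong) (auto simp: indicator_def)
  finally have eq: "(LINT x|lborel. indicator ?N x :: real) = (LINT x|lborel. indicator ?P x)" .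
  have "negligible {x. n \<bullet> x = 0}" using n by (intro negligible_hyperplane) simp
  then have "{x. n \<bullet> x = 0} \<in> null_sets lebesgue" by (simp add: negligible_iff_null_sets)
  moreover have "closed {x. n \<bullet> x = 0}" by (rule closed_hyperplane)
  ultimately have "{x. n \<bullet> x = 0} \<in> null_sets lborel"
    by (auto simp: null_sets_def)
  then have ae: "AE x in lborel. x \<notin> {x. n \<bullet> x = 0}" by (rule AE_not_in)
  have "R ^ DIM('a) * measure lborel (ball (0::'a) 1) = measure lborel (ball (0::'a) R)"
    using content_ball_conv_unit_ball[of R "0::'a"] R by simp
  also have "\<dots> = (LINT x|lborel. indicator (ball (0::'a) R) x)" by simp
  also have "\<dots> = (LINT x|lborel. indicator ?N x + indicator ?P x)"
    using ae by (intro integral_cong_AE) (use opN opP in \<open>auto simp: indicator_def elim!: eventually_mono\<close>)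
  also have "\<dots> = (LINT x|lborel. indicator ?N x) + (LINT x|lborel. indicator ?P x)"
    by (rule Bochner_Integration.integral_add[OF iN iP])
  finally show ?thesis using eq by simp
qed

context C2_domain begin

text \<open>Using densities instead of restricted spaces keeps the Borel sets of the whole space for
  both measures, so Fubini's theorem applies to Borel functions of pairs without subspaces.\<close>

definition \<mu> :: "(real^'n) measure" where
  "\<mu> = density (hausdorff_measure (real CARD('n) - 1)) (\<lambda>x. ennreal (indicator \<Gamma> x))"

definition \<Lambda> :: "(real^'n) measure" where
  "\<Lambda> = density lborel (\<lambda>x. ennreal (indicator \<Omega> x))"

lemma sets_\<mu> [simp, measurable_cong]: "sets \<mu> = sets borel" and space_\<mu> [simp]: "space \<mu> = UNIV"
  by (simp_all add: \<mu>_def)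

lemma sets_\<Lambda> [simp, measurable_cong]: "sets \<Lambda> = sets borel" and space_\<Lambda> [simp]: "space \<Lambda> = UNIV"
  by (simp_all add: \<Lambda>_def)

lemma frontier_borel [measurable]: "\<Gamma> \<in> sets borel" by simp

lemma Omega_borel [measurable]: "\<Omega> \<in> sets borel" using op by simp

lemma emeasure_\<mu>: "A \<in> sets borel \<Longrightarrow> emeasure \<mu> A = ennreal (hmr A)"
proof -
  assume A: "A \<in> sets borel"
  have "emeasure \<mu> A = (\<integral>\<^sup>+x. ennreal (indicator \<Gamma> x) * indicator A x \<partial>hausdorff_measure (real CARD('n) - 1))"
    unfolding \<mu>_def using A by (subst emeasure_density) (auto intro!: borel_measurable_hausdorff_measure)
  also have "\<dots> = (\<integral>\<^sup>+x. indicator (\<Gamma> \<inter> A) x \<partial>hausdorff_measure (real CARD('n) - 1))"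
    by (intro nn_integral_cong) (auto simp: indicator_def)
  also have "\<dots> = emeasure (hausdorff_measure (real CARD('n) - 1)) (\<Gamma> \<inter> A)"
    using A by (subst nn_integral_indicator) auto
  also have "\<dots> = hm (\<Gamma> \<inter> A)" using A by (simp add: hm_def emeasure_hausdorff_measure)
  finally show ?thesis by (simp add: hm_eq_hmr)
qed

lemma emeasure_\<Lambda>: "A \<in> sets borel \<Longrightarrow> emeasure \<Lambda> A = emeasure lborel (\<Omega> \<inter> A)"
proof -
  assume A: "A \<in> sets borel"
  have "emeasure \<Lambda> A = (\<integral>\<^sup>+x. ennreal (indicator \<Omega> x) * indicator A x \<partial>lborel)"
    unfolding \<Lambda>_def using A by (subst emeasure_density) auto
  also have "\<dots> = (\<integral>\<^sup>+x. indicator (\<Omega> \<inter> A) x \<partial>lborel)"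
    by (intro nn_integral_cong) (auto simp: indicator_def)
  finally show ?thesis using A by (subst (asm) nn_integral_indicator) auto
qed

sublocale \<mu>: finite_measure \<mu>
  by (rule finite_measureI) (simp add: emeasure_\<mu>)

sublocale \<Lambda>: finite_measure \<Lambda>
proof (rule finite_measureI)
  have "emeasure lborel \<Omega> < top"
    using emeasure_bounded_finite[OF bdd] by simp
  then show "emeasure \<Lambda> (space \<Lambda>) \<noteq> \<infinity>" by (simp add: emeasure_\<Lambda> less_top)
qed

sublocale \<Lambda>\<mu>: pair_sigma_finite \<Lambda> \<mu> ..

lemma integral_\<Lambda>:
  fixes f :: "real^'n \<Rightarrow> real"
  assumes "f \<in> borel_measurable borel"
  shows "integral\<^sup>L \<Lambda> f = (LINT x|lborel. indicator \<Omega> x * f x)"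
  unfolding \<Lambda>_def using assms by (subst integral_density) auto

lemma AE_\<Lambda>: "AE x in \<Lambda>. x \<in> \<Omega>"
  unfolding \<Lambda>_def by (subst AE_density) (auto simp: indicator_def)

lemma AE_\<mu>: "AE x in \<mu>. x \<in> \<Gamma>"
proof -
  have "(\<lambda>x. ennreal (indicator \<Gamma> x)) \<in> borel_measurable (hausdorff_measure (real CARD('n) - 1))"
    by (rule borel_measurable_hausdorff_measure) measurable
  then show ?thesis unfolding \<mu>_def by (subst AE_density) (auto simp: indicator_def)
qed

lemma surf_int_eq: 
  assumes "continuous_on \<Gamma> f"
  shows "surf_int \<Gamma> f = (LINT x|\<mu>. indicator \<Gamma> x * f x)"
proof -
  have [measurable]: "(\<lambda>x. indicator \<Gamma> x *\<^sub>R f x) \<in> borel_measurable borel"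
    using assms by (intro borel_measurable_continuous_on_indicator) auto
  then have m': "(\<lambda>x. indicator \<Gamma> x * f x) \<in> borel_measurable borel" by simp
  have "(LINT x|\<mu>. indicator \<Gamma> x * f x) = (LINT x|hausdorff_measure (real CARD('n) - 1). indicator \<Gamma> x *\<^sub>R (indicator \<Gamma> x * f x))"
    unfolding \<mu>_def by (rule integral_density) (auto intro!: borel_measurable_hausdorff_measure m')
  also have "\<dots> = surf_int \<Gamma> f"
    unfolding surf_int_def set_lebesgue_integral_def
    by (intro Bochner_Integration.integral_cong) (auto simp: indicator_def)
  finally show ?thesis by simp
qed

text \<open>Fubini for the pairs at distance below \<open>3 * r\<close>: a point within
  \<open>r\<close> of the frontier sees at least a multiple of \<open>r ^ m\<close> of the frontier,
  while a frontier point sees at most a multiple of \<open>r ^ CARD('n)\<close> of the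
  volume.\<close>

lemma layer_volume:
  obtains C r0 where "0 \<le> C" "0 < r0" "\<And>r. 0 < r \<Longrightarrow> r \<le> r0 \<Longrightarrow> measure \<Lambda> {x. infdist x \<Gamma> \<le> r} \<le> C * r"
proof -
  obtain r1 where r1: "0 < r1" 
    "\<And>p x \<rho>. p \<in> \<Gamma> \<Longrightarrow> 0 < \<rho> \<Longrightarrow> \<rho> \<le> r1 \<Longrightarrow> norm (x - p) \<le> 1 * \<rho> \<Longrightarrow>
        ennreal (profile (\<rho>\<^sup>2 - ((x - p) \<bullet> nrm p)\<^sup>2 - 1/2 * \<rho>\<^sup>2)) \<le> hm (\<Gamma> \<inter> ball x \<rho>)"
    by (rule hm_ball_bounds[of "1/2" 1], simp, simp, simp) (rule that, assumption+)
  define c where "c = profile (1/2)"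
  have c: "0 < c" using \<kappa>_pos by (simp add: c_def profile_def)
  define V where "V = measure lborel (ball (0::real^'n) 1)"
  define C where "C = hmr UNIV * 3 ^ CARD('n) * V / c"
  show ?thesis
  proof (rule that[of C r1])
    show "0 < r1" by (rule r1(1))
    show "0 \<le> C" using c hmr_nonneg by (simp add: C_def V_def)
    fix r :: real assume r: "0 < r" "r \<le> r1"
    define A where "A = {x::real^'n. infdist x \<Gamma> \<le> r}"
    have [measurable]: "A \<in> sets borel" 
      unfolding A_def by (intro borel_closed closed_Collect_le continuous_intros)
    \<comment> \<open>The ball of radius \<open>3 * r\<close> contains the ball of radius
      \<open>r\<close> around the nearest frontier point, with room for the strict
      inequality.\<close>
    have low: "ennreal (c * r ^ m) \<le> emeasure \<mu> (ball x (3 * r))" if "x \<in> A" for x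
    proof -
      obtain p where p: "p \<in> \<Gamma>" "infdist x \<Gamma> = dist x p"
        using infdist_attains_inf[OF frontier_closed frontier_nonempty] by blast
      have "ball p r \<subseteq> ball x (3 * r)"
      proof
        fix y assume "y \<in> ball p r"
        then show "y \<in> ball x (3 * r)" using dist_triangle[of x y p] p(2) that r(1) by (simp add: A_def)
      qed
      then have "hm (\<Gamma> \<inter> ball p r) \<le> hm (\<Gamma> \<inter> ball x (3 * r))" by (intro hm_mono) auto
      moreover have "ennreal (profile (r\<^sup>2 * (1/2))) \<le> hm (\<Gamma> \<inter> ball p r)" using r1(2)[OF p(1) r(1,2), of p] r by simp
      moreover have "profile (r\<^sup>2 * (1/2)) = c * r ^ m" using profile_scale[OF r(1), of "1/2"] by (simp add: c_def mult.commute)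
      ultimately show ?thesis by (simp add: emeasure_\<mu> flip: hm_eq_hmr)
    qed
    let ?S = "{z::(real^'n) \<times> (real^'n). dist (fst z) (snd z) < 3 * r}"
    have "open ?S" by (intro open_Collect_less continuous_intros)
    then have S: "?S \<in> sets (\<Lambda> \<Otimes>\<^sub>M \<mu>)" 
    proof -
      have "sets (\<Lambda> \<Otimes>\<^sub>M \<mu>) = sets (borel \<Otimes>\<^sub>M borel)" by (rule sets_pair_measure_cong) simp_all
      then show ?thesis using \<open>open ?S\<close> unfolding borel_prod by simp
    qed
    have "ennreal (c * r ^ m) * emeasure \<Lambda> A = (\<integral>\<^sup>+x. ennreal (c * r ^ m) * indicator A x \<partial>\<Lambda>)"
      by (simp add: nn_integral_cmult_indicator)
    also have "\<dots> \<le> (\<integral>\<^sup>+x. emeasure \<mu> (ball x (3 * r)) \<partial>\<Lambda>)"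
      by (intro nn_integral_mono) (auto simp: indicator_def low)
    also have "\<dots> = emeasure (\<Lambda> \<Otimes>\<^sub>M \<mu>) ?S"
      unfolding \<mu>.emeasure_pair_measure_alt[OF S] by (simp add: vimage_def ball_def)
    also have "\<dots> = (\<integral>\<^sup>+y. emeasure \<Lambda> (ball y (3 * r)) \<partial>\<mu>)"
      unfolding \<Lambda>\<mu>.emeasure_pair_measure_alt2[OF S] by (simp add: vimage_def ball_def dist_commute)
    also have "\<dots> \<le> (\<integral>\<^sup>+y. ennreal ((3 * r) ^ CARD('n) * V) \<partial>\<mu>)"
    proof (rule nn_integral_mono)
      fix y :: "real^'n"
      have "emeasure \<Lambda> (ball y (3 * r)) \<le> emeasure lborel (ball y (3 * r))"
        unfolding emeasure_\<Lambda>[OF borel_open[OF open_ball]] by (rule emeasure_mono) auto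
      also have "\<dots> = ennreal (measure lborel (ball y (3 * r)))"
        using emeasure_lborel_ball_finite[of y "3 * r"] by (simp add: emeasure_eq_ennreal_measure)
      also have "measure lborel (ball y (3 * r)) = (3 * r) ^ CARD('n) * V"
        using content_ball_conv_unit_ball[of "3 * r" y] r by (simp add: V_def)
      finally show "emeasure \<Lambda> (ball y (3 * r)) \<le> ennreal ((3 * r) ^ CARD('n) * V)" .
    qed
    also have "\<dots> = ennreal ((3 * r) ^ CARD('n) * V) * ennreal (hmr UNIV)"
      by (simp add: emeasure_\<mu>)
    finally have "ennreal (c * r ^ m * measure \<Lambda> A) \<le> ennreal ((3 * r) ^ CARD('n) * V * hmr UNIV)"
      using c r hmr_nonneg by (simp add: \<Lambda>.emeasure_eq_measure ennreal_mult' ennreal_mult'')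
    then have "c * r ^ m * measure \<Lambda> A \<le> (3 * r) ^ CARD('n) * V * hmr UNIV"
      using r hmr_nonneg by (subst (asm) ennreal_le_iff) (auto simp: V_def)
    also have "\<dots> = c * r ^ m * (C * r)"
      using c by (simp add: C_def card_m power_mult_distrib field_simps)
    finally show "measure \<Lambda> {x. infdist x \<Gamma> \<le> r} \<le> C * r"
      using c r by (simp add: A_def mult_le_cancel_left_pos)
  qed
qed

text \<open>Under the substitution \<open>x = y + r k *\<^sub>R \<xi>\<close> the domain becomes the
  half-space \<open>Dg y \<bullet> \<xi> < 0\<close> in the limit, and the condition on
  \<open>x\<close> becomes \<open>norm \<xi> * \<beta> y < 1\<close>; dominated convergence then
  gives the volume of a half ball.\<close>

lemma frontier_blowup:
  fixes F :: "real^'n \<Rightarrow> real"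
  assumes F: "continuous_on (closure \<Omega>) F" and y: "y \<in> \<Gamma>" 
    and r: "\<And>k. 0 < r k" "r \<longlonglongrightarrow> 0"
  shows "(\<lambda>k. (1 / r k) ^ CARD('n) * (LINT x|\<Lambda>. indicator {x. norm (x - y) * \<beta> x < r k} x * (indicator \<Omega> x * F x)))
     \<longlonglongrightarrow> measure lborel (ball (0::real^'n) 1) / 2 * F y / \<beta> y ^ CARD('n)"
proof -
  obtain b where b: "0 < b" "b \<le> 1" "\<And>x. x \<in> closure \<Omega> \<Longrightarrow> b \<le> \<beta> x" using \<beta>_lower by blast
  obtain M where M: "\<And>x. x \<in> closure \<Omega> \<Longrightarrow> \<bar>F x\<bar> \<le> M"
    using compact_imp_bounded[OF compact_continuous_image[OF F compact_closure]]
    by (auto simp: bounded_iff)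
  have yc: "y \<in> closure \<Omega>" by (rule frontier_closure[OF y])
  define F' where "F' x = indicator \<Omega> x * F x" for x
  have F'm [measurable]: "F' \<in> borel_measurable borel"
    unfolding F'_def real_scaleR_def[symmetric]
    by (intro borel_measurable_continuous_on_indicator continuous_on_subset[OF F] closure_subset) simp
  have \<beta>m [measurable]: "\<beta> \<in> borel_measurable borel" by (rule borel_measurable_continuous_onI[OF cont_\<beta>])
  define f where "f k \<xi> = indicator {x. norm (x - y) * \<beta> x < r k} (y + r k *\<^sub>R \<xi>) * F' (y + r k *\<^sub>R \<xi>)" for k \<xi>
  define f0 where "f0 \<xi> = indicator {\<xi>. Dg y \<bullet> \<xi> < 0 \<and> norm \<xi> < 1 / \<beta> y} \<xi> * F y" for \<xi>
  have eq: "(1 / r k) ^ CARD('n) * (LINT x|\<Lambda>. indicator {x. norm (x - y) * \<beta> x < r k} x * (indicator \<Omega> x * F x)) = integral\<^sup>L lborel (f k)" for k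
  proof -
    have "(LINT x|\<Lambda>. indicator {x. norm (x - y) * \<beta> x < r k} x * (indicator \<Omega> x * F x))
       = (LINT x|\<Lambda>. indicator {x. norm (x - y) * \<beta> x < r k} x * F' x)" by (simp add: F'_def)
    also have "\<dots> = (LINT x|lborel. indicator \<Omega> x * (indicator {x. norm (x - y) * \<beta> x < r k} x * F' x))"
      by (rule integral_\<Lambda>) measurable
    also have "\<dots> = (LINT x|lborel. indicator {x. norm (x - y) * \<beta> x < r k} x * F' x)"
      by (intro Bochner_Integration.integral_cong) (auto simp: F'_def indicator_def)
    also have "\<dots> = \<bar>r k\<bar> ^ DIM(real^'n) * integral\<^sup>L lborel (f k)"
      unfolding f_def by (rule lborel_integral_affine) (use r(1)[of k] in \<open>measurable, auto\<close>)
    finally show ?thesis using r(1)[of k] by (simp add: power_one_over)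
  qed
  have rlim: "filterlim r (at_right 0) sequentially"
    using r by (intro tendsto_imp_filterlim_at_right always_eventually) auto
  have "(\<lambda>k. integral\<^sup>L lborel (f k)) \<longlonglongrightarrow> integral\<^sup>L lborel f0"
  proof (rule integral_dominated_convergence[where w = "\<lambda>\<xi>. M * indicator (ball 0 (1 / b)) \<xi>"])
    show "f0 \<in> borel_measurable lborel" unfolding f0_def by measurable
    show "f k \<in> borel_measurable lborel" for k unfolding f_def by measurable
    show "integrable lborel (\<lambda>\<xi>::real^'n. M * indicator (ball 0 (1 / b)) \<xi>)"
      by (intro integrable_mult_right integrable_real_indicator emeasure_lborel_ball_finite) auto
    show "AE \<xi> in lborel. norm (f k \<xi>) \<le> M * indicator (ball 0 (1 / b)) \<xi>" for k
    proof (rule AE_I2)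
      fix \<xi> :: "real^'n"
      show "norm (f k \<xi>) \<le> M * indicator (ball 0 (1 / b)) \<xi>"
      proof (cases "y + r k *\<^sub>R \<xi> \<in> \<Omega> \<and> norm (r k *\<^sub>R \<xi>) * \<beta> (y + r k *\<^sub>R \<xi>) < r k")
        case True
        then have c: "y + r k *\<^sub>R \<xi> \<in> closure \<Omega>" using closure_eq by auto
        have "norm \<xi> * \<beta> (y + r k *\<^sub>R \<xi>) < 1" using True r(1)[of k] by simp
        moreover have "norm \<xi> * b \<le> norm \<xi> * \<beta> (y + r k *\<^sub>R \<xi>)" using b(3)[OF c] by (intro mult_left_mono) auto
        ultimately have "norm \<xi> < 1 / b" using b by (simp add: field_simps)
        then show ?thesis using M[OF c] True by (simp add: f_def F'_def)
      next
        case False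
        have "0 \<le> M" using M[OF yc] by linarith
        moreover have "f k \<xi> = 0" using False by (auto simp: f_def F'_def)
        ultimately show ?thesis by simp
      qed
    qed
    \<comment> \<open>Pointwise convergence can fail only where a limiting condition holds with
      equality: on the hyperplane and on the sphere.\<close>
    have "negligible ({\<xi>. Dg y \<bullet> \<xi> = 0} \<union> sphere 0 (1 / \<beta> y))"
      using Dg_nz[OF y] by (intro negligible_Un negligible_hyperplane negligible_sphere) auto
    then have "{\<xi>. Dg y \<bullet> \<xi> = 0} \<union> sphere 0 (1 / \<beta> y) \<in> null_sets lebesgue" by (simp add: negligible_iff_null_sets)
    moreover have "closed ({\<xi>. Dg y \<bullet> \<xi> = 0} \<union> sphere 0 (1 / \<beta> y))" by (intro closed_Un closed_hyperplane closed_sphere)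
    ultimately have "{\<xi>. Dg y \<bullet> \<xi> = 0} \<union> sphere 0 (1 / \<beta> y) \<in> null_sets lborel" by (auto simp: null_sets_def)
    then have "AE \<xi> in lborel. \<xi> \<notin> {\<xi>. Dg y \<bullet> \<xi> = 0} \<union> sphere 0 (1 / \<beta> y)" by (rule AE_not_in)
    then show "AE \<xi> in lborel. (\<lambda>k. f k \<xi>) \<longlonglongrightarrow> f0 \<xi>"
    proof eventually_elim
      case (elim \<xi>)
      have lim: "(\<lambda>k. y + r k *\<^sub>R \<xi>) \<longlonglongrightarrow> y"
        using tendsto_add[OF tendsto_const[of y] tendsto_scaleR[OF r(2) tendsto_const[of \<xi>]]] by simp
      have inW: "\<forall>\<^sub>F k in sequentially. y + r k *\<^sub>R \<xi> \<in> W"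
        using lim opW frontier_W y by (auto dest: topological_tendstoD)
      consider "Dg y \<bullet> \<xi> < 0" | "0 < Dg y \<bullet> \<xi>" using elim by fastforce
      then show ?case
      proof cases
        case 2
        have "\<forall>\<^sub>F t in at_right 0. - g (y + t *\<^sub>R \<xi>) < - g y"
          using 2 by (intro has_derivative_neg_direction[OF has_derivative_minus[OF g_has_derivative]]) simp
        then have "\<forall>\<^sub>F k in sequentially. - g (y + r k *\<^sub>R \<xi>) < - g y"
          using rlim by (rule eventually_compose_filterlim)
        then have "\<forall>\<^sub>F k in sequentially. f k \<xi> = 0"
        proof eventually_elim
          case (elim k)
          then have "y + r k *\<^sub>R \<xi> \<notin> \<Omega>" using neg[of "y + r k *\<^sub>R \<xi>"] zero[OF y] by auto
          then show ?case by (simp add: f_def F'_def)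
        qed
        moreover have "f0 \<xi> = 0" using 2 by (simp add: f0_def)
        ultimately show ?thesis by (simp add: tendsto_eventually)
      next
        case 1
        have "\<forall>\<^sub>F t in at_right 0. g (y + t *\<^sub>R \<xi>) < g y"
          using 1 by (intro has_derivative_neg_direction[OF g_has_derivative]) simp
        then have "\<forall>\<^sub>F k in sequentially. g (y + r k *\<^sub>R \<xi>) < g y"
          using rlim by (rule eventually_compose_filterlim)
        then have in\<Omega>: "\<forall>\<^sub>F k in sequentially. y + r k *\<^sub>R \<xi> \<in> \<Omega>"
          using inW by eventually_elim (use W_neg zero[OF y] in auto)
        have "(\<lambda>k. F (y + r k *\<^sub>R \<xi>)) \<longlonglongrightarrow> F y"
        proof (rule continuous_on_tendsto_compose[OF F lim yc])
          show "\<forall>\<^sub>F k in sequentially. y + r k *\<^sub>R \<xi> \<in> closure \<Omega>"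
            using in\<Omega> by eventually_elim (use closure_eq in auto)
        qed
        then have "(\<lambda>k. F' (y + r k *\<^sub>R \<xi>)) \<longlonglongrightarrow> F y"
          by (rule Lim_transform_eventually) (use in\<Omega> in \<open>eventually_elim, simp add: F'_def\<close>)
        moreover have "(\<lambda>k. indicator {x. norm (x - y) * \<beta> x < r k} (y + r k *\<^sub>R \<xi>) :: real)
           \<longlonglongrightarrow> indicator {\<xi>. Dg y \<bullet> \<xi> < 0 \<and> norm \<xi> < 1 / \<beta> y} \<xi>"
        proof (rule tendsto_eventually)
          have \<beta>y: "0 < \<beta> y" by (rule \<beta>_pos[OF yc])
          have lim\<beta>: "(\<lambda>k. norm \<xi> * \<beta> (y + r k *\<^sub>R \<xi>)) \<longlonglongrightarrow> norm \<xi> * \<beta> y"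
            by (intro tendsto_mult tendsto_const continuous_on_tendsto_compose[OF cont_\<beta>[of UNIV] lim]) auto
          have ind: "indicator {x. norm (x - y) * \<beta> x < r k} (y + r k *\<^sub>R \<xi>) = (indicator {..<1} (norm \<xi> * \<beta> (y + r k *\<^sub>R \<xi>)) :: real)" for k
            using r(1)[of k] by (auto simp: indicator_def)
          consider "norm \<xi> < 1 / \<beta> y" | "1 / \<beta> y < norm \<xi>" using elim by fastforce
          then show "\<forall>\<^sub>F k in sequentially. indicator {x. norm (x - y) * \<beta> x < r k} (y + r k *\<^sub>R \<xi>) 
             = (indicator {\<xi>. Dg y \<bullet> \<xi> < 0 \<and> norm \<xi> < 1 / \<beta> y} \<xi> :: real)"
          proof cases
            assume lt: "norm \<xi> < 1 / \<beta> y"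
            then have "norm \<xi> * \<beta> y < 1" using \<beta>y by (simp add: field_simps)
            from order_tendstoD(2)[OF lim\<beta> this] show ?thesis
              by eventually_elim (use lt 1 ind in \<open>auto simp: indicator_def\<close>)
          next
            assume gt: "1 / \<beta> y < norm \<xi>"
            then have "1 < norm \<xi> * \<beta> y" using \<beta>y by (simp add: field_simps)
            from order_tendstoD(1)[OF lim\<beta> this] show ?thesis
              by eventually_elim (use gt 1 ind in \<open>auto simp: indicator_def\<close>)
          qed
        qed
        ultimately show ?thesis unfolding f_def f0_def by (rule tendsto_mult[rotated])
      qed
    qed
  qed
  moreover have "integral\<^sup>L lborel f0 = measure lborel (ball (0::real^'n) 1) / 2 * F y / \<beta> y ^ CARD('n)"
    unfolding f0_def using half_ball_content[OF Dg_nz[OF y], of "1 / \<beta> y"] \<beta>_pos[OF yc]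
    by (simp add: power_one_over)
  ultimately show ?thesis by (simp only: eq)
qed

lemma continuous_bounded:
  fixes f :: "real^'n \<Rightarrow> 'b::real_normed_vector"
  assumes "continuous_on (closure \<Omega>) f"
  obtains M where "0 < M" "\<And>x. x \<in> closure \<Omega> \<Longrightarrow> norm (f x) \<le> M"
  using compact_imp_bounded[OF compact_continuous_image[OF assms compact_closure]]
  by (auto simp: bounded_pos)

lemma measurable_indicator_times:
  fixes f :: "real^'n \<Rightarrow> real"
  assumes "continuous_on (closure \<Omega>) f"
  shows "(\<lambda>x. indicator \<Omega> x * f x) \<in> borel_measurable borel"
  unfolding real_scaleR_def[symmetric]
  by (intro borel_measurable_continuous_on_indicator continuous_on_subset[OF assms] closure_subset) simp

lemma integrable_indicator_\<Lambda>: "A \<in> sets borel \<Longrightarrow> integrable \<Lambda> (indicator A :: real^'n \<Rightarrow> real)"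
  by (rule \<Lambda>.integrable_const_bound[where B = 1]) (auto simp: indicator_def)

definition half_ball_vol :: real where "half_ball_vol = measure lborel (ball (0::real^'n) 1) / 2"

text \<open>The pairs of an interior point \<open>x\<close> and a frontier point \<open>y\<close>
  with \<open>norm (x - y) * \<beta> x < r k\<close> are integrated in both orders. Over
  \<open>x\<close> first, \<open>frontier_blowup\<close> gives a constant times
  \<open>f y / \<beta> y\<close>; over \<open>y\<close> first, \<open>hmr_asymptotics\<close> gives
  the profile of \<open>g x / r k\<close>.\<close>

lemma layer_limit:
  fixes f :: "real^'n \<Rightarrow> real"
  assumes f: "continuous_on (closure \<Omega>) f" and r: "\<And>k. 0 < r k" "r \<longlonglongrightarrow> 0"
  shows "(\<lambda>k. (1 / r k) * (LINT x|\<Lambda>. profile (1 - (g x / r k)\<^sup>2) * (indicator \<Omega> x * f x)))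
     \<longlonglongrightarrow> half_ball_vol * surf_int \<Gamma> (\<lambda>x. f x / \<beta> x)"
proof -
  obtain b where b: "0 < b" "b \<le> 1" "\<And>x. x \<in> closure \<Omega> \<Longrightarrow> b \<le> \<beta> x" using \<beta>_lower by blast
  \<comment> \<open>The weight matches both orders: it supplies the factor
    \<open>\<beta> x ^ m\<close> that normalises the flat disc, and it leaves one factor
    \<open>1 / \<beta> y\<close> of the power produced by the half ball.\<close>
  define F where "F x = f x * \<beta> x ^ m" for x
  have contF: "continuous_on (closure \<Omega>) F" unfolding F_def by (intro continuous_intros f cont_\<beta>)
  obtain M where M: "0 < M" "\<And>x. x \<in> closure \<Omega> \<Longrightarrow> norm (F x) \<le> M" using continuous_bounded[OF contF] by blast
  obtain Mf where Mf: "0 < Mf" "\<And>x. x \<in> closure \<Omega> \<Longrightarrow> norm (f x) \<le> Mf" using continuous_bounded[OF f] by blast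
  define F' where "F' x = indicator \<Omega> x * F x" for x
  define f' where "f' x = indicator \<Omega> x * f x" for x
  have [measurable]: "F' \<in> borel_measurable borel" "f' \<in> borel_measurable borel"
    unfolding F'_def f'_def by (intro measurable_indicator_times contF f)+
  have [measurable]: "\<beta> \<in> borel_measurable borel" "g \<in> borel_measurable borel" "profile \<in> borel_measurable borel"
    by (rule borel_measurable_continuous_onI[OF cont_\<beta>] borel_measurable_continuous_onI[OF cont_g]
      borel_measurable_continuous_onI[OF cont_profile])+
  have F'M: "\<bar>F' x\<bar> \<le> M" for x using M closure_eq by (auto simp: F'_def indicator_def)
  have f'M: "\<bar>f' x\<bar> \<le> Mf" for x using Mf closure_eq by (auto simp: f'_def indicator_def)
  define V where "V = measure lborel (ball (0::real^'n) 1)"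
  define h where "h k x y = indicator {z. norm (fst z - snd z) * \<beta> (fst z) < r k} (x, y) * F' x" for k and x y :: "real^'n"
  have hm1: "(\<lambda>z. h k (fst z) (snd z)) \<in> borel_measurable (borel \<Otimes>\<^sub>M borel)" for k
  proof -
    have "open {z::(real^'n)\<times>(real^'n). norm (fst z - snd z) * \<beta> (fst z) < r k}"
      by (intro open_Collect_less continuous_intros continuous_on_compose2[OF cont_\<beta>[of UNIV]]) auto
    then have [measurable]: "{z. norm (fst z - snd z) * \<beta> (fst z) < r k} \<in> sets (borel \<Otimes>\<^sub>M borel)"
      unfolding borel_prod by simp
    show ?thesis unfolding h_def by simp measurable
  qed
  have hm\<Lambda>\<mu>: "case_prod (h k) \<in> borel_measurable (\<Lambda> \<Otimes>\<^sub>M \<mu>)" for k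
    using hm1[of k] by (simp add: measurable_cong_sets[OF sets_pair_measure_cong[OF sets_\<Lambda> sets_\<mu>] refl] case_prod_beta')
  have hm\<mu>\<Lambda>: "(\<lambda>(y, x). h k x y) \<in> borel_measurable (\<mu> \<Otimes>\<^sub>M \<Lambda>)" for k
    using measurable_compose[OF measurable_pair_swap' hm\<Lambda>\<mu>[of k]] by (simp add: split_beta' )
  define A where "A k y = (1 / r k) ^ CARD('n) * (LINT x|\<Lambda>. h k x y)" for k y
  have Am: "A k \<in> borel_measurable \<mu>" for k
    unfolding A_def using \<Lambda>.borel_measurable_lebesgue_integral[OF hm\<mu>\<Lambda>[of k]] by measurable
  have A_eq: "A k y = (1 / r k) ^ CARD('n) * (LINT x|\<Lambda>. indicator {x. norm (x - y) * \<beta> x < r k} x * (indicator \<Omega> x * F x))" for k y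
    by (simp add: A_def h_def F'_def indicator_def)
  \<comment> \<open>Uniform in \<open>y\<close> and \<open>k\<close>: the volume of a ball of radius
    \<open>r k / b\<close> compensates the factor \<open>(1 / r k) ^ CARD('n)\<close>.\<close>
  have A_bound: "\<bar>A k y\<bar> \<le> M * V / b ^ CARD('n)" for k y
  proof -
    have le: "\<bar>h k x y\<bar> \<le> M * indicator (ball y (r k / b)) x" for x
    proof (cases "x \<in> \<Omega> \<and> norm (x - y) * \<beta> x < r k")
      case True
      then have "norm (x - y) * b \<le> norm (x - y) * \<beta> x" using b(3)[of x] closure_eq by (intro mult_left_mono) auto
      then have "norm (x - y) < r k / b" using b True by (simp add: field_simps)
      then show ?thesis using F'M[of x] True by (simp add: h_def dist_norm norm_minus_commute)
    next
      case False then show ?thesis using M(1) by (auto simp: h_def F'_def)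
    qed
    have "\<bar>LINT x|\<Lambda>. h k x y\<bar> \<le> (LINT x|\<Lambda>. \<bar>h k x y\<bar>)" by (rule integral_abs_bound)
    also have "\<dots> \<le> (LINT x|\<Lambda>. M * indicator (ball y (r k / b)) x)"
    proof (rule integral_mono_AE')
      show "integrable \<Lambda> (\<lambda>x. M * indicator (ball y (r k / b)) x)"
        by (intro integrable_mult_right integrable_indicator_\<Lambda>) auto
      show "AE x in \<Lambda>. \<bar>h k x y\<bar> \<le> M * indicator (ball y (r k / b)) x" using le by (intro AE_I2)
    qed (use M(1) in simp)
    also have "\<dots> = M * measure \<Lambda> (ball y (r k / b))" by simp
    also have "measure \<Lambda> (ball y (r k / b)) \<le> measure lborel (ball y (r k / b))"
      unfolding measure_def
      using emeasure_lborel_ball_finite[of y "r k / b"]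
      by (intro enn2real_mono) (simp_all add: emeasure_\<Lambda> emeasure_mono)
    also have "\<dots> = (r k / b) ^ CARD('n) * V"
      using content_ball_conv_unit_ball[of "r k / b" y] r(1)[of k] b by (simp add: V_def)
    finally have "\<bar>LINT x|\<Lambda>. h k x y\<bar> \<le> M * ((r k / b) ^ CARD('n) * V)" using M by (simp add: mult_left_mono)
    then have "(1 / r k) ^ CARD('n) * \<bar>LINT x|\<Lambda>. h k x y\<bar> \<le> (1 / r k) ^ CARD('n) * (M * ((r k / b) ^ CARD('n) * V))"
      using r(1)[of k] by (intro mult_left_mono) auto
    also have "\<dots> = M * V / b ^ CARD('n)" using r(1)[of k] b by (simp add: power_divide field_simps)
    finally show ?thesis using r(1)[of k] by (simp add: A_def abs_mult)
  qed
  define J where "J k = (LINT y|\<mu>. A k y)" for k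
  have cont_lim: "continuous_on \<Gamma> (\<lambda>x. f x / \<beta> x)"
  proof -
    have "\<forall>x\<in>\<Gamma>. \<beta> x \<noteq> 0" using \<beta>_pos[OF frontier_closure] less_irrefl by metis
    then show ?thesis
      by (intro continuous_on_divide continuous_on_subset[OF f] cont_\<beta>) (auto simp: frontier_def)
  qed
  have limm: "(\<lambda>x. indicator \<Gamma> x * (f x / \<beta> x)) \<in> borel_measurable borel"
    using borel_measurable_continuous_on_indicator[OF _ cont_lim] by simp
  have J_lim: "J \<longlonglongrightarrow> half_ball_vol * surf_int \<Gamma> (\<lambda>x. f x / \<beta> x)"
  proof -
    have "J \<longlonglongrightarrow> (LINT y|\<mu>. half_ball_vol * (indicator \<Gamma> y * (f y / \<beta> y)))"
      unfolding J_def
    proof (rule integral_dominated_convergence[where w = "\<lambda>_. M * V / b ^ CARD('n)"])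
      show "(\<lambda>y. half_ball_vol * (indicator \<Gamma> y * (f y / \<beta> y))) \<in> borel_measurable \<mu>"
        using limm by measurable
      show "AE y in \<mu>. (\<lambda>k. A k y) \<longlonglongrightarrow> half_ball_vol * (indicator \<Gamma> y * (f y / \<beta> y))"
        using AE_\<mu>
      proof eventually_elim
        case (elim y)
        have "(\<lambda>k. A k y) \<longlonglongrightarrow> measure lborel (ball (0::real^'n) 1) / 2 * F y / \<beta> y ^ CARD('n)"
          unfolding A_eq by (rule frontier_blowup[OF contF elim r])
        also have "measure lborel (ball (0::real^'n) 1) / 2 * F y / \<beta> y ^ CARD('n) = half_ball_vol * (indicator \<Gamma> y * (f y / \<beta> y))"
          using \<beta>_pos[OF frontier_closure[OF elim]] elim by (simp add: half_ball_vol_def F_def card_m)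
        finally show ?case .
      qed
    qed (use Am A_bound in auto)
    then show ?thesis by (simp only: surf_int_eq[OF cont_lim] integral_mult_right_zero)
  qed
  define P where "P k x = profile (1 - (g x / r k)\<^sup>2)" for k x
  define Q where "Q k x = (LINT y|\<mu>. h k x y)" for k x
  have Qm [measurable]: "Q k \<in> borel_measurable \<Lambda>" for k
    unfolding Q_def using \<mu>.borel_measurable_lebesgue_integral[OF hm\<Lambda>\<mu>[of k]] by simp
  have Q_eq: "Q k x = F' x * hmr (ball x (r k / \<beta> x))" if "x \<in> \<Omega>" for k x
  proof -
    have "0 < \<beta> x" using that closure_eq \<beta>_pos by auto
    then have "h k x y = F' x * indicator (ball x (r k / \<beta> x)) y" for y
      by (auto simp: h_def indicator_def dist_norm field_simps)
    then show ?thesis using hmr_nonneg by (simp add: Q_def measure_def emeasure_\<mu>)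
  qed
  have J_eq: "J k = (1 / r k) ^ CARD('n) * (LINT x|\<Lambda>. Q k x)" for k
  proof -
    have "finite_measure (\<Lambda> \<Otimes>\<^sub>M \<mu>)"
      by (rule finite_measure_pair_measure) unfold_locales
    then have "integrable (\<Lambda> \<Otimes>\<^sub>M \<mu>) (case_prod (h k))"
      by (rule finite_measure.integrable_const_bound[where B = M])
        (use hm\<Lambda>\<mu> F'M M in \<open>auto simp: h_def indicator_def\<close>)
    from \<Lambda>\<mu>.Fubini_integral[OF this] show ?thesis unfolding J_def A_def Q_def by simp
  qed
  obtain L where L: "0 < L" and
    asym: "\<And>e. 0 < e \<Longrightarrow> \<exists>r0>0. \<forall>r x. 0 < r \<longrightarrow> r \<le> r0 \<longrightarrow> x \<in> \<Omega> \<longrightarrow> 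
       \<bar>(\<beta> x / r) ^ m * hmr (ball x (r / \<beta> x)) - profile (1 - (g x / r)\<^sup>2)\<bar> \<le> e \<and>
       ((\<forall>p\<in>\<Gamma>. L * r < norm (x - p)) \<longrightarrow> hmr (ball x (r / \<beta> x)) = 0 \<and> profile (1 - (g x / r)\<^sup>2) = 0)"
    using hmr_asymptotics by blast
  obtain C r1 where C: "0 \<le> C" "0 < r1" "\<And>r. 0 < r \<Longrightarrow> r \<le> r1 \<Longrightarrow> measure \<Lambda> {x. infdist x \<Gamma> \<le> r} \<le> C * r"
    using layer_volume by blast
  have diff0: "(\<lambda>k. J k - (1 / r k) * (LINT x|\<Lambda>. P k x * f' x)) \<longlonglongrightarrow> 0"
  proof (rule LIMSEQ_I)
    fix e :: real assume e: "0 < e"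
    \<comment> \<open>The pointwise error \<open>Mf * d / r k\<close> lives on a layer of volume at
      most \<open>C * L * r k\<close>. \<open>S\<close> dominates the resulting constant and is kept
      positive.\<close>
    define S where "S = Mf * (C + 1) * L + 1"
    have S: "0 < S" using Mf C L by (auto simp: S_def intro!: add_nonneg_pos)
    define d where "d = e / S / 2"
    have d: "0 < d" using e S by (simp add: d_def)
    obtain r0 where r0: "0 < r0" "\<And>r x. 0 < r \<Longrightarrow> r \<le> r0 \<Longrightarrow> x \<in> \<Omega> \<Longrightarrow> 
       \<bar>(\<beta> x / r) ^ m * hmr (ball x (r / \<beta> x)) - profile (1 - (g x / r)\<^sup>2)\<bar> \<le> d \<and>
       ((\<forall>p\<in>\<Gamma>. L * r < norm (x - p)) \<longrightarrow> hmr (ball x (r / \<beta> x)) = 0 \<and> profile (1 - (g x / r)\<^sup>2) = 0)"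
      using asym[OF d] by blast
    have "\<forall>\<^sub>F k in sequentially. r k < min r0 (r1 / L)"
      using r0 C L by (intro order_tendstoD(2)[OF r(2)]) auto
    then have "\<forall>\<^sub>F k in sequentially. norm (J k - (1 / r k) * (LINT x|\<Lambda>. P k x * f' x) - 0) < e"
    proof eventually_elim
      case (elim k)
      then have rk: "0 < r k" "r k \<le> r0" "L * r k \<le> r1" using r(1)[of k] L by (auto simp: field_simps)
      define layer where "layer = {x. infdist x \<Gamma> \<le> L * r k}"
      have [measurable]: "layer \<in> sets borel"
        unfolding layer_def by (intro borel_closed closed_Collect_le continuous_intros)
      define D where "D x = (1 / r k) ^ CARD('n) * Q k x - (1 / r k) * (P k x * f' x)" for x
      have D_bound: "\<bar>D x\<bar> \<le> (1 / r k) * Mf * d * indicator layer x" if x: "x \<in> \<Omega>" for x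
      proof -
        have \<beta>x: "0 < \<beta> x" using x closure_eq \<beta>_pos by auto
        define X where "X = (\<beta> x / r k) ^ m * hmr (ball x (r k / \<beta> x)) - P k x"
        have D_eq: "D x = (1 / r k) * f' x * X"
          using rk by (simp add: D_def Q_eq[OF x] X_def F'_def f'_def F_def card_m power_divide field_simps)
        have X: "\<bar>X\<bar> \<le> d" "(\<forall>p\<in>\<Gamma>. L * r k < norm (x - p)) \<Longrightarrow> X = 0"
          using r0(2)[OF rk(1,2) x] by (auto simp: X_def P_def)
        show ?thesis
        proof (cases "x \<in> layer")
          case True
          have "\<bar>D x\<bar> = (1 / r k) * (\<bar>f' x\<bar> * \<bar>X\<bar>)" using rk by (simp add: D_eq abs_mult)
          also have "\<dots> \<le> (1 / r k) * (Mf * d)"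
            using f'M[of x] X Mf rk by (intro mult_left_mono mult_mono) auto
          finally show ?thesis using True by simp
        next
          case False
          have "L * r k < norm (x - p)" if "p \<in> \<Gamma>" for p
            using False infdist_le[OF that, of x] by (simp add: layer_def dist_norm)
          then have "X = 0" using X by blast
          then show ?thesis using False by (simp add: D_eq)
        qed
      qed
      have intQ: "integrable \<Lambda> (Q k)"
      proof (rule \<Lambda>.integrable_const_bound[where B = "M * hmr UNIV"])
        show "AE x in \<Lambda>. norm (Q k x) \<le> M * hmr UNIV"
          using AE_\<Lambda>
        proof eventually_elim
          case (elim x)
          have "hmr (ball x (r k / \<beta> x)) \<le> hmr UNIV"
          proof -
            have "ennreal (hmr (ball x (r k / \<beta> x))) \<le> ennreal (hmr UNIV)"
              unfolding hm_eq_hmr[symmetric] by (rule hm_mono) auto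
            then show ?thesis by (simp add: hmr_nonneg)
          qed
          then show ?case using F'M[of x] M hmr_nonneg by (simp add: Q_eq[OF elim] abs_mult mult_mono)
        qed
      qed simp
      have Pb: "\<bar>P k x\<bar> \<le> profile 1" for x
        using profile_nonneg profile_mono[of "1 - (g x / r k)\<^sup>2" 1] by (simp add: P_def)
      have intP: "integrable \<Lambda> (\<lambda>x. P k x * f' x)"
      proof (rule \<Lambda>.integrable_const_bound[where B = "profile 1 * Mf"])
        show "AE x in \<Lambda>. norm (P k x * f' x) \<le> profile 1 * Mf"
          using Pb f'M profile_nonneg by (intro AE_I2) (simp add: abs_mult mult_mono)
      qed (unfold P_def, measurable)
      have "J k - (1 / r k) * (LINT x|\<Lambda>. P k x * f' x) = integral\<^sup>L \<Lambda> D"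
        unfolding D_def J_eq using intQ intP by (simp add: Bochner_Integration.integral_diff)
      also have "\<bar>\<dots>\<bar> \<le> (LINT x|\<Lambda>. \<bar>D x\<bar>)" by (rule integral_abs_bound)
      also have "\<dots> \<le> (LINT x|\<Lambda>. (1 / r k) * Mf * d * indicator layer x)"
      proof (rule integral_mono_AE')
        show "integrable \<Lambda> (\<lambda>x. 1 / r k * Mf * d * indicator layer x)"
          by (intro integrable_mult_right integrable_indicator_\<Lambda>) auto
        show "AE x in \<Lambda>. \<bar>D x\<bar> \<le> 1 / r k * Mf * d * indicator layer x"
          using AE_\<Lambda> by eventually_elim (rule D_bound)
      qed (use Mf d rk in simp)
      also have "\<dots> = (1 / r k) * Mf * d * measure \<Lambda> layer" by simp
      also have "\<dots> \<le> (1 / r k) * Mf * d * (C * (L * r k))"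
        unfolding layer_def using C(3)[of "L * r k"] rk L Mf d by (intro mult_left_mono) auto
      also have "\<dots> = d * (Mf * C * L)" using rk by simp
      also have "\<dots> \<le> d * S"
        using d Mf L C by (intro mult_left_mono) (auto simp: S_def algebra_simps)
      also have "\<dots> = e / 2" using S by (simp add: d_def)
      also have "\<dots> < e" using e by simp
      finally show ?case by simp
    qed
    then show "\<exists>no. \<forall>k\<ge>no. norm (J k - (1 / r k) * (LINT x|\<Lambda>. P k x * f' x) - 0) < e"
      by (simp add: eventually_sequentially)
  qed
  from tendsto_diff[OF J_lim diff0] show ?thesis by (simp add: P_def f'_def)
qed

end

section \<open>Integration by parts with compact support\<close>

text \<open>Differentiability of \<open>Df\<close> at the single point \<open>x\<close> is enough:
  the second difference of \<open>f\<close> along \<open>a\<close> and \<open>b\<close> is symmetric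
  in the two directions, and by the mean value theorem it approximates
  \<open>t^2 * ((A *v b) \<bullet> a)\<close> up to an arbitrarily small multiple of
  \<open>t^2\<close>.\<close>

lemma second_derivative_symmetric:
  fixes f :: "real^'n::finite \<Rightarrow> real" and A :: "real^'n^'n"
  assumes f: "\<And>y. y \<in> U \<Longrightarrow> (f has_derivative (\<lambda>h. Df y \<bullet> h)) (at y)" and U: "open U" "x \<in> U"
    and A: "(Df has_derivative (\<lambda>h. A *v h)) (at x)"
  shows "transpose A = A"
proof -
  have key: "(A *v b) \<bullet> a = (A *v a) \<bullet> b" for a b
  proof (rule ccontr)
    assume neq: "(A *v b) \<bullet> a \<noteq> (A *v a) \<bullet> b"
    define c where "c = norm a + norm b"
    define D where "D = \<bar>(A *v b) \<bullet> a - (A *v a) \<bullet> b\<bar>"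
    have D: "0 < D" using neq by (simp add: D_def)
    have c: "0 < c"
    proof -
      have "a \<noteq> 0" using neq by auto
      then show ?thesis by (simp add: c_def add_pos_nonneg)
    qed
    \<comment> \<open>With this choice the two errors add up to half of \<open>t^2 * D\<close>,
      which is the contradiction.\<close>
    define \<epsilon> where "\<epsilon> = D / (8 * c * c)"
    have \<epsilon>: "0 < \<epsilon>" using D c by (simp add: \<epsilon>_def)
    obtain d1 where d1: "0 < d1" "\<And>v. norm v < d1 \<Longrightarrow> norm (Df (x + v) - Df x - A *v v) \<le> \<epsilon> * norm v"
      using has_derivative_at_alt[THEN iffD1, OF A] \<epsilon> by (metis add_diff_cancel_left')
    obtain d2 where d2: "0 < d2" "ball x d2 \<subseteq> U" using U open_contains_ball by blast
    define t where "t = min d1 d2 / (2 * c)"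
    have t: "0 < t" "t * c < d1" "t * c < d2" using d1 d2 c by (auto simp: t_def min_def field_simps)
    \<comment> \<open>The unordered pair \<open>{a', b'} = {a, b}\<close> lets one estimate serve
      for both orders of the directions.\<close>
    have small: "norm (s *\<^sub>R a' + s' *\<^sub>R b') \<le> t * c" if "{a', b'} = {a, b}" "0 \<le> s" "s \<le> t" "0 \<le> s'" "s' \<le> t" for s s' a' b'
    proof -
      have "norm (s *\<^sub>R a' + s' *\<^sub>R b') \<le> s * norm a' + s' * norm b'"
        using norm_triangle_ineq[of "s *\<^sub>R a'" "s' *\<^sub>R b'"] that by simp
      also have "\<dots> \<le> t * norm a' + t * norm b'" using that by (intro add_mono mult_right_mono) auto
      also have "\<dots> = t * c" using that(1) by (auto simp: c_def doubleton_eq_iff algebra_simps)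
      finally show ?thesis .
    qed
    have est: "\<bar>f (x + t *\<^sub>R a' + t *\<^sub>R b') - f (x + t *\<^sub>R a') - f (x + t *\<^sub>R b') + f x - t\<^sup>2 * ((A *v b') \<bullet> a')\<bar> \<le> 2 * \<epsilon> * c * c * t\<^sup>2"
      if ab: "{a', b'} = {a, b}" for a' b'
    proof -
      define \<phi> where "\<phi> s = f (x + (s *\<^sub>R a' + t *\<^sub>R b')) - f (x + (s *\<^sub>R a' + 0 *\<^sub>R b'))" for s
      define \<phi>' where "\<phi>' s = (Df (x + (s *\<^sub>R a' + t *\<^sub>R b')) - Df (x + (s *\<^sub>R a' + 0 *\<^sub>R b'))) \<bullet> a'" for s
      have inU: "x + (s *\<^sub>R a' + s' *\<^sub>R b') \<in> U" if "0 \<le> s" "s \<le> t" "0 \<le> s'" "s' \<le> t" for s s'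
      proof -
        have "norm (s *\<^sub>R a' + s' *\<^sub>R b') < d2" using small[OF ab that] t by linarith
        then have "x + (s *\<^sub>R a' + s' *\<^sub>R b') \<in> ball x d2" by (metis add_diff_cancel_left' dist_commute dist_norm mem_ball)
        then show ?thesis using d2(2) by blast
      qed
      have der: "(\<phi> has_real_derivative \<phi>' s) (at s)" if s: "0 \<le> s" "s \<le> t" for s
      proof -
        have 1: "((\<lambda>s. f (x + (s *\<^sub>R a' + s' *\<^sub>R b'))) has_derivative (\<lambda>h. Df (x + (s *\<^sub>R a' + s' *\<^sub>R b')) \<bullet> (h *\<^sub>R a'))) (at s)"
          if "0 \<le> s'" "s' \<le> t" for s'
          by (rule has_derivative_compose[of "\<lambda>s. x + (s *\<^sub>R a' + s' *\<^sub>R b')" "\<lambda>h. h *\<^sub>R a'" s UNIV, OF _ f[OF inU[OF s that]]])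
            (auto intro!: derivative_eq_intros)
        show ?thesis
          unfolding \<phi>_def has_field_derivative_def
          by (rule has_derivative_eq_rhs[OF has_derivative_diff[OF 1 1]])
            (use t in \<open>auto simp: \<phi>'_def inner_diff_left algebra_simps\<close>)
      qed
      obtain s where s: "0 < s" "s < t" "\<phi> t - \<phi> 0 = (t - 0) * \<phi>' s"
        using MVT2[of 0 t \<phi> \<phi>'] der t(1) by auto
      define v1 where "v1 = s *\<^sub>R a' + t *\<^sub>R b'"
      define v2 where "v2 = s *\<^sub>R a' + 0 *\<^sub>R b'"
      have n1: "norm v1 \<le> t * c" and n2: "norm v2 \<le> t * c" 
        unfolding v1_def v2_def using s t by (intro small[OF ab]; simp)+
      have e1: "norm (Df (x + v1) - Df x - A *v v1) \<le> \<epsilon> * (t * c)"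
        by (rule order_trans[OF d1(2) mult_left_mono[OF n1]]) (use n1 t \<epsilon> in auto)
      have e2: "norm (Df (x + v2) - Df x - A *v v2) \<le> \<epsilon> * (t * c)"
        by (rule order_trans[OF d1(2) mult_left_mono[OF n2]]) (use n2 t \<epsilon> in auto)
      have diff: "A *v v1 - A *v v2 = t *\<^sub>R (A *v b')"
        by (simp add: v1_def v2_def matrix_vector_right_distrib matrix_vector_mult_scaleR)
      have "norm (Df (x + v1) - Df (x + v2) - t *\<^sub>R (A *v b')) \<le> 2 * \<epsilon> * (t * c)"
      proof -
        have "norm (Df (x + v1) - Df (x + v2) - t *\<^sub>R (A *v b')) = norm ((Df (x + v1) - Df x - A *v v1) - (Df (x + v2) - Df x - A *v v2))"
          unfolding diff[symmetric] by (rule arg_cong[of _ _ norm]) (simp add: algebra_simps)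
        also have "\<dots> \<le> norm (Df (x + v1) - Df x - A *v v1) + norm (Df (x + v2) - Df x - A *v v2)"
          by (rule norm_triangle_ineq4)
        finally show ?thesis using e1 e2 by linarith
      qed
      then have "\<bar>(Df (x + v1) - Df (x + v2) - t *\<^sub>R (A *v b')) \<bullet> a'\<bar> \<le> 2 * \<epsilon> * (t * c) * norm a'"
        by (intro order_trans[OF Cauchy_Schwarz_ineq2] mult_right_mono) auto
      also have "\<dots> \<le> 2 * \<epsilon> * (t * c) * c"
        using ab t c \<epsilon> by (intro mult_left_mono) (auto simp: c_def doubleton_eq_iff)
      finally have "\<bar>\<phi>' s - t * ((A *v b') \<bullet> a')\<bar> \<le> 2 * \<epsilon> * (t * c) * c"
        by (simp add: \<phi>'_def v1_def v2_def inner_diff_left)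
      then have "t * \<bar>\<phi>' s - t * ((A *v b') \<bullet> a')\<bar> \<le> t * (2 * \<epsilon> * (t * c) * c)"
        using t by (intro mult_left_mono) auto
      moreover have "t * \<bar>\<phi>' s - t * ((A *v b') \<bullet> a')\<bar> = \<bar>t * (\<phi>' s - t * ((A *v b') \<bullet> a'))\<bar>"
        using t by (simp add: abs_mult)
      ultimately have "\<bar>(\<phi> t - \<phi> 0) - t\<^sup>2 * ((A *v b') \<bullet> a')\<bar> \<le> 2 * \<epsilon> * c * c * t\<^sup>2"
        using s(3) by (simp add: power2_eq_square algebra_simps)
      then show ?thesis by (simp add: \<phi>_def algebra_simps)
    qed
    have "\<bar>t\<^sup>2 * ((A *v b) \<bullet> a) - t\<^sup>2 * ((A *v a) \<bullet> b)\<bar> \<le> 4 * \<epsilon> * c * c * t\<^sup>2"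
      using est[of a b] est[of b a] by (auto simp: add_ac insert_commute abs_le_iff)
    then have "t\<^sup>2 * D \<le> 4 * \<epsilon> * c * c * t\<^sup>2"
      unfolding D_def using abs_mult[of "t\<^sup>2" "(A *v b) \<bullet> a - (A *v a) \<bullet> b"] by (simp add: right_diff_distrib)
    also have "\<dots> = t\<^sup>2 * (D / 2)" using c by (simp add: \<epsilon>_def)
    finally show False using t D by simp
  qed
  have "A $ i $ j = A $ j $ i" for i j
    using key[of "axis j 1" "axis i 1"]
    by (simp add: inner_axis matrix_vector_mul_component row_def)
  then show ?thesis by (simp add: transpose_def vec_eq_iff)
qed

section \<open>C^1 functions with compact support\<close>

definition C1_compact :: "'a::euclidean_space set \<Rightarrow> ('a \<Rightarrow> real) \<Rightarrow> ('a \<Rightarrow> 'a) \<Rightarrow> bool" where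
  "C1_compact U f Df \<longleftrightarrow> (\<forall>x. (f has_derivative (\<lambda>h. Df x \<bullet> h)) (at x)) \<and> continuous_on UNIV Df \<and>
     (\<exists>K. compact K \<and> K \<subseteq> U \<and> (\<forall>x. x \<notin> K \<longrightarrow> f x = 0))"

lemma C1_compact_mono: "C1_compact U f Df \<Longrightarrow> U \<subseteq> V \<Longrightarrow> C1_compact V f Df"
  unfolding C1_compact_def by blast

lemma C1_compactE:
  assumes "C1_compact U f Df"
  obtains K B where "compact K" "K \<subseteq> U" "\<And>x. x \<notin> K \<Longrightarrow> f x = 0" "\<And>x. x \<notin> K \<Longrightarrow> Df x = 0"
    "0 \<le> B" "\<And>x. norm (Df x) \<le> B" "\<And>x. \<bar>f x\<bar> \<le> B" "\<And>x y. \<bar>f x - f y\<bar> \<le> B * norm (x - y)"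
proof -
  obtain K where K: "compact K" "K \<subseteq> U" "\<And>x. x \<notin> K \<Longrightarrow> f x = 0" using assms by (auto simp: C1_compact_def)
  have d: "(f has_derivative (\<lambda>h. Df x \<bullet> h)) (at x)" for x using assms by (simp add: C1_compact_def)
  have cf: "continuous_on UNIV f" using has_derivative_continuous[OF d] by (simp add: continuous_at_imp_continuous_on)
  have Df0: "Df x = 0" if "x \<notin> K" for x
  proof (rule has_derivative_inner_unique[OF d])
    have "((\<lambda>_. 0) has_derivative (\<lambda>h. 0 \<bullet> h)) (at x)" by simp
    then show "(f has_derivative (\<lambda>h. 0 \<bullet> h)) (at x)"
      by (rule has_derivative_transform_within_open[OF _ open_Compl[OF compact_imp_closed[OF K(1)]]]) (use that K in auto)
  qed
  have "bounded (Df ` K)" "bounded (f ` K)"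
    using assms cf by (auto intro!: compact_imp_bounded compact_continuous_image K(1)
        intro: continuous_on_subset simp: C1_compact_def)
  then obtain B1 B2 where B: "\<And>x. x \<in> K \<Longrightarrow> norm (Df x) \<le> B1" "\<And>x. x \<in> K \<Longrightarrow> norm (f x) \<le> B2"
    by (auto simp: bounded_iff)
  define B where "B = max 0 (max B1 B2)"
  have BDf: "norm (Df x) \<le> B" for x using B(1)[of x] Df0[of x] by (cases "x \<in> K") (auto simp: B_def)
  have lip: "\<bar>f x - f y\<bar> \<le> B * norm (x - y)" for x y
  proof -
    have "norm (f x - f y) \<le> B * norm (x - y)"
    proof (rule differentiable_bound[where S = UNIV and f' = "\<lambda>x h. Df x \<bullet> h"])
      fix x
      have "norm (Df x \<bullet> h) \<le> B * norm h" for h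
        using Cauchy_Schwarz_ineq2[of "Df x" h] mult_right_mono[OF BDf[of x], of "norm h"] by simp
      then show "onorm ((\<bullet>) (Df x)) \<le> B" by (rule onorm_le)
    qed (use d in auto)
    then show ?thesis by simp
  qed
  have Bf: "\<bar>f x\<bar> \<le> B" for x using B(2)[of x] K(3)[of x] by (cases "x \<in> K") (auto simp: B_def)
  have B0: "0 \<le> B" unfolding B_def by simp
  show ?thesis by (rule that[OF K Df0 B0 BDf Bf lip])
qed

text \<open>\<open>f\<close> is arbitrary off \<open>U\<close>; the product vanishes outside a
  compact subset of \<open>U\<close> because \<open>c\<close> does, so the two local descriptions
  glue.\<close>

lemma C1_compact_mult:
  assumes c: "C1_compact U c Dc" and U: "open U"
    and f: "\<And>x. x \<in> U \<Longrightarrow> (f has_derivative (\<lambda>h. Df x \<bullet> h)) (at x)" and Df: "continuous_on U Df"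
  shows "C1_compact U (\<lambda>x. c x * f x) (\<lambda>x. if x \<in> U then c x *\<^sub>R Df x + f x *\<^sub>R Dc x else 0)"
proof -
  obtain K where K: "compact K" "K \<subseteq> U" "\<And>x. x \<notin> K \<Longrightarrow> c x = 0" "\<And>x. x \<notin> K \<Longrightarrow> Dc x = 0"
    by (rule C1_compactE[OF c]) (rule that, assumption+)
  have dc: "(c has_derivative (\<lambda>h. Dc x \<bullet> h)) (at x)" and contDc: "continuous_on S Dc" for x S
    using c by (auto simp: C1_compact_def intro: continuous_on_subset)
  let ?D = "\<lambda>x. if x \<in> U then c x *\<^sub>R Df x + f x *\<^sub>R Dc x else 0"
  have opK: "open (- K)" using K(1) by (simp add: compact_imp_closed open_Compl)
  have D0: "?D x = 0" if "x \<notin> K" for x using K(3,4)[OF that] by simp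
  have "((\<lambda>x. c x * f x) has_derivative (\<lambda>h. ?D x \<bullet> h)) (at x)" for x
  proof (cases "x \<in> U")
    case True
    show ?thesis by (rule has_derivative_eq_rhs[OF has_derivative_mult[OF dc f[OF True]]])
       (simp add: fun_eq_iff inner_add_left True mult.commute)
  next
    case False
    then have xK: "x \<in> - K" using K(2) by blast
    have "((\<lambda>_. 0) has_derivative (\<lambda>h. ?D x \<bullet> h)) (at x)" using False by simp
    then show ?thesis
      by (rule has_derivative_transform_within_open[OF _ opK xK]) (use K(3) in auto)
  qed
  moreover have "continuous_on UNIV ?D"
  proof -
    have "continuous_on U (\<lambda>x. c x *\<^sub>R Df x + f x *\<^sub>R Dc x)"
      using dc f by (intro continuous_intros Df contDc continuous_at_imp_continuous_on ballI has_derivative_continuous) auto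
    then have "continuous_on U ?D" by (rule continuous_on_eq) simp
    moreover have "continuous_on (- K) ?D"
      by (rule continuous_on_eq[OF continuous_on_const[of _ 0]]) (use D0 in auto)
    ultimately have "continuous_on (U \<union> - K) ?D" using U opK by (rule continuous_on_open_Un[rotated 2])
    moreover have "U \<union> - K = UNIV" using K(2) by auto
    ultimately show ?thesis by simp
  qed
  ultimately show ?thesis unfolding C1_compact_def using K(1-3) by auto
qed

lemma integrable_compact_support:
  fixes f :: "'a::euclidean_space \<Rightarrow> real"
  assumes "continuous_on UNIV f" "compact K" "\<And>x. x \<notin> K \<Longrightarrow> f x = 0"
  shows "integrable lborel f"
proof -
  have "integrable lborel (\<lambda>x. indicator K x *\<^sub>R f x)"
    using borel_integrable_compact[OF assms(2) continuous_on_subset[OF assms(1)]] by (simp add: set_integrable_def)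
  moreover have "(\<lambda>x. indicator K x *\<^sub>R f x) = f" using assms(3) by (auto simp: indicator_def fun_eq_iff)
  ultimately show ?thesis by simp
qed

lemma lborel_integral_translation:
  fixes f :: "'a::euclidean_space \<Rightarrow> real"
  assumes "f \<in> borel_measurable borel"
  shows "(LINT x|lborel. f (x + t)) = integral\<^sup>L lborel f"
  using lborel_integral_affine[OF assms, of 1 t] by (simp add: add.commute)

lemma has_derivative_difference_quotient:
  fixes f :: "'a::euclidean_space \<Rightarrow> real"
  assumes f: "(f has_derivative (\<lambda>h. Df \<bullet> h)) (at x)" and t: "\<And>k. t k \<noteq> 0" "t \<longlonglongrightarrow> 0"
  shows "(\<lambda>k. (f (x + t k *\<^sub>R e) - f x) / t k) \<longlonglongrightarrow> Df \<bullet> e"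
proof -
  have "((\<lambda>s. f (x + s *\<^sub>R e)) has_derivative (\<lambda>s. Df \<bullet> (s *\<^sub>R e))) (at 0)"
    by (rule has_derivative_compose[where f = "\<lambda>s. x + s *\<^sub>R e" and g = f])
      (use f in \<open>auto intro!: derivative_eq_intros\<close>)
  then have "((\<lambda>s. f (x + s *\<^sub>R e)) has_real_derivative (Df \<bullet> e)) (at 0)"
    unfolding has_field_derivative_def by (rule has_derivative_eq_rhs) (simp add: fun_eq_iff)
  then have "(\<lambda>s. (f (x + s *\<^sub>R e) - f x) / s) \<midarrow>0\<rightarrow> Df \<bullet> e" by (simp add: DERIV_def)
  moreover have "filterlim t (at 0) sequentially" using t by (simp add: filterlim_at)
  ultimately show ?thesis by (rule filterlim_compose)
qed

text \<open>Translation invariance makes the integral of every difference quotient zero, and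
  dominated convergence passes to the derivative.\<close>

lemma integral_derivative_zero:
  assumes f: "C1_compact UNIV f Df"
  shows "(LINT x|lborel. Df x \<bullet> e) = 0"
proof -
  obtain K B where K: "compact K" "\<And>x. x \<notin> K \<Longrightarrow> f x = 0" "\<And>x. x \<notin> K \<Longrightarrow> Df x = 0"
    "0 \<le> B" "\<And>x y. \<bar>f x - f y\<bar> \<le> B * norm (x - y)"
    by (rule C1_compactE[OF f]) (rule that, assumption+)
  have d: "(f has_derivative (\<lambda>h. Df x \<bullet> h)) (at x)" for x using f by (simp add: C1_compact_def)
  have cf: "continuous_on UNIV f" using has_derivative_continuous[OF d] by (simp add: continuous_at_imp_continuous_on)
  have cDf: "continuous_on UNIV Df" using f by (simp add: C1_compact_def)
  have [measurable]: "f \<in> borel_measurable borel" "Df \<in> borel_measurable borel"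
    by (rule borel_measurable_continuous_onI[OF cf] borel_measurable_continuous_onI[OF cDf])+
  have intf: "integrable lborel f" by (rule integrable_compact_support[OF cf K(1,2)])
  define t where "t k = 1 / real (Suc k)" for k
  have t: "t k \<noteq> 0" "0 < t k" "t k \<le> 1" for k by (auto simp: t_def)
  have t0: "t \<longlonglongrightarrow> 0" unfolding t_def by (rule LIMSEQ_inverse_real_of_nat[unfolded inverse_eq_divide])
  obtain S where S: "\<And>x. x \<in> K \<Longrightarrow> norm x \<le> S" using compact_imp_bounded[OF K(1)] by (auto simp: bounded_iff)
  have "(\<lambda>k. LINT x|lborel. (f (x + t k *\<^sub>R e) - f x) / t k) \<longlonglongrightarrow> (LINT x|lborel. Df x \<bullet> e)"
  \<comment> \<open>All steps \<open>t k\<close> are at most 1, so this ball contains the supports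
    of \<open>f\<close> and of its translates.\<close>
  proof (rule integral_dominated_convergence[where w = "\<lambda>x. B * norm e * indicator (cball 0 (S + norm e)) x"])
    show "integrable lborel (\<lambda>x::'a. B * norm e * indicator (cball 0 (S + norm e)) x)"
      by (intro integrable_mult_right integrable_real_indicator emeasure_lborel_cball_finite) auto
    show "AE x in lborel. (\<lambda>k. (f (x + t k *\<^sub>R e) - f x) / t k) \<longlonglongrightarrow> Df x \<bullet> e"
      by (intro AE_I2 has_derivative_difference_quotient d t t0)
    show "AE x in lborel. norm ((f (x + t k *\<^sub>R e) - f x) / t k) \<le> B * norm e * indicator (cball 0 (S + norm e)) x" for k
    proof (rule AE_I2)
      fix x
      show "norm ((f (x + t k *\<^sub>R e) - f x) / t k) \<le> B * norm e * indicator (cball 0 (S + norm e)) x"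
      proof (cases "norm x \<le> S + norm e")
        case True
        have "\<bar>f (x + t k *\<^sub>R e) - f x\<bar> \<le> B * (t k * norm e)" using K(5)[of "x + t k *\<^sub>R e" x] t(2)[of k] by simp
        then show ?thesis using True t(2)[of k] by (simp add: field_simps)
      next
        case False
        have "norm x \<le> norm (x + t k *\<^sub>R e) + t k * norm e"
          using norm_triangle_ineq4[of "x + t k *\<^sub>R e" "t k *\<^sub>R e"] t(2)[of k] by simp
        moreover have "t k * norm e \<le> norm e" using t[of k] by (simp add: mult_left_le_one_le)
        ultimately have "S < norm (x + t k *\<^sub>R e)" using False by linarith
        then have "f (x + t k *\<^sub>R e) = 0" using S[of "x + t k *\<^sub>R e"] K(2) by force
        moreover have "S < norm x" using False norm_ge_zero[of e] by linarith
        then have "f x = 0" using S[of x] K(2) by force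
        ultimately show ?thesis using K(4) by simp
      qed
    qed
  qed measurable
  moreover have "(LINT x|lborel. (f (x + t k *\<^sub>R e) - f x) / t k) = 0" for k
  proof -
    have "integrable lborel (\<lambda>x. f (x + t k *\<^sub>R e))"
    proof (rule integrable_compact_support)
      show "continuous_on UNIV (\<lambda>x. f (x + t k *\<^sub>R e))"
        by (intro continuous_on_compose2[OF cf] continuous_intros) auto
      show "compact ((\<lambda>y. y - t k *\<^sub>R e) ` K)" by (intro compact_continuous_image continuous_intros K(1))
      show "f (x + t k *\<^sub>R e) = 0" if "x \<notin> (\<lambda>y. y - t k *\<^sub>R e) ` K" for x
        using that by (intro K(2)) (metis add_diff_cancel_right' imageI)
    qed
    then have "(LINT x|lborel. f (x + t k *\<^sub>R e) - f x) = 0"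
      using intf lborel_integral_translation[of f "t k *\<^sub>R e"] by simp
    then show ?thesis by simp
  qed
  ultimately have "(\<lambda>k. 0) \<longlonglongrightarrow> (LINT x|lborel. Df x \<bullet> e)" by (simp only:)
  from LIMSEQ_unique[OF this tendsto_const] show ?thesis .
qed

lemma integral_by_parts_compact:
  assumes f: "C1_compact UNIV f Df" and g: "C1_compact UNIV g Dg"
  shows "(LINT x|lborel. (Df x \<bullet> e) * g x) = - (LINT x|lborel. f x * (Dg x \<bullet> e))"
proof -
  have fg: "C1_compact UNIV (\<lambda>x. f x * g x) (\<lambda>x. if x \<in> UNIV then f x *\<^sub>R Dg x + g x *\<^sub>R Df x else 0)"
    using g by (intro C1_compact_mult[OF f]) (auto simp: C1_compact_def)
  obtain K where K: "compact K" "\<And>x. x \<notin> K \<Longrightarrow> f x = 0" "\<And>x. x \<notin> K \<Longrightarrow> Df x = 0"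
    by (rule C1_compactE[OF f]) (rule that, assumption+)
  have cf: "continuous_on UNIV f" "continuous_on UNIV g"
    using f g has_derivative_continuous by (auto simp: C1_compact_def intro!: continuous_at_imp_continuous_on) blast+
  have cD: "continuous_on UNIV Df" "continuous_on UNIV Dg" using f g by (auto simp: C1_compact_def)
  have i1: "integrable lborel (\<lambda>x. (Df x \<bullet> e) * g x)"
    by (rule integrable_compact_support[OF _ K(1)]) (use K cf cD in \<open>auto intro!: continuous_intros\<close>)
  have i2: "integrable lborel (\<lambda>x. f x * (Dg x \<bullet> e))"
    by (rule integrable_compact_support[OF _ K(1)]) (use K cf cD in \<open>auto intro!: continuous_intros\<close>)
  have "0 = (LINT x|lborel. (f x *\<^sub>R Dg x + g x *\<^sub>R Df x) \<bullet> e)"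
    using integral_derivative_zero[OF fg, of e] by simp
  also have "\<dots> = (LINT x|lborel. (Df x \<bullet> e) * g x + f x * (Dg x \<bullet> e))"
    by (intro Bochner_Integration.integral_cong) (auto simp: inner_add_left)
  also have "\<dots> = (LINT x|lborel. (Df x \<bullet> e) * g x) + (LINT x|lborel. f x * (Dg x \<bullet> e))"
    by (rule Bochner_Integration.integral_add[OF i1 i2])
  finally show ?thesis by simp
qed

lemma C1_compact_translate:
  assumes "C1_compact UNIV f Df" shows "C1_compact UNIV (\<lambda>x. f (x + v)) (\<lambda>x. Df (x + v))"
proof -
  obtain K where K: "compact K" "\<And>x. x \<notin> K \<Longrightarrow> f x = 0" using assms by (auto simp: C1_compact_def)
  have "((\<lambda>x. f (x + v)) has_derivative (\<lambda>h. Df (x + v) \<bullet> h)) (at x)" for x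
    by (rule has_derivative_compose[where f = "\<lambda>x. x + v" and g = f])
      (use assms in \<open>auto intro!: derivative_eq_intros simp: C1_compact_def\<close>)
  moreover have "continuous_on UNIV (\<lambda>x. Df (x + v))"
  proof -
    have "continuous_on UNIV Df" using assms by (simp add: C1_compact_def)
    then show ?thesis by (rule continuous_on_compose2) (auto intro!: continuous_intros)
  qed
  moreover have "compact ((\<lambda>y. y - v) ` K)" by (intro compact_continuous_image continuous_intros K(1))
  moreover have "f (x + v) = 0" if "x \<notin> (\<lambda>y. y - v) ` K" for x
    using that by (intro K(2)) (metis add_diff_cancel_right' imageI)
  ultimately show ?thesis unfolding C1_compact_def by blast
qed

text \<open>Integrating by parts twice would need second derivatives; moving a difference quotient instead
  of the second derivative gives the identity for functions that are only once differentiable.\<close>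

lemma integral_partials_swap:
  assumes f: "C1_compact UNIV f Df" and g: "C1_compact UNIV g Dg"
  shows "(LINT x|lborel. (Df x \<bullet> a) * (Dg x \<bullet> b)) = (LINT x|lborel. (Df x \<bullet> b) * (Dg x \<bullet> a))"
proof -
  obtain K B where K: "compact K" "\<And>x. x \<notin> K \<Longrightarrow> f x = 0" "\<And>x. x \<notin> K \<Longrightarrow> Df x = 0"
    "0 \<le> B" "\<And>x. norm (Df x) \<le> B" "\<And>x y. \<bar>f x - f y\<bar> \<le> B * norm (x - y)"
    by (rule C1_compactE[OF f]) (rule that, assumption+)
  obtain K' B' where K': "compact K'" "\<And>x. x \<notin> K' \<Longrightarrow> g x = 0" "\<And>x. x \<notin> K' \<Longrightarrow> Dg x = 0"
    "0 \<le> B'" "\<And>x. norm (Dg x) \<le> B'" "\<And>x y. \<bar>g x - g y\<bar> \<le> B' * norm (x - y)"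
    by (rule C1_compactE[OF g]) (rule that, assumption+)
  have d: "(f has_derivative (\<lambda>h. Df x \<bullet> h)) (at x)" "(g has_derivative (\<lambda>h. Dg x \<bullet> h)) (at x)" for x
    using f g by (auto simp: C1_compact_def)
  have cf: "continuous_on UNIV f" "continuous_on UNIV g"
    using has_derivative_continuous[OF d(1)] has_derivative_continuous[OF d(2)] by (simp_all add: continuous_at_imp_continuous_on)
  have cD: "continuous_on UNIV Df" "continuous_on UNIV Dg" using f g by (auto simp: C1_compact_def)
  have [measurable]: "f \<in> borel_measurable borel" "Df \<in> borel_measurable borel" "g \<in> borel_measurable borel" "Dg \<in> borel_measurable borel"
    by (rule borel_measurable_continuous_onI[OF cf(1)] borel_measurable_continuous_onI[OF cD(1)] borel_measurable_continuous_onI[OF cf(2)] borel_measurable_continuous_onI[OF cD(2)])+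
  define t where "t k = 1 / real (Suc k)" for k
  have t: "t k \<noteq> 0" "- t k \<noteq> 0" "0 < t k" for k by (auto simp: t_def)
  have t0: "t \<longlonglongrightarrow> 0" unfolding t_def by (rule LIMSEQ_inverse_real_of_nat[unfolded inverse_eq_divide])
  have mt0: "(\<lambda>k. - t k) \<longlonglongrightarrow> 0" using tendsto_minus[OF t0] by simp
  have lim1: "(\<lambda>k. LINT x|lborel. (Df x \<bullet> a) * ((g (x + t k *\<^sub>R b) - g x) / t k)) \<longlonglongrightarrow> (LINT x|lborel. (Df x \<bullet> a) * (Dg x \<bullet> b))"
  proof (rule integral_dominated_convergence[where w = "\<lambda>x. (B * norm a) * (B' * norm b) * indicator K x"])
    show "integrable lborel (\<lambda>x::'a. (B * norm a) * (B' * norm b) * indicator K x)"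
      using emeasure_compact_finite[OF K(1)] borel_compact[OF K(1)]
      by (intro integrable_mult_right integrable_real_indicator) (auto simp: less_top)
    show "AE x in lborel. (\<lambda>k. (Df x \<bullet> a) * ((g (x + t k *\<^sub>R b) - g x) / t k)) \<longlonglongrightarrow> (Df x \<bullet> a) * (Dg x \<bullet> b)"
      by (intro AE_I2 tendsto_mult tendsto_const has_derivative_difference_quotient d t t0)
    show "AE x in lborel. norm ((Df x \<bullet> a) * ((g (x + t k *\<^sub>R b) - g x) / t k)) \<le> (B * norm a) * (B' * norm b) * indicator K x" for k
    proof (rule AE_I2)
      fix x
      have "\<bar>Df x \<bullet> a\<bar> \<le> B * norm a"
        using Cauchy_Schwarz_ineq2[of "Df x" a] mult_right_mono[OF K(5)[of x], of "norm a"] by simp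
      moreover have "\<bar>(g (x + t k *\<^sub>R b) - g x) / t k\<bar> \<le> B' * norm b"
        using K'(6)[of "x + t k *\<^sub>R b" x] t(3)[of k] by (simp add: field_simps)
      ultimately have "\<bar>Df x \<bullet> a\<bar> * \<bar>(g (x + t k *\<^sub>R b) - g x) / t k\<bar> \<le> (B * norm a) * (B' * norm b)"
        using K(4) by (intro mult_mono) auto
      then show "norm ((Df x \<bullet> a) * ((g (x + t k *\<^sub>R b) - g x) / t k)) \<le> (B * norm a) * (B' * norm b) * indicator K x"
        using K(3)[of x] by (cases "x \<in> K") (auto simp: abs_mult)
    qed
  qed measurable
  have lim2: "(\<lambda>k. LINT x|lborel. ((f (x + (- t k) *\<^sub>R b) - f x) / (- t k)) * (Dg x \<bullet> a)) \<longlonglongrightarrow> (LINT x|lborel. (Df x \<bullet> b) * (Dg x \<bullet> a))"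
  proof (rule integral_dominated_convergence[where w = "\<lambda>x. (B * norm b) * (B' * norm a) * indicator K' x"])
    show "integrable lborel (\<lambda>x::'a. (B * norm b) * (B' * norm a) * indicator K' x)"
      using emeasure_compact_finite[OF K'(1)] borel_compact[OF K'(1)]
      by (intro integrable_mult_right integrable_real_indicator) (auto simp: less_top)
    show "AE x in lborel. (\<lambda>k. ((f (x + (- t k) *\<^sub>R b) - f x) / (- t k)) * (Dg x \<bullet> a)) \<longlonglongrightarrow> (Df x \<bullet> b) * (Dg x \<bullet> a)"
      by (intro AE_I2 tendsto_mult tendsto_const has_derivative_difference_quotient d t mt0)
    show "AE x in lborel. norm (((f (x + (- t k) *\<^sub>R b) - f x) / (- t k)) * (Dg x \<bullet> a)) \<le> (B * norm b) * (B' * norm a) * indicator K' x" for k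
    proof (rule AE_I2)
      fix x
      have "\<bar>Dg x \<bullet> a\<bar> \<le> B' * norm a"
        using Cauchy_Schwarz_ineq2[of "Dg x" a] mult_right_mono[OF K'(5)[of x], of "norm a"] by simp
      moreover have "\<bar>(f (x + (- t k) *\<^sub>R b) - f x) / (- t k)\<bar> \<le> B * norm b"
        using K(6)[of "x + (- t k) *\<^sub>R b" x] t(3)[of k] by (simp add: field_simps)
      ultimately have "\<bar>(f (x + (- t k) *\<^sub>R b) - f x) / (- t k)\<bar> * \<bar>Dg x \<bullet> a\<bar> \<le> (B * norm b) * (B' * norm a)"
        using K(4) by (intro mult_mono) auto
      then show "norm (((f (x + (- t k) *\<^sub>R b) - f x) / (- t k)) * (Dg x \<bullet> a)) \<le> (B * norm b) * (B' * norm a) * indicator K' x"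
        using K'(3)[of x] unfolding real_norm_def abs_mult by (cases "x \<in> K'") auto
    qed
  qed measurable
  \<comment> \<open>Integration by parts and a translation of the variable move the forward quotient
    of \<open>g\<close> to a backward quotient of \<open>f\<close>.\<close>
  have eq: "(LINT x|lborel. (Df x \<bullet> a) * ((g (x + t k *\<^sub>R b) - g x) / t k)) = 
     (LINT x|lborel. ((f (x + (- t k) *\<^sub>R b) - f x) / (- t k)) * (Dg x \<bullet> a))" for k
  proof -
    let ?v = "t k *\<^sub>R b"
    have gv: "C1_compact UNIV (\<lambda>x. g (x + ?v)) (\<lambda>x. Dg (x + ?v))" by (rule C1_compact_translate[OF g])
    have cgv: "continuous_on UNIV (\<lambda>x. g (x + ?v))" "continuous_on UNIV (\<lambda>x. Dg (x + ?v))" "continuous_on UNIV (\<lambda>x. f (x - ?v))"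
      by (intro continuous_on_compose2[OF cf(1)] continuous_on_compose2[OF cf(2)] continuous_on_compose2[OF cD(2)] continuous_intros; simp)+
    have int: "integrable lborel (\<lambda>x. (Df x \<bullet> a) * g (x + ?v))" "integrable lborel (\<lambda>x. (Df x \<bullet> a) * g x)"
      by (rule integrable_compact_support[OF _ K(1)]; use K cf cD cgv in \<open>auto intro!: continuous_intros\<close>)+
    have int': "integrable lborel (\<lambda>x. f (x - ?v) * (Dg x \<bullet> a))" "integrable lborel (\<lambda>x. f x * (Dg x \<bullet> a))"
      by (rule integrable_compact_support[OF _ K'(1)]; use K' cf cD cgv in \<open>auto intro!: continuous_intros\<close>)+
    have "(LINT x|lborel. (Df x \<bullet> a) * g (x + ?v)) = - (LINT x|lborel. f x * (Dg (x + ?v) \<bullet> a))"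
      by (rule integral_by_parts_compact[OF f gv])
    also have "(LINT x|lborel. f x * (Dg (x + ?v) \<bullet> a)) = (LINT x|lborel. f (x - ?v) * (Dg x \<bullet> a))"
      using lborel_integral_translation[of "\<lambda>x. f (x - ?v) * (Dg x \<bullet> a)" ?v] by simp
    finally have "(LINT x|lborel. (Df x \<bullet> a) * g (x + ?v)) - (LINT x|lborel. (Df x \<bullet> a) * g x)
       = - ((LINT x|lborel. f (x - ?v) * (Dg x \<bullet> a)) - (LINT x|lborel. f x * (Dg x \<bullet> a)))"
      using integral_by_parts_compact[OF f g, of a] by simp
    then have "(LINT x|lborel. (Df x \<bullet> a) * g (x + ?v) - (Df x \<bullet> a) * g x)
       = - (LINT x|lborel. f (x - ?v) * (Dg x \<bullet> a) - f x * (Dg x \<bullet> a))"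
      using int int' by simp
    then have "(LINT x|lborel. (Df x \<bullet> a) * g (x + ?v) - (Df x \<bullet> a) * g x) / t k
       = (LINT x|lborel. f (x - ?v) * (Dg x \<bullet> a) - f x * (Dg x \<bullet> a)) / (- t k)" by simp
    then show ?thesis unfolding integral_divide_zero[symmetric]
      by (simp add: left_diff_distrib right_diff_distrib diff_divide_distrib)
  qed
  show ?thesis using LIMSEQ_unique[OF lim1] lim2 unfolding eq by blast
qed

section \<open>From interior cut-offs to boundary integrals\<close>

lemma has_real_derivative_zero_left:
  fixes K :: "real \<Rightarrow> real"
  assumes d: "(K has_real_derivative K') (at s)" and z: "\<And>s. s \<le> e \<Longrightarrow> K s = 0" and s: "s < e"
  shows "K' = 0"
proof -
  have "((\<lambda>_. 0) has_real_derivative 0) (at s)" by simp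
  then have "(K has_real_derivative 0) (at s)"
    by (rule has_field_derivative_transform_within_open[where S = "{..<e}"]) (use z s in auto)
  with d show ?thesis by (rule DERIV_unique)
qed

context C2_domain begin

text \<open>The test for \<open>\<Omega>\<close> matters: \<open>g\<close> may be negative far
  outside, and \<open>K (- g x)\<close> need not vanish there.\<close>

definition cut :: "(real \<Rightarrow> real) \<Rightarrow> real^'n \<Rightarrow> real" where
  "cut K x = (if x \<in> \<Omega> then K (- g x) else 0)"

definition dcut :: "(real \<Rightarrow> real) \<Rightarrow> real^'n \<Rightarrow> real^'n" where
  "dcut K' x = (if x \<in> \<Omega> then (- K' (- g x)) *\<^sub>R Dg x else 0)"

lemma cut_C1_compact:
  assumes e: "0 < e" and K: "\<And>s. (K has_real_derivative K' s) (at s)" and K': "continuous_on UNIV K'"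
    and z: "\<And>s. s \<le> e \<Longrightarrow> K s = 0"
  shows "C1_compact \<Omega> (cut K) (dcut K')"
proof -
  define C where "C = {x \<in> closure \<Omega>. e / 2 \<le> - g x}"
  have C: "compact C"
  proof -
    have "C = closure \<Omega> \<inter> {x. e / 2 \<le> - g x}" by (auto simp: C_def)
    moreover have "closed {x. e / 2 \<le> - g x}"
      by (intro closed_Collect_le continuous_intros cont_g)
    ultimately show ?thesis using compact_closure by (simp add: compact_Int_closed)
  qed
  have C\<Omega>: "C \<subseteq> \<Omega>"
  proof
    fix x assume x: "x \<in> C"
    then have "g x \<noteq> 0" using e by (auto simp: C_def)
    then have "x \<notin> \<Gamma>" using zero by blast
    then show "x \<in> \<Omega>" using x closure_eq by (auto simp: C_def)
  qed
  have opC: "open (- C)" using C by (simp add: compact_imp_closed open_Compl)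
  have cut0: "cut K x = 0" if "x \<notin> C" for x
    using that z[of "- g x"] e closure_eq by (auto simp: cut_def C_def)
  have dcut0: "dcut K' x = 0" if "x \<notin> C" for x
  proof (cases "x \<in> \<Omega>")
    case True
    then have "- g x < e" using that e closure_eq by (auto simp: C_def)
    then have "K' (- g x) = 0" using has_real_derivative_zero_left[OF K] z by blast
    then show ?thesis by (simp add: dcut_def)
  qed (simp add: dcut_def)
  have "(cut K has_derivative (\<lambda>h. dcut K' x \<bullet> h)) (at x)" for x
  proof (cases "x \<in> \<Omega>")
    case True
    have "((\<lambda>x. K (- g x)) has_derivative (\<lambda>h. (- (Dg x \<bullet> h)) * K' (- g x))) (at x)"
      by (rule DERIV_compose_FDERIV[OF K has_derivative_minus[OF g_has_derivative]])
    then have "((\<lambda>x. K (- g x)) has_derivative (\<lambda>h. dcut K' x \<bullet> h)) (at x)"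
      by (rule has_derivative_eq_rhs) (simp add: dcut_def True fun_eq_iff)
    then show ?thesis by (rule has_derivative_transform_within_open[OF _ op True]) (simp add: cut_def)
  next
    case False
    then have x: "x \<in> - C" using C\<Omega> by auto
    have "((\<lambda>_. 0) has_derivative (\<lambda>h. dcut K' x \<bullet> h)) (at x)" using False by (simp add: dcut_def)
    then show ?thesis by (rule has_derivative_transform_within_open[OF _ opC x]) (simp add: cut0)
  qed
  moreover have "continuous_on UNIV (dcut K')"
  proof -
    have "continuous_on \<Omega> (\<lambda>x. (- K' (- g x)) *\<^sub>R Dg x)"
      by (intro continuous_intros cont_Dg continuous_on_compose2[OF K' continuous_on_minus[OF cont_g]]) auto
    then have "continuous_on \<Omega> (dcut K')" by (rule continuous_on_eq) (simp add: dcut_def)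
    moreover have "continuous_on (- C) (dcut K')"
      by (rule continuous_on_eq[OF continuous_on_const[of _ 0]]) (use dcut0 in auto)
    ultimately have "continuous_on (\<Omega> \<union> - C) (dcut K')" using op opC by (rule continuous_on_open_Un[rotated 2])
    moreover have "\<Omega> \<union> - C = UNIV" using C\<Omega> by auto
    ultimately show ?thesis by simp
  qed
  ultimately show ?thesis unfolding C1_compact_def using C C\<Omega> cut0 by blast
qed

text \<open>A function of \<open>g\<close> alone works, since \<open>- g\<close> has a positive
  lower bound on the compact set \<open>C\<close>.\<close>

lemma plateau_exists:
  assumes C: "compact C" "C \<subseteq> \<Omega>"
  obtains P DP V where "C1_compact \<Omega> P DP" "open V" "C \<subseteq> V" "V \<subseteq> \<Omega>" "\<And>x. x \<in> V \<Longrightarrow> P x = 1"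
proof -
  obtain e where e: "0 < e" "\<And>x. x \<in> C \<Longrightarrow> e < - g x"
  proof (cases "C = {}")
    case False
    obtain x0 where x0: "x0 \<in> C" "\<And>x. x \<in> C \<Longrightarrow> g x \<le> g x0"
      using continuous_attains_sup[OF C(1) False cont_g] by blast
    have "0 < - g x0" using x0 C neg by auto
    then show ?thesis by (intro that[of "- g x0 / 2"]) (use x0 in force)+
  qed (use that[of 1] in auto)
  define q where "q t = (max 0 t) ^ 2" for t :: real
  have dq: "(q has_real_derivative 2 * max 0 t) (at t)" for t
    using has_derivative_max_power[of 0 t] by (simp add: q_def[abs_def] numeral_eq_Suc)
  have cq: "continuous_on UNIV q" unfolding q_def[abs_def] by (intro continuous_intros)
  \<comment> \<open>A C^1 transition from 0 for \<open>s \<le> e / 2\<close> to 1 for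
    \<open>s \<ge> e\<close>, obtained by applying the one-sided square \<open>q\<close>
    twice.\<close>
  define S where "S s = 1 - q (1 - q (2 * s / e - 1))" for s
  define S' where "S' s = 2 * max 0 (1 - q (2 * s / e - 1)) * (2 * max 0 (2 * s / e - 1) * (2 / e))" for s
  have "C1_compact \<Omega> (cut S) (dcut S')"
  proof (rule cut_C1_compact)
    show "0 < e / 2" using e by simp
    show "(S has_real_derivative S' s) (at s)" for s
    proof -
      have 1: "((\<lambda>s. 2 * s / e - 1) has_real_derivative 2 / e) (at s)"
        using e by (auto intro!: derivative_eq_intros)
      have 2: "((\<lambda>s. q (2 * s / e - 1)) has_real_derivative 2 * max 0 (2 * s / e - 1) * (2 / e)) (at s)"
        by (rule DERIV_chain2[OF dq 1])
      have 3: "((\<lambda>s. 1 - q (2 * s / e - 1)) has_real_derivative 0 - 2 * max 0 (2 * s / e - 1) * (2 / e)) (at s)"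
        by (rule DERIV_diff[OF DERIV_const 2])
      have 4: "(S has_real_derivative 0 - 2 * max 0 (1 - q (2 * s / e - 1)) * (0 - 2 * max 0 (2 * s / e - 1) * (2 / e))) (at s)"
        unfolding S_def by (rule DERIV_diff[OF DERIV_const DERIV_chain2[OF dq 3]])
      show ?thesis using 4 by (simp add: S'_def)
    qed
    show "continuous_on UNIV S'"
      unfolding S'_def by (intro continuous_intros continuous_on_compose2[OF cq]) (use e in auto)
    show "S s = 0" if "s \<le> e / 2" for s
    proof -
      have "2 * s / e - 1 \<le> 0" using that e by (simp add: field_simps)
      then show ?thesis by (simp add: S_def q_def)
    qed
  qed
  moreover have "cut S x = 1" if "x \<in> {x\<in>\<Omega>. e < - g x}" for x
  proof -
    have "1 \<le> 2 * (- g x) / e - 1" using that e by (simp add: field_simps)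
    then have "1 \<le> q (2 * (- g x) / e - 1)" unfolding q_def by (intro one_le_power) simp
    then show ?thesis using that unfolding cut_def S_def by (simp add: q_def[of "1 - _"])
  qed
  moreover have "open {x\<in>\<Omega>. e < - g x}"
  proof -
    have "open (\<Omega> \<inter> {x. e < - g x})" by (intro open_Int op open_Collect_less continuous_intros cont_g)
    then show ?thesis by (simp add: Int_def)
  qed
  moreover have "C \<subseteq> {x\<in>\<Omega>. e < - g x}" using C e by auto
  ultimately show ?thesis by (intro that[of "cut S" "dcut S'" "{x\<in>\<Omega>. e < - g x}"]) auto
qed

lemma component_has_derivative:
  assumes "(F has_derivative (\<lambda>h. A *v h)) (at x)"
  shows "((\<lambda>x. F x $ i) has_derivative (\<lambda>h. A $ i \<bullet> h)) (at x)"
proof -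
  have "((\<lambda>x. F x $ i) has_derivative (\<lambda>h. (A *v h) $ i)) (at x)"
    by (rule bounded_linear.has_derivative[OF bounded_linear_vec_nth assms])
  then show ?thesis by (simp add: matrix_vector_mul_component)
qed

text \<open>\<open>integral_derivative_zero\<close> for each component of
  \<open>c x *\<^sub>R V x\<close>; the factor \<open>c\<close> extends the field by zero beyond
  \<open>\<Omega>\<close>.\<close>

lemma integral_divergence_compact:
  fixes V :: "real^'n \<Rightarrow> real^'n" and JV :: "real^'n \<Rightarrow> real^'n^'n"
  assumes c: "C1_compact \<Omega> c Dc"
    and V: "\<And>x. x \<in> \<Omega> \<Longrightarrow> (V has_derivative (\<lambda>h. JV x *v h)) (at x)" and JV: "continuous_on \<Omega> JV"
  shows "(LINT x|lborel. indicator \<Omega> x * (Dc x \<bullet> V x + c x * trace (JV x))) = 0"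
proof -
  define D where "D i x = (if x \<in> \<Omega> then c x *\<^sub>R JV x $ i + V x $ i *\<^sub>R Dc x else 0)" for i x
  have C: "C1_compact \<Omega> (\<lambda>x. c x * V x $ i) (D i)" for i
    unfolding D_def
    by (rule C1_compact_mult[OF c op]) (use V JV in \<open>auto intro!: component_has_derivative continuous_intros\<close>)
  have int: "integrable lborel (\<lambda>x. D i x \<bullet> axis i 1)" for i
  proof -
    obtain K where K: "compact K" "\<And>x. x \<notin> K \<Longrightarrow> D i x = 0" by (rule C1_compactE[OF C[of i]]) (rule that, assumption+)
    show ?thesis
      by (rule integrable_compact_support[OF _ K(1)]) (use C[of i] K in \<open>auto simp: C1_compact_def intro!: continuous_intros\<close>)
  qed
  have "(LINT x|lborel. indicator \<Omega> x * (Dc x \<bullet> V x + c x * trace (JV x))) = (LINT x|lborel. (\<Sum>i\<in>UNIV. D i x \<bullet> axis i 1))"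
  proof (rule Bochner_Integration.integral_cong[OF refl])
    fix x
    show "indicator \<Omega> x * (Dc x \<bullet> V x + c x * trace (JV x)) = (\<Sum>i\<in>UNIV. D i x \<bullet> axis i 1)"
    proof (cases "x \<in> \<Omega>")
      case True
      have "(\<Sum>i\<in>UNIV. D i x \<bullet> axis i 1) = (\<Sum>i\<in>UNIV. c x * JV x $ i $ i + Dc x $ i * V x $ i)"
        by (simp add: D_def True inner_axis mult.commute)
      then show ?thesis
        using True by (simp add: trace_def inner_vec_def[of "Dc x"] sum.distrib sum_distrib_left)
    qed (simp add: D_def)
  qed
  also have "\<dots> = (\<Sum>i\<in>UNIV. LINT x|lborel. D i x \<bullet> axis i 1)"
    by (rule Bochner_Integration.integral_sum) (rule int)
  also have "\<dots> = 0"
    using integral_derivative_zero[OF C1_compact_mono[OF C]] by simp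
  finally show ?thesis .
qed

text \<open>For smooth fields the difference of the two integrands is a divergence. Applying
  \<open>integral_partials_swap\<close> to each pair of components avoids the second derivatives
  that this argument would require. The identity later stands in for the divergence of
  \<open>M Du\<close>.\<close>

lemma integral_trace_swap:
  fixes V Z :: "real^'n \<Rightarrow> real^'n" and JV JZ :: "real^'n \<Rightarrow> real^'n^'n"
  assumes V: "\<And>x. x \<in> \<Omega> \<Longrightarrow> (V has_derivative (\<lambda>h. JV x *v h)) (at x)" and JV: "continuous_on \<Omega> JV"
    and Z: "\<And>i. C1_compact \<Omega> (\<lambda>x. Z x $ i) (\<lambda>x. JZ x $ i)"
  shows "(LINT x|lborel. trace (JV x ** JZ x)) = (LINT x|lborel. trace (JV x) * trace (JZ x))"
proof -
  have "\<forall>i. \<exists>K. compact K \<and> K \<subseteq> \<Omega> \<and> (\<forall>x. x \<notin> K \<longrightarrow> JZ x $ i = 0)"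
  proof
    fix i show "\<exists>K. compact K \<and> K \<subseteq> \<Omega> \<and> (\<forall>x. x \<notin> K \<longrightarrow> JZ x $ i = 0)"
      by (rule C1_compactE[OF Z[of i]]) blast
  qed
  then obtain Kf where Kf: "\<And>i. compact (Kf i)" "\<And>i. Kf i \<subseteq> \<Omega>" "\<And>i x. x \<notin> Kf i \<Longrightarrow> JZ x $ i = 0" by metis
  define K where "K = (\<Union>i. Kf i)"
  have K: "compact K" "K \<subseteq> \<Omega>" "\<And>i x. x \<notin> K \<Longrightarrow> JZ x $ i = 0"
    using Kf by (auto simp: K_def intro!: compact_UN)
  \<comment> \<open>\<open>V\<close> lacks compact support; multiplying it by a plateau that equals
    1 near the support of \<open>JZ\<close> changes nothing under the integral.\<close>
  obtain P DP U where P: "C1_compact \<Omega> P DP" "open U" "K \<subseteq> U" "U \<subseteq> \<Omega>" "\<And>x. x \<in> U \<Longrightarrow> P x = 1"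
    using plateau_exists[OF K(1,2)] by blast
  define D where "D i x = (if x \<in> \<Omega> then P x *\<^sub>R JV x $ i + V x $ i *\<^sub>R DP x else 0)" for i x
  have C: "C1_compact \<Omega> (\<lambda>x. P x * V x $ i) (D i)" for i
    unfolding D_def
    by (rule C1_compact_mult[OF P(1) op]) (use V JV in \<open>auto intro!: component_has_derivative continuous_intros\<close>)
  have DP0: "DP x = 0" if "x \<in> U" for x
  proof (rule has_derivative_inner_unique)
    show "(P has_derivative (\<lambda>h. DP x \<bullet> h)) (at x)" using P(1) by (simp add: C1_compact_def)
    have "((\<lambda>_. 1) has_derivative (\<lambda>h. 0 \<bullet> h)) (at x)" by simp
    then show "(P has_derivative (\<lambda>h. 0 \<bullet> h)) (at x)"
      by (rule has_derivative_transform_within_open[OF _ P(2) that]) (simp add: P(5))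
  qed
  have D_eq: "D i x = JV x $ i" if "x \<in> K" for i x
    using that P(3,4,5) DP0 by (auto simp: D_def)
  have prod_eq: "D j x $ k * JZ x $ i $ l = JV x $ j $ k * JZ x $ i $ l" for i j k l x
    using D_eq[of x j] K(3)[of x i] by (cases "x \<in> K") auto
  have contD: "continuous_on UNIV (D i)" "continuous_on UNIV (\<lambda>x. JZ x $ i)" for i
    using C[of i] Z[of i] by (auto simp: C1_compact_def)
  have int: "integrable lborel (\<lambda>x. JV x $ j $ k * JZ x $ i $ l)" for i j k l
    unfolding prod_eq[symmetric]
    by (rule integrable_compact_support[OF _ K(1)])
      (use K(3) in \<open>auto intro: continuous_on_mult bounded_linear.continuous_on[OF bounded_linear_vec_nth contD(1)]
        bounded_linear.continuous_on[OF bounded_linear_vec_nth contD(2)]\<close>)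
  have swap: "(LINT x|lborel. JV x $ j $ i * JZ x $ i $ j) = (LINT x|lborel. JV x $ j $ j * JZ x $ i $ i)" for i j
    using integral_partials_swap[OF C1_compact_mono[OF C[of j] subset_UNIV] C1_compact_mono[OF Z[of i] subset_UNIV], of "axis i 1" "axis j 1"]
    by (simp add: inner_axis prod_eq)
  have "(LINT x|lborel. trace (JV x ** JZ x)) = (LINT x|lborel. (\<Sum>j\<in>UNIV. \<Sum>i\<in>UNIV. JV x $ j $ i * JZ x $ i $ j))"
    by (simp add: trace_def matrix_matrix_mult_def)
  also have "\<dots> = (\<Sum>j\<in>UNIV. \<Sum>i\<in>UNIV. (LINT x|lborel. JV x $ j $ i * JZ x $ i $ j))"
    by (simp add: Bochner_Integration.integral_sum int)
  also have "\<dots> = (\<Sum>j\<in>UNIV. \<Sum>i\<in>UNIV. (LINT x|lborel. JV x $ j $ j * JZ x $ i $ i))"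
    by (simp add: swap)
  also have "\<dots> = (LINT x|lborel. (\<Sum>j\<in>UNIV. \<Sum>i\<in>UNIV. JV x $ j $ j * JZ x $ i $ i))"
    by (simp add: Bochner_Integration.integral_sum int)
  also have "\<dots> = (LINT x|lborel. trace (JV x) * trace (JZ x))"
    by (simp add: trace_def sum_product)
  finally show ?thesis .
qed

text \<open>The cut-off whose derivative is the layer kernel. It is constant from 1 on, so
  \<open>Psi (- g x / r)\<close> tends to \<open>Psi 1\<close> at every interior point as
  \<open>r\<close> tends to 0.\<close>

definition Psi :: "real \<Rightarrow> real" where "Psi s = integral {0..s} (\<lambda>t. profile (1 - t\<^sup>2))"

section \<open>Properties of the layer cut-off\<close>

lemma cont_profile_sq: "continuous_on S (\<lambda>t. profile (1 - t\<^sup>2))"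
  by (intro continuous_on_compose2[OF cont_profile[of UNIV]] continuous_intros) auto

lemma Psi_derivative: assumes s: "0 < s" shows "(Psi has_real_derivative profile (1 - s\<^sup>2)) (at s)"
proof -
  have "((\<lambda>x. integral {0..x} (\<lambda>t. profile (1 - t\<^sup>2))) has_real_derivative profile (1 - s\<^sup>2)) (at s within {0..s + 1})"
    by (rule integral_has_real_derivative[OF cont_profile_sq]) (use s in auto)
  then have "(Psi has_real_derivative profile (1 - s\<^sup>2)) (at s within {0..s + 1})"
    unfolding Psi_def[abs_def] .
  moreover have "at s within {0..s + 1} = at s"
    by (rule at_within_interior) (use s in auto)
  ultimately show ?thesis by simp
qed

lemma Psi_bounds: assumes s: "0 < s" shows "0 < Psi s" "Psi s \<le> profile 1 * s" "Psi s \<le> Psi 1" "1 \<le> s \<Longrightarrow> Psi s = Psi 1"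
proof -
  have ii: "(\<lambda>t. profile (1 - t\<^sup>2)) integrable_on {a..b}" for a b
    by (rule integrable_continuous_interval[OF cont_profile_sq])
  have pos: "0 < Psi t" if t: "0 < t" "t \<le> 1/2" for t
  proof -
    have "integral {0..t} (\<lambda>_. profile (3/4)) \<le> Psi t"
      unfolding Psi_def
    proof (rule integral_le)
      show "profile (3/4) \<le> profile (1 - x\<^sup>2)" if "x \<in> {0..t}" for x
      proof (rule profile_mono)
        have "x\<^sup>2 \<le> (1/2)\<^sup>2" using that t by (intro power_mono) auto
        then show "3/4 \<le> 1 - x\<^sup>2" by (simp add: power2_eq_square)
      qed
    qed (use ii in auto)
    moreover have "0 < profile (3/4)" using \<kappa>_pos by (simp add: profile_def)
    moreover have "integral {0..t} (\<lambda>_. profile (3/4)) = t * profile (3/4)" using t by simp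
    ultimately show ?thesis using t mult_pos_pos[of t "profile (3/4)"] by linarith
  qed
  have mono: "Psi a \<le> Psi b" if "0 \<le> a" "a \<le> b" for a b
    unfolding Psi_def by (rule integral_subset_le) (use that ii profile_nonneg in auto)
  have const: "Psi b = Psi 1" if "1 \<le> b" for b
  proof -
    have "Psi 1 + integral {1..b} (\<lambda>t. profile (1 - t\<^sup>2)) = Psi b"
      unfolding Psi_def by (rule Henstock_Kurzweil_Integration.integral_combine) (use that ii in auto)
    moreover have "integral {1..b} (\<lambda>t. profile (1 - t\<^sup>2)) = integral {1..b} (\<lambda>t. 0)"
    proof (rule integral_cong)
      fix t :: real assume "t \<in> {1..b}"
      then have "1 \<le> t\<^sup>2" by (intro one_le_power) auto
      then show "profile (1 - t\<^sup>2) = 0" using m_pos by (simp add: profile_def)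
    qed
    ultimately show ?thesis by simp
  qed
  show "0 < Psi s"
  proof (cases "s \<le> 1/2")
    case False
    then have "Psi (1/2) \<le> Psi s" by (intro mono) auto
    then show ?thesis using pos[of "1/2"] by simp
  qed (use pos s in auto)
  have "Psi s \<le> integral {0..s} (\<lambda>_. profile 1)"
    unfolding Psi_def by (rule integral_le) (use ii in \<open>auto intro: profile_mono\<close>)
  then show "Psi s \<le> profile 1 * s" using s by (simp add: mult.commute)
  show "1 \<le> s \<Longrightarrow> Psi s = Psi 1" by (rule const)
  then show "Psi s \<le> Psi 1" using mono[of s 1] s by (cases "s \<le> 1") auto
qed

text \<open>\<open>soft \<epsilon> (Psi (s / r))\<close> is an admissible cut-off that vanishes near \<open>0\<close> and whose derivative tends,
  as \<open>\<epsilon>\<close> tends to \<open>0\<close>, to the layer profile of \<open>layer_limit\<close>.\<close>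

definition soft :: "real \<Rightarrow> real \<Rightarrow> real" where "soft \<epsilon> t = (max 0 (t - \<epsilon>))\<^sup>2 / t"

definition dsoft :: "real \<Rightarrow> real \<Rightarrow> real" where "dsoft \<epsilon> t = max 0 (1 - (\<epsilon> / t)\<^sup>2)"

lemma soft_derivative: assumes t: "0 < t" and \<epsilon>: "0 < \<epsilon>" shows "(soft \<epsilon> has_real_derivative dsoft \<epsilon> t) (at t)"
proof -
  have "((\<lambda>t. max 0 t ^ 2) has_real_derivative 2 * max 0 (t - \<epsilon>)) (at (t - \<epsilon>))"
    using has_derivative_max_power[of 0 "t - \<epsilon>"] by (simp add: numeral_eq_Suc)
  moreover have "((\<lambda>t. t - \<epsilon>) has_real_derivative 1) (at t)" by (auto intro!: derivative_eq_intros)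
  ultimately have 1: "((\<lambda>t. max 0 (t - \<epsilon>) ^ 2) has_real_derivative 2 * max 0 (t - \<epsilon>) * 1) (at t)"
    by (rule DERIV_chain2)
  have "(soft \<epsilon> has_real_derivative (2 * max 0 (t - \<epsilon>) * 1 * t - max 0 (t - \<epsilon>) ^ 2 * 1) / (t * t)) (at t)"
    unfolding soft_def[abs_def] by (rule DERIV_divide[OF 1 DERIV_ident]) (use t in auto)
  moreover have "(2 * max 0 (t - \<epsilon>) * 1 * t - max 0 (t - \<epsilon>) ^ 2 * 1) / (t * t) = dsoft \<epsilon> t"
  proof (cases "t \<le> \<epsilon>")
    case True
    then have "1 \<le> \<epsilon> / t" using t by simp
    then have "1 \<le> (\<epsilon> / t)\<^sup>2" by (rule one_le_power)
    then show ?thesis using True by (simp add: dsoft_def)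
  next
    case False
    then have "\<epsilon> / t \<le> 1" using t by simp
    then have "(\<epsilon> / t)\<^sup>2 \<le> 1" using t \<epsilon> by (intro power_le_one) auto
    then show ?thesis using False t by (simp add: dsoft_def max_def power2_eq_square field_simps)
  qed
  ultimately show ?thesis by simp
qed

text \<open>An identity for all cut-offs that vanish near 0 becomes a boundary integral.
  \<open>Psi (s / r)\<close> is not such a cut-off, so for fixed \<open>r\<close> the identity
  reaches it as the limit of the softened versions. Only then does \<open>r\<close> tend to 0: the
  left side converges by domination, the right side by \<open>layer_limit\<close>.\<close>

lemma cutoff_limit:
  fixes p q :: "real^'n \<Rightarrow> real"
  assumes p: "continuous_on (closure \<Omega>) p" and q: "continuous_on (closure \<Omega>) q"
    and H: "\<And>K K' e. 0 < e \<Longrightarrow> (\<And>s. (K has_real_derivative K' s) (at s)) \<Longrightarrow> continuous_on UNIV K' \<Longrightarrow>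
       (\<And>s. s \<le> e \<Longrightarrow> K s = 0) \<Longrightarrow>
       (LINT x|\<Lambda>. K (- g x) * (indicator \<Omega> x * p x)) = (LINT x|\<Lambda>. K' (- g x) * (indicator \<Omega> x * q x))"
  shows "Psi 1 * (LINT x|\<Lambda>. indicator \<Omega> x * p x) = half_ball_vol * surf_int \<Gamma> (\<lambda>x. q x / \<beta> x)"
proof -
  define p' where "p' x = indicator \<Omega> x * p x" for x
  define q' where "q' x = indicator \<Omega> x * q x" for x
  have [measurable]: "p' \<in> borel_measurable borel" "q' \<in> borel_measurable borel"
    unfolding p'_def q'_def by (intro measurable_indicator_times p q)+
  have [measurable]: "g \<in> borel_measurable borel" "profile \<in> borel_measurable borel"
    by (rule borel_measurable_continuous_onI[OF cont_g] borel_measurable_continuous_onI[OF cont_profile])+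
  obtain Mp where Mp: "0 < Mp" "\<And>x. x \<in> closure \<Omega> \<Longrightarrow> norm (p x) \<le> Mp" using continuous_bounded[OF p] by blast
  obtain Mq where Mq: "0 < Mq" "\<And>x. x \<in> closure \<Omega> \<Longrightarrow> norm (q x) \<le> Mq" using continuous_bounded[OF q] by blast
  have p'M: "\<bar>p' x\<bar> \<le> Mp" for x using Mp closure_eq by (auto simp: p'_def indicator_def)
  have q'M: "\<bar>q' x\<bar> \<le> Mq" for x using Mq closure_eq by (auto simp: q'_def indicator_def)
  have p1: "0 < profile 1" using \<kappa>_pos by (simp add: profile_def)
  have P1: "\<bar>profile (1 - t\<^sup>2)\<bar> \<le> profile 1" for t using profile_nonneg profile_mono[of "1 - t\<^sup>2" 1] by simp
  have contPsi: "continuous_on {0<..} Psi"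
    using Psi_derivative by (auto intro!: continuous_at_imp_continuous_on DERIV_isCont)
  have fixed_r: "(LINT x|\<Lambda>. Psi (- g x / r) * p' x) = (1 / r) * (LINT x|\<Lambda>. profile (1 - (g x / r)\<^sup>2) * q' x)"
    if r: "0 < r" for r
  proof -
    define \<epsilon> where "\<epsilon> j = 1 / real (Suc j)" for j
    have \<epsilon>: "0 < \<epsilon> j" for j by (simp add: \<epsilon>_def)
    have \<epsilon>0: "\<epsilon> \<longlonglongrightarrow> 0" unfolding \<epsilon>_def by (rule LIMSEQ_inverse_real_of_nat[unfolded inverse_eq_divide])
    \<comment> \<open>\<open>Psi\<close> is differentiated only at positive arguments, hence the
      separate branch. The branches fit together because \<open>K j\<close> vanishes up to
      \<open>e j > 0\<close>.\<close>
    define K where "K j s = (if s \<le> 0 then 0 else soft (\<epsilon> j) (Psi (s / r)))" for j s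
    define K' where "K' j s = (if s \<le> 0 then 0 else dsoft (\<epsilon> j) (Psi (s / r)) * (profile (1 - (s / r)\<^sup>2) * (1 / r)))" for j s
    \<comment> \<open>Since \<open>Psi t \<le> profile 1 * t\<close>, the argument of
      \<open>soft\<close> is at most \<open>\<epsilon> j\<close> up to this point, and
      \<open>soft\<close> vanishes there.\<close>
    define e where "e j = r * \<epsilon> j / profile 1" for j
    have e: "0 < e j" for j using r \<epsilon> p1 by (simp add: e_def)
    have small: "Psi (s / r) \<le> \<epsilon> j" if "0 < s" "s \<le> e j" for s j
    proof -
      have "Psi (s / r) \<le> profile 1 * (s / r)" using that r by (intro Psi_bounds) auto
      also have "\<dots> \<le> profile 1 * (e j / r)" using that r p1 by (intro mult_left_mono divide_right_mono) auto
      also have "\<dots> = \<epsilon> j" using r p1 by (simp add: e_def)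
      finally show ?thesis .
    qed
    have K0: "K j s = 0" if "s \<le> e j" for j s
      using small[OF _ that] by (auto simp: K_def soft_def)
    have dK_pos: "(K j has_real_derivative K' j s) (at s)" if s: "0 < s" for j s
    proof -
      have sr: "0 < s / r" using s r by simp
      have "((\<lambda>s. s / r) has_real_derivative 1 / r) (at s)" using r by (auto intro!: derivative_eq_intros)
      from DERIV_chain2[OF Psi_derivative[OF sr] this]
      have "((\<lambda>s. Psi (s / r)) has_real_derivative profile (1 - (s / r)\<^sup>2) * (1 / r)) (at s)" .
      from DERIV_chain2[OF soft_derivative[OF Psi_bounds(1)[OF sr] \<epsilon>] this]
      have "((\<lambda>s. soft (\<epsilon> j) (Psi (s / r))) has_real_derivative dsoft (\<epsilon> j) (Psi (s / r)) * (profile (1 - (s / r)\<^sup>2) * (1 / r))) (at s)" .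
      then have "((\<lambda>s. soft (\<epsilon> j) (Psi (s / r))) has_real_derivative K' j s) (at s)" using s by (simp add: K'_def)
      then show ?thesis
        by (rule has_field_derivative_transform_within_open[where S = "{0<..}"]) (use s in \<open>auto simp: K_def\<close>)
    qed
    have K'0: "K' j s = 0" if "s < e j" for j s
      using has_real_derivative_zero_left[OF dK_pos K0 that] by (cases "s \<le> 0") (auto simp: K'_def)
    have dK: "(K j has_real_derivative K' j s) (at s)" for j s
    proof (cases "s < e j")
      case True
      have "((\<lambda>_. 0) has_real_derivative 0) (at s)" by simp
      then have "(K j has_real_derivative 0) (at s)"
        by (rule has_field_derivative_transform_within_open[where S = "{..<e j}"]) (use K0 True in auto)
      then show ?thesis using K'0[OF True] by simp
    qed (use dK_pos e[of j] in auto)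
    have contK': "continuous_on UNIV (K' j)" for j
    proof -
      have "continuous_on {0<..} (\<lambda>s. dsoft (\<epsilon> j) (Psi (s / r)) * (profile (1 - (s / r)\<^sup>2) * (1 / r)))"
      proof -
        have 1: "continuous_on {0<..} (\<lambda>s. Psi (s / r))"
          by (rule continuous_on_compose2[OF contPsi]) (use r in \<open>auto intro!: continuous_intros\<close>)
        have 2: "continuous_on {0<..} (\<lambda>s. profile (1 - (s / r)\<^sup>2))"
          by (rule continuous_on_compose2[OF cont_profile[of UNIV]]) (use r in \<open>auto intro!: continuous_intros\<close>)
        have nz: "\<forall>s\<in>{0<..}. Psi (s / r) \<noteq> 0" using Psi_bounds(1) r by (metis divide_pos_pos greaterThan_iff less_irrefl)
        show ?thesis unfolding dsoft_def by (intro continuous_intros 1 2 nz)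
      qed
      then have "continuous_on {0<..} (K' j)" by (rule continuous_on_eq) (simp add: K'_def)
      moreover have "continuous_on {..<e j} (K' j)"
        by (rule continuous_on_eq[OF continuous_on_const[of _ 0]]) (use K'0 in auto)
      ultimately have "continuous_on ({0<..} \<union> {..<e j}) (K' j)" by (intro continuous_on_open_Un) auto
      moreover have "{0<..} \<union> {..<e j} = UNIV" using e[of j] by auto
      ultimately show ?thesis by simp
    qed
    have soft_bounds: "0 \<le> soft (\<epsilon> j) t" "soft (\<epsilon> j) t \<le> t" "0 \<le> dsoft (\<epsilon> j) t" "dsoft (\<epsilon> j) t \<le> 1" if "0 < t" for j t
    proof -
      have "(max 0 (t - \<epsilon> j))\<^sup>2 \<le> t\<^sup>2" using that \<epsilon>[of j] by (intro power_mono) auto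
      then show "soft (\<epsilon> j) t \<le> t" using that by (simp add: soft_def power2_eq_square field_simps)
    qed (use that in \<open>auto simp: soft_def dsoft_def\<close>)
    have pos: "0 < - g x / r" if "x \<in> \<Omega>" for x using neg[OF that] r by (simp add: divide_neg_pos)
    have contK: "continuous_on UNIV (K j)" for j
      using dK by (auto intro!: continuous_at_imp_continuous_on DERIV_isCont)
    have [measurable]: "K j \<in> borel_measurable borel" "K' j \<in> borel_measurable borel" for j
      by (rule borel_measurable_continuous_onI[OF contK] borel_measurable_continuous_onI[OF contK'])+
    have mPsi: "(\<lambda>x. Psi (- g x / r) * p' x) \<in> borel_measurable borel"
    proof -
      have "continuous_on \<Omega> (\<lambda>x. Psi (- g x / r) * p x)"
        by (intro continuous_intros continuous_on_compose2[OF contPsi] cont_g continuous_on_subset[OF p] closure_subset)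
          (use pos r in auto)
      then have "(\<lambda>x. indicator \<Omega> x *\<^sub>R (Psi (- g x / r) * p x)) \<in> borel_measurable borel"
        by (intro borel_measurable_continuous_on_indicator) auto
      then show ?thesis by (simp add: p'_def mult_ac)
    qed
    have lima: "(\<lambda>j. LINT x|\<Lambda>. K j (- g x) * p' x) \<longlonglongrightarrow> (LINT x|\<Lambda>. Psi (- g x / r) * p' x)"
    proof (rule integral_dominated_convergence[where w = "\<lambda>_. Psi 1 * Mp"])
      show "(\<lambda>x. Psi (- g x / r) * p' x) \<in> borel_measurable \<Lambda>" using mPsi by simp
      show "AE x in \<Lambda>. (\<lambda>j. K j (- g x) * p' x) \<longlonglongrightarrow> Psi (- g x / r) * p' x"
        using AE_\<Lambda>
      proof eventually_elim
        case (elim x)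
        define t where "t = Psi (- g x / r)"
        have t: "0 < t" unfolding t_def by (rule Psi_bounds(1)[OF pos[OF elim]])
        have "(\<lambda>j. (max 0 (t - \<epsilon> j))\<^sup>2 / t) \<longlonglongrightarrow> (max 0 (t - 0))\<^sup>2 / t"
          by (intro tendsto_intros \<epsilon>0) (use t in auto)
        also have "(max 0 (t - 0))\<^sup>2 / t = t" using t by (simp add: power2_eq_square)
        finally have "(\<lambda>j. K j (- g x)) \<longlonglongrightarrow> t" using neg[OF elim] by (simp add: K_def soft_def t_def)
        then show ?case unfolding t_def by (intro tendsto_mult tendsto_const)
      qed
      show "AE x in \<Lambda>. norm (K j (- g x) * p' x) \<le> Psi 1 * Mp" for j
        using AE_\<Lambda>
      proof eventually_elim
        case (elim x)
        have "\<bar>K j (- g x)\<bar> \<le> Psi 1"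
          using soft_bounds(1,2)[OF Psi_bounds(1)[OF pos[OF elim]], of j] Psi_bounds(3)[OF pos[OF elim]] neg[OF elim]
          by (simp add: K_def)
        then show ?case using p'M[of x] by (simp add: abs_mult mult_mono)
      qed
    qed measurable
    have limb: "(\<lambda>j. LINT x|\<Lambda>. K' j (- g x) * q' x) \<longlonglongrightarrow> (LINT x|\<Lambda>. profile (1 - (g x / r)\<^sup>2) * (1 / r) * q' x)"
    proof (rule integral_dominated_convergence[where w = "\<lambda>_. (profile 1 * (1 / r)) * Mq"])
      show "AE x in \<Lambda>. (\<lambda>j. K' j (- g x) * q' x) \<longlonglongrightarrow> profile (1 - (g x / r)\<^sup>2) * (1 / r) * q' x"
        using AE_\<Lambda>
      proof eventually_elim
        case (elim x)
        define t where "t = Psi (- g x / r)"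
        have t: "0 < t" unfolding t_def by (rule Psi_bounds(1)[OF pos[OF elim]])
        have "(\<lambda>j. max 0 (1 - (\<epsilon> j / t)\<^sup>2) * (profile (1 - (g x / r)\<^sup>2) * (1 / r))) \<longlonglongrightarrow> max 0 (1 - (0 / t)\<^sup>2) * (profile (1 - (g x / r)\<^sup>2) * (1 / r))"
          by (intro tendsto_intros \<epsilon>0) (use t in auto)
        then have "(\<lambda>j. K' j (- g x)) \<longlonglongrightarrow> profile (1 - (g x / r)\<^sup>2) * (1 / r)"
          using neg[OF elim] by (simp add: K'_def dsoft_def t_def)
        then show ?case by (intro tendsto_mult tendsto_const)
      qed
      show "AE x in \<Lambda>. norm (K' j (- g x) * q' x) \<le> (profile 1 * (1 / r)) * Mq" for j
        using AE_\<Lambda>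
      proof eventually_elim
        case (elim x)
        have "\<bar>dsoft (\<epsilon> j) (Psi (- g x / r))\<bar> * (\<bar>profile (1 - (- g x / r)\<^sup>2)\<bar> * (1 / r)) \<le> 1 * (profile 1 * (1 / r))"
          using soft_bounds(3,4)[OF Psi_bounds(1)[OF pos[OF elim]], of j] P1[of "- g x / r"] r
          by (intro mult_mono mult_right_mono) auto
        then have "\<bar>K' j (- g x)\<bar> \<le> profile 1 * (1 / r)"
          using neg[OF elim] r by (simp add: K'_def abs_mult)
        then have "\<bar>K' j (- g x)\<bar> * \<bar>q' x\<bar> \<le> (profile 1 * (1 / r)) * Mq"
          by (rule mult_mono[OF _ q'M]) (use p1 r in auto)
        then show ?case by (simp only: real_norm_def abs_mult)
      qed
    qed measurable
    have Keq: "(LINT x|\<Lambda>. K j (- g x) * p' x) = (LINT x|\<Lambda>. K' j (- g x) * q' x)" for j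
      unfolding p'_def q'_def by (rule H[OF e dK contK' K0])
    have "(LINT x|\<Lambda>. Psi (- g x / r) * p' x) = (LINT x|\<Lambda>. profile (1 - (g x / r)\<^sup>2) * (1 / r) * q' x)"
      by (rule LIMSEQ_unique[OF lima limb[folded Keq]])
    also have "\<dots> = (LINT x|\<Lambda>. (1 / r) * (profile (1 - (g x / r)\<^sup>2) * q' x))"
      by (simp add: mult_ac)
    finally show ?thesis by (simp only: integral_mult_right_zero)
  qed
  define r where "r k = 1 / real (Suc k)" for k
  have r: "0 < r k" for k by (simp add: r_def)
  have r0: "r \<longlonglongrightarrow> 0" unfolding r_def by (rule LIMSEQ_inverse_real_of_nat[unfolded inverse_eq_divide])
  have lim1: "(\<lambda>k. LINT x|\<Lambda>. Psi (- g x / r k) * p' x) \<longlonglongrightarrow> (LINT x|\<Lambda>. Psi 1 * p' x)"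
  proof (rule integral_dominated_convergence[where w = "\<lambda>_. Psi 1 * Mp"])
    show "(\<lambda>x. Psi (- g x / r k) * p' x) \<in> borel_measurable \<Lambda>" for k
    proof -
      have "continuous_on \<Omega> (\<lambda>x. Psi (- g x / r k) * p x)"
        by (intro continuous_intros continuous_on_compose2[OF contPsi] cont_g continuous_on_subset[OF p] closure_subset)
          (use neg r[of k] in \<open>auto simp: field_simps\<close>)
      then have "(\<lambda>x. indicator \<Omega> x *\<^sub>R (Psi (- g x / r k) * p x)) \<in> borel_measurable borel"
        by (intro borel_measurable_continuous_on_indicator) auto
      then show ?thesis by (simp add: p'_def mult_ac)
    qed
    show "AE x in \<Lambda>. (\<lambda>k. Psi (- g x / r k) * p' x) \<longlonglongrightarrow> Psi 1 * p' x"
      using AE_\<Lambda>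
    proof eventually_elim
      case (elim x)
      have "\<forall>\<^sub>F k in sequentially. r k < - g x" using neg[OF elim] by (intro order_tendstoD(2)[OF r0]) auto
      then have "\<forall>\<^sub>F k in sequentially. Psi (- g x / r k) * p' x = Psi 1 * p' x"
      proof eventually_elim
        case (elim k)
        then have "1 \<le> - g x / r k" using r[of k] by (simp only: pos_le_divide_eq mult_1)
        then show ?case using Psi_bounds(4)[of "- g x / r k"] by simp
      qed
      then show ?case by (rule tendsto_eventually)
    qed
    show "AE x in \<Lambda>. norm (Psi (- g x / r k) * p' x) \<le> Psi 1 * Mp" for k
      using AE_\<Lambda>
    proof eventually_elim
      case (elim x)
      have "0 < - g x / r k" using neg[OF elim] r[of k] by (simp add: divide_neg_pos)
      then have "\<bar>Psi (- g x / r k)\<bar> \<le> Psi 1" using Psi_bounds(1,3)[of "- g x / r k"] by simp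
      then show ?case using p'M[of x] by (simp add: abs_mult mult_mono)
    qed
  qed measurable
  have lim2: "(\<lambda>k. LINT x|\<Lambda>. Psi (- g x / r k) * p' x) \<longlonglongrightarrow> half_ball_vol * surf_int \<Gamma> (\<lambda>x. q x / \<beta> x)"
    unfolding fixed_r[OF r] q'_def by (rule layer_limit[OF q r r0])
  from LIMSEQ_unique[OF lim1 lim2] show ?thesis by (simp only: integral_mult_right_zero p'_def)
qed

end

section \<open>The surface divergence theorem\<close>

lemma trace_scaleR: "trace (c *\<^sub>R A) = c * trace (A :: real^'n::finite^'n)"
  by (simp add: trace_def sum_distrib_left)

lemma trace_outer_prod: "trace (outer_prod x y) = x \<bullet> y"
  by (simp add: trace_def outer_prod_def inner_vec_def)

lemma has_derivative_scale_field:
  fixes V :: "real^'n::finite \<Rightarrow> real^'n"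
  assumes "(f has_derivative (\<lambda>h. a \<bullet> h)) (at x within S)" "(V has_derivative (\<lambda>h. J *v h)) (at x within S)"
  shows "((\<lambda>x. f x *\<^sub>R V x) has_derivative (\<lambda>h. (f x *\<^sub>R J + outer_prod (V x) a) *v h)) (at x within S)"
  by (rule has_derivative_eq_rhs[OF has_derivative_scaleR[OF assms]])
    (simp add: fun_eq_iff matrix_vector_mult_add_rdistrib outer_prod_mult_vec scaleR_matrix_vector_assoc)

lemma has_derivative_diff_field:
  fixes V :: "real^'n::finite \<Rightarrow> real^'n"
  assumes "(V has_derivative (\<lambda>h. J *v h)) (at x within S)" "(W has_derivative (\<lambda>h. J' *v h)) (at x within S)"
  shows "((\<lambda>x. V x - W x) has_derivative (\<lambda>h. (J - J') *v h)) (at x within S)"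
  by (rule has_derivative_eq_rhs[OF has_derivative_diff[OF assms]])
    (simp add: fun_eq_iff matrix_vector_mult_diff_rdistrib)

lemma has_derivative_inner_field:
  fixes V :: "real^'n::finite \<Rightarrow> real^'n"
  assumes "(V has_derivative (\<lambda>h. J *v h)) (at x within S)" "(W has_derivative (\<lambda>h. J' *v h)) (at x within S)"
  shows "((\<lambda>x. V x \<bullet> W x) has_derivative (\<lambda>h. (W x v* J + V x v* J') \<bullet> h)) (at x within S)"
  by (rule has_derivative_eq_rhs[OF has_derivative_inner[OF assms]])
    (simp add: fun_eq_iff inner_add_left dot_lmul_matrix, simp add: inner_commute)

lemma surf_int_cong: "(\<And>x. x \<in> S \<Longrightarrow> f x = f' x) \<Longrightarrow> surf_int S f = surf_int S f'"
  unfolding surf_int_def set_lebesgue_integral_def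
  by (intro Bochner_Integration.integral_cong) (auto simp: indicator_def)

lemma continuous_on_matrix_vector:
  fixes A :: "'a::topological_space \<Rightarrow> real^'n::finite^'m::finite"
  assumes "continuous_on S A" "continuous_on S v" shows "continuous_on S (\<lambda>x. A x *v v x)"
  unfolding matrix_vector_mult_def by (intro continuous_intros assms)

lemma continuous_on_vector_matrix:
  fixes A :: "'a::topological_space \<Rightarrow> real^'n::finite^'m::finite"
  assumes "continuous_on S A" "continuous_on S v" shows "continuous_on S (\<lambda>x. v x v* A x)"
  unfolding vector_matrix_mult_def by (intro continuous_intros assms)

lemma continuous_on_trace:
  fixes A :: "'a::topological_space \<Rightarrow> real^'n::finite^'n"
  assumes "continuous_on S A" shows "continuous_on S (\<lambda>x. trace (A x))"
  unfolding trace_def by (intro continuous_intros assms)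

lemma continuous_on_matrix_matrix:
  fixes A B :: "'a::topological_space \<Rightarrow> real^'n::finite^'n"
  assumes "continuous_on S A" "continuous_on S B" shows "continuous_on S (\<lambda>x. A x ** B x)"
  unfolding matrix_matrix_mult_def by (intro continuous_intros assms)

context C2_domain begin

lemma D2g_symmetric: "transpose (D2g x) = D2g x"
  by (rule second_derivative_symmetric[OF g_has_derivative open_UNIV UNIV_I Dg_has_derivative])

lemma D2g_vector: "v v* D2g x = D2g x *v v"
  using transpose_matrix_vector[of "D2g x" v] by (simp add: D2g_symmetric)

lemma half_ball_vol_pos: "0 < half_ball_vol"
  unfolding half_ball_vol_def using content_ball_pos[of 1 "0::real^'n"] by simp

lemma Omega_sub_closure: "x \<in> \<Omega> \<Longrightarrow> x \<in> closure \<Omega>" using closure_eq by auto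

text \<open>The gradient of a function of \<open>g\<close> is orthogonal to \<open>V\<close>, so the
  integral of \<open>K (- g x) * trace (JV x)\<close> vanishes for every admissible
  \<open>K\<close>. Difference quotients of \<open>K\<close> are combinations of admissible
  functions, hence \<open>K'\<close> may replace \<open>K\<close>. This is the hypothesis of
  \<open>cutoff_limit\<close> with \<open>p = 0\<close>, and it asks for one derivative of
  \<open>V\<close> only.\<close>

lemma surface_divergence_tangential:
  fixes V :: "real^'n \<Rightarrow> real^'n" and JV :: "real^'n \<Rightarrow> real^'n^'n"
  assumes V: "\<And>x. x \<in> \<Omega> \<Longrightarrow> (V has_derivative (\<lambda>h. JV x *v h)) (at x)" 
    and JV: "continuous_on (closure \<Omega>) JV" and tang: "\<And>x. x \<in> \<Omega> \<Longrightarrow> V x \<bullet> Dg x = 0"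
  shows "surf_int \<Gamma> (\<lambda>x. trace (JV x) / \<beta> x) = 0"
proof -
  define q where "q x = trace (JV x)" for x
  define q' where "q' x = indicator \<Omega> x * q x" for x
  have cq: "continuous_on (closure \<Omega>) q" unfolding q_def by (rule continuous_on_trace[OF JV])
  have q'm: "q' \<in> borel_measurable borel" unfolding q'_def by (rule measurable_indicator_times[OF cq])
  have gm: "g \<in> borel_measurable borel" by (rule borel_measurable_continuous_onI[OF cont_g])
  obtain Mq where Mq: "0 < Mq" "\<And>x. x \<in> closure \<Omega> \<Longrightarrow> norm (q x) \<le> Mq" using continuous_bounded[OF cq] by blast
  have q'M: "\<bar>q' x\<bar> \<le> Mq" for x using Mq closure_eq by (auto simp: q'_def indicator_def)
  obtain G where G: "0 < G" "\<And>x. x \<in> closure \<Omega> \<Longrightarrow> norm (g x) \<le> G" using continuous_bounded[OF cont_g] by blast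
  have "Psi 1 * (LINT x|\<Lambda>. indicator \<Omega> x * 0) = half_ball_vol * surf_int \<Gamma> (\<lambda>x. q x / \<beta> x)"
  proof (rule cutoff_limit[OF continuous_on_const cq])
    fix K K' :: "real \<Rightarrow> real" and e :: real
    assume e: "0 < e" and K: "\<And>s. (K has_real_derivative K' s) (at s)" and K': "continuous_on UNIV K'"
      and z: "\<And>s. s \<le> e \<Longrightarrow> K s = 0"
    have cK: "continuous_on UNIV K" using K by (auto intro!: continuous_at_imp_continuous_on DERIV_isCont)
    have Km: "K \<in> borel_measurable borel" "K' \<in> borel_measurable borel"
      by (rule borel_measurable_continuous_onI[OF cK] borel_measurable_continuous_onI[OF K'])+
    have meas: "(\<lambda>x. K (- g x - s) * q' x) \<in> borel_measurable borel" for s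
      using Km gm q'm by measurable
    \<comment> \<open>A shift to the right preserves vanishing near 0; this is why backward
      quotients are used below.\<close>
    have shift: "(LINT x|\<Lambda>. K (- g x - s) * q' x) = 0" if s: "0 \<le> s" for s
    proof -
      have d: "((\<lambda>t. K (t - s)) has_real_derivative K' (t - s)) (at t)" for t
      proof -
        have "((\<lambda>t. t - s) has_real_derivative 1) (at t)" by (auto intro!: derivative_eq_intros)
        from DERIV_chain2[OF K this] show ?thesis by simp
      qed
      have C: "C1_compact \<Omega> (cut (\<lambda>t. K (t - s))) (dcut (\<lambda>t. K' (t - s)))"
        by (rule cut_C1_compact[OF e d]) 
          (use z s in \<open>auto intro!: continuous_on_compose2[OF K'] continuous_intros\<close>)
      have "(LINT x|\<Lambda>. K (- g x - s) * q' x) = (LINT x|lborel. indicator \<Omega> x * (K (- g x - s) * q' x))"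
        by (rule integral_\<Lambda>[OF meas])
      also have "\<dots> = (LINT x|lborel. indicator \<Omega> x * (dcut (\<lambda>t. K' (t - s)) x \<bullet> V x + cut (\<lambda>t. K (t - s)) x * trace (JV x)))"
      proof (rule Bochner_Integration.integral_cong[OF refl])
        fix x
        show "indicator \<Omega> x * (K (- g x - s) * q' x) = indicator \<Omega> x * (dcut (\<lambda>t. K' (t - s)) x \<bullet> V x + cut (\<lambda>t. K (t - s)) x * trace (JV x))"
          using tang[of x] by (cases "x \<in> \<Omega>") (simp_all add: q'_def q_def cut_def dcut_def inner_commute)
      qed
      also have "\<dots> = 0"
        by (rule integral_divergence_compact[OF C V continuous_on_subset[OF JV closure_subset]])
      finally show ?thesis .
    qed
    define t where "t j = 1 / real (Suc j)" for j
    have t: "0 < t j" "t j \<le> 1" for j by (auto simp: t_def)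
    have t0: "t \<longlonglongrightarrow> 0" unfolding t_def by (rule LIMSEQ_inverse_real_of_nat[unfolded inverse_eq_divide])
    \<comment> \<open>The arguments \<open>s - t j\<close> with \<open>0 \<le> s\<close> and
      \<open>t j \<le> 1\<close> reach down to -1.\<close>
    have "bounded (K' ` {-1..G})"
      by (intro compact_imp_bounded compact_continuous_image continuous_on_subset[OF K']) auto
    then obtain B where "\<forall>y\<in>K' ` {-1..G}. norm y \<le> B" unfolding bounded_iff by blast
    then have B: "\<And>s. s \<in> {-1..G} \<Longrightarrow> norm (K' s) \<le> B" by blast
    have lip: "\<bar>(K s - K (s - t j)) / t j\<bar> \<le> B" if s: "0 \<le> s" "s \<le> G" for s j
    proof -
      have "norm (K s - K (s - t j)) \<le> B * norm (s - (s - t j))"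
      proof (rule differentiable_bound[where S = "{-1..G}" and f' = "\<lambda>s h. K' s * h"])
        fix y assume y: "y \<in> {-1..G}"
        show "(K has_derivative (*) (K' y)) (at y within {- 1..G})"
          using K[of y] by (auto simp: has_field_derivative_def intro: has_derivative_at_withinI)
        show "onorm ((*) (K' y)) \<le> B"
          using B[OF y] by (intro onorm_le) (simp add: abs_mult mult_right_mono)
      qed (use s t[of j] in auto)
      then show ?thesis using t(1)[of j] by (simp add: field_simps)
    qed
    have "(\<lambda>j. LINT x|\<Lambda>. (K (- g x) - K (- g x - t j)) / t j * q' x) \<longlonglongrightarrow> (LINT x|\<Lambda>. K' (- g x) * q' x)"
    proof (rule integral_dominated_convergence[where w = "\<lambda>_. B * Mq"])
      show "(\<lambda>x. K' (- g x) * q' x) \<in> borel_measurable \<Lambda>" using Km gm q'm by measurable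
      show "(\<lambda>x. (K (- g x) - K (- g x - t j)) / t j * q' x) \<in> borel_measurable \<Lambda>" for j using Km gm q'm by measurable
      show "AE x in \<Lambda>. (\<lambda>j. (K (- g x) - K (- g x - t j)) / t j * q' x) \<longlonglongrightarrow> K' (- g x) * q' x"
      proof (rule AE_I2, rule tendsto_mult[OF _ tendsto_const])
        fix x
        have "(\<lambda>h. (K (- g x + h) - K (- g x)) / h) \<midarrow>0\<rightarrow> K' (- g x)" using K[of "- g x"] by (simp add: DERIV_def)
        moreover have "filterlim (\<lambda>j. - t j) (at 0) sequentially"
          using tendsto_minus[OF t0] t(1) by (auto simp: filterlim_at less_imp_neq[symmetric])
        ultimately have "(\<lambda>j. (K (- g x + - t j) - K (- g x)) / - t j) \<longlonglongrightarrow> K' (- g x)"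
          by (rule filterlim_compose)
        moreover have "(K (- g x + - t j) - K (- g x)) / - t j = (K (- g x) - K (- g x - t j)) / t j" for j
          using t(1)[of j] by (simp add: field_simps)
        ultimately show "(\<lambda>j. (K (- g x) - K (- g x - t j)) / t j) \<longlonglongrightarrow> K' (- g x)" by simp
      qed
      show "AE x in \<Lambda>. norm ((K (- g x) - K (- g x - t j)) / t j * q' x) \<le> B * Mq" for j
        using AE_\<Lambda>
      proof eventually_elim
        case (elim x)
        have "\<bar>(K (- g x) - K (- g x - t j)) / t j\<bar> \<le> B"
          using G(2)[OF Omega_sub_closure[OF elim]] neg[OF elim] by (intro lip) auto
        then have "\<bar>(K (- g x) - K (- g x - t j)) / t j\<bar> * \<bar>q' x\<bar> \<le> B * Mq"
          by (rule mult_mono[OF _ q'M]) (use B[of 0] G in auto)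
        then show ?case by (simp only: real_norm_def abs_mult)
      qed
    qed simp
    moreover have "(LINT x|\<Lambda>. (K (- g x) - K (- g x - t j)) / t j * q' x) = 0" for j
    proof -
      have bK: "\<exists>C. \<forall>x\<in>\<Omega>. norm (K (- g x - s)) \<le> C" for s
      proof -
        have "compact ((\<lambda>x. K (- g x - s)) ` closure \<Omega>)"
          by (intro compact_continuous_image compact_closure continuous_on_compose2[OF cK] continuous_intros cont_g) auto
        then have "bounded ((\<lambda>x. K (- g x - s)) ` closure \<Omega>)" by (rule compact_imp_bounded)
        then obtain C where "\<forall>y\<in>(\<lambda>x. K (- g x - s)) ` closure \<Omega>. norm y \<le> C" unfolding bounded_iff by blast
        then show ?thesis using Omega_sub_closure by blast
      qed
      have int: "integrable \<Lambda> (\<lambda>x. K (- g x - s) * q' x)" for s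
      proof -
        obtain C where C: "\<forall>x\<in>\<Omega>. norm (K (- g x - s)) \<le> C" using bK by blast
        show ?thesis
        proof (rule \<Lambda>.integrable_const_bound[where B = "C * Mq"])
          show "AE x in \<Lambda>. norm (K (- g x - s) * q' x) \<le> C * Mq"
            using AE_\<Lambda>
          proof eventually_elim
            case (elim x)
            then have "0 \<le> C" using C norm_ge_zero order_trans by blast
            then show ?case using C elim q'M[of x] by (simp add: abs_mult mult_mono)
          qed
        qed (use meas[of s] in simp)
      qed
      have "(LINT x|\<Lambda>. (K (- g x) - K (- g x - t j)) / t j * q' x) = (LINT x|\<Lambda>. (1 / t j) * (K (- g x - 0) * q' x - K (- g x - t j) * q' x))"
        by (intro Bochner_Integration.integral_cong) (auto simp: field_simps)
      also have "\<dots> = (1 / t j) * ((LINT x|\<Lambda>. K (- g x - 0) * q' x) - (LINT x|\<Lambda>. K (- g x - t j) * q' x))"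
        using int[of 0] int[of "t j"] by simp
      also have "\<dots> = 0" using shift[of 0] shift[of "t j"] t(1)[of j] by simp
      finally show ?thesis .
    qed
    ultimately have "(\<lambda>_::nat. 0) \<longlonglongrightarrow> (LINT x|\<Lambda>. K' (- g x) * q' x)" by (simp only:)
    from LIMSEQ_unique[OF this tendsto_const]
    show "(LINT x|\<Lambda>. K (- g x) * (indicator \<Omega> x * 0)) = (LINT x|\<Lambda>. K' (- g x) * (indicator \<Omega> x * q x))"
      by (simp add: q'_def)
  qed
  then show ?thesis using half_ball_vol_pos by (simp add: q_def)
qed

text \<open>The sum of the principal curvatures, that is the divergence of \<open>Dg / |Dg|\<close>.\<close>

definition curv :: "real^'n \<Rightarrow> real" where "curv x = (trace (D2g x) - nrm x \<bullet> (D2g x *v nrm x)) / \<beta> x"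

definition Dbeta :: "real^'n \<Rightarrow> real^'n" where "Dbeta x = (1 / \<beta> x) *\<^sub>R (D2g x *v Dg x + g x *\<^sub>R Dg x)"

lemma \<beta>_has_derivative:
  assumes "x \<in> closure \<Omega>" shows "(\<beta> has_derivative (\<lambda>h. Dbeta x \<bullet> h)) (at x)"
proof -
  have "((\<lambda>x. Dg x \<bullet> Dg x) has_derivative (\<lambda>h. (Dg x v* D2g x + Dg x v* D2g x) \<bullet> h)) (at x)"
    by (rule has_derivative_inner_field[OF Dg_has_derivative Dg_has_derivative])
  moreover have "((\<lambda>x. g x * g x) has_derivative (\<lambda>h. g x * (Dg x \<bullet> h) + (Dg x \<bullet> h) * g x)) (at x)"
    by (rule has_derivative_mult[OF g_has_derivative g_has_derivative])
  ultimately have 1: "((\<lambda>x. Dg x \<bullet> Dg x + g x * g x) has_derivative 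
      (\<lambda>h. (Dg x v* D2g x + Dg x v* D2g x) \<bullet> h + (g x * (Dg x \<bullet> h) + (Dg x \<bullet> h) * g x))) (at x)"
    by (rule has_derivative_add)
  have \<beta>x: "0 < \<beta> x" by (rule \<beta>_pos[OF assms])
  have eq: "\<beta> = (\<lambda>x. sqrt (Dg x \<bullet> Dg x + g x * g x))"
    by (simp add: \<beta>_def fun_eq_iff power2_norm_eq_inner power2_eq_square[of "g _"])
  have pos: "0 < Dg x \<bullet> Dg x + g x * g x" using \<beta>x by (simp add: eq)
  have "(sqrt has_real_derivative inverse (sqrt (Dg x \<bullet> Dg x + g x * g x)) / 2) (at (Dg x \<bullet> Dg x + g x * g x))"
    by (rule DERIV_real_sqrt[OF pos])
  from DERIV_compose_FDERIV[OF this 1]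
  have "(\<beta> has_derivative (\<lambda>h. ((Dg x v* D2g x + Dg x v* D2g x) \<bullet> h + (g x * (Dg x \<bullet> h) + (Dg x \<bullet> h) * g x)) * (inverse (\<beta> x) / 2))) (at x)"
    by (simp add: eq)
  moreover have "((Dg x v* D2g x + Dg x v* D2g x) \<bullet> h + (g x * (Dg x \<bullet> h) + (Dg x \<bullet> h) * g x)) * (inverse (\<beta> x) / 2) = Dbeta x \<bullet> h" for h
  proof -
    have "(Dg x v* D2g x + Dg x v* D2g x) \<bullet> h = 2 * ((D2g x *v Dg x) \<bullet> h)"
      by (simp only: D2g_vector inner_add_left mult_2)
    then show ?thesis using \<beta>x by (simp add: Dbeta_def inner_add_left field_simps)
  qed
  ultimately show ?thesis by (simp only:)
qed

text \<open>The field is first made tangential: \<open>c x *\<^sub>R Q x\<close> is orthogonal to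
  \<open>Dg x\<close> on every level set of \<open>g\<close>. It involves no division by the length
  of \<open>Dg\<close>, which may vanish inside, and on the frontier it equals
  \<open>\<beta> x\<close> times the tangential part of \<open>Y x\<close>. That factor cancels the
  \<open>1 / \<beta> x\<close> in \<open>surface_divergence_tangential\<close>.\<close>

lemma surface_divergence:
  fixes Y :: "real^'n \<Rightarrow> real^'n" and JY :: "real^'n \<Rightarrow> real^'n^'n"
  assumes Y: "\<And>x. x \<in> \<Omega> \<Longrightarrow> (Y has_derivative (\<lambda>h. JY x *v h)) (at x)" 
    and cY: "continuous_on (closure \<Omega>) Y" and cJY: "continuous_on (closure \<Omega>) JY"
  shows "surf_int \<Gamma> (\<lambda>x. trace (JY x) - nrm x \<bullet> (JY x *v nrm x) - (Y x \<bullet> nrm x) * curv x) = 0"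
proof -
  define c where "c x = 1 / \<beta> x" for x
  define Dc where "Dc x = (- 1 / (\<beta> x)\<^sup>2) *\<^sub>R Dbeta x" for x
  define Q where "Q x = (Dg x \<bullet> Dg x) *\<^sub>R Y x - (Y x \<bullet> Dg x) *\<^sub>R Dg x" for x
  define JQ where "JQ x = ((Dg x \<bullet> Dg x) *\<^sub>R JY x + outer_prod (Y x) (Dg x v* D2g x + Dg x v* D2g x))
     - ((Y x \<bullet> Dg x) *\<^sub>R D2g x + outer_prod (Dg x) (Dg x v* JY x + Y x v* D2g x))" for x
  define JV where "JV x = c x *\<^sub>R JQ x + outer_prod (Q x) (Dc x)" for x
  have bnz: "\<forall>x\<in>closure \<Omega>. \<beta> x \<noteq> 0" using \<beta>_pos less_irrefl by metis
  have zero_int: "surf_int \<Gamma> (\<lambda>x. trace (JV x) / \<beta> x) = 0"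
  proof (rule surface_divergence_tangential[where V = "\<lambda>x. c x *\<^sub>R Q x"])
    fix x assume x: "x \<in> \<Omega>"
    have xc: "x \<in> closure \<Omega>" by (rule Omega_sub_closure[OF x])
    have dc: "(c has_derivative (\<lambda>h. Dc x \<bullet> h)) (at x)"
    proof -
      have "((\<lambda>x. inverse (\<beta> x)) has_derivative (\<lambda>h. - (inverse (\<beta> x) * (Dbeta x \<bullet> h) * inverse (\<beta> x)))) (at x)"
        by (rule Deriv.has_derivative_inverse[OF _ \<beta>_has_derivative[OF xc]]) (use \<beta>_pos[OF xc] in simp)
      then have "(c has_derivative (\<lambda>h. - (inverse (\<beta> x) * (Dbeta x \<bullet> h) * inverse (\<beta> x)))) (at x)"
        by (simp add: c_def[abs_def] inverse_eq_divide)
      then show ?thesis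
        by (rule has_derivative_eq_rhs) (simp add: fun_eq_iff Dc_def power2_eq_square inverse_eq_divide)
    qed
    have dQ: "(Q has_derivative (\<lambda>h. JQ x *v h)) (at x)"
      unfolding Q_def[abs_def] JQ_def
      by (intro has_derivative_diff_field has_derivative_scale_field has_derivative_inner_field Dg_has_derivative Y x)
    show "((\<lambda>x. c x *\<^sub>R Q x) has_derivative (\<lambda>h. JV x *v h)) (at x)"
      unfolding JV_def by (rule has_derivative_scale_field[OF dc dQ])
    show "c x *\<^sub>R Q x \<bullet> Dg x = 0"
      by (simp add: Q_def inner_diff_left mult.commute)
  next
    show "continuous_on (closure \<Omega>) JV"
      unfolding JV_def JQ_def Q_def Dc_def c_def Dbeta_def
      by (intro continuous_intros continuous_on_outer_prod continuous_on_vector_matrix continuous_on_matrix_vector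
          cont_Dg cont_D2g cont_g cont_\<beta> cY cJY) (use bnz in auto)
  qed
  have eq: "trace (JV x) / \<beta> x = trace (JY x) - nrm x \<bullet> (JY x *v nrm x) - (Y x \<bullet> nrm x) * curv x" if x: "x \<in> \<Gamma>" for x
  proof -
    define b where "b = \<beta> x"
    have b: "0 < b" using \<beta>_pos[OF frontier_closure[OF x]] by (simp add: b_def)
    define n where "n = nrm x"
    have nn: "n \<bullet> n = 1" using nrm_inner_self[OF x] by (simp add: n_def)
    have Dg: "Dg x = b *\<^sub>R n" unfolding b_def n_def by (rule Dg_eq_nrm[OF frontier_closure[OF x]])
    define A where "A = D2g x"
    have sym: "v \<bullet> (A *v w) = w \<bullet> (A *v v)" for v w
      using dot_lmul_matrix[of v A w] D2g_vector[of v x] by (simp add: A_def inner_commute)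
    have vA: "v v* A = A *v v" for v using D2g_vector[of v x] by (simp add: A_def)
    \<comment> \<open>The terms with \<open>Y x \<bullet> (A *v n)\<close> cancel in the end: two
      come from differentiating \<open>Dg x \<bullet> Dg x\<close>, minus one from
      \<open>Y x \<bullet> Dg x\<close>, minus one from \<open>1 / \<beta> x\<close>.\<close>
    have trJQ: "trace (JQ x) = b\<^sup>2 * trace (JY x) + 2 * b * (Y x \<bullet> (A *v n)) - b * (Y x \<bullet> n) * trace A
       - (b\<^sup>2 * (n \<bullet> (JY x *v n)) + b * (Y x \<bullet> (A *v n)))"
    proof -
      have t: "trace (JQ x) = (Dg x \<bullet> Dg x) * trace (JY x) + Y x \<bullet> (Dg x v* A + Dg x v* A)
          - ((Y x \<bullet> Dg x) * trace A + Dg x \<bullet> (Dg x v* JY x + Y x v* A))"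
        by (simp only: JQ_def A_def trace_sub trace_add trace_scaleR trace_outer_prod)
      have e1: "Dg x \<bullet> Dg x = b\<^sup>2" using nn by (simp add: Dg power2_eq_square)
      have e2: "Y x \<bullet> (Dg x v* A + Dg x v* A) = 2 * b * (Y x \<bullet> (A *v n))"
      proof -
        have "Y x \<bullet> (Dg x v* A) = b * (Y x \<bullet> (A *v n))"
          unfolding vA Dg by (subst matrix_vector_mult_scaleR) simp
        then show ?thesis unfolding inner_add_right by linarith
      qed
      have e3: "Y x \<bullet> Dg x = b * (Y x \<bullet> n)" by (simp add: Dg)
      have e4: "Dg x \<bullet> (Dg x v* JY x) = b\<^sup>2 * (n \<bullet> (JY x *v n))"
        by (subst inner_commute) (simp add: dot_lmul_matrix Dg matrix_vector_mult_scaleR power2_eq_square)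
      have e5: "Dg x \<bullet> (Y x v* A) = b * (Y x \<bullet> (A *v n))"
        unfolding vA Dg inner_scaleR_left sym[of n "Y x"] ..
      have e6: "Dg x \<bullet> (Dg x v* JY x + Y x v* A) = b\<^sup>2 * (n \<bullet> (JY x *v n)) + b * (Y x \<bullet> (A *v n))"
        by (simp only: inner_add_right e4 e5)
      show ?thesis unfolding t e1 e2 e3 e6 by (simp add: algebra_simps)
    qed
    have Db: "Dbeta x = A *v n" using b zero[OF x] by (simp add: Dbeta_def Dg A_def matrix_vector_mult_scaleR b_def)
    have Q: "Q x = b\<^sup>2 *\<^sub>R (Y x - (Y x \<bullet> n) *\<^sub>R n)"
      using nn by (simp add: Q_def Dg power2_eq_square scaleR_diff_right mult_ac)
    have "trace (JV x) = (1 / b) * trace (JQ x) - ((Y x \<bullet> (A *v n)) - (Y x \<bullet> n) * (n \<bullet> (A *v n)))"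
      using b by (simp add: JV_def c_def b_def[symmetric] trace_add trace_scaleR trace_outer_prod Q Dc_def Db inner_diff_left)
    also have "\<dots> = b * (trace (JY x) - n \<bullet> (JY x *v n) - (Y x \<bullet> n) * ((trace A - n \<bullet> (A *v n)) / b))"
      unfolding trJQ using b by (simp add: field_simps power2_eq_square)
    finally show ?thesis using b by (simp add: b_def[symmetric] n_def[symmetric] curv_def A_def[symmetric])
  qed
  show ?thesis unfolding zero_int[symmetric] by (rule surf_int_cong) (rule eq[symmetric])
qed

end

section \<open>The normal field and its Jacobian on the boundary\<close>

text \<open>A derivative within \<open>S\<close> is evaluated along rays that stay in
  \<open>S\<close>; for the closure of \<open>\<Omega>\<close> the inward directions provide
  them.\<close>

lemma has_derivative_within_ray:
  fixes f :: "'a::real_normed_vector \<Rightarrow> 'b::real_normed_vector"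
  assumes f: "(f has_derivative L) (at p within S)" and ev: "\<forall>\<^sub>F t in at_right 0. p + t *\<^sub>R h \<in> S"
  shows "((\<lambda>t. (f (p + t *\<^sub>R h) - f p) /\<^sub>R t) \<longlongrightarrow> L h) (at_right 0)"
proof (rule tendstoI)
  fix e :: real assume e: "0 < e"
  have lin: "linear L" using f by (rule has_derivative_linear)
  define d where "d = e / 2 / (norm h + 1)"
  have d: "0 < d" using e by (simp add: d_def add_nonneg_pos)
  obtain r where r: "0 < r" "\<And>y. y \<in> S \<Longrightarrow> norm (y - p) < r \<Longrightarrow> norm (f y - f p - L (y - p)) \<le> d * norm (y - p)"
    using f d unfolding has_derivative_within_alt by metis
  have "\<forall>\<^sub>F t in at_right (0::real). t < r / (norm h + 1)"
    using r by (intro order_tendstoD(2)[OF tendsto_ident_at]) (auto simp: add_nonneg_pos)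
  moreover have "\<forall>\<^sub>F t in at_right (0::real). 0 < t" by (rule eventually_at_right_less)
  ultimately show "\<forall>\<^sub>F t in at_right 0. dist ((f (p + t *\<^sub>R h) - f p) /\<^sub>R t) (L h) < e"
    using ev
  proof eventually_elim
    case (elim t)
    have hp: "0 < norm h + 1" by (simp add: add_nonneg_pos)
    have "t * (norm h + 1) < r" using elim(1) hp by (simp only: pos_less_divide_eq)
    then have "norm (t *\<^sub>R h) < r" using elim(2) by (simp add: distrib_left)
    then have "norm (f (p + t *\<^sub>R h) - f p - L (t *\<^sub>R h)) \<le> d * (t * norm h)"
      using r(2)[OF elim(3)] elim(2) by simp
    then have "norm (f (p + t *\<^sub>R h) - f p - t *\<^sub>R L h) \<le> d * (t * norm h)"
      by (simp add: linear_scale[OF lin])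
    moreover have "dist ((f (p + t *\<^sub>R h) - f p) /\<^sub>R t) (L h) = norm (f (p + t *\<^sub>R h) - f p - t *\<^sub>R L h) / t"
    proof -
      have "(f (p + t *\<^sub>R h) - f p) /\<^sub>R t - L h = (f (p + t *\<^sub>R h) - f p - t *\<^sub>R L h) /\<^sub>R t"
        using elim(2) by (simp add: scaleR_diff_right)
      then show ?thesis unfolding dist_norm using elim(2) by (simp only: norm_scaleR) (simp add: divide_inverse)
    qed
    ultimately have "dist ((f (p + t *\<^sub>R h) - f p) /\<^sub>R t) (L h) \<le> d * norm h"
      using elim(2) by (simp only: pos_divide_le_eq mult_ac)
    also have "\<dots> \<le> d * (norm h + 1)" using d by simp
    also have "\<dots> = e / 2" unfolding d_def by (rule nonzero_eq_divide_eq[THEN iffD1, OF _ refl]) (use hp in simp)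
    finally show ?case using e by simp
  qed
qed

context C2_domain begin

lemma inward_ray:
  assumes p: "p \<in> \<Gamma>" and h: "Dg p \<bullet> h < 0"
  shows "\<forall>\<^sub>F t in at_right 0. p + t *\<^sub>R h \<in> \<Omega>"
proof -
  have "((\<lambda>t. p + t *\<^sub>R h) \<longlongrightarrow> p + 0 *\<^sub>R h) (at_right 0)" by (intro tendsto_intros)
  then have "\<forall>\<^sub>F t in at_right 0. p + t *\<^sub>R h \<in> W"
    using opW frontier_W p by (auto dest: topological_tendstoD)
  moreover have "\<forall>\<^sub>F t in at_right 0. g (p + t *\<^sub>R h) < g p"
    using h by (intro has_derivative_neg_direction[OF g_has_derivative])
  ultimately show ?thesis by eventually_elim (use W_neg zero[OF p] in auto)
qed

lemma inward_ray_closure: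
  assumes "p \<in> \<Gamma>" "Dg p \<bullet> h < 0" shows "\<forall>\<^sub>F t in at_right 0. p + t *\<^sub>R h \<in> closure \<Omega>"
  using inward_ray[OF assms] by eventually_elim (rule Omega_sub_closure)

lemma Dg_nrm_pos: "p \<in> \<Gamma> \<Longrightarrow> 0 < Dg p \<bullet> nrm p"
  using Dg_eq_nrm[OF frontier_closure] nrm_inner_self \<beta>_pos[OF frontier_closure] by simp

text \<open>Every vector is a difference of two inward ones: a large multiple of the normal is
  subtracted.\<close>

lemma derivative_zero_of_inward:
  assumes p: "p \<in> \<Gamma>" and lin: "linear L" and z: "\<And>h. Dg p \<bullet> h < 0 \<Longrightarrow> L h = 0"
  shows "L h = 0"
proof -
  define c where "c = (\<bar>Dg p \<bullet> h\<bar> + 1) / (Dg p \<bullet> nrm p)"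
  have n: "0 < Dg p \<bullet> nrm p" by (rule Dg_nrm_pos[OF p])
  have c: "c * (Dg p \<bullet> nrm p) = \<bar>Dg p \<bullet> h\<bar> + 1" using n by (simp add: c_def)
  have "L (h - c *\<^sub>R nrm p) = 0" by (rule z) (simp add: inner_diff_right c)
  moreover have "L (- c *\<^sub>R nrm p) = 0" by (rule z) (simp add: c)
  moreover have "h = (h - c *\<^sub>R nrm p) - (- c *\<^sub>R nrm p)" by simp
  ultimately show ?thesis using linear_diff[OF lin, of "h - c *\<^sub>R nrm p" "- c *\<^sub>R nrm p"] by simp
qed

text \<open>No curves in the frontier are constructed. By \<open>flatness\<close> the frontier has
  chords \<open>t *\<^sub>R \<tau> + s *\<^sub>R nrm p\<close> at \<open>p\<close> with
  \<open>s\<close> small against \<open>t\<close>, and \<open>f\<close> does not change along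
  them.\<close>

lemma tangential_derivative_zero:
  fixes f :: "real^'n \<Rightarrow> 'b::real_normed_vector"
  assumes p: "p \<in> \<Gamma>" and f: "(f has_derivative L) (at p within closure \<Omega>)"
    and const: "\<And>y. y \<in> \<Gamma> \<Longrightarrow> f y = c" and \<tau>: "\<tau> \<bullet> nrm p = 0"
  shows "L \<tau> = 0"
proof (cases "\<tau> = 0")
  case True then show ?thesis using linear_0[OF has_derivative_linear[OF f]] by simp
next
  case False
  then have n\<tau>: "0 < norm \<tau>" by simp
  have lin: "linear L" using f by (rule has_derivative_linear)
  have "norm (L \<tau>) \<le> e * ((2 + norm (L (nrm p))) * norm \<tau>)" if e: "0 < e" "e < 1" for e
  proof -
    obtain r where r: "0 < r" "\<And>y. y \<in> closure \<Omega> \<Longrightarrow> norm (y - p) < r \<Longrightarrow> norm (f y - f p - L (y - p)) \<le> e * norm (y - p)"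
      using f e(1) unfolding has_derivative_within_alt by metis
    obtain r1 where r1: "0 < r1" "\<And>p v. p \<in> \<Gamma> \<Longrightarrow> v \<bullet> nrm p = 0 \<Longrightarrow> norm v < r1 / 2 \<Longrightarrow>
        \<exists>t. \<bar>t\<bar> \<le> e * norm v \<and> p + v + t *\<^sub>R nrm p \<in> \<Gamma>"
      by (rule flatness[OF e]) (rule that, assumption+)
    define t where "t = min r r1 / (4 * norm \<tau>)"
    have t: "0 < t" "2 * (t * norm \<tau>) < r" "t * norm \<tau> < r1 / 2" using r r1 n\<tau> by (auto simp: t_def field_simps min_def)
    obtain s where s: "\<bar>s\<bar> \<le> e * norm (t *\<^sub>R \<tau>)" "p + t *\<^sub>R \<tau> + s *\<^sub>R nrm p \<in> \<Gamma>"
      using r1(2)[OF p, of "t *\<^sub>R \<tau>"] \<tau> t by auto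
    define y where "y = p + t *\<^sub>R \<tau> + s *\<^sub>R nrm p"
    have s': "\<bar>s\<bar> \<le> e * (t * norm \<tau>)" using s(1) t by simp
    have "e * (t * norm \<tau>) \<le> t * norm \<tau>" using e t by (simp add: mult_left_le_one_le)
    then have s2: "\<bar>s\<bar> \<le> t * norm \<tau>" using s' by linarith
    have yp: "norm (y - p) \<le> 2 * (t * norm \<tau>)"
      using norm_triangle_ineq[of "t *\<^sub>R \<tau>" "s *\<^sub>R nrm p"] norm_nrm[OF p] s2 t by (simp add: y_def add.assoc)
    have "norm (f y - f p - L (y - p)) \<le> e * norm (y - p)"
      using s(2) yp t frontier_closure by (intro r(2)) (auto simp: y_def)
    moreover have "f y - f p = 0" using const[OF s(2)] const[OF p] by (simp add: y_def)
    moreover have "L (y - p) = t *\<^sub>R L \<tau> + s *\<^sub>R L (nrm p)"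
      by (simp add: y_def add.assoc linear_add[OF lin] linear_scale[OF lin])
    ultimately have "norm (t *\<^sub>R L \<tau> + s *\<^sub>R L (nrm p)) \<le> e * norm (y - p)"
      by (metis diff_0 norm_minus_cancel)
    also have "\<dots> \<le> e * (2 * (t * norm \<tau>))" using yp e by (intro mult_left_mono) auto
    finally have "norm (t *\<^sub>R L \<tau>) \<le> e * (2 * (t * norm \<tau>)) + norm (s *\<^sub>R L (nrm p))"
      using norm_triangle_ineq4[of "t *\<^sub>R L \<tau> + s *\<^sub>R L (nrm p)" "s *\<^sub>R L (nrm p)"] by simp
    also have "norm (s *\<^sub>R L (nrm p)) \<le> (e * (t * norm \<tau>)) * norm (L (nrm p))"
      using s' by (simp add: mult_right_mono)
    finally have "t * norm (L \<tau>) \<le> t * (e * ((2 + norm (L (nrm p))) * norm \<tau>))"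
      using t by (simp add: algebra_simps)
    then show ?thesis using t by simp
  qed
  note est = this
  have "norm (L \<tau>) \<le> d" if d: "0 < d" for d
  proof -
    define C where "C = (2 + norm (L (nrm p))) * norm \<tau>"
    have C: "0 < C" using n\<tau> by (auto simp: C_def intro!: mult_pos_pos add_pos_nonneg)
    \<comment> \<open>The bound 1/2 meets the requirement \<open>e < 1\<close> of
      \<open>flatness\<close>.\<close>
    define e where "e = min (1/2) (d / C)"
    have e: "0 < e" "e < 1" using d C by (auto simp: e_def)
    have "norm (L \<tau>) \<le> e * C" unfolding C_def by (rule est[OF e])
    also have "\<dots> \<le> d / C * C" using C by (intro mult_right_mono) (auto simp: e_def)
    finally show ?thesis using C by simp
  qed
  note small = this
  have "norm (L \<tau>) \<le> 0" by (rule field_le_epsilon) (simp add: small)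
  then show ?thesis by simp
qed

end

locale C2_domain_normal = C2_domain \<Omega> g Dg D2g W
  for \<Omega> :: "(real^'n::finite) set" and g Dg D2g W +
  fixes nu :: "real^'n \<Rightarrow> real^'n" and Dnu :: "real^'n \<Rightarrow> real^'n^'n"
  assumes normal: "normal_field_with \<Omega> nu Dnu"
begin

definition Dnrm :: "real^'n \<Rightarrow> real^'n^'n" where
  "Dnrm x = (1 / \<beta> x) *\<^sub>R D2g x + outer_prod (Dg x) ((- 1 / (\<beta> x)\<^sup>2) *\<^sub>R Dbeta x)"

lemma nrm_has_derivative:
  assumes x: "x \<in> closure \<Omega>" shows "(nrm has_derivative (\<lambda>h. Dnrm x *v h)) (at x)"
proof -
  have "((\<lambda>x. inverse (\<beta> x)) has_derivative (\<lambda>h. - (inverse (\<beta> x) * (Dbeta x \<bullet> h) * inverse (\<beta> x)))) (at x)"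
    by (rule Deriv.has_derivative_inverse[OF _ \<beta>_has_derivative[OF x]]) (use \<beta>_pos[OF x] in simp)
  then have "((\<lambda>x. 1 / \<beta> x) has_derivative (\<lambda>h. ((- 1 / (\<beta> x)\<^sup>2) *\<^sub>R Dbeta x) \<bullet> h)) (at x)"
    by (simp add: inverse_eq_divide power2_eq_square)
  from has_derivative_scale_field[OF this Dg_has_derivative[of x]]
  show ?thesis by (simp add: nrm_def[abs_def] Dnrm_def)
qed

lemma nu_derivative: "x \<in> \<Gamma> \<Longrightarrow> (nu has_derivative (\<lambda>h. Dnu x *v h)) (at x within closure \<Omega>)"
  using normal by (simp add: normal_field_with_def)

text \<open>The eikonal equation at a point of differentiability: the distance to the frontier is
  1-Lipschitz, and towards a nearest frontier point it decreases with unit speed.\<close>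

lemma norm_nu_interior:
  assumes x: "x \<in> \<Omega>" and d: "((\<lambda>y. setdist {y} \<Gamma>) has_derivative (\<lambda>h. - (nu x \<bullet> h))) (at x within closure \<Omega>)"
  shows "norm (nu x) = 1"
proof -
  define \<delta> where "\<delta> y = infdist y \<Gamma>" for y
  have \<delta>: "(\<delta> has_derivative (\<lambda>h. - (nu x \<bullet> h))) (at x)"
  proof -
    have "at x within closure \<Omega> = at x"
      by (rule at_within_interior) (use x op interior_maximal[OF closure_subset op] in blast)
    moreover have "(\<lambda>y. setdist {y} \<Gamma>) = \<delta>"
      using frontier_nonempty by (auto simp: fun_eq_iff \<delta>_def infdist_eq_setdist)
    ultimately show ?thesis using d by simp
  qed
  have ray: "((\<lambda>t. (\<delta> (x + t *\<^sub>R h) - \<delta> x) /\<^sub>R t) \<longlongrightarrow> - (nu x \<bullet> h)) (at_right 0)" for h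
    by (rule has_derivative_within_ray[OF \<delta>]) simp
  have lip: "\<bar>\<delta> y - \<delta> y'\<bar> \<le> dist y y'" for y y'
    using infdist_triangle[of y \<Gamma> y'] infdist_triangle[of y' \<Gamma> y] by (simp add: \<delta>_def dist_commute abs_le_iff)
  have le: "\<bar>nu x \<bullet> h\<bar> \<le> norm h" for h
  proof -
    have "\<bar>- (nu x \<bullet> h)\<bar> \<le> norm h"
    proof (rule tendsto_upperbound[OF tendsto_rabs[OF ray]])
      have "\<forall>\<^sub>F t in at_right (0::real). 0 < t" by (rule eventually_at_right_less)
      then show "\<forall>\<^sub>F t in at_right 0. \<bar>(\<delta> (x + t *\<^sub>R h) - \<delta> x) /\<^sub>R t\<bar> \<le> norm h"
      proof eventually_elim
        case (elim t)
        have "\<bar>\<delta> (x + t *\<^sub>R h) - \<delta> x\<bar> \<le> t * norm h" using lip[of "x + t *\<^sub>R h" x] elim by (simp add: dist_norm)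
        then show ?case using elim by (simp add: abs_mult field_simps)
      qed
    qed simp
    then show ?thesis by simp
  qed
  have "norm (nu x) \<le> 1"
    using le[of "nu x"] by (cases "nu x = 0") (simp_all add: dot_square_norm power2_eq_square)
  moreover have "1 \<le> norm (nu x)"
  proof -
    obtain p where p: "p \<in> \<Gamma>" "infdist x \<Gamma> = dist x p"
      using infdist_attains_inf[OF frontier_closed frontier_nonempty] by blast
    define d where "d = norm (p - x)"
    have d: "0 < d" using p x frontier_disjoint by (auto simp: d_def)
    define e where "e = (1 / d) *\<^sub>R (p - x)"
    have ne: "norm e = 1" using d by (simp add: e_def d_def)
    have \<delta>x: "\<delta> x = d" using p by (simp add: \<delta>_def d_def dist_norm norm_minus_commute)
    \<comment> \<open>A step \<open>t\<close> towards the nearest point \<open>p\<close> lowers the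
      distance by exactly \<open>t\<close>: by no more because of the Lipschitz bound, by no less
      because \<open>p\<close> is then at distance \<open>d - t\<close>.\<close>
    have "- (nu x \<bullet> e) = - 1"
    proof (rule tendsto_unique[OF _ ray])
      have "\<forall>\<^sub>F t in at_right 0. t < d" using d by (intro order_tendstoD(2)[OF tendsto_ident_at])
      moreover have "\<forall>\<^sub>F t in at_right (0::real). 0 < t" by (rule eventually_at_right_less)
      ultimately have "\<forall>\<^sub>F t in at_right 0. (\<delta> (x + t *\<^sub>R e) - \<delta> x) /\<^sub>R t = - 1"
      proof eventually_elim
        case (elim t)
        have de: "p - x = d *\<^sub>R e" using d by (simp add: e_def)
        have "p - (x + t *\<^sub>R e) = (p - x) - t *\<^sub>R e" by simp
        also have "\<dots> = (d - t) *\<^sub>R e" unfolding de by (simp add: scaleR_diff_left)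
        finally have "p - (x + t *\<^sub>R e) = (d - t) *\<^sub>R e" .
        then have "\<delta> (x + t *\<^sub>R e) \<le> d - t"
          using infdist_le[OF p(1), of "x + t *\<^sub>R e"] ne elim by (simp add: \<delta>_def dist_norm norm_minus_commute)
        moreover have "d - t \<le> \<delta> (x + t *\<^sub>R e)"
          using lip[of x "x + t *\<^sub>R e"] ne elim \<delta>x by (simp add: dist_norm)
        ultimately have "\<delta> (x + t *\<^sub>R e) - \<delta> x = - t" using \<delta>x by simp
        then show ?case using elim by simp
      qed
      then show "((\<lambda>t. (\<delta> (x + t *\<^sub>R e) - \<delta> x) /\<^sub>R t) \<longlongrightarrow> - 1) (at_right 0)" by (rule tendsto_eventually)
    qed simp
    then show ?thesis using Cauchy_Schwarz_ineq2[of "nu x" e] ne by simp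
  qed
  ultimately show ?thesis by simp
qed

lemma norm_nu_near: 
  assumes p: "p \<in> \<Gamma>" and h: "Dg p \<bullet> h < 0"
  shows "\<forall>\<^sub>F t in at_right 0. norm (nu (p + t *\<^sub>R h)) = 1"
proof -
  obtain U where U: "open U" "\<Gamma> \<subseteq> U" and
    d: "\<And>x. x \<in> U \<inter> closure \<Omega> \<Longrightarrow> ((\<lambda>y. setdist {y} \<Gamma>) has_derivative (\<lambda>h. - (nu x \<bullet> h))) (at x within closure \<Omega>)"
    using normal unfolding normal_field_with_def by blast
  have "((\<lambda>t. p + t *\<^sub>R h) \<longlongrightarrow> p + 0 *\<^sub>R h) (at_right 0)" by (intro tendsto_intros)
  then have "\<forall>\<^sub>F t in at_right 0. p + t *\<^sub>R h \<in> U" using U p by (auto dest: topological_tendstoD)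
  then show ?thesis using inward_ray[OF p h]
    by eventually_elim (intro norm_nu_interior d, auto simp: Omega_sub_closure)
qed

text \<open>The length is a limit of interior values along the inner normal; the existence of
  \<open>Dnu p\<close> supplies the continuity of \<open>nu\<close> at \<open>p\<close>.\<close>

lemma norm_nu: assumes p: "p \<in> \<Gamma>" shows "norm (nu p) = 1"
proof -
  have h: "Dg p \<bullet> (- nrm p) < 0" using Dg_nrm_pos[OF p] by simp
  have "((\<lambda>t. norm (nu (p + t *\<^sub>R (- nrm p)))) \<longlongrightarrow> norm (nu p)) (at_right 0)"
  proof (rule tendsto_norm)
    have cont: "continuous (at p within closure \<Omega>) nu" by (rule has_derivative_continuous[OF nu_derivative[OF p]])
    have "filterlim (\<lambda>t. p + t *\<^sub>R (- nrm p)) (at p within closure \<Omega>) (at_right 0)"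
      unfolding filterlim_at
    proof
      have "((\<lambda>t. p + t *\<^sub>R (- nrm p)) \<longlongrightarrow> p + 0 *\<^sub>R (- nrm p)) (at_right 0)" by (intro tendsto_intros)
      then show "((\<lambda>t. p + t *\<^sub>R (- nrm p)) \<longlongrightarrow> p) (at_right 0)" by simp
      show "\<forall>\<^sub>F t in at_right 0. p + t *\<^sub>R (- nrm p) \<in> closure \<Omega> \<and> p + t *\<^sub>R (- nrm p) \<noteq> p"
        using inward_ray[OF p h]
        by eventually_elim (use frontier_disjoint[OF p] Omega_sub_closure in auto)
    qed
    then show "((\<lambda>t. nu (p + t *\<^sub>R (- nrm p))) \<longlongrightarrow> nu p) (at_right 0)"
      using cont unfolding continuous_within by (rule filterlim_compose[rotated])
  qed
  moreover have "((\<lambda>t. norm (nu (p + t *\<^sub>R (- nrm p)))) \<longlongrightarrow> 1) (at_right 0)"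
    by (rule tendsto_eventually[OF norm_nu_near[OF p h]])
  ultimately show ?thesis by (rule tendsto_unique[rotated]) simp
qed

text \<open>The distance is nonnegative and zero at \<open>p\<close>, so
  \<open>- (nu p \<bullet> h)\<close> is nonnegative in inward directions.
  \<open>half_space_cone\<close> makes \<open>nu p\<close> a nonnegative multiple of
  \<open>Dg p\<close>, and unit length fixes the factor.\<close>

lemma nu_eq_nrm: assumes p: "p \<in> \<Gamma>" shows "nu p = nrm p"
proof -
  have d: "((\<lambda>y. setdist {y} \<Gamma>) has_derivative (\<lambda>h. - (nu p \<bullet> h))) (at p within closure \<Omega>)"
    using normal p frontier_closure unfolding normal_field_with_def by blast
  have le: "nu p \<bullet> h \<le> 0" if h: "Dg p \<bullet> h < 0" for h
  proof -
    have "0 \<le> - (nu p \<bullet> h)"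
    proof (rule tendsto_lowerbound[OF has_derivative_within_ray[OF d inward_ray_closure[OF p h]]])
      have "\<forall>\<^sub>F t in at_right (0::real). 0 < t" by (rule eventually_at_right_less)
      then show "\<forall>\<^sub>F t in at_right 0. 0 \<le> (setdist {p + t *\<^sub>R h} \<Gamma> - setdist {p} \<Gamma>) /\<^sub>R t"
      proof eventually_elim
        case (elim t)
        have "setdist {p} \<Gamma> = 0" using p by (simp add: setdist_eq_0_sing_1 closure_subset[THEN subsetD])
        then show ?case using elim setdist_pos_le[of "{p + t *\<^sub>R h}" \<Gamma>] by simp
      qed
    qed simp
    then show ?thesis by simp
  qed
  from half_space_cone[OF Dg_nz[OF p] le]
  have k: "nu p = ((nu p \<bullet> Dg p) / (Dg p \<bullet> Dg p)) *\<^sub>R Dg p" "0 \<le> nu p \<bullet> Dg p" by blast+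
  define c where "c = ((nu p \<bullet> Dg p) / (Dg p \<bullet> Dg p)) * \<beta> p"
  have c0: "0 \<le> c" using k(2) \<beta>_pos[OF frontier_closure[OF p]] by (simp add: c_def)
  have nc: "nu p = c *\<^sub>R nrm p" using k(1) unfolding c_def by (subst (asm) (3) Dg_eq_nrm[OF frontier_closure[OF p]]) simp
  then have "\<bar>c\<bar> = 1" using norm_nu[OF p] norm_nrm[OF p] by simp
  then show ?thesis using nc c0 by simp
qed

text \<open>\<open>nu\<close> has length 1 along inward rays close to \<open>p\<close>, and the
  inward directions determine the derivative of \<open>nu x \<bullet> nu x\<close>.\<close>

lemma nu_Dnu_zero: assumes p: "p \<in> \<Gamma>" shows "nu p \<bullet> (Dnu p *v h) = 0"
proof -
  define L where "L h = nu p \<bullet> (Dnu p *v h) + (Dnu p *v h) \<bullet> nu p" for h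
  have d: "((\<lambda>x. nu x \<bullet> nu x) has_derivative L) (at p within closure \<Omega>)"
    unfolding L_def by (rule has_derivative_inner[OF nu_derivative[OF p] nu_derivative[OF p]])
  have "L h = 0"
  proof (rule derivative_zero_of_inward[OF p has_derivative_linear[OF d]])
    fix h assume h: "Dg p \<bullet> h < 0"
    show "L h = 0"
    proof (rule tendsto_unique[OF _ has_derivative_within_ray[OF d inward_ray_closure[OF p h]]])
      have "\<forall>\<^sub>F t in at_right 0. (nu (p + t *\<^sub>R h) \<bullet> nu (p + t *\<^sub>R h) - nu p \<bullet> nu p) /\<^sub>R t = 0"
        using norm_nu_near[OF p h] by eventually_elim (use norm_nu[OF p] in \<open>simp add: norm_eq_1\<close>)
      then show "((\<lambda>t. (nu (p + t *\<^sub>R h) \<bullet> nu (p + t *\<^sub>R h) - nu p \<bullet> nu p) /\<^sub>R t) \<longlongrightarrow> 0) (at_right 0)"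
        by (rule tendsto_eventually)
    qed simp
  qed
  then show ?thesis by (simp add: L_def inner_commute)
qed

text \<open>The matrix equals \<open>outer_prod (A *v n) n\<close>. It will be the difference of two
  Jacobians that agree on tangent vectors.\<close>

lemma trace_normal_matrix:
  fixes A :: "real^'n^'n"
  assumes A: "\<And>\<tau>. \<tau> \<bullet> n = 0 \<Longrightarrow> A *v \<tau> = 0" and n: "n \<bullet> n = 1"
  shows "trace A = (A *v n) \<bullet> n"
proof -
  have "A = outer_prod (A *v n) n"
  proof -
    have "A *v v = outer_prod (A *v n) n *v v" for v
    proof -
      have "A *v (v - (v \<bullet> n) *\<^sub>R n) = 0" by (rule A) (simp add: inner_diff_left n)
      then show ?thesis
        by (simp add: outer_prod_mult_vec matrix_vector_mult_diff_distrib matrix_vector_mult_scaleR inner_commute)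
    qed
    then show ?thesis unfolding matrix_eq by blast
  qed
  then have "trace A = trace (outer_prod (A *v n) n)" by (rule arg_cong)
  then show ?thesis by (simp only: trace_outer_prod)
qed

text \<open>\<open>nu\<close> and \<open>nrm\<close> agree on the frontier, so their Jacobians agree
  on tangent vectors and the traces can differ only by the normal entries. Both entries are 0: for
  \<open>nu\<close> because of its constant length, for \<open>nrm\<close> because its squared
  length is \<open>1 - (g x / \<beta> x)^2\<close>, which is constant to first order on the
  frontier.\<close>

lemma trace_Dnu: assumes p: "p \<in> \<Gamma>" shows "trace (Dnu p) = curv p"
proof -
  define b where "b = \<beta> p"
  have b: "0 < b" using \<beta>_pos[OF frontier_closure[OF p]] by (simp add: b_def)
  define n where "n = nrm p"
  have nn: "n \<bullet> n = 1" using nrm_inner_self[OF p] by (simp add: n_def)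
  have Dg: "Dg p = b *\<^sub>R n" unfolding b_def n_def by (rule Dg_eq_nrm[OF frontier_closure[OF p]])
  have Db: "Dbeta p = D2g p *v n" using b zero[OF p] by (simp add: Dbeta_def Dg matrix_vector_mult_scaleR b_def)
  have Dn: "Dnrm p = (1 / b) *\<^sub>R D2g p + outer_prod (b *\<^sub>R n) ((- 1 / b\<^sup>2) *\<^sub>R (D2g p *v n))"
    by (simp add: Dnrm_def b_def[symmetric] Db Dg)
  have "trace (Dnu p - Dnrm p) = ((Dnu p - Dnrm p) *v n) \<bullet> n"
  proof (rule trace_normal_matrix[OF _ nn])
    fix \<tau> assume \<tau>: "\<tau> \<bullet> n = 0"
    show "(Dnu p - Dnrm p) *v \<tau> = 0"
    proof (rule tangential_derivative_zero[OF p, where f = "\<lambda>x. nu x - nrm x" and c = 0 and L = "\<lambda>h. (Dnu p - Dnrm p) *v h"])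
      show "((\<lambda>x. nu x - nrm x) has_derivative (\<lambda>h. (Dnu p - Dnrm p) *v h)) (at p within closure \<Omega>)"
        by (rule has_derivative_diff_field[OF nu_derivative[OF p] has_derivative_at_withinI[OF nrm_has_derivative[OF frontier_closure[OF p]]]])
      show "nu y - nrm y = 0" if "y \<in> \<Gamma>" for y using nu_eq_nrm[OF that] by simp
    qed (use \<tau> in \<open>simp add: n_def\<close>)
  qed
  also have "\<dots> = n \<bullet> (Dnu p *v n) - n \<bullet> (Dnrm p *v n)"
    by (simp only: matrix_vector_mult_diff_rdistrib inner_diff_left inner_commute[of "_ *v n" n])
  also have "n \<bullet> (Dnu p *v n) = 0"
    using nu_Dnu_zero[OF p, of n] unfolding nu_eq_nrm[OF p] n_def .
  also have "n \<bullet> (Dnrm p *v n) = 0"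
  proof -
    have E: "Dnrm p *v n = (1 / b) *\<^sub>R (D2g p *v n) + (((- 1 / b\<^sup>2) *\<^sub>R (D2g p *v n)) \<bullet> n) *\<^sub>R (b *\<^sub>R n)"
      unfolding Dn matrix_vector_mult_add_rdistrib outer_prod_mult_vec scaleR_matrix_vector_assoc[symmetric] ..
    define k where "k = n \<bullet> (D2g p *v n)"
    have k: "(D2g p *v n) \<bullet> n = k" by (simp add: k_def inner_commute)
    have "n \<bullet> (Dnrm p *v n) = (1 / b) * k + ((- 1 / b\<^sup>2) * k) * b"
      unfolding E inner_add_right inner_scaleR_right inner_scaleR_left nn k k_def[symmetric] by simp
    then show ?thesis using b by (simp add: power2_eq_square)
  qed
  finally have "trace (Dnu p) = trace (Dnrm p)" by (simp add: trace_sub)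
  also have "\<dots> = (1 / b) * trace (D2g p) - (1 / b) * (n \<bullet> (D2g p *v n))"
  proof -
    have "trace (Dnrm p) = (1 / b) * trace (D2g p) + b * ((- 1 / b\<^sup>2) * (n \<bullet> (D2g p *v n)))"
      unfolding Dn trace_add trace_scaleR trace_outer_prod inner_scaleR_left inner_scaleR_right by simp
    then show ?thesis using b by (simp add: power2_eq_square)
  qed
  finally show ?thesis by (simp add: curv_def b_def[symmetric] n_def[symmetric] diff_divide_distrib)
qed

end

section \<open>The integral identities\<close>

lemma matrix_mult_outer_prod: "A ** outer_prod x y = outer_prod (A *v x) y"
  by (simp add: outer_prod_def matrix_matrix_mult_def matrix_vector_mult_def vec_eq_iff sum_distrib_right sum_distrib_left mult_ac)

lemma trace_mult_add: "trace (A ** (B + C)) = trace (A ** B) + trace (A ** (C :: real^'n::finite^'n))"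
  by (simp add: trace_def matrix_matrix_mult_def distrib_left sum.distrib)

lemma trace_mult_diff: "trace (A ** (B - C)) = trace (A ** B) - trace (A ** (C :: real^'n::finite^'n))"
  by (simp add: trace_def matrix_matrix_mult_def right_diff_distrib sum_subtractf)

lemma trace_mult_scaleR: "trace (A ** (c *\<^sub>R B)) = c * trace (A ** (B :: real^'n::finite^'n))"
  by (simp add: trace_def matrix_matrix_mult_def sum_distrib_left mult_ac)

lemma trace_square_symmetric:
  assumes "transpose A = (A :: real^'n::finite^'n)"
  shows "trace (A ** A) = (\<Sum>i\<in>UNIV. \<Sum>j\<in>UNIV. (A $ i $ j)\<^sup>2)"
proof -
  have "A $ j $ i = A $ i $ j" for i j using assms by (metis transpose_def vec_lambda_beta)
  then show ?thesis by (simp add: trace_def matrix_matrix_mult_def power2_eq_square)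
qed

locale torsion_problem = C2_domain_normal \<Omega> g Dg D2g W nu Dnu
  for \<Omega> :: "(real^'n::finite) set" and g Dg D2g W nu Dnu +
  fixes u :: "real^'n \<Rightarrow> real" and Du :: "real^'n \<Rightarrow> real^'n" and D2u :: "real^'n \<Rightarrow> real^'n^'n"
    and z :: "real^'n" and R :: real
  assumes C2u: "C2_closure_with \<Omega> u Du D2u"
    and lap: "x \<in> \<Omega> \<Longrightarrow> trace (D2u x) = real CARD('n)"
    and neu: "x \<in> \<Gamma> \<Longrightarrow> Du x \<bullet> nu x = R"
begin

definition ubar :: real where "ubar = Sup (u ` closure \<Omega>)"
definition w :: "real^'n \<Rightarrow> real" where "w x = ubar - u x"
definition Dh :: "real^'n \<Rightarrow> real^'n" where "Dh x = (x - z) - Du x"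
definition Mh :: "real^'n \<Rightarrow> real^'n^'n" where "Mh x = mat 1 - D2u x"

lemma cont_u: "continuous_on (closure \<Omega>) u" and cont_Du: "continuous_on (closure \<Omega>) Du"
  and cont_D2u: "continuous_on (closure \<Omega>) D2u"
  using C2u by (auto simp: C2_closure_with_def)

lemma Du_within: "x \<in> closure \<Omega> \<Longrightarrow> (Du has_derivative (\<lambda>h. D2u x *v h)) (at x within closure \<Omega>)"
  using C2u by (auto simp: C2_closure_with_def)

lemma at_within_closure: "x \<in> \<Omega> \<Longrightarrow> at x within closure \<Omega> = at x"
  using op interior_maximal[OF closure_subset op] by (intro at_within_interior) blast

lemma u_derivative: "x \<in> \<Omega> \<Longrightarrow> (u has_derivative (\<lambda>h. Du x \<bullet> h)) (at x)"
  and Du_derivative: "x \<in> \<Omega> \<Longrightarrow> (Du has_derivative (\<lambda>h. D2u x *v h)) (at x)"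
proof -
  assume x: "x \<in> \<Omega>"
  have "(u has_derivative (\<lambda>h. Du x \<bullet> h)) (at x within closure \<Omega>)" "(Du has_derivative (\<lambda>h. D2u x *v h)) (at x within closure \<Omega>)"
    using C2u Omega_sub_closure[OF x] by (auto simp: C2_closure_with_def)
  then show "(u has_derivative (\<lambda>h. Du x \<bullet> h)) (at x)" "(Du has_derivative (\<lambda>h. D2u x *v h)) (at x)"
    unfolding at_within_closure[OF x] .
qed

lemma D2u_symmetric: "x \<in> \<Omega> \<Longrightarrow> transpose (D2u x) = D2u x"
  by (rule second_derivative_symmetric[OF u_derivative op _ Du_derivative])

lemma trace_D2u: "x \<in> closure \<Omega> \<Longrightarrow> trace (D2u x) = real CARD('n)"
  by (rule continuous_constant_on_closure[OF continuous_on_trace[OF cont_D2u] lap])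

lemma trace_Mh: "x \<in> closure \<Omega> \<Longrightarrow> trace (Mh x) = 0"
  by (simp add: Mh_def trace_sub trace_D2u trace_I)

lemma cont_w: "continuous_on (closure \<Omega>) w" and cont_Dh: "continuous_on (closure \<Omega>) Dh"
  and cont_Mh: "continuous_on (closure \<Omega>) Mh"
  unfolding w_def Dh_def Mh_def by (intro continuous_intros cont_u cont_Du cont_D2u)+

lemma w_derivative: "x \<in> \<Omega> \<Longrightarrow> (w has_derivative (\<lambda>h. (- Du x) \<bullet> h)) (at x)"
  unfolding w_def[abs_def] by (auto intro!: derivative_eq_intros u_derivative)

lemma Dh_derivative: "x \<in> \<Omega> \<Longrightarrow> (Dh has_derivative (\<lambda>h. Mh x *v h)) (at x)"
  unfolding Dh_def[abs_def] Mh_def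
  by (intro has_derivative_diff_field Du_derivative) (auto intro!: derivative_eq_intros)

lemma integrable_compact_Omega:
  fixes f :: "real^'n \<Rightarrow> real"
  assumes f: "continuous_on \<Omega> f" and C: "compact C" "C \<subseteq> \<Omega>" "\<And>x. x \<notin> C \<Longrightarrow> x \<in> \<Omega> \<Longrightarrow> f x = 0"
  shows "integrable lborel (\<lambda>x. indicator \<Omega> x * f x)"
proof -
  have "integrable lborel (\<lambda>x. indicator C x *\<^sub>R f x)"
    using borel_integrable_compact[OF C(1) continuous_on_subset[OF f C(2)]] by (simp add: set_integrable_def)
  moreover have "(\<lambda>x. indicator C x *\<^sub>R f x) = (\<lambda>x. indicator \<Omega> x * f x)"
    using C(2,3) by (auto simp: indicator_def fun_eq_iff)
  ultimately show ?thesis by simp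
qed

text \<open>\<open>F\<close> is only continuous, so its divergence cannot be taken directly; the part \<open>G\<close> is differentiable and
  the remaining term is handled by \<open>integral_trace_swap\<close>.\<close>

definition G :: "real^'n \<Rightarrow> real^'n" where
  "G x = (1/2 * (Du x \<bullet> Du x + R\<^sup>2)) *\<^sub>R Dh x - (Du x \<bullet> Dh x) *\<^sub>R Du x - (real CARD('n) * w x) *\<^sub>R Dh x"

definition F :: "real^'n \<Rightarrow> real^'n" where "F x = G x - w x *\<^sub>R (Mh x *v Du x)"

definition JG :: "real^'n \<Rightarrow> real^'n^'n" where
  "JG x = ((1/2 * (Du x \<bullet> Du x + R\<^sup>2)) *\<^sub>R Mh x + outer_prod (Dh x) ((1/2) *\<^sub>R (Du x v* D2u x + Du x v* D2u x)))
    - ((Du x \<bullet> Dh x) *\<^sub>R D2u x + outer_prod (Du x) (Dh x v* D2u x + Du x v* Mh x))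
    - ((real CARD('n) * w x) *\<^sub>R Mh x + outer_prod (Dh x) (real CARD('n) *\<^sub>R (- Du x)))"

lemma G_derivative: assumes x: "x \<in> \<Omega>" shows "(G has_derivative (\<lambda>h. JG x *v h)) (at x)"
proof -
  have 1: "((\<lambda>x. 1/2 * (Du x \<bullet> Du x + R\<^sup>2)) has_derivative (\<lambda>h. ((1/2) *\<^sub>R (Du x v* D2u x + Du x v* D2u x)) \<bullet> h)) (at x)"
  proof -
    have "((\<lambda>x. Du x \<bullet> Du x) has_derivative (\<lambda>h. (Du x v* D2u x + Du x v* D2u x) \<bullet> h)) (at x)"
      by (rule has_derivative_inner_field[OF Du_derivative[OF x] Du_derivative[OF x]])
    then have "((\<lambda>x. Du x \<bullet> Du x + R\<^sup>2) has_derivative (\<lambda>h. (Du x v* D2u x + Du x v* D2u x) \<bullet> h + 0)) (at x)"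
      by (rule has_derivative_add) (rule has_derivative_const)
    from has_derivative_mult_right[OF this, of "1/2"] show ?thesis
      by (rule has_derivative_eq_rhs) (simp only: inner_scaleR_left add_0_right)
  qed
  have 2: "((\<lambda>x. real CARD('n) * w x) has_derivative (\<lambda>h. (real CARD('n) *\<^sub>R (- Du x)) \<bullet> h)) (at x)"
    using has_derivative_mult_right[OF w_derivative[OF x], of "real CARD('n)"]
    by (rule has_derivative_eq_rhs) (simp only: inner_scaleR_left)
  show ?thesis unfolding G_def[abs_def] JG_def
    by (intro has_derivative_diff_field has_derivative_scale_field has_derivative_inner_field 1 2 Du_derivative Dh_derivative x)
qed

lemma Du_D2u: assumes x: "x \<in> \<Omega>" shows "v v* D2u x = D2u x *v v" "v \<bullet> (D2u x *v v') = v' \<bullet> (D2u x *v v)"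
proof -
  show *: "v v* D2u x = D2u x *v v" for v
    using transpose_matrix_vector[of "D2u x" v] by (simp add: D2u_symmetric[OF x])
  show "v \<bullet> (D2u x *v v') = v' \<bullet> (D2u x *v v)"
    using dot_lmul_matrix[of v "D2u x" v'] unfolding * by (simp add: inner_commute)
qed

text \<open>The coefficient \<open>CARD('n)\<close> in front of \<open>w\<close> in \<open>G\<close>
  is chosen so that the term from differentiating \<open>w\<close> cancels the one from
  \<open>trace (D2u x)\<close>. The two terms \<open>Dh x \<bullet> (D2u x *v Du x)\<close> cancel
  as well, and the rest except the last carries the factor \<open>trace (Mh x) = 0\<close>.\<close>

lemma trace_JG: assumes x: "x \<in> \<Omega>" shows "trace (JG x) = - (Du x \<bullet> (Mh x *v Du x))"
proof -
  have xc: "x \<in> closure \<Omega>" by (rule Omega_sub_closure[OF x])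
  have a: "Dh x \<bullet> ((1/2) *\<^sub>R (Du x v* D2u x + Du x v* D2u x)) = Dh x \<bullet> (D2u x *v Du x)"
    unfolding Du_D2u(1)[OF x] by (simp only: inner_scaleR_right inner_add_right) simp
  have b: "Du x \<bullet> (Dh x v* D2u x + Du x v* Mh x) = Dh x \<bullet> (D2u x *v Du x) + Du x \<bullet> (Mh x *v Du x)"
    unfolding inner_add_right by (simp only: inner_commute[of "Du x" "_ v* _"] dot_lmul_matrix)
  have c: "Dh x \<bullet> (real CARD('n) *\<^sub>R (- Du x)) = - real CARD('n) * (Du x \<bullet> Dh x)" by (simp add: inner_commute)
  show ?thesis
    unfolding JG_def trace_sub trace_add trace_scaleR trace_outer_prod a b c trace_Mh[OF xc] trace_D2u[OF xc]
    by simp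
qed

lemma cont_JG: "continuous_on (closure \<Omega>) JG"
  unfolding JG_def
  by (intro continuous_intros continuous_on_outer_prod continuous_on_vector_matrix
      cont_Du cont_D2u cont_Dh cont_Mh cont_w)

lemma cont_G: "continuous_on (closure \<Omega>) G" and cont_F: "continuous_on (closure \<Omega>) F"
  unfolding F_def G_def
  by (intro continuous_intros continuous_on_matrix_vector cont_Du cont_D2u cont_Dh cont_Mh cont_w)+

text \<open>The weak form of the formula for div F. \<open>Mh\<close> is the Jacobian of
  \<open>Dh\<close> and has trace 0, so by \<open>integral_trace_swap\<close> the trace of
  \<open>Mh x ** JZ x\<close> integrates to 0 when \<open>JZ\<close> is the Jacobian of the cut-off
  times \<open>w\<close> times \<open>Du\<close>. This stands for the divergence theorem for the
  merely continuous part of \<open>F\<close>.\<close>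

lemma interior_identity:
  "Psi 1 * (LINT x|\<Lambda>. indicator \<Omega> x * (w x * trace (Mh x ** Mh x))) = half_ball_vol * surf_int \<Gamma> (\<lambda>x. F x \<bullet> nrm x)"
proof -
  define p where "p x = w x * trace (Mh x ** Mh x)" for x
  define q where "q x = F x \<bullet> Dg x" for x
  have cp: "continuous_on (closure \<Omega>) p"
    unfolding p_def by (intro continuous_intros cont_w continuous_on_trace continuous_on_matrix_matrix cont_Mh)
  have cq: "continuous_on (closure \<Omega>) q"
    unfolding q_def by (intro continuous_intros cont_F cont_Dg)
  have "Psi 1 * (LINT x|\<Lambda>. indicator \<Omega> x * p x) = half_ball_vol * surf_int \<Gamma> (\<lambda>x. q x / \<beta> x)"
  proof (rule cutoff_limit[OF cp cq])
    fix K K' :: "real \<Rightarrow> real" and e :: real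
    assume e: "0 < e" and K: "\<And>s. (K has_real_derivative K' s) (at s)" and K': "continuous_on UNIV K'"
      and z: "\<And>s. s \<le> e \<Longrightarrow> K s = 0"
    define c where "c = cut K"
    define Dc where "Dc = dcut K'"
    have C: "C1_compact \<Omega> c Dc" unfolding c_def Dc_def by (rule cut_C1_compact[OF e K K' z])
    obtain S where S: "compact S" "S \<subseteq> \<Omega>" "\<And>x. x \<notin> S \<Longrightarrow> c x = 0" "\<And>x. x \<notin> S \<Longrightarrow> Dc x = 0"
      by (rule C1_compactE[OF C]) (rule that, assumption+)
    have cc: "continuous_on \<Omega> c" "continuous_on \<Omega> Dc"
      using C has_derivative_continuous unfolding C1_compact_def
      by (blast intro: continuous_at_imp_continuous_on continuous_on_subset)+
    note sub = continuous_on_subset[OF _ closure_subset[of \<Omega>]]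
    define JZ where "JZ x = (\<chi> i. if x \<in> \<Omega> then c x *\<^sub>R (w x *\<^sub>R D2u x $ i + Du x $ i *\<^sub>R (- Du x)) + (w x * Du x $ i) *\<^sub>R Dc x else 0)" for x
    have Z: "C1_compact \<Omega> (\<lambda>x. (\<chi> i. c x * (w x * Du x $ i)) $ i) (\<lambda>x. JZ x $ i)" for i
      unfolding JZ_def vec_lambda_beta
    proof (rule C1_compact_mult[OF C op])
      fix x assume x: "x \<in> \<Omega>"
      show "((\<lambda>x. w x * Du x $ i) has_derivative (\<lambda>h. (w x *\<^sub>R D2u x $ i + Du x $ i *\<^sub>R (- Du x)) \<bullet> h)) (at x)"
        by (rule has_derivative_eq_rhs[OF has_derivative_mult[OF w_derivative[OF x] component_has_derivative[OF Du_derivative[OF x]]]])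
          (simp add: fun_eq_iff inner_add_left inner_diff_left mult.commute)
    next
      show "continuous_on \<Omega> (\<lambda>x. w x *\<^sub>R D2u x $ i + Du x $ i *\<^sub>R (- Du x))"
        by (intro continuous_intros sub[OF cont_w] sub[OF cont_D2u] sub[OF cont_Du])
    qed
    have JZ_eq: "JZ x = c x *\<^sub>R (w x *\<^sub>R D2u x - outer_prod (Du x) (Du x)) + outer_prod (w x *\<^sub>R Du x) (Dc x)" if "x \<in> \<Omega>" for x
      using that by (simp add: JZ_def vec_eq_iff outer_prod_def)
    have JZ0: "JZ x = 0" if "x \<notin> S" for x using S(3,4)[OF that] by (simp add: JZ_def vec_eq_iff)
    have cJZ: "continuous_on \<Omega> JZ"
    proof -
      have "continuous_on \<Omega> (\<lambda>x. c x *\<^sub>R (w x *\<^sub>R D2u x - outer_prod (Du x) (Du x)) + outer_prod (w x *\<^sub>R Du x) (Dc x))"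
        by (intro continuous_intros continuous_on_outer_prod cc sub[OF cont_w] sub[OF cont_D2u] sub[OF cont_Du])
      then show ?thesis by (rule continuous_on_eq) (simp add: JZ_eq)
    qed
    \<comment> \<open>\<open>I1\<close> is the divergence of \<open>c x *\<^sub>R G x\<close>, and
      \<open>I2\<close> stands for that of the remaining part of the field. Both integrate to
      0.\<close>
    define I1 where "I1 x = Dc x \<bullet> G x + c x * trace (JG x)" for x
    define I2 where "I2 x = trace (Mh x ** JZ x)" for x
    have I20: "trace (Mh x ** JZ x) = 0" if "x \<notin> S" for x
      by (simp add: JZ0[OF that] trace_def matrix_matrix_mult_def)
    have int1: "(LINT x|lborel. indicator \<Omega> x * I1 x) = 0"
      unfolding I1_def by (rule integral_divergence_compact[OF C G_derivative sub[OF cont_JG]])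
    have int2: "(LINT x|lborel. indicator \<Omega> x * I2 x) = 0"
    proof -
      have "(LINT x|lborel. indicator \<Omega> x * I2 x) = (LINT x|lborel. trace (Mh x ** JZ x))"
      proof (intro Bochner_Integration.integral_cong refl)
        fix x show "indicator \<Omega> x * I2 x = trace (Mh x ** JZ x)"
          using I20[of x] S(2) by (cases "x \<in> \<Omega>") (auto simp: I2_def)
      qed
      also have "\<dots> = (LINT x|lborel. trace (Mh x) * trace (JZ x))"
        by (rule integral_trace_swap[OF Dh_derivative sub[OF cont_Mh] Z])
      also have "\<dots> = (LINT x|(lborel :: (real^'n) measure). (0::real))"
      proof (rule Bochner_Integration.integral_cong[OF refl])
        fix x show "trace (Mh x) * trace (JZ x) = 0"
        proof (cases "x \<in> \<Omega>")
          case False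
          then have "JZ x = 0" using JZ0 S(2) by blast
          then show ?thesis by (simp add: trace_def)
        qed (simp add: trace_Mh Omega_sub_closure)
      qed
      finally show ?thesis by simp
    qed
    have i1: "integrable lborel (\<lambda>x. indicator \<Omega> x * I1 x)"
      by (rule integrable_compact_Omega[OF _ S(1,2)])
        (use S(3,4) in \<open>auto simp: I1_def intro!: continuous_intros continuous_on_trace cc sub[OF cont_JG] sub[OF cont_G]\<close>)
    have i2: "integrable lborel (\<lambda>x. indicator \<Omega> x * I2 x)"
      by (rule integrable_compact_Omega[OF _ S(1,2)])
        (use I20 in \<open>auto simp: I2_def intro!: continuous_on_trace continuous_on_matrix_matrix cJZ sub[OF cont_Mh]\<close>)
    have ip: "integrable lborel (\<lambda>x. indicator \<Omega> x * (c x * p x))"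
      by (rule integrable_compact_Omega[OF _ S(1,2)])
        (use S(3) in \<open>auto intro!: continuous_intros cc sub[OF cp]\<close>)
    have iF: "integrable lborel (\<lambda>x. indicator \<Omega> x * (Dc x \<bullet> F x))"
      by (rule integrable_compact_Omega[OF _ S(1,2)])
        (use S(4) in \<open>auto intro!: continuous_intros cc sub[OF cont_F]\<close>)
    have diff: "I1 x - I2 x = c x * p x + Dc x \<bullet> F x" if x: "x \<in> \<Omega>" for x
    proof -
      \<comment> \<open>Because \<open>Mh\<close> has trace 0, its product with \<open>D2u\<close>
        has the same trace as minus its square.\<close>
      have "D2u x = mat 1 - Mh x" by (simp add: Mh_def)
      then have tr: "trace (Mh x ** D2u x) = - trace (Mh x ** Mh x)"
        using trace_mult_diff[of "Mh x" "mat 1" "Mh x"] trace_Mh[OF Omega_sub_closure[OF x]] by simp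
      have "I2 x = c x * (w x * trace (Mh x ** D2u x) - (Mh x *v Du x) \<bullet> Du x) + (w x *\<^sub>R (Mh x *v Du x)) \<bullet> Dc x"
        unfolding I2_def JZ_eq[OF x] trace_mult_add trace_mult_diff trace_mult_scaleR matrix_mult_outer_prod trace_outer_prod
        by (simp add: matrix_vector_mult_scaleR)
      then show ?thesis
        unfolding I1_def trace_JG[OF x] tr p_def F_def by (simp add: inner_diff_right inner_commute algebra_simps)
    qed
    have "0 = (LINT x|lborel. indicator \<Omega> x * I1 x - indicator \<Omega> x * I2 x)"
      using i1 i2 int1 int2 by simp
    also have "\<dots> = (LINT x|lborel. indicator \<Omega> x * (c x * p x) + indicator \<Omega> x * (Dc x \<bullet> F x))"
      by (intro Bochner_Integration.integral_cong) (auto simp: indicator_def diff)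
    also have "\<dots> = (LINT x|lborel. indicator \<Omega> x * (c x * p x)) + (LINT x|lborel. indicator \<Omega> x * (Dc x \<bullet> F x))"
      by (rule Bochner_Integration.integral_add[OF ip iF])
    finally have fin: "(LINT x|lborel. indicator \<Omega> x * (c x * p x)) = - (LINT x|lborel. indicator \<Omega> x * (Dc x \<bullet> F x))" by simp
    have cK: "continuous_on UNIV K" using K by (auto intro!: continuous_at_imp_continuous_on DERIV_isCont)
    have m: "K \<in> borel_measurable borel" "K' \<in> borel_measurable borel" "g \<in> borel_measurable borel"
      "(\<lambda>x. indicator \<Omega> x * p x) \<in> borel_measurable borel" "(\<lambda>x. indicator \<Omega> x * q x) \<in> borel_measurable borel"
      by (rule borel_measurable_continuous_onI[OF cK] borel_measurable_continuous_onI[OF K']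
          borel_measurable_continuous_onI[OF cont_g] measurable_indicator_times[OF cp] measurable_indicator_times[OF cq])+
    have "(LINT x|\<Lambda>. K (- g x) * (indicator \<Omega> x * p x)) = (LINT x|lborel. indicator \<Omega> x * (K (- g x) * (indicator \<Omega> x * p x)))"
      by (rule integral_\<Lambda>) (use m in measurable)
    also have "\<dots> = (LINT x|lborel. indicator \<Omega> x * (c x * p x))"
      by (intro Bochner_Integration.integral_cong) (auto simp: c_def cut_def indicator_def)
    also have "\<dots> = - (LINT x|lborel. indicator \<Omega> x * (Dc x \<bullet> F x))" by (rule fin)
    also have "\<dots> = (LINT x|lborel. - (indicator \<Omega> x * (Dc x \<bullet> F x)))" by simp
    also have "\<dots> = (LINT x|lborel. indicator \<Omega> x * (K' (- g x) * (indicator \<Omega> x * q x)))"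
      by (intro Bochner_Integration.integral_cong) (auto simp: Dc_def dcut_def q_def indicator_def inner_commute)
    also have "\<dots> = (LINT x|\<Lambda>. K' (- g x) * (indicator \<Omega> x * q x))"
      by (rule integral_\<Lambda>[symmetric]) (use m in measurable)
    finally show "(LINT x|\<Lambda>. K (- g x) * (indicator \<Omega> x * p x)) = (LINT x|\<Lambda>. K' (- g x) * (indicator \<Omega> x * q x))" .
  qed
  also have "surf_int \<Gamma> (\<lambda>x. q x / \<beta> x) = surf_int \<Gamma> (\<lambda>x. F x \<bullet> nrm x)"
    by (rule surf_int_cong) (simp add: q_def nrm_def)
  finally show ?thesis by (simp add: p_def)
qed

lemma surf_int_lincomb:
  assumes f: "continuous_on \<Gamma> f" and f': "continuous_on \<Gamma> f'"
  shows "surf_int \<Gamma> (\<lambda>x. f x + c * f' x) = surf_int \<Gamma> f + c * surf_int \<Gamma> f'"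
proof -
  have int: "integrable \<mu> (\<lambda>x. indicator \<Gamma> x * k x)" if k: "continuous_on \<Gamma> k" for k :: "real^'n \<Rightarrow> real"
  proof -
    have "bounded (k ` \<Gamma>)" by (intro compact_imp_bounded compact_continuous_image k compact_frontier)
    then obtain B where B: "\<forall>y\<in>k ` \<Gamma>. norm y \<le> B" unfolding bounded_iff by blast
    have m: "(\<lambda>x. indicator \<Gamma> x * k x) \<in> borel_measurable borel"
      using borel_measurable_continuous_on_indicator[OF _ k] by simp
    show ?thesis
    proof (rule \<mu>.integrable_const_bound[where B = B])
      show "AE x in \<mu>. norm (indicator \<Gamma> x * k x) \<le> B"
        using AE_\<mu> by eventually_elim (use B in auto)
    qed (use m in simp)
  qed
  have "surf_int \<Gamma> (\<lambda>x. f x + c * f' x) = (LINT x|\<mu>. indicator \<Gamma> x * f x + c * (indicator \<Gamma> x * f' x))"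
    using f f' by (subst surf_int_eq) (auto intro!: continuous_intros Bochner_Integration.integral_cong simp: algebra_simps)
  also have "\<dots> = surf_int \<Gamma> f + c * surf_int \<Gamma> f'"
    using int[OF f] int[OF f'] by (simp add: surf_int_eq f f')
  finally show ?thesis .
qed

section \<open>The boundary integrand\<close>

lemma cont_nrm: "continuous_on (closure \<Omega>) nrm"
proof -
  have "\<forall>x\<in>closure \<Omega>. \<beta> x \<noteq> 0" using \<beta>_pos less_irrefl by metis
  then show ?thesis unfolding nrm_def by (intro continuous_intros cont_\<beta> cont_Dg)
qed

lemma cont_curv: "continuous_on (closure \<Omega>) curv"
proof -
  have "\<forall>x\<in>closure \<Omega>. \<beta> x \<noteq> 0" using \<beta>_pos less_irrefl by metis
  then show ?thesis unfolding curv_def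
    by (intro continuous_intros continuous_on_trace continuous_on_matrix_vector cont_nrm cont_\<beta> cont_D2g)
qed

lemma Mh_vector: "Mh x *v v = v - D2u x *v v"
  by (simp add: Mh_def matrix_vector_mult_diff_rdistrib)

text \<open>The Neumann datum is constant on the frontier, so the derivative of
  \<open>Du x \<bullet> nu x\<close> vanishes in the tangential direction \<open>t\<close>. The
  normal part of \<open>Du x\<close> drops out because
  \<open>nu x \<bullet> (Dnu x *v t) = 0\<close>.\<close>

lemma tangential_gradient_curvature:
  assumes x: "x \<in> \<Gamma>" and t: "t = Du x - R *\<^sub>R nrm x"
  shows "(Dnu x *v t) \<bullet> t = - ((D2u x *v t) \<bullet> nrm x)"
proof -
  have R: "Du x \<bullet> nrm x = R" using neu[OF x] nu_eq_nrm[OF x] by simp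
  have d: "((\<lambda>x. Du x \<bullet> nu x) has_derivative (\<lambda>h. Du x \<bullet> (Dnu x *v h) + (D2u x *v h) \<bullet> nu x)) (at x within closure \<Omega>)"
    by (rule has_derivative_inner[OF Du_within[OF frontier_closure[OF x]] nu_derivative[OF x]])
  have "t \<bullet> nrm x = 0" using R nrm_inner_self[OF x] by (simp add: t inner_diff_left)
  from tangential_derivative_zero[OF x d neu this]
  have 1: "Du x \<bullet> (Dnu x *v t) + (D2u x *v t) \<bullet> nrm x = 0" by (simp add: nu_eq_nrm[OF x])
  have "Du x = t + R *\<^sub>R nrm x" by (simp add: t)
  then have "Du x \<bullet> (Dnu x *v t) = t \<bullet> (Dnu x *v t) + R * (nrm x \<bullet> (Dnu x *v t))"
    by (simp add: inner_add_left)
  also have "nrm x \<bullet> (Dnu x *v t) = 0" using nu_Dnu_zero[OF x, of t] nu_eq_nrm[OF x] by simp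
  finally show ?thesis using 1 by (simp add: inner_commute)
qed

text \<open>Pointwise on the frontier, \<open>F x \<bullet> nrm x\<close> differs from the
  combination of the three integrands by \<open>R\<close> times the integrand of the surface
  divergence theorem for \<open>w x *\<^sub>R Dh x\<close>. That multiple accounts for the mean
  curvature and for \<open>R * (Du x \<bullet> Dh x)\<close>.\<close>

lemma boundary_identity:
  defines "gT \<equiv> \<lambda>x. Du x - (Du x \<bullet> nu x) *\<^sub>R nu x"
    and "h_nu \<equiv> \<lambda>x. ((x - z) - Du x) \<bullet> nu x"
  shows "(1/2) * surf_int \<Gamma> (\<lambda>x. (norm (gT x))\<^sup>2 * h_nu x)
      + surf_int \<Gamma> (\<lambda>x. (ubar - u x) * ((real CARD('n) - 1) * R * mean_curv Dnu x - real CARD('n)) * h_nu x)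
      - surf_int \<Gamma> (\<lambda>x. (ubar - u x) * ((Dnu x *v gT x) \<bullet> gT x))
    = surf_int \<Gamma> (\<lambda>x. F x \<bullet> nrm x)"
proof -
  define f1 where "f1 x = (norm (Du x - R *\<^sub>R nrm x))\<^sup>2 * (Dh x \<bullet> nrm x)" for x
  define f2 where "f2 x = w x * (R * curv x - real CARD('n)) * (Dh x \<bullet> nrm x)" for x
  define f3 where "f3 x = - (w x * ((D2u x *v (Du x - R *\<^sub>R nrm x)) \<bullet> nrm x))" for x
  define JY where "JY x = w x *\<^sub>R Mh x + outer_prod (Dh x) (- Du x)" for x
  define sd where "sd x = trace (JY x) - nrm x \<bullet> (JY x *v nrm x) - ((w x *\<^sub>R Dh x) \<bullet> nrm x) * curv x" for x
  note conts = cont_nrm cont_curv cont_w cont_Dh cont_Mh cont_Du cont_D2u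
  have cJY: "continuous_on (closure \<Omega>) JY"
    unfolding JY_def by (intro continuous_intros continuous_on_outer_prod conts)
  have sub: "continuous_on \<Gamma> f" if "continuous_on (closure \<Omega>) f" for f :: "real^'n \<Rightarrow> real"
    using continuous_on_subset[OF that] frontier_closure by auto
  have c1: "continuous_on \<Gamma> f1"
    unfolding f1_def by (rule sub) (intro continuous_intros conts)
  have c2: "continuous_on \<Gamma> f2"
    unfolding f2_def by (rule sub) (intro continuous_intros conts)
  have c3: "continuous_on \<Gamma> f3"
    unfolding f3_def by (rule sub) (intro continuous_intros continuous_on_matrix_vector conts)
  have cs: "continuous_on \<Gamma> sd"
    unfolding sd_def by (rule sub) (intro continuous_intros continuous_on_trace continuous_on_matrix_vector cJY conts)
  have sd0: "surf_int \<Gamma> sd = 0"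
    unfolding sd_def[abs_def]
  proof (rule surface_divergence[OF _ _ cJY])
    show "((\<lambda>x. w x *\<^sub>R Dh x) has_derivative (\<lambda>h. JY x *v h)) (at x)" if "x \<in> \<Omega>" for x
      unfolding JY_def by (rule has_derivative_scale_field[OF w_derivative[OF that] Dh_derivative[OF that]])
    show "continuous_on (closure \<Omega>) (\<lambda>x. w x *\<^sub>R Dh x)" by (intro continuous_intros conts)
  qed
  have pt: "f2 x + 1/2 * f1 x + (- 1) * f3 x + R * sd x = F x \<bullet> nrm x" if x: "x \<in> \<Gamma>" for x
  proof -
    have xc: "x \<in> closure \<Omega>" by (rule frontier_closure[OF x])
    define n where "n = nrm x"
    have nn: "n \<bullet> n = 1" using nrm_inner_self[OF x] by (simp add: n_def)
    have Rn: "Du x \<bullet> n = R" using neu[OF x] nu_eq_nrm[OF x] by (simp add: n_def)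
    define t where "t = Du x - R *\<^sub>R n"
    define a where "a = Dh x \<bullet> n"
    define b where "b = Du x \<bullet> Du x"
    define c where "c = Du x \<bullet> Dh x"
    define p where "p = (D2u x *v t) \<bullet> n"
    define q where "q = (D2u x *v n) \<bullet> n"
    have 1: "(norm t)\<^sup>2 = b - R\<^sup>2"
    proof -
      have "t \<bullet> t = b - R * (Du x \<bullet> n) - R * (Du x \<bullet> n - R * (n \<bullet> n))"
        unfolding t_def b_def inner_diff_left inner_diff_right inner_scaleR_left inner_scaleR_right inner_commute[of n "Du x"]
        by (rule refl)
      then show ?thesis unfolding nn Rn power2_norm_eq_inner power2_eq_square[of R] by simp
    qed
    have Du: "Du x = t + R *\<^sub>R n" by (simp add: t_def)
    have AU: "(D2u x *v Du x) \<bullet> n = p + R * q"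
      unfolding p_def q_def by (subst Du) (simp add: matrix_vector_right_distrib matrix_vector_mult_scaleR inner_add_left)
    have MU: "(Mh x *v Du x) \<bullet> n = R - (p + R * q)" by (simp add: Mh_vector inner_diff_left AU Rn)
    have Mn: "n \<bullet> (Mh x *v n) = 1 - q" by (simp add: Mh_vector inner_diff_right nn q_def inner_commute)
    have trJ: "trace (JY x) = - c"
      by (simp add: JY_def trace_add trace_scaleR trace_outer_prod trace_Mh[OF xc] c_def inner_commute)
    have nJ: "n \<bullet> (JY x *v n) = w x * (1 - q) - R * a"
    proof -
      have "JY x *v n = w x *\<^sub>R (Mh x *v n) + ((- Du x) \<bullet> n) *\<^sub>R Dh x"
        unfolding JY_def matrix_vector_mult_add_rdistrib outer_prod_mult_vec scaleR_matrix_vector_assoc[symmetric] ..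
      then show ?thesis by (simp add: inner_add_right inner_diff_right Mn Rn a_def inner_commute[of n "Dh x"])
    qed
    have sdx: "sd x = - c - (w x * (1 - q) - R * a) - w x * a * curv x"
      by (simp add: sd_def n_def[symmetric] trJ nJ a_def)
    have Fx: "F x \<bullet> n = 1/2 * (b + R\<^sup>2) * a - c * R - real CARD('n) * w x * a - w x * (R - (p + R * q))"
      by (simp add: F_def G_def inner_diff_left MU Rn a_def b_def c_def)
    have f: "f1 x = (b - R\<^sup>2) * a" "f2 x = w x * (R * curv x - real CARD('n)) * a" "f3 x = - (w x * p)"
      by (simp_all add: f1_def f2_def f3_def n_def[symmetric] t_def[symmetric] 1 a_def p_def)
    show ?thesis unfolding n_def[symmetric] Fx f sdx by (simp add: algebra_simps power2_eq_square)
  qed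
  have N1: "real CARD('n) - 1 \<noteq> 0" using card2 by auto
  have e1: "surf_int \<Gamma> (\<lambda>x. (norm (gT x))\<^sup>2 * h_nu x) = surf_int \<Gamma> f1"
    by (rule surf_int_cong) (simp add: gT_def h_nu_def f1_def Dh_def neu nu_eq_nrm[symmetric])
  have e2: "surf_int \<Gamma> (\<lambda>x. (ubar - u x) * ((real CARD('n) - 1) * R * mean_curv Dnu x - real CARD('n)) * h_nu x) = surf_int \<Gamma> f2"
  proof (rule surf_int_cong)
    fix x assume x: "x \<in> \<Gamma>"
    have "(real CARD('n) - 1) * R * mean_curv Dnu x = R * curv x"
      using N1 by (simp add: mean_curv_def trace_Dnu[OF x])
    then show "(ubar - u x) * ((real CARD('n) - 1) * R * mean_curv Dnu x - real CARD('n)) * h_nu x = f2 x"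
      by (simp only: f2_def w_def h_nu_def Dh_def nu_eq_nrm[OF x])
  qed
  have e3: "surf_int \<Gamma> (\<lambda>x. (ubar - u x) * ((Dnu x *v gT x) \<bullet> gT x)) = surf_int \<Gamma> f3"
  proof (rule surf_int_cong)
    fix x assume x: "x \<in> \<Gamma>"
    have "gT x = Du x - R *\<^sub>R nrm x" using neu[OF x] by (simp add: gT_def nu_eq_nrm[OF x])
    from tangential_gradient_curvature[OF x this] this
    show "(ubar - u x) * ((Dnu x *v gT x) \<bullet> gT x) = f3 x" by (simp add: f3_def w_def)
  qed
  have c12: "continuous_on \<Gamma> (\<lambda>x. f2 x + 1/2 * f1 x)" by (intro continuous_intros c1 c2)
  have c123: "continuous_on \<Gamma> (\<lambda>x. f2 x + 1/2 * f1 x + (- 1) * f3 x)" by (intro continuous_intros c1 c2 c3)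
  have "surf_int \<Gamma> (\<lambda>x. F x \<bullet> nrm x) = surf_int \<Gamma> (\<lambda>x. f2 x + 1/2 * f1 x + (- 1) * f3 x + R * sd x)"
    by (rule surf_int_cong) (rule pt[symmetric])
  also have "\<dots> = surf_int \<Gamma> (\<lambda>x. f2 x + 1/2 * f1 x + (- 1) * f3 x) + R * surf_int \<Gamma> sd"
    by (rule surf_int_lincomb[OF c123 cs])
  also have "\<dots> = surf_int \<Gamma> (\<lambda>x. f2 x + 1/2 * f1 x) + (- 1) * surf_int \<Gamma> f3"
    unfolding sd0 by (subst surf_int_lincomb[OF c12 c3]) simp
  also have "\<dots> = surf_int \<Gamma> f2 + 1/2 * surf_int \<Gamma> f1 + (- 1) * surf_int \<Gamma> f3"
    by (subst surf_int_lincomb[OF c2 c1]) simp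
  finally show ?thesis unfolding e1 e2 e3 by simp
qed

section \<open>Rigidity\<close>

lemma u_le_ubar: "x \<in> closure \<Omega> \<Longrightarrow> u x \<le> ubar"
  unfolding ubar_def
  by (intro cSup_upper bounded_imp_bdd_above compact_imp_bounded compact_continuous_image cont_u compact_closure) auto

text \<open>A positive Laplacian forces a positive second derivative along some coordinate axis,
  which rules out an interior maximum of \<open>u\<close>.\<close>

lemma w_pos: assumes x: "x \<in> \<Omega>" shows "0 < w x"
proof (rule ccontr)
  assume "\<not> 0 < w x"
  then have max: "u y \<le> u x" if "y \<in> closure \<Omega>" for y using u_le_ubar[OF that] by (simp add: w_def)
  have "0 < trace (D2u x)" using lap[OF x] by simp
  then have "\<exists>i. 0 < D2u x $ i $ i"
    using sum_nonpos[of UNIV "\<lambda>i. D2u x $ i $ i"] unfolding trace_def by (meson not_le)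
  then obtain i where i: "0 < D2u x $ i $ i" by blast
  obtain r where r: "0 < r" "ball x r \<subseteq> \<Omega>" using op x open_contains_ball by blast
  let ?e = "axis i 1 :: real^'n"
  have inO: "x + t *\<^sub>R ?e \<in> \<Omega>" if "\<bar>t\<bar> < r" for t
  proof -
    have "x + t *\<^sub>R ?e \<in> ball x r" using that by (simp add: dist_norm norm_axis_1)
    then show ?thesis using r by blast
  qed
  have line: "((\<lambda>t. x + t *\<^sub>R ?e) has_derivative (\<lambda>h. h *\<^sub>R ?e)) (at t)" for t
    by (auto intro!: derivative_eq_intros)
  have d1: "((\<lambda>t. u (x + t *\<^sub>R ?e)) has_real_derivative Du (x + t *\<^sub>R ?e) \<bullet> ?e) (at t)" if t: "\<bar>t\<bar> < r" for t
    using has_derivative_compose[OF line u_derivative[OF inO[OF t]]]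
    unfolding has_field_derivative_def by (rule has_derivative_eq_rhs) (simp add: fun_eq_iff)
  have d2: "((\<lambda>t. Du (x + t *\<^sub>R ?e) \<bullet> ?e) has_real_derivative D2u x $ i $ i) (at 0)"
  proof -
    have "(Du has_derivative (\<lambda>h. D2u x *v h)) (at (x + 0 *\<^sub>R ?e))" using Du_derivative[OF x] by simp
    from has_derivative_compose[OF line this]
    have "((\<lambda>t. Du (x + t *\<^sub>R ?e)) has_derivative (\<lambda>h. D2u x *v (h *\<^sub>R ?e))) (at 0)" .
    from has_derivative_inner_left[OF this, of ?e]
    have "((\<lambda>t. Du (x + t *\<^sub>R ?e) \<bullet> ?e) has_derivative (\<lambda>h. (D2u x *v (h *\<^sub>R ?e)) \<bullet> ?e)) (at 0)" .
    moreover have "(D2u x *v ?e) \<bullet> ?e = D2u x $ i $ i"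
      by (simp add: inner_axis matrix_vector_mul_component)
    ultimately show ?thesis
      unfolding has_field_derivative_def
      by (elim has_derivative_eq_rhs) (simp add: fun_eq_iff matrix_vector_mult_scaleR mult.commute)
  qed
  have crit: "Du x \<bullet> ?e = 0"
  proof -
    have "((\<lambda>t. u (x + t *\<^sub>R ?e)) has_real_derivative Du x \<bullet> ?e) (at 0)" using d1[of 0] r by simp
    then show ?thesis
      by (rule DERIV_local_max[OF _ r(1)]) (use max inO Omega_sub_closure in auto)
  qed
  obtain d where d: "0 < d" "\<And>h. 0 < h \<Longrightarrow> h < d \<Longrightarrow> 0 < Du (x + h *\<^sub>R ?e) \<bullet> ?e"
    using DERIV_pos_inc_right[OF d2 i] crit by auto
  define t where "t = min d r / 2"
  have t: "0 < t" "t < d" "t < r" using d r by (auto simp: t_def)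
  obtain s where s: "0 < s" "s < t" "u (x + t *\<^sub>R ?e) - u (x + 0 *\<^sub>R ?e) = (t - 0) * (Du (x + s *\<^sub>R ?e) \<bullet> ?e)"
    using MVT2[of 0 t "\<lambda>t. u (x + t *\<^sub>R ?e)" "\<lambda>t. Du (x + t *\<^sub>R ?e) \<bullet> ?e"] d1 t by force
  have "0 < t * (Du (x + s *\<^sub>R ?e) \<bullet> ?e)" by (rule mult_pos_pos[OF t(1) d(2)]) (use s t in auto)
  then have "u x < u (x + t *\<^sub>R ?e)" using s(3) by (simp only: diff_0_right scaleR_zero_left add_0_right)
  then show False using max[OF Omega_sub_closure[OF inO[of t]]] t by simp
qed

lemma Mh_symmetric: "x \<in> \<Omega> \<Longrightarrow> transpose (Mh x) = Mh x"
proof -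
  assume x: "x \<in> \<Omega>"
  have "D2u x $ i $ j = D2u x $ j $ i" for i j using D2u_symmetric[OF x] by (metis transpose_def vec_lambda_beta)
  then show ?thesis by (simp add: Mh_def transpose_def vec_eq_iff mat_def)
qed

text \<open>The inequality forces the integral of a nonnegative function to be zero, so the function
  vanishes almost everywhere. Continuity removes the exceptional set, since a nonempty open set is
  not null. By symmetry of \<open>Mh\<close> the trace is the sum of the squares of its
  entries.\<close>

lemma Mh_zero:
  assumes T: "surf_int \<Gamma> (\<lambda>x. F x \<bullet> nrm x) \<le> 0" and x: "x \<in> \<Omega>"
  shows "Mh x = 0"
proof -
  define p where "p x = w x * trace (Mh x ** Mh x)" for x
  have cp: "continuous_on (closure \<Omega>) p"
    unfolding p_def by (intro continuous_intros cont_w continuous_on_trace continuous_on_matrix_matrix cont_Mh)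
  have tr: "trace (Mh y ** Mh y) = (\<Sum>i\<in>UNIV. \<Sum>j\<in>UNIV. (Mh y $ i $ j)\<^sup>2)" if "y \<in> \<Omega>" for y
    by (rule trace_square_symmetric[OF Mh_symmetric[OF that]])
  have p0: "0 \<le> p y" if "y \<in> \<Omega>" for y
    using w_pos[OF that] by (auto simp: p_def tr[OF that] intro!: mult_nonneg_nonneg sum_nonneg)
  have pm: "(\<lambda>x. indicator \<Omega> x * p x) \<in> borel_measurable \<Lambda>" using measurable_indicator_times[OF cp] by simp
  obtain B where B: "0 < B" "\<And>x. x \<in> closure \<Omega> \<Longrightarrow> norm (p x) \<le> B" using continuous_bounded[OF cp] by blast
  have int: "integrable \<Lambda> (\<lambda>x. indicator \<Omega> x * p x)"
  proof (rule \<Lambda>.integrable_const_bound[OF _ pm, where B = B])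
    show "AE x in \<Lambda>. norm (indicator \<Omega> x * p x) \<le> B"
      using AE_\<Lambda> by eventually_elim (use B(2) Omega_sub_closure in auto)
  qed
  have "Psi 1 * (LINT x|\<Lambda>. indicator \<Omega> x * p x) \<le> 0"
    using interior_identity T half_ball_vol_pos by (simp add: p_def mult_nonneg_nonpos)
  then have "(LINT x|\<Lambda>. indicator \<Omega> x * p x) \<le> 0" using Psi_bounds(1)[of 1] by (simp add: mult_le_0_iff)
  moreover have nn: "AE x in \<Lambda>. 0 \<le> indicator \<Omega> x * p x"
    using AE_\<Lambda> by eventually_elim (use p0 in auto)
  then have "0 \<le> (LINT x|\<Lambda>. indicator \<Omega> x * p x)" by (rule integral_nonneg_AE)
  ultimately have "AE x in \<Lambda>. indicator \<Omega> x * p x = 0"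
    using integral_nonneg_eq_0_iff_AE[OF int nn] by simp
  then have ae: "AE x in lborel. 0 < ennreal (indicator \<Omega> x) \<longrightarrow> indicator \<Omega> x * p x = 0"
    unfolding \<Lambda>_def by (subst (asm) AE_density) auto
  have "p x = 0"
  proof (rule ccontr)
    assume "p x \<noteq> 0"
    define S where "S = {y \<in> \<Omega>. p y \<noteq> 0}"
    have opS: "open S"
    proof -
      have "open (\<Omega> \<inter> p -` (- {0}))"
        by (rule continuous_open_preimage[OF continuous_on_subset[OF cp closure_subset] op]) auto
      moreover have "\<Omega> \<inter> p -` (- {0}) = S" by (auto simp: S_def)
      ultimately show ?thesis by simp
    qed
    have "AE y in lborel. y \<notin> S"
      using ae by eventually_elim (auto simp: S_def)
    then have "S \<in> null_sets lborel"
      using opS by (subst (asm) AE_iff_null_sets[symmetric]) auto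
    then have "negligible S" by (simp add: negligible_iff_null_sets null_sets_completionI)
    moreover have "S \<noteq> {}" using x \<open>p x \<noteq> 0\<close> by (auto simp: S_def)
    ultimately show False using open_not_negligible[OF opS] by blast
  qed
  then have "(\<Sum>i\<in>UNIV. \<Sum>j\<in>UNIV. (Mh x $ i $ j)\<^sup>2) = 0" using w_pos[OF x] tr[OF x] by (simp add: p_def)
  then have "(Mh x $ i $ j)\<^sup>2 = 0" for i j
    by (simp add: sum_nonneg_eq_0_iff sum_nonneg)
  then show ?thesis by (simp add: vec_eq_iff)
qed

lemma farthest_not_interior:
  assumes x: "x \<in> \<Omega>" shows "\<exists>y\<in>\<Omega>. norm (x - c) < norm (y - c)"
proof -
  obtain r where r: "0 < r" "cball x r \<subseteq> \<Omega>" using op x open_contains_cball by blast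
  obtain v :: "real^'n" where v: "norm v = 1" "norm (x - c + r *\<^sub>R v) = norm (x - c) + r"
  proof (cases "x = c")
    case True
    show ?thesis using that[of "axis undefined 1"] r(1) True by simp
  next
    case False
    then have n: "0 < norm (x - c)" by simp
    define v where "v = (1 / norm (x - c)) *\<^sub>R (x - c)"
    have "x - c + r *\<^sub>R v = (1 + r / norm (x - c)) *\<^sub>R (x - c)" by (simp add: v_def scaleR_add_left)
    moreover have "norm ((1 + r / norm (x - c)) *\<^sub>R (x - c)) = (1 + r / norm (x - c)) * norm (x - c)"
      using r(1) n by (simp add: abs_of_pos add_pos_pos)
    moreover have "(1 + r / norm (x - c)) * norm (x - c) = norm (x - c) + r" using n by (simp add: distrib_right)
    moreover have "norm v = 1" using n by (simp add: v_def)
    ultimately show ?thesis using that by metis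
  qed
  have "x + r *\<^sub>R v \<in> \<Omega>" using r v(1) by (intro subsetD[OF r(2)]) (simp add: dist_norm)
  moreover have "norm (x + r *\<^sub>R v - c) = norm (x - c) + r" using v(2) by (simp add: algebra_simps)
  ultimately show ?thesis using r(1) by (intro bexI[of _ "x + r *\<^sub>R v"]) auto
qed

text \<open>At a farthest point \<open>p\<close>, inward directions have nonpositive inner product
  with \<open>p - c\<close>, so \<open>half_space_cone\<close> makes \<open>p - c\<close> an outward
  normal. Cauchy-Schwarz at the other frontier points then puts the whole frontier on one
  sphere.\<close>

lemma overdetermined_ball:
  assumes c: "\<And>x. x \<in> closure \<Omega> \<Longrightarrow> Du x = x - c"
  shows "\<Omega> = ball c R"
proof -
  have cont: "continuous_on (closure \<Omega>) (\<lambda>y. norm (y - c))" by (intro continuous_intros)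
  have "closure \<Omega> \<noteq> {}" using ne by simp
  from continuous_attains_sup[OF compact_closure this cont]
  obtain p where p: "p \<in> closure \<Omega>" "\<And>y. y \<in> closure \<Omega> \<Longrightarrow> norm (y - c) \<le> norm (p - c)" by blast
  have "p \<notin> \<Omega>"
    using farthest_not_interior[of p c] p(2) Omega_sub_closure by (metis linorder_not_less)
  then have pG: "p \<in> \<Gamma>" using p(1) closure_eq by auto
  have le: "(p - c) \<bullet> h \<le> 0" if h: "Dg p \<bullet> h < 0" for h
  proof -
    have "\<forall>\<^sub>F t in at_right (0::real). 0 < t" by (rule eventually_at_right_less)
    from eventually_happens'[OF trivial_limit_at_right_real eventually_conj[OF this inward_ray_closure[OF pG h]]]
    obtain t :: real where t: "0 < t" "p + t *\<^sub>R h \<in> closure \<Omega>" by blast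
    have "(norm ((p - c) + t *\<^sub>R h))\<^sup>2 \<le> (norm (p - c))\<^sup>2"
      using p(2)[OF t(2)] by (intro power_mono) (simp_all add: algebra_simps)
    then have "2 * (t * ((p - c) \<bullet> h)) + t * t * (h \<bullet> h) \<le> 0"
      unfolding power2_norm_eq_inner inner_add_left inner_add_right inner_commute[of "t *\<^sub>R h" "p - c"]
      by (simp add: mult.assoc)
    moreover have "0 \<le> t * t * (h \<bullet> h)" by simp
    ultimately have "t * ((p - c) \<bullet> h) \<le> 0" by linarith
    then show ?thesis using t(1) by (simp add: mult_le_0_iff)
  qed
  from half_space_cone[OF Dg_nz[OF pG] le]
  have k: "p - c = (((p - c) \<bullet> Dg p) / (Dg p \<bullet> Dg p)) *\<^sub>R Dg p" "0 \<le> (p - c) \<bullet> Dg p" by blast+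
  define s where "s = ((p - c) \<bullet> Dg p) / (Dg p \<bullet> Dg p) * \<beta> p"
  have s0: "0 \<le> s" using k(2) \<beta>_pos[OF p(1)] by (simp add: s_def)
  have ps: "p - c = s *\<^sub>R nrm p"
    using k(1) Dg_eq_nrm[OF p(1)] unfolding s_def by (metis scaleR_scaleR)
  have R_eq: "R = norm (p - c)"
    using neu[OF pG] s0 by (simp add: nu_eq_nrm[OF pG] c[OF p(1)] ps nrm_inner_self[OF pG] norm_nrm[OF pG])
  have sphere: "norm (y - c) = R" if y: "y \<in> \<Gamma>" for y
  proof -
    have yc: "y \<in> closure \<Omega>" by (rule frontier_closure[OF y])
    have "R = (y - c) \<bullet> nrm y" using neu[OF y] by (simp add: nu_eq_nrm[OF y] c[OF yc])
    also have "\<dots> \<le> norm (y - c)" using norm_cauchy_schwarz[of "y - c" "nrm y"] norm_nrm[OF y] by simp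
    finally show ?thesis using p(2)[OF yc] R_eq by simp
  qed
  have sub: "\<Omega> \<subseteq> ball c R"
  proof
    fix x assume x: "x \<in> \<Omega>"
    obtain y where "y \<in> \<Omega>" "norm (x - c) < norm (y - c)" using farthest_not_interior[OF x] by blast
    then have "norm (x - c) < R" using p(2)[OF Omega_sub_closure] R_eq by force
    then show "x \<in> ball c R" by (simp add: dist_norm norm_minus_commute)
  qed
  \<comment> \<open>The ball is connected and meets \<open>\<Omega>\<close>. If it left
    \<open>\<Omega>\<close> it would contain a frontier point, but these all have distance exactly
    \<open>R\<close> from \<open>c\<close>.\<close>
  have "ball c R \<subseteq> \<Omega>"
  proof (rule ccontr)
    assume "\<not> ?thesis"
    then have "ball c R - \<Omega> \<noteq> {}" by blast
    moreover have "ball c R \<inter> \<Omega> \<noteq> {}" using sub ne by blast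
    ultimately have "ball c R \<inter> \<Gamma> \<noteq> {}" by (intro connected_Int_frontier) auto
    then show False using sphere by (auto simp: dist_norm norm_minus_commute)
  qed
  then show ?thesis using sub by blast
qed

lemma conclusion:
  assumes conn: "connected \<Omega>" and T: "surf_int \<Gamma> (\<lambda>x. F x \<bullet> nrm x) \<le> 0"
  shows "(\<exists>b c. \<forall>x\<in>closure \<Omega>. (1/2) * (norm (x - z))\<^sup>2 + a - u x = b \<bullet> x + c)
       \<and> (\<exists>A b c. \<forall>x\<in>closure \<Omega>. u x = x \<bullet> (A *v x) + b \<bullet> x + c)
       \<and> (\<exists>x0. \<Omega> = ball x0 R)"
proof -
  obtain x0 where x0: "x0 \<in> \<Omega>" using ne by blast
  define b where "b = Dh x0"
  have "Dh x = b" if x: "x \<in> \<Omega>" for x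
    unfolding b_def
  proof (rule has_derivative_zero_unique_connected[OF op conn _ x x0])
    show "(Dh has_derivative (\<lambda>h. 0)) (at y)" if "y \<in> \<Omega>" for y
      using Dh_derivative[OF that] by (simp add: Mh_zero[OF T that])
  qed
  then have Dh_b: "Dh x = b" if "x \<in> closure \<Omega>" for x
    by (rule continuous_constant_on_closure[OF cont_Dh _ that])
  \<comment> \<open>\<open>k\<close> is h minus its linear part; its gradient
    \<open>Dh x - b\<close> vanishes.\<close>
  define k where "k x = (1/2) * (norm (x - z))\<^sup>2 + a - u x - b \<bullet> x" for x
  have k_const: "k x = k x0" if x: "x \<in> \<Omega>" for x
  proof (rule has_derivative_zero_unique_connected[OF op conn _ x x0])
    fix y assume y: "y \<in> \<Omega>"
    have "((\<lambda>x. (1/2) * ((x - z) \<bullet> (x - z)) + a - u x - b \<bullet> x) has_derivative (\<lambda>h. (Dh y - b) \<bullet> h)) (at y)"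
    proof -
      have q: "((\<lambda>x. x - z) has_derivative (\<lambda>h. h)) (at y)" by (auto intro!: derivative_eq_intros)
      have l: "((\<lambda>x. b \<bullet> x) has_derivative (\<lambda>h. b \<bullet> h)) (at y)" by (auto intro!: derivative_eq_intros)
      have "((\<lambda>x. (1/2) * ((x - z) \<bullet> (x - z)) + a - u x - b \<bullet> x) has_derivative
             (\<lambda>h. (1/2) * ((y - z) \<bullet> h + h \<bullet> (y - z)) + 0 - Du y \<bullet> h - b \<bullet> h)) (at y)"
        by (intro has_derivative_diff has_derivative_add has_derivative_mult_right has_derivative_inner q l
            has_derivative_const u_derivative[OF y])
      moreover have "(1/2) * ((y - z) \<bullet> h + h \<bullet> (y - z)) + 0 - Du y \<bullet> h - b \<bullet> h = (Dh y - b) \<bullet> h" for h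
      proof -
        have "(1/2) * (p + p) + 0 - q - r = p - q - r" for p q r :: real by simp
        then show ?thesis unfolding inner_commute[of h] Dh_def inner_diff_left .
      qed
      ultimately show ?thesis by (simp only:)
    qed
    then show "(k has_derivative (\<lambda>h. 0)) (at y)"
      unfolding k_def power2_norm_eq_inner using Dh_b[OF Omega_sub_closure[OF y]] by simp
  qed
  have ck: "continuous_on (closure \<Omega>) k" unfolding k_def by (intro continuous_intros cont_u)
  have kc: "k x = k x0" if "x \<in> closure \<Omega>" for x
    by (rule continuous_constant_on_closure[OF ck k_const that])
  have 1: "\<forall>x\<in>closure \<Omega>. (1/2) * (norm (x - z))\<^sup>2 + a - u x = b \<bullet> x + k x0"
  proof
    fix x assume "x \<in> closure \<Omega>"
    from kc[OF this, unfolded k_def[of x]]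
    show "(1/2) * (norm (x - z))\<^sup>2 + a - u x = b \<bullet> x + k x0" by linarith
  qed
  have 2: "\<forall>x\<in>closure \<Omega>. u x = x \<bullet> (((1/2) *\<^sub>R mat 1) *v x) + (- z - b) \<bullet> x + ((1/2) * (z \<bullet> z) + a - k x0)"
  proof
    fix x assume "x \<in> closure \<Omega>"
    with 1 have "(1/2) * ((x - z) \<bullet> (x - z)) + a - u x = b \<bullet> x + k x0" unfolding power2_norm_eq_inner by blast
    then have "u x = (1/2) * ((x - z) \<bullet> (x - z)) + a - b \<bullet> x - k x0" by linarith
    also have "\<dots> = x \<bullet> (((1/2) *\<^sub>R mat 1) *v x) + (- z - b) \<bullet> x + ((1/2) * (z \<bullet> z) + a - k x0)"
    proof -
      have "x \<bullet> (((1/2) *\<^sub>R mat 1) *v x) = (1/2) * (x \<bullet> x)"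
        by (simp add: scaleR_matrix_vector_assoc[symmetric])
      moreover have "(x - z) \<bullet> (x - z) = x \<bullet> x - z \<bullet> x - z \<bullet> x + z \<bullet> z"
        by (simp only: inner_diff_left inner_diff_right inner_commute[of x z])
      moreover have "(- z - b) \<bullet> x = - (z \<bullet> x) - b \<bullet> x"
        by (simp only: inner_diff_left inner_minus_left)
      ultimately show ?thesis by argo
    qed
    finally show "u x = x \<bullet> (((1/2) *\<^sub>R mat 1) *v x) + (- z - b) \<bullet> x + ((1/2) * (z \<bullet> z) + a - k x0)" .
  qed
  have "\<Omega> = ball (z + b) R"
  proof (rule overdetermined_ball)
    show "Du x = x - (z + b)" if "x \<in> closure \<Omega>" for x
      using Dh_b[OF that] by (simp add: Dh_def algebra_simps)
  qed
  with 1 2 show ?thesis by (intro conjI exI)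
qed

end

theorem theorem1p3:
  fixes \<Omega> :: "(real^'n::finite) set"
    and u :: "real^'n \<Rightarrow> real" and Du :: "real^'n \<Rightarrow> real^'n" and D2u :: "real^'n \<Rightarrow> real^'n^'n"
    and nu :: "real^'n \<Rightarrow> real^'n" and Dnu :: "real^'n \<Rightarrow> real^'n^'n"
    and z :: "real^'n" and a R :: real
  assumes N2: "CARD('n) \<ge> 2"
    and dom: "C2_bounded_domain \<Omega>"
    and nu: "normal_field_with \<Omega> nu Dnu"
    and R_def: "R = real CARD('n) * measure lebesgue \<Omega> / surf_area (frontier \<Omega>)"
    and u: "C2_closure_with \<Omega> u Du D2u"
    and lap: "\<forall>x\<in>\<Omega>. trace (D2u x) = real CARD('n)"
    and neu: "\<forall>x\<in>frontier \<Omega>. Du x \<bullet> nu x = R"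
    and ineq: "let q = (\<lambda>x. (1/2) * (norm (x - z))\<^sup>2 + a);
                   h = (\<lambda>x. q x - u x);
                   h_nu = (\<lambda>x. ((x - z) - Du x) \<bullet> nu x);
                   ubar = Sup (u ` closure \<Omega>);
                   gT = (\<lambda>x. Du x - (Du x \<bullet> nu x) *\<^sub>R nu x)
               in (1/2) * surf_int (frontier \<Omega>) (\<lambda>x. (norm (gT x))\<^sup>2 * h_nu x)
                  + surf_int (frontier \<Omega>) (\<lambda>x. (ubar - u x) *
                        ((real CARD('n) - 1) * R * mean_curv Dnu x - real CARD('n)) * h_nu x)
                  - surf_int (frontier \<Omega>) (\<lambda>x. (ubar - u x) * ((Dnu x *v gT x) \<bullet> gT x))
                  \<le> 0"
  shows "(\<exists>b c. \<forall>x\<in>closure \<Omega>. (1/2) * (norm (x - z))\<^sup>2 + a - u x = b \<bullet> x + c)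
       \<and> (\<exists>A b c. \<forall>x\<in>closure \<Omega>. u x = x \<bullet> (A *v x) + b \<bullet> x + c)
       \<and> (\<exists>x0. \<Omega> = ball x0 R)"
proof -
  have dom': "bounded \<Omega>" "open \<Omega>" "connected \<Omega>" "\<Omega> \<noteq> {}" using dom by (auto simp: C2_bounded_domain_def)
  obtain g Dg D2g W where g: "C2_on_with UNIV g Dg D2g" "\<And>x. x \<in> \<Omega> \<Longrightarrow> g x < 0"
    "\<And>x. x \<in> frontier \<Omega> \<Longrightarrow> g x = 0" "\<And>x. x \<in> frontier \<Omega> \<Longrightarrow> Dg x \<noteq> 0"
    "open W" "frontier \<Omega> \<subseteq> W" "\<And>x. x \<in> W \<Longrightarrow> g x < 0 \<Longrightarrow> x \<in> \<Omega>"
    by (rule global_defining_function[OF dom]) (rule that, assumption+)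
  interpret torsion_problem \<Omega> g Dg D2g W nu Dnu u Du D2u z R
    by unfold_locales (use N2 dom' g nu u lap neu in auto)
  have "surf_int (frontier \<Omega>) (\<lambda>x. F x \<bullet> nrm x) \<le> 0"
    using ineq unfolding Let_def boundary_identity[symmetric] ubar_def .
  then show ?thesis by (rule conclusion[OF dom'(3)])
qed

end
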